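(* For $\varepsilon>0$ let $N_\varepsilon=\sup N_\varepsilon(x,y)$, where $N_\varepsilon(x,y)$ is the number of zeroes of the adjoint variable $\psi$ (control switchings) along an optimal (minimum-time) trajectory of the controlled pendulum $\dot x=y,\ \dot y=-\sin x+\varepsilon u,\ |u|\le1$, connecting $(x,y)$ with $(0,0)$, and the supremum is taken over the entire phase space. Then $$N_\varepsilon\sim\frac{D}{\varepsilon}\quad\text{as }\varepsilon\to0,\qquad\text{where } D=\int_0^\pi\frac{\sin x}{2x}\,dx,$$ i.e. $\lim_{\varepsilon\to0}\varepsilon N_\varepsilon$ exists and equals $D$.
   Context: Setting. The phase space is the cylinder $S^1\times\mathbb{R}$ with coordinates $(x,y)$, $x\in S^1=\mathbb{R}/2\pi\mathbb{Z}$, $y=\dot x\in\mathbb{R}$. For $\varepsilon>0$ the control system is $\dot x=y,\ \dot y=-\sin x+\varepsilon u$, with measurable controls $u=u(t)$, $|u|\le1$. An optimal trajectory is a trajectory $(x(t),y(t))$, $t\in[0,T]$, that goes from its initial point to the lower equilibrium $(0,0)$ in the minimal possible time (an optimal control exists for every initial point). Adjoint variables. By the Pontryagin maximum principle an optimal trajectory is accompanied by adjoint variables $(\phi,\psi)$ on $[0,T]$ satisfying $\dot\phi=(\cos x)\psi$, $\dot\psi=-\phi$, $u=\operatorname{sign}\psi$ (wherever $\psi\neq0$), and $y\phi+(-\sin x+\varepsilon u)\psi-1\equiv0$. In particular $\ddot\psi+(\cos x)\psi=0$, and the zeroes of $\psi$ are the possible switching instants of the control. Convention. $N_\varepsilon(x,y)$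 is the number of zeroes of $\psi$ on $[0,T]$; $N_\varepsilon$ is the supremum of this number over all initial points $(x,y)$, all optimal trajectories from $(x,y)$ to $(0,0)$, and all adjoint variables $(\phi,\psi)$ on $[0,T]$ satisfying $\dot\phi=(\cos x)\psi$, $\dot\psi=-\phi$, $u=\operatorname{sign}\psi$ (wherever $\psi\neq0$) and $y\phi+(-\sin x+\varepsilon u)\psi-1\equiv0$ along the trajectory. Numerically $D=\tfrac12\mathrm{Si}(\pi)=0.925968526\ldots$, where $\mathrm{Si}$ is the sine integral. *)

theory Defs
  imports "HOL-Analysis.Analysis" "HOL-Library.Real_Mod" "HOL-Library.Extended_Nat"
begin

text \<open>
  The angular coordinate on the circle of length \<open>2 * pi\<close> is represented by real lifts: a
  point of the cylinder is a pair of reals whose first component matters only modulo \<open>2 * pi\<close>,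
  and a trajectory is given by a lift \<open>x\<close> of its angular component (every continuous curve on
  the cylinder has one).
\<close>

text \<open>
  As the control is merely measurable, the differential equations are understood in the sense of
  Caratheodory, i.e. in integrated form.
\<close>
definition controlled_pendulum ::
  "real \<Rightarrow> real \<Rightarrow> (real \<Rightarrow> real) \<Rightarrow> (real \<Rightarrow> real) \<Rightarrow> (real \<Rightarrow> real) \<Rightarrow> bool"
  where "controlled_pendulum \<epsilon> T u x y \<longleftrightarrow>
    0 \<le> T \<and>
    u \<in> borel_measurable (lebesgue_on {0..T}) \<and>
    (\<forall>t\<in>{0..T}. \<bar>u t\<bar> \<le> 1) \<and>
    (\<forall>t\<in>{0..T}. (y has_integral (x t - x 0)) {0..t}) \<and>
    (\<forall>t\<in>{0..T}. ((\<lambda>s. - sin (x s) + \<epsilon> * u s) has_integral (y t - y 0)) {0..t})"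

definition steers_to_origin ::
  "real \<Rightarrow> real \<times> real \<Rightarrow> real \<Rightarrow> (real \<Rightarrow> real) \<Rightarrow> (real \<Rightarrow> real) \<Rightarrow> (real \<Rightarrow> real) \<Rightarrow> bool"
  where "steers_to_origin \<epsilon> p T u x y \<longleftrightarrow>
    controlled_pendulum \<epsilon> T u x y \<and>
    [x 0 = fst p] (rmod 2 * pi) \<and> y 0 = snd p \<and>
    [x T = 0] (rmod 2 * pi) \<and> y T = 0"

definition time_optimal ::
  "real \<Rightarrow> real \<times> real \<Rightarrow> real \<Rightarrow> (real \<Rightarrow> real) \<Rightarrow> (real \<Rightarrow> real) \<Rightarrow> (real \<Rightarrow> real) \<Rightarrow> bool"
  where "time_optimal \<epsilon> p T u x y \<longleftrightarrow>
    steers_to_origin \<epsilon> p T u x y \<and>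
    (\<forall>T' u' x' y'. steers_to_origin \<epsilon> p T' u' x' y' \<longrightarrow> T \<le> T')"

text \<open>
  Since \<open>x\<close> is continuous, the adjoint equations can be imposed classically, with one-sided
  derivatives at the end points. Requiring \<open>u = sgn \<psi>\<close> at every (rather than almost every)
  time with \<open>\<psi> \<noteq> 0\<close> is harmless, because \<open>u\<close> may be changed on a null set without changing
  the trajectory.
\<close>
definition adjoint_variables ::
  "real \<Rightarrow> real \<Rightarrow> (real \<Rightarrow> real) \<Rightarrow> (real \<Rightarrow> real) \<Rightarrow> (real \<Rightarrow> real) \<Rightarrow>
   (real \<Rightarrow> real) \<Rightarrow> (real \<Rightarrow> real) \<Rightarrow> bool"
  where "adjoint_variables \<epsilon> T u x y \<phi> \<psi> \<longleftrightarrow>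
    (\<forall>t\<in>{0..T}.
      (\<phi> has_real_derivative cos (x t) * \<psi> t) (at t within {0..T}) \<and>
      (\<psi> has_real_derivative - \<phi> t) (at t within {0..T}) \<and>
      (\<psi> t \<noteq> 0 \<longrightarrow> u t = sgn (\<psi> t)) \<and>
      y t * \<phi> t + (- sin (x t) + \<epsilon> * u t) * \<psi> t - 1 = 0)"

definition num_zeros :: "real \<Rightarrow> (real \<Rightarrow> real) \<Rightarrow> enat"
  where "num_zeros T \<psi> =
    (let Z = {t \<in> {0..T}. \<psi> t = 0} in if finite Z then enat (card Z) else \<infinity>)"

text \<open>
  Optimal trajectories and adjoint variables for a given initial point need not be unique, so
  the number of switchings at a point is itself a supremum.
\<close>
definition switchings_from :: "real \<Rightarrow> real \<times> real \<Rightarrow> enat"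
  where "switchings_from \<epsilon> p =
    Sup {num_zeros T \<psi> | T u x y \<phi> \<psi>.
           time_optimal \<epsilon> p T u x y \<and> adjoint_variables \<epsilon> T u x y \<phi> \<psi>}"

definition max_switchings :: "real \<Rightarrow> enat"
  where "max_switchings \<epsilon> = (SUP p. switchings_from \<epsilon> p)"

end

theory Submission
  imports Defs "HOL-Complex_Analysis.Great_Picard"
begin

text \<open>
  In the variables \<open>sin (x / 2) = k sin \<theta>\<close>, \<open>y / 2 = k cos \<theta>\<close> the modulus \<open>k\<close> is slow,
  \<open>k' = \<epsilon> u cos \<theta> / 2\<close>, and \<open>\<theta>\<close> is fast, so averaging over a half turn applies away from the
  lower equilibrium \<open>k = 0\<close> and the separatrix \<open>k = 1\<close>.

  Upper bound. By Sturm comparison the zeros of \<open>\<psi>\<close> are at least \<open>\<pi>\<close> apart, and as \<open>y \<phi> = 1\<close> at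
  every zero, \<open>y\<close> has opposite signs at consecutive zeros. Hence \<open>y\<close> vanishes between the first two
  zeros, and from there on the optimal time is at most that of explicit steering by damping. In
  the middle range of \<open>k\<close> the zeros are counted by \<open>\<Delta>\<theta> / \<pi>\<close>, elsewhere by the elapsed time divided
  by \<open>\<pi>\<close>. Averaging bounds the sum by the swing integral: what the rotation \<open>\<Delta>\<theta>\<close> lags behind
  the elapsed time is exactly compensated by the damping time.

  Lower bound. Minimising the time plus a penalty for the distance to the upper equilibrium yields
  an optimal trajectory that starts near it and satisfies the maximum principle. Between zeros of \<open>\<psi>\<close>
  the control is constant, so the energy \<open>1 - cos a\<close> changes by \<open>\<epsilon> \<bar>\<Delta>x\<bar>\<close>, which is at most \<open>\<epsilon>\<close> times
  the sum of the two amplitudes \<open>a\<close>; therefore the integral of \<open>sin s / (2 s)\<close> between consecutive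
  amplitudes is at most \<open>\<epsilon> + O(\<epsilon>\<^sup>2)\<close>.
\<close>

section \<open>Piecewise smooth trajectories\<close>

text \<open>Where D comes from: a swing between turning angles of size a sweeps an angle of about 2
  a, so a constant control changes the energy 1 - cos a by 2 a \<epsilon>; a unit of amplitude thus
  takes sin a / (2 a \<epsilon>) swings, with one switching each. Averaging in k gives the same
  density under a = 2 arcsin k. The averaging errors are not uniform as k tends to 0 or 1. Hence a
  margin \<delta> is fixed before \<epsilon> tends to 0 and removed at the end. A Lyapunov function
  shows that the layers within \<delta> of either end add only O(sqrt \<delta> + sqrt \<epsilon>) to
  \<epsilon> times the damping time, and from k = sqrt \<epsilon> on an explicit control finishes in
  time O(1 / sqrt \<epsilon>). In the lower bound the initial point is not prescribed. With a free,
  penalised end point (in reversed time) every admissible control can serve as a variation, the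
  terminal adjoint is the gradient of the penalty, and stationarity in the terminal time gives the
  Hamiltonian the value that the normalised adjoint system requires. Neither a separation of
  reachable cones nor an abnormal multiplier comes in.\<close>

lemma increment_ge:
  fixes f f' :: "real \<Rightarrow> real"
  assumes S: "finite S" and ab: "a \<le> b" and f: "continuous_on {a..b} f"
    and d: "\<And>t. t \<in> {a<..<b} - S \<Longrightarrow> (f has_real_derivative f' t) (at t)"
    and le: "\<And>t. t \<in> {a<..<b} - S \<Longrightarrow> c \<le> f' t"
  shows "c * (b - a) \<le> f b - f a"
proof -
  \<comment> \<open>The values at the exceptional points do not affect the integral;
    \<open>c\<close> makes the comparison with the constant hold everywhere.\<close>
  define g where "g t = (if t \<in> {a<..<b} - S then f' t else c)" for t
  have 1: "(g has_integral (f b - f a)) {a..b}"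
    by (rule fundamental_theorem_of_calculus_interior_strong[OF S ab _ f])
      (use d in \<open>auto simp: g_def has_real_derivative_iff_has_vector_derivative[symmetric]\<close>)
  have 2: "((\<lambda>_. c) has_integral (c * (b - a))) {a..b}"
    using has_integral_const_real[of c a b] ab by (simp add: mult.commute)
  show ?thesis
    by (rule has_integral_le[OF 2 1]) (use le in \<open>auto simp: g_def\<close>)
qed

lemma increment_le:
  fixes f f' :: "real \<Rightarrow> real"
  assumes S: "finite S" and ab: "a \<le> b" and f: "continuous_on {a..b} f"
    and d: "\<And>t. t \<in> {a<..<b} - S \<Longrightarrow> (f has_real_derivative f' t) (at t)"
    and le: "\<And>t. t \<in> {a<..<b} - S \<Longrightarrow> f' t \<le> c"
  shows "f b - f a \<le> c * (b - a)"
proof -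
  have "(- c) * (b - a) \<le> (- f b) - (- f a)"
    by (rule increment_ge[OF S ab, where f' = "\<lambda>t. - f' t"])
      (use f d le in \<open>auto intro!: continuous_intros derivative_intros\<close>)
  then show ?thesis by simp
qed

lemma increment_eq:
  fixes f f' :: "real \<Rightarrow> real"
  assumes "finite S" "a \<le> b" "continuous_on {a..b} f"
    and "\<And>t. t \<in> {a<..<b} - S \<Longrightarrow> (f has_real_derivative c) (at t)"
  shows "f b - f a = c * (b - a)"
  using increment_ge[OF assms(1-3), of "\<lambda>_. c" c] increment_le[OF assms(1-3), of "\<lambda>_. c" c] assms(4)
  by (intro antisym) auto

text \<open>Every trajectory built below is differentiable outside a finite set, where the
  integrated equations become pointwise ones. Controls that are total and Borel make reversal and
  concatenation plain substitutions.\<close>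

definition pw_trajectory ::
  "real \<Rightarrow> real \<Rightarrow> (real \<Rightarrow> real) \<Rightarrow> (real \<Rightarrow> real) \<Rightarrow> (real \<Rightarrow> real) \<Rightarrow> bool"
  where "pw_trajectory \<epsilon> T u x y \<longleftrightarrow>
    0 \<le> T \<and> u \<in> borel_measurable borel \<and> (\<forall>t. \<bar>u t\<bar> \<le> 1) \<and>
    continuous_on {0..T} x \<and> continuous_on {0..T} y \<and>
    (\<exists>S. finite S \<and> (\<forall>t\<in>{0<..<T} - S.
       (x has_real_derivative y t) (at t) \<and>
       (y has_real_derivative - sin (x t) + \<epsilon> * u t) (at t)))"

lemma pw_trajectoryI:
  assumes "0 \<le> T" "u \<in> borel_measurable borel" "\<And>t. \<bar>u t\<bar> \<le> 1"
    "continuous_on {0..T} x" "continuous_on {0..T} y" "finite S"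
    "\<And>t. t \<in> {0<..<T} - S \<Longrightarrow> (x has_real_derivative y t) (at t)"
    "\<And>t. t \<in> {0<..<T} - S \<Longrightarrow> (y has_real_derivative - sin (x t) + \<epsilon> * u t) (at t)"
  shows "pw_trajectory \<epsilon> T u x y"
  unfolding pw_trajectory_def using assms by blast

lemma pw_trajectoryE:
  assumes "pw_trajectory \<epsilon> T u x y"
  obtains S where "0 \<le> T" "u \<in> borel_measurable borel" "\<And>t. \<bar>u t\<bar> \<le> 1"
    "continuous_on {0..T} x" "continuous_on {0..T} y" "finite S"
    "\<And>t. t \<in> {0<..<T} - S \<Longrightarrow> (x has_real_derivative y t) (at t)"
    "\<And>t. t \<in> {0<..<T} - S \<Longrightarrow> (y has_real_derivative - sin (x t) + \<epsilon> * u t) (at t)"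
  using assms unfolding pw_trajectory_def by metis

lemma pw_trajectory_controlled_pendulum:
  assumes "pw_trajectory \<epsilon> T u x y"
  shows "controlled_pendulum \<epsilon> T u x y"
  using assms
proof (rule pw_trajectoryE)
  fix S
  assume *: "0 \<le> T" "u \<in> borel_measurable borel" "\<And>t. \<bar>u t\<bar> \<le> 1"
    "continuous_on {0..T} x" "continuous_on {0..T} y" "finite S"
    "\<And>t. t \<in> {0<..<T} - S \<Longrightarrow> (x has_real_derivative y t) (at t)"
    "\<And>t. t \<in> {0<..<T} - S \<Longrightarrow> (y has_real_derivative - sin (x t) + \<epsilon> * u t) (at t)"
  have "u \<in> borel_measurable (lebesgue_on {0..T})"
    using *(2) by (intro measurable_restrict_space1 measurable_completion) auto
  moreover have "(y has_integral (x t - x 0)) {0..t}" if "t \<in> {0..T}" for t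
    by (rule fundamental_theorem_of_calculus_interior_strong[OF *(6)])
      (use that *(7) in \<open>auto intro: continuous_on_subset[OF *(4)]
        simp: has_real_derivative_iff_has_vector_derivative[symmetric]\<close>)
  moreover have "((\<lambda>s. - sin (x s) + \<epsilon> * u s) has_integral (y t - y 0)) {0..t}" if "t \<in> {0..T}" for t
    by (rule fundamental_theorem_of_calculus_interior_strong[OF *(6)])
      (use that *(8) in \<open>auto intro: continuous_on_subset[OF *(5)]
        simp: has_real_derivative_iff_has_vector_derivative[symmetric]\<close>)
  ultimately show ?thesis
    unfolding controlled_pendulum_def using *(1,3) by auto
qed

lemma pw_trajectory_shift:
  assumes "pw_trajectory \<epsilon> T u x y"
  shows "pw_trajectory \<epsilon> T u (\<lambda>t. x t + of_int n * (2 * pi)) y"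
proof -
  have "sin (a + of_int n * (2 * pi)) = sin a" for a
    using sin.plus_of_int[of a n] by (simp add: mult.commute)
  then show ?thesis
    using assms by (elim pw_trajectoryE, intro pw_trajectoryI) (auto intro!: continuous_intros derivative_eq_intros)
qed

lemma pw_trajectory_reflect:
  assumes "pw_trajectory \<epsilon> T u x y"
  shows "pw_trajectory \<epsilon> T (\<lambda>t. - u t) (\<lambda>t. - x t) (\<lambda>t. - y t)"
  using assms by (elim pw_trajectoryE, intro pw_trajectoryI) (auto intro!: continuous_intros derivative_eq_intros)

text \<open>The pendulum is reversible: reversing time together with y -> - y keeps the equation and
  the control values.\<close>

lemma pw_trajectory_reverse:
  assumes "pw_trajectory \<epsilon> T u x y"
  shows "pw_trajectory \<epsilon> T (\<lambda>t. u (T - t)) (\<lambda>t. x (T - t)) (\<lambda>t. - y (T - t))"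
  using assms
proof (rule pw_trajectoryE)
  fix S
  assume *: "0 \<le> T" "u \<in> borel_measurable borel" "\<And>t. \<bar>u t\<bar> \<le> 1"
    "continuous_on {0..T} x" "continuous_on {0..T} y" "finite S"
    "\<And>t. t \<in> {0<..<T} - S \<Longrightarrow> (x has_real_derivative y t) (at t)"
    "\<And>t. t \<in> {0<..<T} - S \<Longrightarrow> (y has_real_derivative - sin (x t) + \<epsilon> * u t) (at t)"
  have c: "continuous_on {0..T} (\<lambda>t. f (T - t))" if "continuous_on {0..T} f" for f :: "real \<Rightarrow> real"
    by (rule continuous_on_compose2[OF that]) (auto intro!: continuous_intros)
  show ?thesis
  proof (rule pw_trajectoryI[where S = "(\<lambda>t. T - t) ` S"])
    fix t assume t: "t \<in> {0<..<T} - (\<lambda>t. T - t) ` S"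
    then have t': "T - t \<in> {0<..<T} - S" by (auto simp: image_iff)
    have sub: "((\<lambda>t. T - t) has_real_derivative - 1) (at t)" by (auto intro!: derivative_eq_intros)
    show "((\<lambda>t. x (T - t)) has_real_derivative - y (T - t)) (at t)"
      using DERIV_chain2[OF *(7)[OF t'] sub] by simp
    show "((\<lambda>t. - y (T - t)) has_real_derivative - sin (x (T - t)) + \<epsilon> * u (T - t)) (at t)"
      using DERIV_minus[OF DERIV_chain2[OF *(8)[OF t'] sub]] by simp
  qed (use * in \<open>auto intro!: c continuous_intros\<close>)
qed

lemma pw_trajectory_concat:
  assumes 1: "pw_trajectory \<epsilon> T1 u1 x1 y1" and 2: "pw_trajectory \<epsilon> T2 u2 x2 y2"
    and x: "x2 0 = x1 T1" and y: "y2 0 = y1 T1"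
  shows "pw_trajectory \<epsilon> (T1 + T2) (\<lambda>t. if t \<le> T1 then u1 t else u2 (t - T1))
    (\<lambda>t. if t \<le> T1 then x1 t else x2 (t - T1)) (\<lambda>t. if t \<le> T1 then y1 t else y2 (t - T1))"
proof -
  obtain S1 where 1: "0 \<le> T1" "u1 \<in> borel_measurable borel" "\<And>t. \<bar>u1 t\<bar> \<le> 1"
    "continuous_on {0..T1} x1" "continuous_on {0..T1} y1" "finite S1"
    "\<And>t. t \<in> {0<..<T1} - S1 \<Longrightarrow> (x1 has_real_derivative y1 t) (at t)"
    "\<And>t. t \<in> {0<..<T1} - S1 \<Longrightarrow> (y1 has_real_derivative - sin (x1 t) + \<epsilon> * u1 t) (at t)"
    using 1 by (rule pw_trajectoryE) blast
  obtain S2 where 2: "0 \<le> T2" "u2 \<in> borel_measurable borel" "\<And>t. \<bar>u2 t\<bar> \<le> 1"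
    "continuous_on {0..T2} x2" "continuous_on {0..T2} y2" "finite S2"
    "\<And>t. t \<in> {0<..<T2} - S2 \<Longrightarrow> (x2 has_real_derivative y2 t) (at t)"
    "\<And>t. t \<in> {0<..<T2} - S2 \<Longrightarrow> (y2 has_real_derivative - sin (x2 t) + \<epsilon> * u2 t) (at t)"
    using 2 by (rule pw_trajectoryE) blast
  have c: "continuous_on {0..T1 + T2} (\<lambda>t. if t \<le> T1 then f t else g (t - T1))"
    if "continuous_on {0..T1} f" "continuous_on {0..T2} g" "g 0 = f T1" for f g :: "real \<Rightarrow> real"
  proof -
    have "continuous_on ({0..T1} \<union> {T1..T1 + T2}) (\<lambda>t. if t \<le> T1 then f t else g (t - T1))"
      using that
      by (intro continuous_on_If) (auto intro!: continuous_on_compose2[OF that(2)] continuous_intros)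
    then show ?thesis using 1(1) 2(1) by (simp add: ivl_disj_un_two_touch)
  qed
  have dl: "((\<lambda>t. if t \<le> T1 then f t else g (t - T1)) has_real_derivative D) (at t)"
    if "(f has_real_derivative D) (at t)" "t < T1" for f g :: "real \<Rightarrow> real" and D t
    by (rule has_field_derivative_transform_within_open[OF that(1), of "{..<T1}"]) (use that(2) in auto)
  have dr: "((\<lambda>t. if t \<le> T1 then f t else g (t - T1)) has_real_derivative D) (at t)"
    if "(g has_real_derivative D) (at (t - T1))" "T1 < t" for f g :: "real \<Rightarrow> real" and D t
  proof -
    have "((\<lambda>t. g (t - T1)) has_real_derivative D) (at t)"
      using DERIV_shift[of g D t "- T1"] that(1) by simp
    then show ?thesis
      by (rule has_field_derivative_transform_within_open[of _ _ _ "{T1<..}"]) (use that(2) in auto)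
  qed
  show ?thesis
  \<comment> \<open>The junction \<open>T1\<close> joins the exceptional set because the control,
    and with it the derivative of y, may jump there.\<close>
  proof (rule pw_trajectoryI[where S = "insert T1 (S1 \<union> (\<lambda>t. t + T1) ` S2)"])
    fix t assume t: "t \<in> {0<..<T1 + T2} - insert T1 (S1 \<union> (\<lambda>t. t + T1) ` S2)"
    consider "t < T1" "t \<in> {0<..<T1} - S1" | "T1 < t" "t - T1 \<in> {0<..<T2} - S2"
      using t by (cases "t < T1") (auto simp: image_iff, metis diff_add_cancel)
    note cs = this
    show "((\<lambda>t. if t \<le> T1 then x1 t else x2 (t - T1)) has_real_derivative
            (if t \<le> T1 then y1 t else y2 (t - T1))) (at t)"
      by (cases rule: cs) (use dl[OF 1(7)] dr[OF 2(7)] in auto)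
    show "((\<lambda>t. if t \<le> T1 then y1 t else y2 (t - T1)) has_real_derivative
            - sin (if t \<le> T1 then x1 t else x2 (t - T1)) + \<epsilon> * (if t \<le> T1 then u1 t else u2 (t - T1))) (at t)"
      by (cases rule: cs) (use dl[OF 1(8)] dr[OF 2(8)] in auto)
  next
    have [measurable]: "u1 \<in> borel_measurable borel" "u2 \<in> borel_measurable borel" using 1 2 by auto
    show "(\<lambda>t. if t \<le> T1 then u1 t else u2 (t - T1)) \<in> borel_measurable borel" by measurable
  qed (use 1 2 c x y in auto)
qed

lemma pw_trajectory_restrict:
  assumes "pw_trajectory \<epsilon> T u x y" "0 \<le> s" "s \<le> T"
  shows "pw_trajectory \<epsilon> s u x y"
  using assms
  by (elim pw_trajectoryE) (rule pw_trajectoryI, auto intro: continuous_on_subset)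

lemma controlled_pendulum_continuous:
  assumes "controlled_pendulum \<epsilon> T u x y"
  shows "continuous_on {0..T} x" "continuous_on {0..T} y"
proof -
  have c: "continuous_on {0..T} f" if "\<And>t. t \<in> {0..T} \<Longrightarrow> (g has_integral (f t - f 0)) {0..t}" "0 \<le> T"
    for f g :: "real \<Rightarrow> real"
  proof -
    have "continuous_on {0..T} (\<lambda>t. f 0 + integral {0..t} g)"
      using that(1)[of T] that(2)
      by (intro continuous_intros indefinite_integral_continuous_1) auto
    then show ?thesis
      by (rule continuous_on_eq) (use integral_unique[OF that(1)] in auto)
  qed
  show "continuous_on {0..T} x" "continuous_on {0..T} y"
    using assms unfolding controlled_pendulum_def by (auto intro!: c)
qed

text \<open>The way back from the integrated equations to pointwise ones, at any instant where the
  right-hand side happens to be continuous.\<close>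

lemma has_real_derivative_of_has_integral:
  fixes f g :: "real \<Rightarrow> real"
  assumes g: "\<And>t. t \<in> {0..T} \<Longrightarrow> (g has_integral (f t - f 0)) {0..t}"
    and t: "t \<in> {0<..<T}" and c: "isCont g t"
  shows "(f has_real_derivative g t) (at t)"
proof -
  have "((\<lambda>s. integral {0..s} g) has_vector_derivative g t) (at t within ({0..T} - {}))"
    using g[of T] t c by (intro integral_has_vector_derivative_continuous_at)
      (auto intro: continuous_at_imp_continuous_within)
  then have "((\<lambda>s. integral {0..s} g) has_real_derivative g t) (at t)"
    using t by (simp add: has_real_derivative_iff_has_vector_derivative at_within_Icc_at)
  then have "((\<lambda>s. f 0 + integral {0..s} g) has_real_derivative g t) (at t)"
    by (auto intro!: derivative_eq_intros)
  then show ?thesis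
    by (rule has_field_derivative_transform_within_open[of _ _ _ "{0<..<T}"])
      (use t integral_unique[OF g] in auto)
qed

text \<open>Banach's fixed point theorem for the rescaled unknown exp (- 2 L t) z: in this weighted
  norm the Picard operator contracts by 1 / 2 on the whole interval, so no short solutions have to
  be glued. The term \<open>h\<close> need only be continuous, which later admits \<epsilon> times
  the primitive of a measurable control.\<close>

lemma picard_existence:
  fixes F :: "real \<Rightarrow> 'a::banach \<Rightarrow> 'a" and h :: "real \<Rightarrow> 'a"
  assumes T: "0 \<le> T" and L: "0 < L"
    and h: "continuous_on {0..T} h"
    and F: "continuous_on ({0..T} \<times> UNIV) (\<lambda>(t, z). F t z)"
    and lip: "\<And>t z w. t \<in> {0..T} \<Longrightarrow> norm (F t z - F t w) \<le> L * norm (z - w)"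
  obtains z where "continuous_on {0..T} z"
    "\<And>t. t \<in> {0..T} \<Longrightarrow> z t = h t + integral {0..t} (\<lambda>s. F s (z s))"
proof -
  define P :: "(real \<Rightarrow>\<^sub>C 'a) \<Rightarrow> real \<Rightarrow> 'a" where
    "P w t = exp (- 2 * L * t) *\<^sub>R (h t + integral {0..t} (\<lambda>s. F s (exp (2 * L * s) *\<^sub>R w s)))" for w t
  \<comment> \<open>Bounded continuous functions live on the whole line; clamping the time reduces
    them to their values on \<open>{0..T}\<close>.\<close>
  define cl where "cl t = max 0 (min T t)" for t :: real
  have cl: "cl t \<in> {0..T}" for t using T by (auto simp: cl_def)
  have cl_id: "cl t = t" if "t \<in> {0..T}" for t using that by (auto simp: cl_def)
  have contF: "continuous_on {0..T} (\<lambda>s. F s (exp (2 * L * s) *\<^sub>R w s))" for w :: "real \<Rightarrow>\<^sub>C 'a"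
    using continuous_on_compose2[OF F, of "{0..T}" "\<lambda>s. (s, exp (2 * L * s) *\<^sub>R w s)"]
    by (simp add: continuous_intros image_subset_iff)
  have contP: "continuous_on {0..T} (P w)" for w
    unfolding P_def
    by (intro continuous_intros h indefinite_integral_continuous_1 integrable_continuous_real contF)
  have contPcl: "continuous_on UNIV (\<lambda>t. P w (cl t))" for w
    by (rule continuous_on_compose2[OF contP]) (use cl in \<open>auto simp: cl_def intro!: continuous_intros\<close>)
  have bddP: "bounded (range (\<lambda>t. P w (cl t)))" for w
  proof -
    have "bounded (P w ` {0..T})"
      using compact_continuous_image[OF contP] compact_imp_bounded by blast
    then show ?thesis by (rule bounded_subset) (use cl in auto)
  qed
  define Phi where "Phi w = Bcontfun (\<lambda>t. P w (cl t))" for w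
  have Phi: "apply_bcontfun (Phi w) = (\<lambda>t. P w (cl t))" for w
    unfolding Phi_def using contPcl bddP by (intro Bcontfun_inverse) (auto simp: bcontfun_def)
  have step: "norm (P w t - P v t) \<le> 1/2 * dist w v" if t: "t \<in> {0..T}" for w v t
  proof -
    have int: "(\<lambda>s. F s (exp (2 * L * s) *\<^sub>R w s)) integrable_on {0..t}" for w :: "real \<Rightarrow>\<^sub>C 'a"
      using t by (intro integrable_continuous_real continuous_on_subset[OF contF]) auto
    have I: "((\<lambda>s. L * (exp (2 * L * s) * dist w v)) has_integral
        (exp (2 * L * t) * dist w v / 2 - exp (2 * L * 0) * dist w v / 2)) {0..t}"
      using t L
      by (intro fundamental_theorem_of_calculus)
        (auto intro!: derivative_eq_intros simp: has_real_derivative_iff_has_vector_derivative[symmetric])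
    have "norm (integral {0..t} (\<lambda>s. F s (exp (2 * L * s) *\<^sub>R w s)) - integral {0..t} (\<lambda>s. F s (exp (2 * L * s) *\<^sub>R v s)))
        = norm (integral {0..t} (\<lambda>s. F s (exp (2 * L * s) *\<^sub>R w s) - F s (exp (2 * L * s) *\<^sub>R v s)))"
      by (simp add: integral_diff int)
    also have "\<dots> \<le> integral {0..t} (\<lambda>s. L * (exp (2 * L * s) * dist w v))"
    proof (rule integral_norm_bound_integral)
      show "(\<lambda>s. F s (exp (2 * L * s) *\<^sub>R w s) - F s (exp (2 * L * s) *\<^sub>R v s)) integrable_on {0..t}"
        by (intro integrable_diff int)
      show "(\<lambda>s. L * (exp (2 * L * s) * dist w v)) integrable_on {0..t}" using I by blast
      fix s assume s: "s \<in> {0..t}"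
      have "norm (F s (exp (2 * L * s) *\<^sub>R w s) - F s (exp (2 * L * s) *\<^sub>R v s))
          \<le> L * norm (exp (2 * L * s) *\<^sub>R w s - exp (2 * L * s) *\<^sub>R v s)"
        using s t by (intro lip) auto
      also have "\<dots> = L * (exp (2 * L * s) * dist (w s) (v s))"
        by (simp add: dist_norm flip: scaleR_diff_right)
      also have "\<dots> \<le> L * (exp (2 * L * s) * dist w v)"
        using L dist_bounded[of w s v] by (intro mult_left_mono) auto
      finally show "norm (F s (exp (2 * L * s) *\<^sub>R w s) - F s (exp (2 * L * s) *\<^sub>R v s)) \<le> L * (exp (2 * L * s) * dist w v)" .
    qed
    also have "\<dots> \<le> exp (2 * L * t) * dist w v / 2"
      unfolding integral_unique[OF I] by simp
    finally have *: "norm (integral {0..t} (\<lambda>s. F s (exp (2 * L * s) *\<^sub>R w s)) - integral {0..t} (\<lambda>s. F s (exp (2 * L * s) *\<^sub>R v s)))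
      \<le> exp (2 * L * t) * dist w v / 2" .
    have "norm (P w t - P v t) = exp (- 2 * L * t) * norm (integral {0..t} (\<lambda>s. F s (exp (2 * L * s) *\<^sub>R w s)) - integral {0..t} (\<lambda>s. F s (exp (2 * L * s) *\<^sub>R v s)))"
      unfolding P_def scaleR_diff_right[symmetric] by simp
    also have "\<dots> \<le> exp (- 2 * L * t) * (exp (2 * L * t) * dist w v / 2)"
      by (intro mult_left_mono *) auto
    also have "\<dots> = 1/2 * dist w v" by (simp add: exp_minus field_simps)
    finally show ?thesis .
  qed
  have "\<exists>!w. Phi w = w"
  proof (rule banach_fix_type[of "1/2"])
    show "\<forall>x y. dist (Phi x) (Phi y) \<le> 1/2 * dist x y"
      by (intro allI dist_bound) (use step[OF cl] in \<open>simp add: Phi dist_norm\<close>)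
  qed auto
  then obtain w where w: "Phi w = w" by blast
  have wP: "w t = P w t" if "t \<in> {0..T}" for t
    using fun_cong[OF Phi[of w], of t] by (simp add: w cl_id[OF that])
  show thesis
  proof
    show "continuous_on {0..T} (\<lambda>t. exp (2 * L * t) *\<^sub>R w t)" by (intro continuous_intros) auto
    fix t assume t: "t \<in> {0..T}"
    show "exp (2 * L * t) *\<^sub>R w t = h t + integral {0..t} (\<lambda>s. F s (exp (2 * L * s) *\<^sub>R w s))"
      by (subst wP[OF t]) (simp add: P_def flip: exp_add)
  qed
qed

lemma gronwall_integral:
  fixes v :: "real \<Rightarrow> real"
  assumes v: "continuous_on {0..T} v" and L: "0 \<le> L"
    and le: "\<And>t. t \<in> {0..T} \<Longrightarrow> v t \<le> A + L * integral {0..t} v"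
    and t: "t \<in> {0..T}"
  shows "v t \<le> A * exp (L * t)"
proof -
  \<comment> \<open>The right-hand side of the hypothesis times exp (- L t). Its derivative is L exp
    (- L t) times \<open>v\<close> minus that right-hand side, hence not positive, so it stays below
    its initial value \<open>A\<close>.\<close>
  define q where "q t = exp (- L * t) * (A + L * integral {0..t} v)" for t
  have "q t - q 0 \<le> 0 * (t - 0)"
  proof (rule increment_le[of "{}" 0 t q "\<lambda>s. exp (- L * s) * (L * (v s - (A + L * integral {0..s} v)))"])
    show "0 \<le> t" using t by simp
    show "continuous_on {0..t} q" unfolding q_def
      using t by (intro continuous_intros indefinite_integral_continuous_1 integrable_continuous_real continuous_on_subset[OF v]) auto
    fix s assume s: "s \<in> {0<..<t} - {}"
    have "((\<lambda>x. integral {0..x} v) has_real_derivative v s) (at s within {0..T})"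
      using integral_has_real_derivative[OF v] s t by auto
    then have "((\<lambda>x. integral {0..x} v) has_real_derivative v s) (at s)"
      using s t by (simp add: at_within_Icc_at)
    then show "(q has_real_derivative (exp (- L * s) * (L * (v s - (A + L * integral {0..s} v))))) (at s)"
      unfolding q_def by (auto intro!: derivative_eq_intros simp: algebra_simps)
    show "exp (- L * s) * (L * (v s - (A + L * integral {0..s} v))) \<le> 0"
      using le[of s] s t L by (intro mult_nonneg_nonpos) auto
  qed auto
  then have "exp (- L * t) * (A + L * integral {0..t} v) \<le> A" by (simp add: q_def)
  then have "A + L * integral {0..t} v \<le> A * exp (L * t)"
    by (simp add: exp_minus field_simps)
  then show ?thesis using le[OF t] by linarith
qed

section \<open>Averaging over half turns\<close>

text \<open>Mean zero over a period makes the primitive itself periodic, so its size is decided on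
  the first period.\<close>

lemma integral_periodic_mean_zero:
  fixes p :: "real \<Rightarrow> real"
  assumes cont: "continuous_on UNIV p" and per: "\<And>t. p (t + pi) = p t"
    and mean: "integral {0..pi} p = 0"
    and B: "\<And>t. t \<in> {0..pi} \<Longrightarrow> \<bar>p t\<bar> \<le> B"
    and t: "0 \<le> t"
  shows "\<bar>integral {0..t} p\<bar> \<le> pi * B"
proof -
  have int: "p integrable_on {a..b}" for a b
    by (intro integrable_continuous_real continuous_on_subset[OF cont]) auto
  have der: "((\<lambda>x. integral {0..x} p) has_real_derivative p s) (at s)" if "0 < s" for s
  proof -
    have "((\<lambda>x. integral {0..x} p) has_real_derivative p s) (at s within {0..s+1})"
      using that by (intro integral_has_real_derivative continuous_on_subset[OF cont]) auto
    then show ?thesis using that by (simp add: at_within_Icc_at)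
  qed
  have cI: "continuous_on {0..s} (\<lambda>x. integral {0..x} p)" for s
    by (intro indefinite_integral_continuous_1 int)
  have shift: "integral {0..s + pi} p = integral {0..s} p" if "0 \<le> s" for s
  proof -
    have "(\<lambda>s. integral {0..s + pi} p - integral {0..s} p) s - (\<lambda>s. integral {0..s + pi} p - integral {0..s} p) 0 = 0 * (s - 0)"
    proof (rule increment_eq[of "{}"])
      show "continuous_on {0..s} (\<lambda>s. integral {0..s + pi} p - integral {0..s} p)"
        by (intro continuous_intros cI continuous_on_compose2[OF cI[of "s + pi"], of "{0..s}" "\<lambda>s. s + pi"]) auto
      fix x assume x: "x \<in> {0<..<s} - {}"
      have "((\<lambda>x. integral {0..x + pi} p) has_real_derivative p (x + pi)) (at x)"
        using DERIV_shift[of "\<lambda>x. integral {0..x} p" "p (x + pi)" x pi] der[of "x + pi"] x add_pos_pos[of x pi] by auto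
      then show "((\<lambda>s. integral {0..s + pi} p - integral {0..s} p) has_real_derivative 0) (at x)"
        using DERIV_diff[OF _ der[of x], of "\<lambda>x. integral {0..x + pi} p" "p (x + pi)"] x per by simp
    qed (use that in auto)
    then show ?thesis using mean by simp
  qed
  have base: "\<bar>integral {0..s} p\<bar> \<le> pi * B" if "s \<in> {0..pi}" for s
  proof -
    have B0: "0 \<le> B" using B[of 0] by auto
    have "norm (integral {0..s} p) \<le> integral {0..s} (\<lambda>_. B)"
      using that B by (intro integral_norm_bound_integral int) auto
    also have "\<dots> = s * B" using that by simp
    also have "\<dots> \<le> pi * B" using that B0 by (intro mult_right_mono) auto
    finally show ?thesis by simp
  qed
  have "\<forall>s\<in>{0..real n * pi + pi}. \<bar>integral {0..s} p\<bar> \<le> pi * B" for n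
  proof (induction n)
    case 0 then show ?case using base by simp
  next
    case (Suc n)
    show ?case
    proof
      fix s assume s: "s \<in> {0..real (Suc n) * pi + pi}"
      show "\<bar>integral {0..s} p\<bar> \<le> pi * B"
      proof (cases "s \<le> pi")
        case True then show ?thesis using base s by auto
      next
        case False
        then have "\<bar>integral {0..s - pi} p\<bar> \<le> pi * B"
          using s Suc by (auto simp: algebra_simps)
        then show ?thesis using shift[of "s - pi"] False by simp
      qed
    qed
  qed
  moreover obtain n where "t / pi < real n" using reals_Archimedean2 by blast
  then have "t < real n * pi" by (simp add: field_simps)
  then have "t \<le> real n * pi + pi" using pi_gt_zero by linarith
  ultimately show ?thesis using t by auto
qed

text \<open>The primitive in the fast variable is the corrector of first-order averaging. Mean zero
  for every k bounds it, and also bounds its k-derivative, whose integrand then has mean zero too.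
  The joint derivative is stated because the corrector is composed with a curve in (k, \<theta>). In
  the fast variable \<open>f\<close> need only be continuous, which lets in |cos|.\<close>

lemma corrector_exists:
  fixes f fk :: "real \<Rightarrow> real \<Rightarrow> real"
  assumes U: "l < p" "p \<le> q" "q < r"
    and der: "\<And>k t. k \<in> {l<..<r} \<Longrightarrow> ((\<lambda>k. f k t) has_real_derivative fk k t) (at k)"
    and cf: "continuous_on ({l<..<r} \<times> UNIV) (\<lambda>(k, t). f k t)"
    and cfk: "continuous_on ({l<..<r} \<times> UNIV) (\<lambda>(k, t). fk k t)"
    and per: "\<And>k t. k \<in> {l<..<r} \<Longrightarrow> f k (t + pi) = f k t"
    and perk: "\<And>k t. k \<in> {l<..<r} \<Longrightarrow> fk k (t + pi) = fk k t"
    and mean: "\<And>k. k \<in> {l<..<r} \<Longrightarrow> integral {0..pi} (f k) = 0"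
  obtains g gk B where
    "\<And>k t. k \<in> {p..q} \<Longrightarrow> 0 < t \<Longrightarrow> \<bar>g k t\<bar> \<le> B \<and> \<bar>gk k t\<bar> \<le> B \<and> \<bar>f k t\<bar> \<le> B"
    "\<And>k t. k \<in> {p..q} \<Longrightarrow> 0 < t \<Longrightarrow>
      ((\<lambda>(k, t). g k t) has_derivative (\<lambda>(dk, dt). gk k t * dk + f k t * dt)) (at (k, t))"
proof -
  define g where "g k t = integral {0..t} (f k)" for k t
  define gk where "gk k t = integral {0..t} (fk k)" for k t
  have cp: "continuous_on A (Pair k)" for A :: "real set" and k :: real
    by (rule continuous_on_Pair) (auto intro: continuous_intros)
  have cs: "continuous_on A (f k)" "continuous_on A (fk k)" if "k \<in> {l<..<r}" for A k
    using continuous_on_compose2[OF cf, of A "\<lambda>t. (k, t)"] continuous_on_compose2[OF cfk, of A "\<lambda>t. (k, t)"] that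
    by (auto simp: image_subset_iff cp)
  have gkd: "((\<lambda>k. g k t) has_real_derivative gk k t) (at k within {l<..<r})" if k: "k \<in> {l<..<r}" for k t
    unfolding g_def gk_def cbox_interval[symmetric]
  proof (rule leibniz_rule_field_derivative)
    show "((\<lambda>x. f x s) has_real_derivative fk x s) (at x within {l<..<r})" if "x \<in> {l<..<r}" for x s
      by (rule has_field_derivative_at_within[OF der[OF that]])
    show "f x integrable_on cbox 0 t" if "x \<in> {l<..<r}" for x
      unfolding cbox_interval by (rule integrable_continuous_real[OF cs(1)[OF that]])
    show "continuous_on ({l<..<r} \<times> cbox 0 t) (\<lambda>(x, t). fk x t)"
      by (rule continuous_on_subset[OF cfk]) auto
  qed (use k in auto)
  have gtd: "((\<lambda>t. g k t) has_real_derivative f k t) (at t)" if k: "k \<in> {l<..<r}" "0 < t" for k t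
  proof -
    have "((\<lambda>x. g k x) has_real_derivative f k t) (at t within {0..t+1})"
      unfolding g_def using that by (intro integral_has_real_derivative cs) auto
    then show ?thesis using that by (simp add: at_within_Icc_at)
  qed
  \<comment> \<open>The map sending k to the integral of \<open>f k\<close> over a period vanishes
    identically, so its derivative does too.\<close>
  have meank: "integral {0..pi} (fk k) = 0" if k: "k \<in> {l<..<r}" for k
  proof -
    have "((\<lambda>k. g k pi) has_real_derivative gk k pi) (at k)"
      using gkd[OF k, of pi] at_within_open[OF k] by simp
    moreover have "((\<lambda>k. g k pi) has_real_derivative 0) (at k)"
      by (rule has_field_derivative_transform_within_open[of "\<lambda>_. 0" _ _ "{l<..<r}"])
        (use k mean in \<open>auto simp: g_def\<close>)
    ultimately show ?thesis using DERIV_unique unfolding gk_def by blast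
  qed
  have cmp: "compact ({p..q} \<times> {0..pi})" by (intro compact_Times compact_Icc)
  obtain B1 where B1: "\<And>k t. k \<in> {p..q} \<Longrightarrow> t \<in> {0..pi} \<Longrightarrow> \<bar>f k t\<bar> \<le> B1"
  proof -
    have "compact ((\<lambda>(k, t). f k t) ` ({p..q} \<times> {0..pi}))"
      using U by (intro compact_continuous_image cmp continuous_on_subset[OF cf]) auto
    from compact_imp_bounded[OF this] obtain a where "\<forall>x\<in>{p..q}. \<forall>y\<in>{0..pi}. \<bar>f x y\<bar> \<le> a"
      by (auto simp: bounded_iff)
    then show ?thesis by (intro that[of a]) auto
  qed
  obtain B2 where B2: "\<And>k t. k \<in> {p..q} \<Longrightarrow> t \<in> {0..pi} \<Longrightarrow> \<bar>fk k t\<bar> \<le> B2"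
  proof -
    have "compact ((\<lambda>(k, t). fk k t) ` ({p..q} \<times> {0..pi}))"
      using U by (intro compact_continuous_image cmp continuous_on_subset[OF cfk]) auto
    from compact_imp_bounded[OF this] obtain a where "\<forall>x\<in>{p..q}. \<forall>y\<in>{0..pi}. \<bar>fk x y\<bar> \<le> a"
      by (auto simp: bounded_iff)
    then show ?thesis by (intro that[of a]) auto
  qed
  have B1': "\<bar>f k t\<bar> \<le> B1" if "k \<in> {p..q}" "0 < t" for k t
  proof -
    have "\<forall>s\<in>{0..real n * pi + pi}. \<bar>f k s\<bar> \<le> B1" for n
    proof (induction n)
      case 0 then show ?case using B1 that by simp
    next
      case (Suc n)
      show ?case
      proof
        fix s assume s: "s \<in> {0..real (Suc n) * pi + pi}"
        show "\<bar>f k s\<bar> \<le> B1"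
        proof (cases "s \<le> pi")
          case True then show ?thesis using B1 that s by auto
        next
          case False
          then have "\<bar>f k (s - pi)\<bar> \<le> B1" using s Suc by (auto simp: algebra_simps)
          then show ?thesis using per[of k "s - pi"] that U by simp
        qed
      qed
    qed
    moreover obtain n where "t / pi < real n" using reals_Archimedean2 by blast
    then have "t < real n * pi" by (simp add: field_simps)
  then have "t \<le> real n * pi + pi" using pi_gt_zero by linarith
    ultimately show ?thesis using that by auto
  qed
  show thesis
  proof
    fix k t :: real assume kt: "k \<in> {p..q}" "0 < t"
    then have k: "k \<in> {l<..<r}" using U by auto
    have "\<bar>g k t\<bar> \<le> pi * B1" unfolding g_def
      by (rule integral_periodic_mean_zero) (use cs per mean B1 k kt in auto)
    moreover have "\<bar>gk k t\<bar> \<le> pi * B2" unfolding gk_def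
      by (rule integral_periodic_mean_zero) (use cs perk meank B2 k kt in auto)
    ultimately show "\<bar>g k t\<bar> \<le> max (max (pi * B1) (pi * B2)) B1 \<and> \<bar>gk k t\<bar> \<le> max (max (pi * B1) (pi * B2)) B1
        \<and> \<bar>f k t\<bar> \<le> max (max (pi * B1) (pi * B2)) B1"
      using B1'[OF kt] by auto
    \<comment> \<open>Joint differentiability from the partial derivative in k at the point and a
      partial derivative in t, namely \<open>f\<close>, that is jointly continuous.\<close>
    have "((\<lambda>(k, t). g k t) has_derivative (\<lambda>(dk, dt). gk k t * dk + blinfun_scaleR_right (f k t) dt))
        (at (k, t) within {l<..<r} \<times> {0<..})"
    proof (rule has_derivative_partialsI)
      show "((\<lambda>x. g x t) has_derivative (*) (gk k t)) (at k within {l<..<r})"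
        using gkd[OF k] by (simp add: has_field_derivative_def)
      show "((\<lambda>y. g x y) has_derivative blinfun_apply (blinfun_scaleR_right (f x y))) (at y within {0<..})"
        if "x \<in> {l<..<r}" "y \<in> {0<..}" for x y
        using has_field_derivative_at_within[OF gtd, of x y "{0<..}"] that
        by (simp add: has_field_derivative_def blinfun_scaleR_right.rep_eq real_scaleR_def[abs_def])
      have "isCont (\<lambda>(k, t). f k t) (k, t)"
        using cf k by (intro continuous_on_interior[OF cf]) (simp add: interior_Times interior_open)
      then have "isCont (\<lambda>x. blinfun_scaleR_right (case x of (k, t) \<Rightarrow> f k t)) (k, t)"
        by (rule bounded_linear.isCont[OF bounded_linear_blinfun_scaleR_right])
      then have "isCont (\<lambda>(k, t). blinfun_scaleR_right (f k t)) (k, t)"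
        by (simp add: case_prod_beta')
      then show "continuous (at (k, t) within {l<..<r} \<times> {0<..}) (\<lambda>(k, t). blinfun_scaleR_right (f k t))"
        by (rule continuous_at_imp_continuous_within)
    qed (use kt in auto)
    moreover have "at (k, t) within {l<..<r} \<times> {0<..} = at (k, t)"
      by (rule at_within_open) (use k kt in \<open>auto intro!: open_Times\<close>)
    ultimately show "((\<lambda>(k, t). g k t) has_derivative (\<lambda>(dk, dt). gk k t * dk + f k t * dt)) (at (k, t))"
      by (simp add: blinfun_scaleR_right.rep_eq)
  qed
qed

text \<open>This is 2 K(k) with K the complete elliptic integral of the first kind: the time in
  which the uncontrolled pendulum, whose angle has speed sqrt (1 - k^2 sin^2 \<theta>), makes a half
  turn of \<theta>.\<close>

definition half_period :: "real \<Rightarrow> real" where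
  "half_period k = integral {0..pi} (\<lambda>\<theta>. 1 / sqrt (1 - k\<^sup>2 * (sin \<theta>)\<^sup>2))"

definition half_period_deriv :: "real \<Rightarrow> real" where
  "half_period_deriv k = integral {0..pi} (\<lambda>\<theta>. k * (sin \<theta>)\<^sup>2 / (sqrt (1 - k\<^sup>2 * (sin \<theta>)\<^sup>2))^3)"

lemma modulus_pos:
  fixes k t :: real assumes "k \<in> {-1<..<1}"
  shows "0 < 1 - k\<^sup>2 * (sin t)\<^sup>2"
proof -
  have "k\<^sup>2 < 1" using assms by (auto simp: abs_square_less_1 abs_less_iff)
  moreover have "k\<^sup>2 * (sin t)\<^sup>2 \<le> k\<^sup>2 * 1"
    by (intro mult_left_mono) (auto simp: abs_square_le_1)
  ultimately show ?thesis by simp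
qed

lemma continuous_modulus:
  "continuous_on ({-1<..<1} \<times> UNIV) (\<lambda>(k::real, t). sqrt (1 - k\<^sup>2 * (sin t)\<^sup>2))"
  by (auto simp: split_beta intro!: continuous_intros)

lemma modulus_deriv:
  assumes "k \<in> {-1<..<1::real}"
  shows "((\<lambda>k. 1 / sqrt (1 - k\<^sup>2 * (sin t)\<^sup>2)) has_real_derivative
    k * (sin t)\<^sup>2 / (sqrt (1 - k\<^sup>2 * (sin t)\<^sup>2))^3) (at k)"
proof -
  have p: "0 < 1 - k\<^sup>2 * (sin t)\<^sup>2" by (rule modulus_pos[OF assms])
  show ?thesis
    using p by (auto intro!: derivative_eq_intros simp: field_simps power2_eq_square power3_eq_cube)
qed

lemma half_period_has_derivative:
  assumes k: "k \<in> {-1<..<1}"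
  shows "(half_period has_real_derivative half_period_deriv k) (at k)"
proof -
  have c1: "continuous_on ({-1<..<1} \<times> UNIV) (\<lambda>(k::real, t). 1 / sqrt (1 - k\<^sup>2 * (sin t)\<^sup>2))"
    using continuous_modulus modulus_pos by (auto simp: split_beta intro!: continuous_intros) (smt (verit))
  have c2: "continuous_on ({-1<..<1} \<times> UNIV) (\<lambda>(k::real, t). k * (sin t)\<^sup>2 / (sqrt (1 - k\<^sup>2 * (sin t)\<^sup>2))^3)"
    using continuous_modulus modulus_pos by (auto simp: split_beta intro!: continuous_intros) (smt (verit))
  have "((\<lambda>k. integral (cbox 0 pi) (\<lambda>t. 1 / sqrt (1 - k\<^sup>2 * (sin t)\<^sup>2))) has_field_derivative
     integral (cbox 0 pi) (\<lambda>t. k * (sin t)\<^sup>2 / (sqrt (1 - k\<^sup>2 * (sin t)\<^sup>2))^3)) (at k within {-1<..<1})"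
  proof (rule leibniz_rule_field_derivative)
    show "((\<lambda>x. 1 / sqrt (1 - x\<^sup>2 * (sin t)\<^sup>2)) has_real_derivative x * (sin t)\<^sup>2 / (sqrt (1 - x\<^sup>2 * (sin t)\<^sup>2))^3) (at x within {-1<..<1})"
      if "x \<in> {-1<..<1}" for x t
      by (rule has_field_derivative_at_within[OF modulus_deriv[OF that]])
    show "(\<lambda>t. 1 / sqrt (1 - x\<^sup>2 * (sin t)\<^sup>2)) integrable_on cbox 0 pi" if "x \<in> {-1<..<1}" for x
      using modulus_pos[OF that] by (auto intro!: integrable_continuous_real continuous_intros) (smt (verit))
    show "continuous_on ({-1<..<1} \<times> cbox 0 pi) (\<lambda>(k, t). k * (sin t)\<^sup>2 / (sqrt (1 - k\<^sup>2 * (sin t)\<^sup>2))^3)"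
      by (rule continuous_on_subset[OF c2]) auto
  qed (use k in auto)
  then show ?thesis using at_within_open[OF k]
    by (simp add: half_period_def[abs_def] half_period_deriv_def)
qed

lemma continuous_half_period_deriv: "continuous_on {-1<..<1} half_period_deriv"
proof -
  have c2: "continuous_on ({-1<..<1} \<times> UNIV) (\<lambda>(k::real, t). k * (sin t)\<^sup>2 / (sqrt (1 - k\<^sup>2 * (sin t)\<^sup>2))^3)"
    using continuous_modulus modulus_pos by (auto simp: split_beta intro!: continuous_intros) (smt (verit))
  have "continuous_on {-1<..<1} (\<lambda>k. integral (cbox 0 pi) (\<lambda>t. k * (sin t)\<^sup>2 / (sqrt (1 - k\<^sup>2 * (sin t)\<^sup>2))^3))"
    by (rule integral_continuous_on_param) (rule continuous_on_subset[OF c2], auto)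
  then show ?thesis by (simp add: half_period_deriv_def[abs_def])
qed

lemma half_period_ge_pi:
  assumes k: "k \<in> {-1<..<1}"
  shows "pi \<le> half_period k"
proof -
  have "integral {0..pi} (\<lambda>_. 1::real) \<le> half_period k"
    unfolding half_period_def
  proof (rule integral_le)
    show "(\<lambda>t. 1 / sqrt (1 - k\<^sup>2 * (sin t)\<^sup>2)) integrable_on {0..pi}"
      using modulus_pos[OF k] by (auto intro!: integrable_continuous_real continuous_intros) (smt (verit))
    show "1 \<le> 1 / sqrt (1 - k\<^sup>2 * (sin t)\<^sup>2)" for t
      using modulus_pos[OF k, of t] by (simp add: divide_simps)
  qed auto
  then show ?thesis by simp
qed

text \<open>Up to the sign of cos, arcsin (k sin t) / k is a primitive. Since 2 arcsin k is the
  turning angle of the free swing of modulus k, this is how the amplitude enters the weight.\<close>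

lemma integral_abs_cos_modulus:
  assumes k: "k \<in> {0<..<1}"
  shows "((\<lambda>t. \<bar>cos t\<bar> / sqrt (1 - k\<^sup>2 * (sin t)\<^sup>2)) has_integral 2 * arcsin k / k) {0..pi}"
proof -
  have k': "k \<in> {-1<..<1}" using k by auto
  have lt: "-1 < k * sin t \<and> k * sin t < 1" for t
  proof -
    have "\<bar>k * sin t\<bar> \<le> k" using k by (simp add: abs_mult mult_left_le)
    then show ?thesis using k by auto
  qed
  have der: "((\<lambda>t. arcsin (k * sin t) / k) has_real_derivative cos t / sqrt (1 - k\<^sup>2 * (sin t)\<^sup>2)) (at t within A)" for t A
    using lt[of t] k by (auto intro!: derivative_eq_intros simp: power_mult_distrib divide_simps)
  have 1: "((\<lambda>t. \<bar>cos t\<bar> / sqrt (1 - k\<^sup>2 * (sin t)\<^sup>2)) has_integral (arcsin (k * sin (pi/2)) / k - arcsin (k * sin 0) / k)) {0..pi/2}"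
  proof (rule fundamental_theorem_of_calculus)
    fix t assume "t \<in> {0..pi/2}"
    then have "0 \<le> cos t" by (intro cos_ge_zero) auto
    then show "((\<lambda>t. arcsin (k * sin t) / k) has_vector_derivative \<bar>cos t\<bar> / sqrt (1 - k\<^sup>2 * (sin t)\<^sup>2)) (at t within {0..pi/2})"
      using der[of t] by (simp add: has_real_derivative_iff_has_vector_derivative)
  qed auto
  have 2: "((\<lambda>t. \<bar>cos t\<bar> / sqrt (1 - k\<^sup>2 * (sin t)\<^sup>2)) has_integral (- (arcsin (k * sin pi) / k) - - (arcsin (k * sin (pi/2)) / k))) {pi/2..pi}"
  proof (rule fundamental_theorem_of_calculus)
    fix t assume "t \<in> {pi/2..pi}"
    then have "0 \<le> cos (pi - t)" by (intro cos_ge_zero) auto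
    then have "cos t \<le> 0" by simp
    then show "((\<lambda>t. - (arcsin (k * sin t) / k)) has_vector_derivative \<bar>cos t\<bar> / sqrt (1 - k\<^sup>2 * (sin t)\<^sup>2)) (at t within {pi/2..pi})"
      using DERIV_minus[OF der[of t]] by (simp add: has_real_derivative_iff_has_vector_derivative)
  qed auto
  have "((\<lambda>t. \<bar>cos t\<bar> / sqrt (1 - k\<^sup>2 * (sin t)\<^sup>2)) has_integral
    (arcsin (k * sin (pi/2)) / k - arcsin (k * sin 0) / k) + (- (arcsin (k * sin pi) / k) - - (arcsin (k * sin (pi/2)) / k))) {0..pi}"
    by (rule has_integral_combine[OF _ _ 1 2]) auto
  then show ?thesis by simp
qed

text \<open>
  The weight is the one for which the oscillating term of \<open>energy_weight_mean\<close> has mean zero. Its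
  potential is \<open>\<epsilon>\<close> times the damping time for \<open>(a, b) = (1, 0)\<close>, and \<open>\<epsilon>\<close> times the excess of the
  damping time over the rotation for \<open>(a, b) = (1, 1)\<close>.
\<close>

definition energy_weight :: "real \<Rightarrow> real \<Rightarrow> real \<Rightarrow> real" where
  "energy_weight a b k = k * (a * half_period k - b * pi) / arcsin k"

definition energy_weight_deriv :: "real \<Rightarrow> real \<Rightarrow> real \<Rightarrow> real" where
  "energy_weight_deriv a b k = (a * half_period k - b * pi + k * (a * half_period_deriv k)) / arcsin k
     - k * (a * half_period k - b * pi) / ((arcsin k)\<^sup>2 * sqrt (1 - k\<^sup>2))"

lemma arcsin_gt_zero: "0 < k \<Longrightarrow> k \<le> 1 \<Longrightarrow> 0 < arcsin k"
  using arcsin_less_arcsin[of 0 k] by simp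

lemma energy_weight_has_derivative:
  assumes k: "k \<in> {0<..<1}"
  shows "(energy_weight a b has_real_derivative energy_weight_deriv a b k) (at k)"
  unfolding energy_weight_def[abs_def] energy_weight_deriv_def
  using k arcsin_gt_zero[of k] abs_square_less_1[of k]
  by (auto intro!: derivative_eq_intros half_period_has_derivative simp: field_simps power2_eq_square)

lemma continuous_energy_weight: "continuous_on {0<..<1} (energy_weight a b)"
  using energy_weight_has_derivative
  by (metis DERIV_atLeastAtMost_imp_continuous_on DERIV_isCont continuous_at_imp_continuous_on)

lemma continuous_energy_weight_deriv: "continuous_on {0<..<1} (energy_weight_deriv a b)"
proof -
  have 1: "continuous_on {0<..<1} half_period"
    by (rule continuous_at_imp_continuous_on) (auto intro!: DERIV_isCont[OF half_period_has_derivative])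
  have 2: "continuous_on {0<..<1} half_period_deriv"
    by (rule continuous_on_subset[OF continuous_half_period_deriv]) auto
  have 3: "arcsin k \<noteq> 0" "k\<^sup>2 < 1" if "k \<in> {0<..<1}" for k
    using that arcsin_gt_zero[of k] abs_square_less_1[of k] by auto
  have 4: "(arcsin k)\<^sup>2 * sqrt (1 - k\<^sup>2) \<noteq> 0" if "k \<in> {0<..<1}" for k
    using 3[OF that] by auto
  show ?thesis unfolding energy_weight_deriv_def[abs_def]
    by (intro continuous_intros 1 2) (use 3 4 in auto)
qed

text \<open>Only differences are used. The base point lies below \<delta> so that the two-sided
  derivative exists at k = \<delta> as well.\<close>

definition energy_potential :: "real \<Rightarrow> real \<Rightarrow> real \<Rightarrow> real \<Rightarrow> real" where
  "energy_potential a b \<delta> k = integral {\<delta> / 2..k} (energy_weight a b)"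

lemma energy_potential_has_derivative:
  assumes "0 < \<delta>" "\<delta> \<le> k" "k < 1"
  shows "(energy_potential a b \<delta> has_real_derivative energy_weight a b k) (at k)"
proof -
  have "((\<lambda>x. integral {\<delta> / 2..x} (energy_weight a b)) has_real_derivative energy_weight a b k)
      (at k within {\<delta> / 2..(k + 1) / 2})"
    using assms by (intro integral_has_real_derivative continuous_on_subset[OF continuous_energy_weight]) auto
  moreover have "at k within {\<delta> / 2..(k + 1) / 2} = at k"
    using assms by (intro at_within_Icc_at) auto
  ultimately show ?thesis by (simp add: energy_potential_def[abs_def])
qed

lemma energy_weight_mean:
  assumes k: "k \<in> {0<..<1}"
  shows "integral {0..pi} (\<lambda>t. (energy_weight a b k * \<bar>cos t\<bar> / 2 - a) / sqrt (1 - k\<^sup>2 * (sin t)\<^sup>2) + b) = 0"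
proof -
  have k': "k \<in> {-1<..<1}" using k by auto
  have i: "((\<lambda>t. 1 / sqrt (1 - k\<^sup>2 * (sin t)\<^sup>2)) has_integral half_period k) {0..pi}"
    unfolding half_period_def has_integral_integral[symmetric]
    using modulus_pos[OF k'] by (auto intro!: integrable_continuous_real continuous_intros) (smt (verit))
  have b: "((\<lambda>t. b) has_integral b * pi) {0..pi}"
    using has_integral_const_real[of b 0 pi] by (simp add: mult.commute)
  have "((\<lambda>t. energy_weight a b k / 2 * (\<bar>cos t\<bar> / sqrt (1 - k\<^sup>2 * (sin t)\<^sup>2)) - a * (1 / sqrt (1 - k\<^sup>2 * (sin t)\<^sup>2)) + b)
     has_integral (energy_weight a b k / 2 * (2 * arcsin k / k) - a * half_period k + b * pi)) {0..pi}"
    by (intro has_integral_add has_integral_diff has_integral_mult_right i b integral_abs_cos_modulus[OF k])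
  also have "energy_weight a b k / 2 * (2 * arcsin k / k) - a * half_period k + b * pi = 0"
    using k arcsin_gt_zero[of k] by (simp add: energy_weight_def field_simps)
  finally show ?thesis
    by (intro integral_unique) (simp add: diff_divide_distrib)
qed

text \<open>Full damping u = - sgn (cos \<theta>) is the reference control: the expression u cos
  \<theta> + |cos \<theta>| measures the distance from it. After the corrector is added, what
  remains is a drift \<epsilon> (w - a), with w the weighted distance, and a remainder of order
  \<epsilon>^2. A bound on w from either side gives one of the two conclusions. The constant
  \<open>K\<close> depends on \<delta>, \<open>a\<close> and \<open>b\<close> only, so the same
  statement serves damped and optimal trajectories.\<close>

lemma averaging:
  assumes \<delta>: "0 < \<delta>" "\<delta> < 1 / 2"
  obtains K where "0 \<le> K"
    "\<And>\<epsilon> t0 t1 \<kappa> \<theta> u S c. \<lbrakk>0 < \<epsilon>; t0 \<le> t1; finite S; continuous_on {t0..t1} \<kappa>; continuous_on {t0..t1} \<theta>;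
       \<And>t. t \<in> {t0..t1} \<Longrightarrow> \<kappa> t \<in> {\<delta>..1 - \<delta>} \<and> 0 < \<theta> t;
       \<And>t. t \<in> {t0<..<t1} - S \<Longrightarrow> \<bar>u t\<bar> \<le> 1 \<and>
          (\<kappa> has_real_derivative \<epsilon> * u t * cos (\<theta> t) / 2) (at t) \<and>
          (\<theta> has_real_derivative sqrt (1 - (\<kappa> t)\<^sup>2 * (sin (\<theta> t))\<^sup>2) - \<epsilon> * u t * sin (\<theta> t) / (2 * \<kappa> t)) (at t)\<rbrakk>
     \<Longrightarrow> ((\<forall>t\<in>{t0<..<t1} - S. c \<le> energy_weight a b (\<kappa> t) * (u t * cos (\<theta> t) + \<bar>cos (\<theta> t)\<bar>) / 2) \<longrightarrow>
           \<epsilon> * (c - a) * (t1 - t0) - K * \<epsilon>\<^sup>2 * (t1 - t0) - K * \<epsilon> \<le>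
           energy_potential a b \<delta> (\<kappa> t1) - energy_potential a b \<delta> (\<kappa> t0) - \<epsilon> * b * (\<theta> t1 - \<theta> t0)) \<and>
         ((\<forall>t\<in>{t0<..<t1} - S. energy_weight a b (\<kappa> t) * (u t * cos (\<theta> t) + \<bar>cos (\<theta> t)\<bar>) / 2 \<le> c) \<longrightarrow>
           energy_potential a b \<delta> (\<kappa> t1) - energy_potential a b \<delta> (\<kappa> t0) - \<epsilon> * b * (\<theta> t1 - \<theta> t0) \<le>
           \<epsilon> * (c - a) * (t1 - t0) + K * \<epsilon>\<^sup>2 * (t1 - t0) + K * \<epsilon>)"
proof -
  \<comment> \<open>A rate per unit of angle: dividing by the square root, the leading part of the
    speed of \<theta>, turns a rate in time into one in \<theta>, and \<open>energy_weight\<close>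
    is the weight whose integral over a half turn vanishes.\<close>
  define f where "f k t = (energy_weight a b k * \<bar>cos t\<bar> / 2 - a) * (1 / sqrt (1 - k\<^sup>2 * (sin t)\<^sup>2)) + b" for k t
  define fk where "fk k t = energy_weight_deriv a b k * \<bar>cos t\<bar> / 2 * (1 / sqrt (1 - k\<^sup>2 * (sin t)\<^sup>2)) +
     (energy_weight a b k * \<bar>cos t\<bar> / 2 - a) * (k * (sin t)\<^sup>2 / (sqrt (1 - k\<^sup>2 * (sin t)\<^sup>2))^3)" for k t
  have ne: "1 - k\<^sup>2 * (sin t)\<^sup>2 \<noteq> 0" if "k \<in> {0<..<1}" for k t :: real
    using modulus_pos[of k t] that by auto
  have c1: "continuous_on ({0<..<1} \<times> UNIV) (\<lambda>p. energy_weight a b (fst p))"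
    by (rule continuous_on_compose2[OF continuous_energy_weight]) (auto intro!: continuous_intros)
  have c2: "continuous_on ({0<..<1} \<times> UNIV) (\<lambda>p. energy_weight_deriv a b (fst p))"
    by (rule continuous_on_compose2[OF continuous_energy_weight_deriv]) (auto intro!: continuous_intros)
  obtain g gk B where
    gB: "\<And>k t. k \<in> {\<delta>..1 - \<delta>} \<Longrightarrow> 0 < t \<Longrightarrow> \<bar>g k t\<bar> \<le> B \<and> \<bar>gk k t\<bar> \<le> B \<and> \<bar>f k t\<bar> \<le> B" and
    gd: "\<And>k t. k \<in> {\<delta>..1 - \<delta>} \<Longrightarrow> 0 < t \<Longrightarrow>
      ((\<lambda>(k, t). g k t) has_derivative (\<lambda>(dk, dt). gk k t * dk + f k t * dt)) (at (k, t))"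
  proof (rule corrector_exists[of 0 \<delta> "1 - \<delta>" 1 f fk])
    show "((\<lambda>k. f k t) has_real_derivative fk k t) (at k)" if "k \<in> {0<..<1}" for k t
    proof -
      have 1: "((\<lambda>k. energy_weight a b k * \<bar>cos t\<bar> / 2 - a) has_real_derivative energy_weight_deriv a b k * \<bar>cos t\<bar> / 2) (at k)"
        by (auto intro!: derivative_eq_intros energy_weight_has_derivative[OF that])
      have 2: "((\<lambda>k. 1 / sqrt (1 - k\<^sup>2 * (sin t)\<^sup>2)) has_real_derivative
          k * (sin t)\<^sup>2 / (sqrt (1 - k\<^sup>2 * (sin t)\<^sup>2))^3) (at k)"
        by (rule modulus_deriv) (use that in auto)
      show ?thesis
        unfolding f_def fk_def using DERIV_add[OF DERIV_mult[OF 1 2] DERIV_const[of b]]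
        by (simp add: algebra_simps)
    qed
    show "continuous_on ({0<..<1} \<times> UNIV) (\<lambda>(k, t). f k t)"
      unfolding f_def split_beta by (intro continuous_intros c1) (use ne in auto)
    show "continuous_on ({0<..<1} \<times> UNIV) (\<lambda>(k, t). fk k t)"
      unfolding fk_def split_beta by (intro continuous_intros c1 c2) (use ne in auto)
    show "integral {0..pi} (f k) = 0" if "k \<in> {0<..<1}" for k
      using energy_weight_mean[OF that, of a b] by (simp add: f_def[abs_def])
  qed (use \<delta> in \<open>auto simp: f_def fk_def\<close>)
  have B0: "0 \<le> B" using gB[of \<delta> 1] \<delta> by auto
  \<comment> \<open>In order: the corrector values at the two ends, the term produced by the motion
    of k, and the term produced by the part of order \<epsilon> in the speed of \<theta>, where 1 /
    k is at most 1 / \<delta>.\<close>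
  define K where "K = 2 * B + B / 2 + (B + \<bar>b\<bar>) / (2 * \<delta>)"
  have "0 \<le> (B + \<bar>b\<bar>) / (2 * \<delta>)" using B0 \<delta> by simp
  then have K2: "2 * B \<le> K" and K0: "0 \<le> K" and K1: "B * (1 / 2) + (B + \<bar>b\<bar>) * (1 / (2 * \<delta>)) \<le> K"
    using B0 unfolding K_def by simp_all
  show thesis
  proof (rule that[OF K0])
    fix \<epsilon> t0 t1 \<kappa> \<theta> u S c
    assume \<epsilon>: "0 < \<epsilon>" and t01: "t0 \<le> t1" and S: "finite S"
      and c\<kappa>: "continuous_on {t0..t1} \<kappa>" and c\<theta>: "continuous_on {t0..t1} \<theta>"
      and r: "\<And>t. t \<in> {t0..t1} \<Longrightarrow> \<kappa> t \<in> {\<delta>..1 - \<delta>} \<and> 0 < \<theta> t"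
      and d: "\<And>t. t \<in> {t0<..<t1} - S \<Longrightarrow> \<bar>u t\<bar> \<le> 1 \<and>
          (\<kappa> has_real_derivative \<epsilon> * u t * cos (\<theta> t) / 2) (at t) \<and>
          (\<theta> has_real_derivative sqrt (1 - (\<kappa> t)\<^sup>2 * (sin (\<theta> t))\<^sup>2) - \<epsilon> * u t * sin (\<theta> t) / (2 * \<kappa> t)) (at t)"
    \<comment> \<open>With C the square root in the speed of \<theta>, the corrector contributes
      \<epsilon> f C. This completes u cos to u cos + |cos|, adds the drift - a, and leaves b C,
      which the last term of \<open>h\<close> removes.\<close>
    define h where "h t = energy_potential a b \<delta> (\<kappa> t) + \<epsilon> * g (\<kappa> t) (\<theta> t) - \<epsilon> * b * \<theta> t" for t
    define w where "w t = energy_weight a b (\<kappa> t) * (u t * cos (\<theta> t) + \<bar>cos (\<theta> t)\<bar>) / 2" for t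
    define R where "R t = gk (\<kappa> t) (\<theta> t) * (u t * cos (\<theta> t) / 2) + (b - f (\<kappa> t) (\<theta> t)) * (u t * sin (\<theta> t) / (2 * \<kappa> t))" for t
    have ch: "continuous_on {t0..t1} h"
    proof -
      have 1: "continuous_on {t0..t1} (\<lambda>t. energy_potential a b \<delta> (\<kappa> t))"
        by (rule continuous_on_compose2[OF _ c\<kappa>, of "{\<delta>..1 - \<delta>}"])
          (use r \<delta> in \<open>auto intro!: continuous_at_imp_continuous_on DERIV_isCont[OF energy_potential_has_derivative]\<close>)
      have "continuous_on ({\<delta>..1 - \<delta>} \<times> {0<..}) (\<lambda>(k, t). g k t)"
        by (rule continuous_at_imp_continuous_on) (use gd has_derivative_continuous in blast)
      then have 2: "continuous_on {t0..t1} (\<lambda>t. (\<lambda>(k, t). g k t) (\<kappa> t, \<theta> t))"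
        by (rule continuous_on_compose2) (use r in \<open>auto intro!: continuous_on_Pair c\<kappa> c\<theta>\<close>)
      show ?thesis unfolding h_def using 1 2 by (auto intro!: continuous_intros c\<theta>)
    qed
    have dh: "(h has_real_derivative (\<epsilon> * (w t - a) + \<epsilon>\<^sup>2 * R t)) (at t)" if t: "t \<in> {t0<..<t1} - S" for t
    proof -
      have k: "\<kappa> t \<in> {\<delta>..1 - \<delta>}" "0 < \<theta> t" using r[of t] t by auto
      define C where "C = sqrt (1 - (\<kappa> t)\<^sup>2 * (sin (\<theta> t))\<^sup>2)"
      have C: "C > 0" using modulus_pos[of "\<kappa> t" "\<theta> t"] k \<delta> by (simp add: C_def)
      have d\<kappa>: "(\<kappa> has_real_derivative \<epsilon> * u t * cos (\<theta> t) / 2) (at t)"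
       and d\<theta>: "(\<theta> has_real_derivative C - \<epsilon> * u t * sin (\<theta> t) / (2 * \<kappa> t)) (at t)"
        using d[OF t] by (auto simp: C_def)
      have pair: "((\<lambda>t. (\<kappa> t, \<theta> t)) has_derivative
          (\<lambda>s. (\<epsilon> * u t * cos (\<theta> t) / 2 * s, (C - \<epsilon> * u t * sin (\<theta> t) / (2 * \<kappa> t)) * s))) (at t)"
        by (rule has_derivative_Pair[OF d\<kappa>[unfolded has_field_derivative_def] d\<theta>[unfolded has_field_derivative_def]])
      have "((\<lambda>t. g (\<kappa> t) (\<theta> t)) has_derivative
          (\<lambda>s. gk (\<kappa> t) (\<theta> t) * (\<epsilon> * u t * cos (\<theta> t) / 2 * s) + f (\<kappa> t) (\<theta> t) * ((C - \<epsilon> * u t * sin (\<theta> t) / (2 * \<kappa> t)) * s))) (at t)"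
        using has_derivative_compose[OF pair gd[OF k]] by simp
      then have dg: "((\<lambda>t. g (\<kappa> t) (\<theta> t)) has_real_derivative
          (gk (\<kappa> t) (\<theta> t) * (\<epsilon> * u t * cos (\<theta> t) / 2) + f (\<kappa> t) (\<theta> t) * (C - \<epsilon> * u t * sin (\<theta> t) / (2 * \<kappa> t)))) (at t)"
        unfolding has_field_derivative_def
        by (rule back_subst[of "\<lambda>D. (_ has_derivative D) _"]) (auto simp: fun_eq_iff algebra_simps)
      have dM: "((\<lambda>t. energy_potential a b \<delta> (\<kappa> t)) has_real_derivative energy_weight a b (\<kappa> t) * (\<epsilon> * u t * cos (\<theta> t) / 2)) (at t)"
        by (rule DERIV_chain2[OF energy_potential_has_derivative d\<kappa>]) (use \<delta> k in auto)
      have fC: "f (\<kappa> t) (\<theta> t) * C = energy_weight a b (\<kappa> t) * \<bar>cos (\<theta> t)\<bar> / 2 - a + b * C"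
        using C by (simp add: f_def flip: C_def) (simp add: field_simps)
      have "energy_weight a b (\<kappa> t) * (\<epsilon> * u t * cos (\<theta> t) / 2)
          + \<epsilon> * (gk (\<kappa> t) (\<theta> t) * (\<epsilon> * u t * cos (\<theta> t) / 2) + f (\<kappa> t) (\<theta> t) * (C - \<epsilon> * u t * sin (\<theta> t) / (2 * \<kappa> t)))
          - \<epsilon> * b * (C - \<epsilon> * u t * sin (\<theta> t) / (2 * \<kappa> t))
         = \<epsilon> * (energy_weight a b (\<kappa> t) * u t * cos (\<theta> t) / 2 + f (\<kappa> t) (\<theta> t) * C - b * C) + \<epsilon>\<^sup>2 * R t"
        by (simp add: R_def algebra_simps power2_eq_square diff_divide_distrib)
      also have "\<dots> = \<epsilon> * (w t - a) + \<epsilon>\<^sup>2 * R t"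
        unfolding fC w_def by (simp add: algebra_simps add_divide_distrib)
      finally have eq: "energy_weight a b (\<kappa> t) * (\<epsilon> * u t * cos (\<theta> t) / 2)
          + \<epsilon> * (gk (\<kappa> t) (\<theta> t) * (\<epsilon> * u t * cos (\<theta> t) / 2) + f (\<kappa> t) (\<theta> t) * (C - \<epsilon> * u t * sin (\<theta> t) / (2 * \<kappa> t)))
          - \<epsilon> * b * (C - \<epsilon> * u t * sin (\<theta> t) / (2 * \<kappa> t)) = \<epsilon> * (w t - a) + \<epsilon>\<^sup>2 * R t" .
      show ?thesis unfolding h_def eq[symmetric]
        by (intro DERIV_diff DERIV_add dM DERIV_cmult dg d\<theta>)
    qed
    have R: "\<bar>R t\<bar> \<le> K" if t: "t \<in> {t0<..<t1} - S" for t
    proof -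
      have k: "\<kappa> t \<in> {\<delta>..1 - \<delta>}" "0 < \<theta> t" using r[of t] t by auto
      have u: "\<bar>u t\<bar> \<le> 1" using d[OF t] by auto
      have u1: "\<bar>u t * cos (\<theta> t) / 2\<bar> \<le> 1 / 2" "\<bar>u t * sin (\<theta> t)\<bar> \<le> 1"
        using u by (auto simp: abs_mult intro!: mult_le_one)
      have u2: "\<bar>u t * sin (\<theta> t) / (2 * \<kappa> t)\<bar> \<le> 1 / (2 * \<delta>)"
        using u1(2) k \<delta> unfolding abs_divide by (intro frac_le) auto
      have "\<bar>R t\<bar> \<le> \<bar>gk (\<kappa> t) (\<theta> t)\<bar> * \<bar>u t * cos (\<theta> t) / 2\<bar> + \<bar>b - f (\<kappa> t) (\<theta> t)\<bar> * \<bar>u t * sin (\<theta> t) / (2 * \<kappa> t)\<bar>"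
        unfolding R_def by (rule order_trans[OF abs_triangle_ineq]) (simp only: abs_mult)
      also have "\<dots> \<le> B * (1 / 2) + (B + \<bar>b\<bar>) * (1 / (2 * \<delta>))"
      proof (intro add_mono mult_mono)
        show "\<bar>gk (\<kappa> t) (\<theta> t)\<bar> \<le> B" using gB[OF k] by blast
        show "\<bar>b - f (\<kappa> t) (\<theta> t)\<bar> \<le> B + \<bar>b\<bar>" using gB[OF k] by linarith
      qed (use u1 u2 B0 in auto)
      also have "\<dots> \<le> K" by (rule K1)
      finally show ?thesis .
    qed
    have hE: "\<bar>h s - (energy_potential a b \<delta> (\<kappa> s) - \<epsilon> * b * \<theta> s)\<bar> \<le> \<epsilon> * B" if "s \<in> {t0..t1}" for s
      using gB[of "\<kappa> s" "\<theta> s"] r[OF that] \<epsilon> by (simp add: h_def abs_mult)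
    have hE: "\<bar>(h t1 - h t0) - (energy_potential a b \<delta> (\<kappa> t1) - energy_potential a b \<delta> (\<kappa> t0) - \<epsilon> * b * (\<theta> t1 - \<theta> t0))\<bar> \<le> K * \<epsilon>"
    proof -
      have "\<bar>(h t1 - h t0) - (energy_potential a b \<delta> (\<kappa> t1) - energy_potential a b \<delta> (\<kappa> t0) - \<epsilon> * b * (\<theta> t1 - \<theta> t0))\<bar> \<le> \<epsilon> * B + \<epsilon> * B"
        using hE[of t0] hE[of t1] t01 by (simp add: algebra_simps)
      also have "\<dots> \<le> K * \<epsilon>" using mult_right_mono[OF K2, of \<epsilon>] \<epsilon> by (simp add: algebra_simps)
      finally show ?thesis .
    qed
    have Reps: "\<bar>\<epsilon>\<^sup>2 * R t\<bar> \<le> K * \<epsilon>\<^sup>2" if t: "t \<in> {t0<..<t1} - S" for t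
      using mult_left_mono[OF R[OF t], of "\<epsilon>\<^sup>2"] by (simp add: abs_mult mult.commute)
    show "((\<forall>t\<in>{t0<..<t1} - S. c \<le> energy_weight a b (\<kappa> t) * (u t * cos (\<theta> t) + \<bar>cos (\<theta> t)\<bar>) / 2) \<longrightarrow>
           \<epsilon> * (c - a) * (t1 - t0) - K * \<epsilon>\<^sup>2 * (t1 - t0) - K * \<epsilon> \<le>
           energy_potential a b \<delta> (\<kappa> t1) - energy_potential a b \<delta> (\<kappa> t0) - \<epsilon> * b * (\<theta> t1 - \<theta> t0)) \<and>
         ((\<forall>t\<in>{t0<..<t1} - S. energy_weight a b (\<kappa> t) * (u t * cos (\<theta> t) + \<bar>cos (\<theta> t)\<bar>) / 2 \<le> c) \<longrightarrow>
           energy_potential a b \<delta> (\<kappa> t1) - energy_potential a b \<delta> (\<kappa> t0) - \<epsilon> * b * (\<theta> t1 - \<theta> t0) \<le>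
           \<epsilon> * (c - a) * (t1 - t0) + K * \<epsilon>\<^sup>2 * (t1 - t0) + K * \<epsilon>)"
      unfolding w_def[symmetric]
    proof (intro conjI impI)
      assume w: "\<forall>t\<in>{t0<..<t1} - S. c \<le> w t"
      have "(\<epsilon> * (c - a) - K * \<epsilon>\<^sup>2) * (t1 - t0) \<le> h t1 - h t0"
      proof (rule increment_ge[OF S t01 ch dh])
        fix t assume t: "t \<in> {t0<..<t1} - S"
        have "\<epsilon> * (c - a) \<le> \<epsilon> * (w t - a)" using w t \<epsilon> by (intro mult_left_mono) auto
        then show "\<epsilon> * (c - a) - K * \<epsilon>\<^sup>2 \<le> \<epsilon> * (w t - a) + \<epsilon>\<^sup>2 * R t" using Reps[OF t] by linarith
      qed
      then have "\<epsilon> * (c - a) * (t1 - t0) - K * \<epsilon>\<^sup>2 * (t1 - t0) \<le> h t1 - h t0" by (simp add: algebra_simps)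
      then show "\<epsilon> * (c - a) * (t1 - t0) - K * \<epsilon>\<^sup>2 * (t1 - t0) - K * \<epsilon> \<le>
           energy_potential a b \<delta> (\<kappa> t1) - energy_potential a b \<delta> (\<kappa> t0) - \<epsilon> * b * (\<theta> t1 - \<theta> t0)"
        using hE by linarith
    next
      assume w: "\<forall>t\<in>{t0<..<t1} - S. w t \<le> c"
      have "h t1 - h t0 \<le> (\<epsilon> * (c - a) + K * \<epsilon>\<^sup>2) * (t1 - t0)"
      proof (rule increment_le[OF S t01 ch dh])
        fix t assume t: "t \<in> {t0<..<t1} - S"
        have "\<epsilon> * (w t - a) \<le> \<epsilon> * (c - a)" using w t \<epsilon> by (intro mult_left_mono) auto
        then show "\<epsilon> * (w t - a) + \<epsilon>\<^sup>2 * R t \<le> \<epsilon> * (c - a) + K * \<epsilon>\<^sup>2" using Reps[OF t] by linarith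
      qed
      then have "h t1 - h t0 \<le> \<epsilon> * (c - a) * (t1 - t0) + K * \<epsilon>\<^sup>2 * (t1 - t0)" by (simp add: algebra_simps)
      then show "energy_potential a b \<delta> (\<kappa> t1) - energy_potential a b \<delta> (\<kappa> t0) - \<epsilon> * b * (\<theta> t1 - \<theta> t0) \<le>
           \<epsilon> * (c - a) * (t1 - t0) + K * \<epsilon>\<^sup>2 * (t1 - t0) + K * \<epsilon>"
        using hE by linarith
    qed
  qed
qed

section \<open>The swing integral\<close>

definition swing_integral :: "real \<Rightarrow> real" where
  "swing_integral a = integral {0..a} (\<lambda>x. sin x / (2 * x))"

text \<open>The singularity at 0 is removable: the continuous extension takes the value 1 / 2, and
  the value 0 that division by zero produces is a spike at one point.\<close>

lemma swing_integrable: "(\<lambda>x. sin x / (2 * x)) integrable_on {a..b::real}"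
proof -
  define s where "s x = (if x = 0 then 1 / 2 else sin x / (2 * x))" for x :: real
  have "isCont s x" for x
  proof (cases "x = 0")
    case True
    have "((\<lambda>x. sin x / x) \<longlongrightarrow> 1) (at (0::real))"
      using DERIV_sin[of "0::real"] by (simp add: DERIV_def)
    then have "((\<lambda>x. sin x / x / 2) \<longlongrightarrow> 1 / 2) (at (0::real))"
      by (intro tendsto_divide tendsto_const) auto
    then have "(s \<longlongrightarrow> 1 / 2) (at 0)"
      by (rule Lim_transform_eventually) (auto simp: s_def eventually_at_filter)
    then show ?thesis using True by (simp add: isCont_def s_def)
  next
    case False
    have "isCont (\<lambda>x. sin x / (2 * x)) x" using False by (intro continuous_intros) auto
    moreover have "\<forall>\<^sub>F y in nhds x. s y = sin y / (2 * y)"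
      using False eventually_nhds_in_open[of "-{0}" x] by (auto elim!: eventually_mono simp: s_def)
    ultimately show ?thesis by (simp add: isCont_cong)
  qed
  then have "s integrable_on {a..b}"
    by (intro integrable_continuous_real continuous_at_imp_continuous_on) auto
  then show ?thesis
    by (rule integrable_spike_finite[of "{0}", rotated 2]) (auto simp: s_def)
qed

lemma swing_integral_has_derivative:
  assumes "0 < a"
  shows "(swing_integral has_real_derivative sin a / (2 * a)) (at a)"
proof -
  have "((\<lambda>x. integral {0..x} (\<lambda>x. sin x / (2 * x))) has_vector_derivative sin a / (2 * a)) (at a within {0..a + 1} - {})"
  proof (rule integral_has_vector_derivative_continuous_at[OF swing_integrable])
    have "isCont (\<lambda>x. sin x / (2 * x)) a" using assms by (intro continuous_intros) auto
    then show "continuous (at a within {0..a + 1} - {}) (\<lambda>x. sin x / (2 * x))"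
      by (rule continuous_at_imp_continuous_within)
  qed (use assms in auto)
  then show ?thesis using assms
    by (simp add: swing_integral_def[abs_def] has_real_derivative_iff_has_vector_derivative at_within_Icc_at)
qed

lemma swing_integral_diff:
  assumes "0 \<le> a" "a \<le> b" "b \<le> pi"
  shows "0 \<le> swing_integral b - swing_integral a" "swing_integral b - swing_integral a \<le> (b - a) / 2"
proof -
  have eq: "swing_integral b - swing_integral a = integral {a..b} (\<lambda>x. sin x / (2 * x))"
    using Henstock_Kurzweil_Integration.integral_combine[of 0 a b "\<lambda>x. sin x / (2 * x)"] assms swing_integrable
    by (simp add: swing_integral_def)
  show "0 \<le> swing_integral b - swing_integral a"
    unfolding eq using assms sin_ge_zero by (intro integral_nonneg swing_integrable) auto
  have "integral {a..b} (\<lambda>x. sin x / (2 * x)) \<le> integral {a..b} (\<lambda>_. 1 / 2)"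
  proof (rule integral_le[OF swing_integrable])
    fix x assume "x \<in> {a..b}"
    then have x: "0 \<le> x" using assms by auto
    then show "sin x / (2 * x) \<le> 1 / 2" using sin_x_le_x[OF x] by (cases "x = 0") (auto simp: divide_simps)
  qed auto
  then show "swing_integral b - swing_integral a \<le> (b - a) / 2"
    unfolding eq using assms by simp
qed

lemma swing_integral_0: "swing_integral 0 = 0"
  by (simp add: swing_integral_def)

text \<open>A continuous argument of the curve y / 2 + i sin (x / 2) comes from a logarithm, since
  an interval is contractible. The hypothesis on cos (x / 2) decides the sign of the square root in
  the equation for \<theta>. Positivity of \<theta> is reached by adding whole turns; the corrector,
  an integral from 0, is controlled only there.\<close>

lemma polar_lift:
  fixes x y u :: "real \<Rightarrow> real"
  assumes t01: "t0 \<le> t1" and cx: "continuous_on {t0..t1} x" and cy: "continuous_on {t0..t1} y"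
    and C: "\<And>t. t \<in> {t0..t1} \<Longrightarrow> 0 < cos (x t / 2)"
    and k0: "\<And>t. t \<in> {t0..t1} \<Longrightarrow> 0 < (sin (x t / 2))\<^sup>2 + (y t / 2)\<^sup>2"
    and d: "\<And>t. t \<in> {t0<..<t1} - S \<Longrightarrow> (x has_real_derivative y t) (at t) \<and>
       (y has_real_derivative - sin (x t) + \<epsilon> * u t) (at t)"
  obtains \<kappa> \<theta> where "continuous_on {t0..t1} \<kappa>" "continuous_on {t0..t1} \<theta>"
    "\<And>t. t \<in> {t0..t1} \<Longrightarrow> 0 < \<theta> t"
    "\<And>t. \<kappa> t = sqrt ((sin (x t / 2))\<^sup>2 + (y t / 2)\<^sup>2)"
    "\<And>t. t \<in> {t0..t1} \<Longrightarrow> sin (x t / 2) = \<kappa> t * sin (\<theta> t) \<and> y t / 2 = \<kappa> t * cos (\<theta> t)"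
    "\<And>t. t \<in> {t0<..<t1} - S \<Longrightarrow>
       (\<kappa> has_real_derivative \<epsilon> * u t * cos (\<theta> t) / 2) (at t) \<and>
       (\<theta> has_real_derivative sqrt (1 - (\<kappa> t)\<^sup>2 * (sin (\<theta> t))\<^sup>2) - \<epsilon> * u t * sin (\<theta> t) / (2 * \<kappa> t)) (at t)"
proof -
  define X where "X t = sin (x t / 2)" for t
  define Y where "Y t = y t / 2" for t
  define \<kappa> where "\<kappa> t = sqrt ((X t)\<^sup>2 + (Y t)\<^sup>2)" for t
  have cX: "continuous_on {t0..t1} X" unfolding X_def by (intro continuous_intros cx) auto
  have cY: "continuous_on {t0..t1} Y" unfolding Y_def by (intro continuous_intros cy) auto
  have \<kappa>0: "0 < \<kappa> t" if "t \<in> {t0..t1}" for t using k0[OF that] by (simp add: \<kappa>_def X_def Y_def)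
  have c\<kappa>: "continuous_on {t0..t1} \<kappa>" unfolding \<kappa>_def by (intro continuous_intros cX cY)
  have cg: "continuous_on {t0..t1} (\<lambda>t. Complex (Y t) (X t))"
    unfolding Complex_eq by (intro continuous_intros cX cY)
  have nz: "Complex (Y t) (X t) \<noteq> 0" if "t \<in> {t0..t1}" for t
    using \<kappa>0[OF that] by (auto simp: \<kappa>_def complex_eq_iff)
  obtain g where g: "continuous_on {t0..t1} g" "\<And>t. t \<in> {t0..t1} \<Longrightarrow> Complex (Y t) (X t) = exp (g t)"
    using continuous_logarithm_on_contractible[OF cg convex_imp_contractible[of "{t0..t1}"]] nz by auto
  have ci: "continuous_on {t0..t1} (\<lambda>t. Im (g t))" by (intro continuous_intros g)
  obtain m where m: "\<And>t. t \<in> {t0..t1} \<Longrightarrow> m \<le> Im (g t)"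
  proof -
    obtain s where "s \<in> {t0..t1}" "\<forall>t\<in>{t0..t1}. Im (g s) \<le> Im (g t)"
      using continuous_attains_inf[OF compact_Icc _ ci] t01 by auto
    then show ?thesis using that[of "Im (g s)"] by auto
  qed
  obtain N :: nat where N: "- m / (2 * pi) < real N" using reals_Archimedean2 by blast
  define \<theta> where "\<theta> t = Im (g t) + 2 * pi * real N" for t
  have c\<theta>: "continuous_on {t0..t1} \<theta>" unfolding \<theta>_def by (intro continuous_intros ci)
  have \<theta>0: "0 < \<theta> t" if "t \<in> {t0..t1}" for t
    using m[OF that] N pi_gt_zero by (simp add: \<theta>_def field_simps)
  have pol: "X t = \<kappa> t * sin (\<theta> t) \<and> Y t = \<kappa> t * cos (\<theta> t)" if "t \<in> {t0..t1}" for t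
  proof -
    have "Y t = exp (Re (g t)) * cos (Im (g t))" "X t = exp (Re (g t)) * sin (Im (g t))"
      using g(2)[OF that] by (auto simp: complex_eq_iff Re_exp Im_exp)
    moreover have "\<kappa> t = exp (Re (g t))"
      unfolding \<kappa>_def calculation by (simp add: power_mult_distrib flip: distrib_left)
    moreover have "sin (\<theta> t) = sin (Im (g t))" "cos (\<theta> t) = cos (Im (g t))"
      using sin.plus_of_nat[of "Im (g t)" N] cos.plus_of_nat[of "Im (g t)" N] by (simp_all add: \<theta>_def mult_ac)
    ultimately show ?thesis by simp
  qed
  show thesis
  proof (rule that[OF c\<kappa> c\<theta> \<theta>0])
    show "\<kappa> t = sqrt ((sin (x t / 2))\<^sup>2 + (y t / 2)\<^sup>2)" for t by (simp add: \<kappa>_def X_def Y_def)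
    show "sin (x t / 2) = \<kappa> t * sin (\<theta> t) \<and> y t / 2 = \<kappa> t * cos (\<theta> t)" if "t \<in> {t0..t1}" for t
      using pol[OF that] by (simp add: X_def Y_def)
    fix t assume t: "t \<in> {t0<..<t1} - S"
    then have t': "t \<in> {t0..t1}" by auto
    define c where "c = cos (x t / 2)"
    have X': "(X has_real_derivative c * Y t) (at t)"
      unfolding X_def Y_def c_def using d[OF t] by (auto intro!: derivative_eq_intros)
    have "sin (x t) = 2 * X t * c" using sin_double[of "x t / 2"] by (simp add: X_def c_def)
    then have Y': "(Y has_real_derivative - c * X t + \<epsilon> * u t / 2) (at t)"
      unfolding Y_def using d[OF t] by (auto intro!: derivative_eq_intros simp: field_simps)
    have sq: "(X t)\<^sup>2 + (Y t)\<^sup>2 = (\<kappa> t)\<^sup>2" by (simp add: \<kappa>_def)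
    have \<kappa>t: "0 < \<kappa> t" by (rule \<kappa>0[OF t'])
    have "((\<lambda>t. (X t)\<^sup>2 + (Y t)\<^sup>2) has_real_derivative 2 * X t * (c * Y t) + 2 * Y t * (- c * X t + \<epsilon> * u t / 2)) (at t)"
      using X' Y' by (auto intro!: derivative_eq_intros)
    moreover have "0 < (X t)\<^sup>2 + (Y t)\<^sup>2" using \<kappa>t sq by simp
    ultimately have "(\<kappa> has_real_derivative inverse (\<kappa> t) / 2 * (2 * X t * (c * Y t) + 2 * Y t * (- c * X t + \<epsilon> * u t / 2))) (at t)"
      unfolding \<kappa>_def[abs_def] by (intro DERIV_chain2[OF DERIV_real_sqrt])
    also have "inverse (\<kappa> t) / 2 * (2 * X t * (c * Y t) + 2 * Y t * (- c * X t + \<epsilon> * u t / 2)) = \<epsilon> * u t * cos (\<theta> t) / 2"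
      using pol[OF t'] \<kappa>t by (simp add: field_simps)
    finally have \<kappa>': "(\<kappa> has_real_derivative \<epsilon> * u t * cos (\<theta> t) / 2) (at t)" .
    \<comment> \<open>On the interval \<open>P s\<close> is sin (\<theta> s - \<theta> t). Near
      \<open>t\<close> the angle, so far only continuous, therefore equals \<theta> t + arcsin (P
      s), which can be differentiated.\<close>
    define P where "P s = (X s * cos (\<theta> t) - Y s * sin (\<theta> t)) / \<kappa> s" for s
    have Pt: "P t = 0" using pol[OF t'] by (simp add: P_def)
    have "(P has_real_derivative ((c * Y t * cos (\<theta> t) - (- c * X t + \<epsilon> * u t / 2) * sin (\<theta> t)) * \<kappa> t
        - (X t * cos (\<theta> t) - Y t * sin (\<theta> t)) * (\<epsilon> * u t * cos (\<theta> t) / 2)) / (\<kappa> t * \<kappa> t)) (at t)"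
      unfolding P_def using \<kappa>t by (intro DERIV_divide DERIV_diff DERIV_cmult_right X' Y' \<kappa>') auto
    also have "((c * Y t * cos (\<theta> t) - (- c * X t + \<epsilon> * u t / 2) * sin (\<theta> t)) * \<kappa> t
        - (X t * cos (\<theta> t) - Y t * sin (\<theta> t)) * (\<epsilon> * u t * cos (\<theta> t) / 2)) / (\<kappa> t * \<kappa> t)
        = c * ((sin (\<theta> t))\<^sup>2 + (cos (\<theta> t))\<^sup>2) - \<epsilon> * u t * sin (\<theta> t) / (2 * \<kappa> t)"
    proof -
      have "(c * (k * C) * C - (- c * (k * S) + e / 2) * S) * k - (k * S * C - k * C * S) * q
          = (c * (S\<^sup>2 + C\<^sup>2) - e * S / (2 * k)) * (k * k)" if "k \<noteq> 0" for C S k e q :: real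
        using that by (simp add: field_simps power2_eq_square)
      then show ?thesis using pol[OF t'] \<kappa>t by (simp del: sin_cos_squared_add sin_cos_squared_add2)
    qed
    also have "\<dots> = c - \<epsilon> * u t * sin (\<theta> t) / (2 * \<kappa> t)" by simp
    finally have P': "(P has_real_derivative c - \<epsilon> * u t * sin (\<theta> t) / (2 * \<kappa> t)) (at t)" .
    have as: "((\<lambda>s. \<theta> t + arcsin (P s)) has_real_derivative c - \<epsilon> * u t * sin (\<theta> t) / (2 * \<kappa> t)) (at t)"
      using P' Pt by (auto intro!: derivative_eq_intros)
    have "continuous (at t) \<theta>" using continuous_on_interior[OF c\<theta>, of t] t by auto
    then have "\<forall>\<^sub>F s in at t. dist (\<theta> s) (\<theta> t) < pi / 2"
      using pi_gt_zero unfolding continuous_at by (intro tendstoD) auto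
    moreover have "\<forall>\<^sub>F s in at t. s \<in> {t0<..<t1}"
      by (rule eventually_at_in_open') (use t in auto)
    ultimately have ev: "\<forall>\<^sub>F s in at t. \<theta> t + arcsin (P s) = \<theta> s"
    proof eventually_elim
      case (elim s)
      have s: "s \<in> {t0..t1}" using elim by auto
      have "P s = sin (\<theta> s - \<theta> t)"
        using pol[OF s] \<kappa>0[OF s] by (simp add: P_def sin_diff field_simps)
      moreover have "arcsin (sin (\<theta> s - \<theta> t)) = \<theta> s - \<theta> t"
        using elim unfolding dist_real_def by (intro arcsin_sin) linarith+
      ultimately show ?case by simp
    qed
    then have evn: "\<forall>\<^sub>F s in nhds t. \<theta> t + arcsin (P s) = \<theta> s"
      using Pt by (simp add: eventually_at_filter) (auto elim!: eventually_mono)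
    have "(\<theta> has_real_derivative c - \<epsilon> * u t * sin (\<theta> t) / (2 * \<kappa> t)) (at t)"
      using as DERIV_cong_ev[OF refl evn refl] by simp
    moreover have "sqrt (1 - (\<kappa> t)\<^sup>2 * (sin (\<theta> t))\<^sup>2) = c"
    proof -
      have "1 - (\<kappa> t)\<^sup>2 * (sin (\<theta> t))\<^sup>2 = 1 - (X t)\<^sup>2" using pol[OF t'] by (simp add: power_mult_distrib)
      also have "\<dots> = c\<^sup>2" by (simp add: X_def c_def cos_squared_eq)
      finally show ?thesis using C[OF t'] by (simp add: c_def)
    qed
    ultimately show "(\<kappa> has_real_derivative \<epsilon> * u t * cos (\<theta> t) / 2) (at t) \<and>
       (\<theta> has_real_derivative sqrt (1 - (\<kappa> t)\<^sup>2 * (sin (\<theta> t))\<^sup>2) - \<epsilon> * u t * sin (\<theta> t) / (2 * \<kappa> t)) (at t)"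
      using \<kappa>' by simp
  qed
qed

lemma energy_weight_diff:
  "energy_weight 1 0 k - energy_weight 1 1 k = k * pi / arcsin k"
  by (simp add: energy_weight_def diff_divide_distrib[symmetric] algebra_simps)

text \<open>The two weights differ by k \<pi> / arcsin k, and the substitution a = 2 arcsin k turns
  this density into \<pi> sin a / (2 a). In terms of meaning: damping time minus its excess over the
  rotation is the rotation during damping, that is, \<pi> times the number of half turns.\<close>

lemma energy_potential_diff:
  assumes "0 < \<delta>" "\<delta> \<le> k0" "k0 \<le> k1" "k1 < 1"
  shows "(energy_potential 1 0 \<delta> k1 - energy_potential 1 0 \<delta> k0)
     - (energy_potential 1 1 \<delta> k1 - energy_potential 1 1 \<delta> k0)
     = pi * (swing_integral (2 * arcsin k1) - swing_integral (2 * arcsin k0))"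
proof -
  define h where "h k = energy_potential 1 0 \<delta> k - energy_potential 1 1 \<delta> k - pi * swing_integral (2 * arcsin k)" for k
  have d: "(h has_real_derivative 0) (at k)" if k: "\<delta> \<le> k" "k < 1" for k
  proof -
    have a: "0 < arcsin k" using k assms by (intro arcsin_gt_zero) auto
    have "k\<^sup>2 < 1" using k assms by (simp add: abs_square_less_1)
    then have q: "0 < sqrt (1 - k\<^sup>2)" by simp
    have da: "((\<lambda>k. 2 * arcsin k) has_real_derivative 2 * inverse (sqrt (1 - k\<^sup>2))) (at k)"
      using k assms by (auto intro!: derivative_eq_intros)
    have "sin (2 * arcsin k) = 2 * k * sqrt (1 - k\<^sup>2)"
      using k assms by (simp add: sin_double cos_arcsin)
    moreover have "(h has_real_derivative energy_weight 1 0 k - energy_weight 1 1 k -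
        pi * (sin (2 * arcsin k) / (2 * (2 * arcsin k)) * (2 * inverse (sqrt (1 - k\<^sup>2))))) (at k)"
      unfolding h_def[abs_def]
      by (intro DERIV_diff DERIV_cmult energy_potential_has_derivative
            DERIV_chain2[OF swing_integral_has_derivative da]) (use assms k a in auto)
    moreover have "energy_weight 1 0 k - energy_weight 1 1 k -
        pi * (2 * k * sqrt (1 - k\<^sup>2) / (2 * (2 * arcsin k)) * (2 * inverse (sqrt (1 - k\<^sup>2)))) = 0"
      using q a by (simp add: energy_weight_diff field_simps)
    ultimately show ?thesis by simp
  qed
  have "h k1 - h k0 = 0 * (k1 - k0)"
    by (rule increment_eq[of "{}"])
      (use assms d in \<open>auto intro!: continuous_at_imp_continuous_on DERIV_isCont[OF d]\<close>)
  then show ?thesis by (simp add: h_def algebra_simps)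
qed

lemma energy_weight_nonneg:
  assumes "k \<in> {0<..<1}" "a \<ge> 0" "b \<le> a"
  shows "0 \<le> energy_weight a b k"
proof -
  have "b * pi \<le> a * half_period k"
    using half_period_ge_pi[of k] assms by (smt (verit) atLeastAtMost_iff greaterThanLessThan_iff mult_left_mono mult_right_mono pi_ge_zero)
  then show ?thesis
    using assms arcsin_gt_zero[of k] by (simp add: energy_weight_def)
qed

section \<open>Explicit steering\<close>

lemma abs_fst_snd_le_norm:
  fixes p :: "real \<times> real"
  shows "\<bar>fst p\<bar> \<le> norm p" "\<bar>snd p\<bar> \<le> norm p"
  using norm_fst_le[of "fst p" "snd p"] norm_snd_le[of "snd p" "fst p"] by simp_all

text \<open>Picard's theorem for a Lipschitz feedback. The solution is frozen outside
  \<open>{0..B}\<close> so that the resulting control is continuous on the whole line and hence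
  Borel.\<close>

lemma feedback_trajectory:
  fixes \<rho> :: "real \<Rightarrow> real \<Rightarrow> real"
  assumes \<epsilon>: "0 < \<epsilon>" and B: "0 \<le> B" and M: "0 \<le> M"
    and bd: "\<And>a b. \<bar>\<rho> a b\<bar> \<le> 1"
    and lip: "\<And>a b a' b'. \<bar>\<rho> a b - \<rho> a' b'\<bar> \<le> M * (\<bar>a - a'\<bar> + \<bar>b - b'\<bar>)"
  obtains x y where "continuous_on UNIV x" "continuous_on UNIV y" "x 0 = x0" "y 0 = y0"
    "\<And>t. t \<in> {0<..<B} \<Longrightarrow> (x has_real_derivative y t) (at t)"
    "\<And>t. t \<in> {0<..<B} \<Longrightarrow> (y has_real_derivative - sin (x t) + \<epsilon> * \<rho> (x t) (y t)) (at t)"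
    "pw_trajectory \<epsilon> B (\<lambda>t. \<rho> (x t) (y t)) x y"
proof -
  define F where "F t z = (snd z, - sin (fst z) + \<epsilon> * \<rho> (fst z) (snd z))" for t :: real and z :: "real \<times> real"
  define L where "L = 2 + 2 * \<epsilon> * M"
  have lipF: "norm (F t z - F t w) \<le> L * norm (z - w)" for t z w
  proof -
    define N where "N = norm (z - w)"
    have 1: "\<bar>fst z - fst w\<bar> \<le> N" "\<bar>snd z - snd w\<bar> \<le> N"
      using abs_fst_snd_le_norm[of "z - w"] by (auto simp: N_def)
    have s: "\<bar>sin (fst z) - sin (fst w)\<bar> \<le> N"
      using abs_sin_x_le_abs_x 1
    proof -
      have "\<bar>sin (fst z) - sin (fst w)\<bar> \<le> \<bar>fst z - fst w\<bar>"
      proof -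
        have "\<bar>sin (fst z) - sin (fst w)\<bar> = 2 * \<bar>sin ((fst z - fst w) / 2)\<bar> * \<bar>cos ((fst z + fst w) / 2)\<bar>"
          by (simp add: sin_diff_sin abs_mult)
        also have "\<dots> \<le> 2 * \<bar>(fst z - fst w) / 2\<bar> * 1"
          by (intro mult_mono abs_sin_x_le_abs_x) auto
        finally show ?thesis by simp
      qed
      then show ?thesis using 1 by linarith
    qed
    have r: "\<bar>\<rho> (fst z) (snd z) - \<rho> (fst w) (snd w)\<bar> \<le> M * (N + N)"
      by (rule order_trans[OF lip]) (use 1 M in \<open>intro mult_left_mono; linarith\<close>)
    have r': "\<bar>\<epsilon> * \<rho> (fst z) (snd z) - \<epsilon> * \<rho> (fst w) (snd w)\<bar> \<le> \<epsilon> * (M * (N + N))"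
      using mult_left_mono[OF r, of \<epsilon>] \<epsilon> by (simp add: abs_mult flip: right_diff_distrib)
    have "norm (F t z - F t w) \<le> norm (snd z - snd w) + norm (- sin (fst z) + \<epsilon> * \<rho> (fst z) (snd z) - (- sin (fst w) + \<epsilon> * \<rho> (fst w) (snd w)))"
      unfolding F_def diff_Pair by (rule norm_Pair_le)
    also have "\<dots> \<le> N + (N + \<epsilon> * (M * (N + N)))"
      using 1 s r' by (intro add_mono) (auto simp: abs_if split: if_splits)
    also have "\<dots> = L * norm (z - w)" by (simp add: L_def N_def algebra_simps)
    finally show ?thesis .
  qed
  have contF: "continuous_on UNIV (F t)" for t
    by (rule lipschitz_on_continuous_on[of L]) (use lipF \<epsilon> M in \<open>auto intro!: lipschitz_onI simp: dist_norm L_def\<close>)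
  obtain z where z: "continuous_on {0..B} z"
    "\<And>t. t \<in> {0..B} \<Longrightarrow> z t = (x0, y0) + integral {0..t} (\<lambda>s. F s (z s))"
  proof (rule picard_existence[of B L "\<lambda>_. (x0, y0)" F])
    show "continuous_on ({0..B} \<times> UNIV) (\<lambda>(t, z). F t z)"
      unfolding split_beta using continuous_on_compose2[OF contF[of 0], of "{0..B} \<times> UNIV" snd]
      by (simp add: F_def continuous_on_snd)
  qed (use B lipF \<epsilon> M in \<open>auto simp: L_def\<close>, simp add: add_pos_nonneg)
  have cFz: "continuous_on {0..B} (\<lambda>s. F s (z s))"
    using continuous_on_compose2[OF contF[of 0] z(1)] by (simp add: F_def)
  have dz: "(z has_vector_derivative F t (z t)) (at t)" if t: "t \<in> {0<..<B}" for t
  proof -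
    have "((\<lambda>t. integral {0..t} (\<lambda>s. F s (z s))) has_vector_derivative F t (z t)) (at t within {0..B})"
      using t by (intro integral_has_vector_derivative cFz) auto
    then have "((\<lambda>t. (x0, y0) + integral {0..t} (\<lambda>s. F s (z s))) has_vector_derivative F t (z t)) (at t)"
      using t by (auto simp: at_within_Icc_at intro!: derivative_eq_intros)
    then show ?thesis
      by (rule has_vector_derivative_transform_within_open[of _ _ _ "{0<..<B}"]) (use t z(2) in auto)
  qed
  define cl where "cl t = max 0 (min B t)" for t :: real
  have cl: "cl t \<in> {0..B}" for t using B by (auto simp: cl_def)
  have cl_id: "cl t = t" if "t \<in> {0..B}" for t using that by (auto simp: cl_def)
  have czc: "continuous_on UNIV (\<lambda>t. z (cl t))"
    by (rule continuous_on_compose2[OF z(1)]) (use cl in \<open>auto simp: cl_def intro!: continuous_intros\<close>)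
  have dzc: "((\<lambda>t. z (cl t)) has_vector_derivative F t (z t)) (at t)" if t: "t \<in> {0<..<B}" for t
    by (rule has_vector_derivative_transform_within_open[OF dz[OF t], of "{0<..<B}"]) (use t cl_id in auto)
  define x where "x t = fst (z (cl t))" for t
  define y where "y t = snd (z (cl t))" for t
  have cx: "continuous_on UNIV x" and cy: "continuous_on UNIV y"
    unfolding x_def y_def by (intro continuous_intros czc)+
  have dx: "(x has_real_derivative y t) (at t)" if t: "t \<in> {0<..<B}" for t
  proof -
    have "((\<lambda>t. fst (z (cl t))) has_vector_derivative fst (F t (z t))) (at t)"
      by (rule bounded_linear.has_vector_derivative[OF bounded_linear_fst dzc[OF t]])
    then show ?thesis using t cl_id by (simp add: x_def[abs_def] y_def F_def has_real_derivative_iff_has_vector_derivative)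
  qed
  have dy: "(y has_real_derivative - sin (x t) + \<epsilon> * \<rho> (x t) (y t)) (at t)" if t: "t \<in> {0<..<B}" for t
  proof -
    have "((\<lambda>t. snd (z (cl t))) has_vector_derivative snd (F t (z t))) (at t)"
      by (rule bounded_linear.has_vector_derivative[OF bounded_linear_snd dzc[OF t]])
    then show ?thesis using t cl_id by (simp add: x_def y_def[abs_def] F_def has_real_derivative_iff_has_vector_derivative)
  qed
  have c\<rho>: "continuous_on UNIV (\<lambda>t. \<rho> (x t) (y t))"
  proof -
    have "M-lipschitz_on UNIV (\<lambda>p. \<rho> (fst p) (snd p)) \<or> True" by simp
    have "continuous_on UNIV (\<lambda>p::real \<times> real. \<rho> (fst p) (snd p))"
    proof (rule lipschitz_on_continuous_on[of "2 * M"], rule lipschitz_onI)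
      fix p q :: "real \<times> real"
      have "\<bar>fst p - fst q\<bar> \<le> norm (p - q)" "\<bar>snd p - snd q\<bar> \<le> norm (p - q)"
        using abs_fst_snd_le_norm[of "p - q"] by auto
      then have "M * (\<bar>fst p - fst q\<bar> + \<bar>snd p - snd q\<bar>) \<le> M * (norm (p - q) + norm (p - q))"
        using M by (intro mult_left_mono) auto
      then show "dist (\<rho> (fst p) (snd p)) (\<rho> (fst q) (snd q)) \<le> 2 * M * dist p q"
        using lip[of "fst p" "snd p" "fst q" "snd q"] by (simp add: dist_norm)
    qed (use M in auto)
    from continuous_on_compose2[OF this, of UNIV "\<lambda>t. (x t, y t)"] show ?thesis
      using cx cy by (simp add: continuous_on_Pair)
  qed
  show thesis
  proof (rule that[OF cx cy _ _ dx dy])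
    show "x 0 = x0" "y 0 = y0" using z(2)[of 0] B cl_id[of 0] by (auto simp: x_def y_def)
    show "pw_trajectory \<epsilon> B (\<lambda>t. \<rho> (x t) (y t)) x y"
      by (rule pw_trajectoryI[where S = "{}"])
        (use B bd dx dy c\<rho> in \<open>auto intro: continuous_on_subset[OF cx] continuous_on_subset[OF cy] borel_measurable_continuous_onI\<close>)
  qed auto
qed

lemma abs_sin_minus_le: "\<bar>sin z - z\<bar> \<le> \<bar>z\<bar> ^ 3 / 6" for z :: real
proof -
  have pos: "\<bar>sin z - z\<bar> \<le> z ^ 3 / 6" if z: "0 \<le> z" for z :: real
  proof -
    have c: "1 - s\<^sup>2 / 2 \<le> cos s" if "0 \<le> s" for s :: real
    proof -
      have "0 * (s - 0) \<le> (cos s - (1 - s\<^sup>2 / 2)) - (cos 0 - (1 - 0\<^sup>2 / 2))"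
        by (rule increment_ge[of "{}" 0 s _ "\<lambda>s. s - sin s"])
          (use that sin_x_le_x in \<open>auto intro!: continuous_intros derivative_eq_intros\<close>)
      then show ?thesis by simp
    qed
    have "0 * (z - 0) \<le> (sin z - (z - z ^ 3 / 6)) - (sin 0 - (0 - 0 ^ 3 / 6))"
      by (rule increment_ge[of "{}" 0 z _ "\<lambda>s. cos s - (1 - s\<^sup>2 / 2)"])
        (use z c in \<open>auto intro!: continuous_intros derivative_eq_intros\<close>)
    then show ?thesis using sin_x_le_x[OF z] by simp
  qed
  show ?thesis using pos[of z] pos[of "- z"] by (cases "0 \<le> z") auto
qed

text \<open>
  The solution of the uncontrolled linearisation is multiplied by a cubic cut-off; the control is
  then whatever the equation requires.
\<close>

lemma capture_trajectory:
  assumes \<epsilon>: "0 < \<epsilon>" and A: "0 < A" "x0\<^sup>2 + y0\<^sup>2 \<le> A\<^sup>2" "A ^ 3 \<le> 3 * \<epsilon>"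
    and L: "L = 1 + 18 * A / \<epsilon>"
  obtains u x y where "pw_trajectory \<epsilon> L u x y" "x 0 = x0" "y 0 = y0" "x L = 0" "y L = 0"
proof -
  have L1: "1 \<le> L" using \<epsilon> A by (simp add: L)
  then have L0: "0 < L" by simp
  define z where "z t = x0 * cos t + y0 * sin t" for t
  define z' where "z' t = y0 * cos t - x0 * sin t" for t
  \<comment> \<open>The Hermite cubic with value 1 and slope 0 at time 0 and value 0 and slope 0 at
    time \<open>L\<close>: it keeps the initial state of \<open>z\<close> and ends in the
    origin.\<close>
  define s where "s t = 1 - 3 * (t / L)\<^sup>2 + 2 * (t / L) ^ 3" for t
  define s' where "s' t = - 6 * (t / L) * (1 - t / L) / L" for t
  define s'' where "s'' t = (12 * (t / L) - 6) / L / L" for t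
  have ds: "(s has_real_derivative s' t) (at t)" for t
    unfolding s_def[abs_def] s'_def divide_inverse
    by (auto intro!: derivative_eq_intros simp: algebra_simps power2_eq_square power3_eq_cube)
  have ds': "(s' has_real_derivative s'' t) (at t)" for t
    unfolding s'_def[abs_def] s''_def divide_inverse
    by (auto intro!: derivative_eq_intros simp: algebra_simps power2_eq_square power3_eq_cube)
  have dz: "(z has_real_derivative z' t) (at t)" for t
    unfolding z_def[abs_def] z'_def by (auto intro!: derivative_eq_intros)
  have dz': "(z' has_real_derivative - z t) (at t)" for t
    unfolding z'_def[abs_def] z_def by (auto intro!: derivative_eq_intros)
  have zz: "(z t)\<^sup>2 + (z' t)\<^sup>2 = x0\<^sup>2 + y0\<^sup>2" for t
  proof -
    have "(z t)\<^sup>2 + (z' t)\<^sup>2 = (x0\<^sup>2 + y0\<^sup>2) * ((cos t)\<^sup>2 + (sin t)\<^sup>2)"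
      unfolding z_def z'_def by algebra
    then show ?thesis by simp
  qed
  have zA: "\<bar>z t\<bar> \<le> A" "\<bar>z' t\<bar> \<le> A" for t
  proof -
    have "(z t)\<^sup>2 \<le> A\<^sup>2" "(z' t)\<^sup>2 \<le> A\<^sup>2" using zz[of t] A(2) by (smt (verit) zero_le_power2)+
    then show "\<bar>z t\<bar> \<le> A" "\<bar>z' t\<bar> \<le> A" using A(1) by (auto simp: abs_le_square_iff[symmetric])
  qed
  define x where "x t = s t * z t" for t
  define y where "y t = s' t * z t + s t * z' t" for t
  \<comment> \<open>By design the acceleration of \<open>x\<close> is w - sin x, so the control is w
    / \<epsilon>. As z'' = - z, the linear parts cancel; there remain derivatives of
    \<open>s\<close>, which are of order 1 / L, and the cubic error of sin.\<close>
  define w where "w t = s'' t * z t + 2 * s' t * z' t - s t * z t + sin (x t)" for t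
  define u where "u t = max (-1) (min 1 (w t / \<epsilon>))" for t
  have dx: "(x has_real_derivative y t) (at t)" for t
    unfolding x_def[abs_def] y_def using DERIV_mult[OF ds dz] by (simp add: algebra_simps)
  have dy: "(y has_real_derivative (w t - sin (x t))) (at t)" for t
    unfolding y_def[abs_def] w_def using DERIV_add[OF DERIV_mult[OF ds' dz] DERIV_mult[OF ds dz']]
    by (simp add: algebra_simps)
  have cs: "continuous_on UNIV f" if "\<And>t. (f has_real_derivative f' t) (at t)" for f f' :: "real \<Rightarrow> real"
    using that by (intro continuous_at_imp_continuous_on) (auto intro: DERIV_isCont)
  have cw: "continuous_on UNIV w"
  proof -
    have "continuous_on UNIV s''" unfolding s''_def[abs_def] using L0 by (intro continuous_intros) auto
    then show ?thesis unfolding w_def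
      by (intro continuous_intros cs[OF ds] cs[OF ds'] cs[OF dz] cs[OF dz'] cs[OF dx])
  qed
  have wb: "\<bar>w t\<bar> \<le> \<epsilon>" if t: "t \<in> {0..L}" for t
  proof -
    define r where "r = t / L"
    have r: "0 \<le> r" "r \<le> 1" using t L0 by (auto simp: r_def)
    have "s t = (1 - r)\<^sup>2 * (1 + 2 * r)" by (simp add: s_def r_def[symmetric] power2_eq_square power3_eq_cube algebra_simps)
    moreover have "1 - s t = r\<^sup>2 * (3 - 2 * r)" by (simp add: s_def r_def[symmetric] power2_eq_square power3_eq_cube algebra_simps)
    ultimately have s1: "\<bar>s t\<bar> \<le> 1" using r by (smt (verit) mult_nonneg_nonneg zero_le_power2)
    have "r * (1 - r) \<le> 1 / 4" using zero_le_power2[of "r - 1 / 2"] by (simp add: power2_eq_square algebra_simps)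
    then have s2: "\<bar>s' t\<bar> \<le> 3 / 2 / L"
      unfolding s'_def r_def[symmetric] abs_divide using r L0
      by (intro frac_le) (auto simp: abs_mult)
    have s3: "\<bar>s'' t\<bar> \<le> 6 / L"
    proof -
      have "\<bar>s'' t\<bar> \<le> 6 / L / L"
        unfolding s''_def r_def[symmetric] abs_divide using r L0 by (intro frac_le) auto
      also have "\<dots> \<le> 6 / L" using L1 divide_left_mono[of 1 L 6] by (simp add: divide_simps)
      finally show ?thesis .
    qed
    have x3: "\<bar>sin (x t) - x t\<bar> \<le> A ^ 3 / 6"
    proof -
      have "\<bar>x t\<bar> \<le> 1 * A" unfolding x_def abs_mult using s1 zA(1) by (intro mult_mono) auto
      then have "\<bar>x t\<bar> ^ 3 \<le> A ^ 3" by (intro power_mono) auto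
      then show ?thesis using abs_sin_minus_le[of "x t"] by linarith
    qed
    have "w t = s'' t * z t + 2 * (s' t * z' t) + (sin (x t) - x t)" by (simp add: w_def x_def)
    then have "\<bar>w t\<bar> \<le> \<bar>s'' t\<bar> * \<bar>z t\<bar> + 2 * (\<bar>s' t\<bar> * \<bar>z' t\<bar>) + \<bar>sin (x t) - x t\<bar>"
      unfolding abs_mult[symmetric] by linarith
    also have "\<dots> \<le> 6 / L * A + 2 * (3 / 2 / L * A) + A ^ 3 / 6"
      using s2 s3 zA x3 L0 by (intro add_mono mult_mono mult_left_mono) auto
    \<comment> \<open>6 from the second derivative of \<open>s\<close> and 3 from twice the first.
      The choice of \<open>L\<close> makes this term at most \<epsilon> / 2, and
      \<open>A ^ 3 \<le> 3 * \<epsilon>\<close> bounds the other by \<epsilon> / 2.\<close>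
    also have "\<dots> = 9 * A / L + A ^ 3 / 6" by (simp add: field_simps)
    also have "9 * A / L \<le> 9 * A / (18 * A / \<epsilon>)" 
    proof (rule divide_left_mono)
      show "18 * A / \<epsilon> \<le> L" by (simp add: L)
      show "0 < L * (18 * A / \<epsilon>)" using L0 A \<epsilon> by (intro mult_pos_pos) auto
    qed (use A in auto)
    also have "9 * A / (18 * A / \<epsilon>) = \<epsilon> / 2" using A by simp
    finally show ?thesis using A(3) by linarith
  qed
  show thesis
  proof (rule that)
    show "pw_trajectory \<epsilon> L u x y"
    proof (rule pw_trajectoryI[where S = "{}"])
      show "u \<in> borel_measurable borel" unfolding u_def
        by (intro borel_measurable_continuous_onI continuous_intros cw) (use \<epsilon> in auto)
      show "\<bar>u t\<bar> \<le> 1" for t by (auto simp: u_def)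
      show "(y has_real_derivative - sin (x t) + \<epsilon> * u t) (at t)" if t: "t \<in> {0<..<L} - {}" for t
      proof -
        have "-1 \<le> w t / \<epsilon>" "w t / \<epsilon> \<le> 1" using wb[of t] t \<epsilon> by (simp_all add: divide_simps abs_le_iff)
        then have "u t = w t / \<epsilon>" by (simp add: u_def)
        then show ?thesis using dy[of t] \<epsilon> by simp
      qed
    qed (use L0 dx continuous_on_subset[OF cs[OF dx]] continuous_on_subset[OF cs[OF dy]] in auto)
  qed (use L0 in \<open>auto simp: x_def y_def s_def s'_def z_def z'_def\<close>)
qed

section \<open>A Lyapunov function for the damped pendulum\<close>

lemma artanh_bounds:
  fixes k :: real
  assumes k: "0 \<le> k" "k < 1"
  shows "0 \<le> artanh k" "artanh k \<le> 2 / sqrt (1 - k\<^sup>2)"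
proof -
  have k2: "k\<^sup>2 < 1" using k by (simp add: abs_square_less_1)
  have r: "1 \<le> (1 + k) / (1 - k)" using k by simp
  show "0 \<le> artanh k" using r by (simp add: artanh_def)
  have s: "sqrt ((1 + k) / (1 - k)) = (1 + k) / sqrt (1 - k\<^sup>2)"
  proof -
    have "(1 + k) / (1 - k) = (1 + k)\<^sup>2 / (1 - k\<^sup>2)"
    proof -
      have "1 - k\<^sup>2 = (1 - k) * (1 + k)" by (simp add: power2_eq_square algebra_simps)
      then show ?thesis using k by (simp add: power2_eq_square)
    qed
    then show ?thesis using k by (simp add: real_sqrt_divide)
  qed
  have "artanh k = ln (sqrt ((1 + k) / (1 - k)))" using r by (simp add: artanh_def ln_sqrt)
  also have "\<dots> \<le> sqrt ((1 + k) / (1 - k)) - 1" using r k by (intro ln_le_minus_one) auto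
  also have "\<dots> \<le> (1 + k) / sqrt (1 - k\<^sup>2)" using s by simp
  also have "\<dots> \<le> 2 / sqrt (1 - k\<^sup>2)" using k k2 by (intro divide_right_mono) auto
  finally show "artanh k \<le> 2 / sqrt (1 - k\<^sup>2)" .
qed

lemma artanh_mono:
  fixes a b :: real
  assumes "-1 < a" "a \<le> b" "b < 1" shows "artanh a \<le> artanh b"
proof -
  have "(1 + a) / (1 - a) \<le> (1 + b) / (1 - b)" using assms by (intro frac_le) auto
  then show ?thesis using assms by (simp add: artanh_def)
qed

text \<open>The left side is the derivative of the Lyapunov function \<open>damped.\<Lambda>\<close>
  divided by \<epsilon>, with \<open>a\<close> = artanh k and \<open>b\<close> = artanh (Y / C) in
  mind. Damping absorbs C Y b because |b| \<le> a, which leaves - X^2; the terms with powers of 1 /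
  k leave - C; and |X| C - C - X^2 \<le> - 1 / 2 on the unit circle. The errors are 3 / 2 sqrt
  \<epsilon> twice, together at most 1 / 4 since sqrt \<epsilon> \<le> 1 / 12; this is the origin of
  144.\<close>

lemma lyapunov_bound:
  fixes X Y C u k \<epsilon> b a :: real
  assumes \<epsilon>: "0 < \<epsilon>" "144 * \<epsilon> \<le> 1"
    and C: "0 < C" "X\<^sup>2 + C\<^sup>2 = 1" and k: "k\<^sup>2 = X\<^sup>2 + Y\<^sup>2" "sqrt \<epsilon> \<le> k" and k1: "\<epsilon> / 2 \<le> 1 - k\<^sup>2"
    and u: "u = - max (-1) (min 1 (2 * Y / \<epsilon>))"
    and b: "\<bar>b\<bar> \<le> a" and a: "a \<le> 2 / sqrt (1 - k\<^sup>2)"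
  shows "u * Y * a + (C * Y * b - X\<^sup>2 + \<epsilon> * u * X * C / (2 * (1 - k\<^sup>2))) + 2 * u * Y / k
     + (C * (Y\<^sup>2 - X\<^sup>2) / k\<^sup>2 + \<epsilon> * u * X / (2 * k\<^sup>2) - X * Y * (\<epsilon> * u * Y) / k ^ 4) \<le> - 1 / 4"
proof -
  define r where "r = sqrt \<epsilon>"
  have r: "0 < r" "r\<^sup>2 = \<epsilon>" "r \<le> 1 / 12"
  proof -
    show "0 < r" "r\<^sup>2 = \<epsilon>" using \<epsilon> by (auto simp: r_def)
    have "r \<le> sqrt ((1 / 12)\<^sup>2)" unfolding r_def using \<epsilon>(2) by (intro real_sqrt_le_mono) (simp add: power2_eq_square)
    then show "r \<le> 1 / 12" by simp
  qed
  have k0: "0 < k" "r \<le> k" using k(2) r(1) unfolding r_def by linarith+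
  have re: "\<epsilon> \<le> r" using r by (simp add: power2_eq_square mult_left_le flip: r(2))
  have "X\<^sup>2 \<le> 1" "C\<^sup>2 \<le> 1" using C(2) zero_le_power2[of C] zero_le_power2[of X] by linarith+
  then have X1: "\<bar>X\<bar> \<le> 1" and C1: "C \<le> 1" using C(1) by (auto simp: abs_square_le_1)
  have Yk: "\<bar>Y\<bar> \<le> k" by (rule power2_le_imp_le) (use k(1) k0 in auto)
  have Xk: "\<bar>X\<bar> \<le> k" by (rule power2_le_imp_le) (use k(1) k0 in auto)
  have u1: "\<bar>u\<bar> \<le> 1" by (auto simp: u)
  have uY: "u * Y = - (\<bar>u\<bar> * \<bar>Y\<bar>)"
  proof (cases "0 \<le> Y")
    case True
    then have "0 \<le> 2 * Y / \<epsilon>" using \<epsilon> by simp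
    then have "u \<le> 0" unfolding u by linarith
    then show ?thesis using True by simp
  next
    case False
    then have "2 * Y / \<epsilon> \<le> 0" using \<epsilon> by (simp add: divide_simps)
    then have "0 \<le> u" unfolding u by linarith
    then show ?thesis using False by simp
  qed
  \<comment> \<open>As k \<ge> sqrt \<epsilon> \<ge> \<epsilon>, the unsaturated slope 2 /
    \<epsilon> exceeds 1 / k; when saturated, |u| = 1 and |Y| \<le> k.\<close>
  have us: "\<bar>Y\<bar> / k \<le> \<bar>u\<bar>"
  proof (cases "\<bar>2 * Y / \<epsilon>\<bar> \<le> 1")
    case True
    then have "\<bar>u\<bar> = 2 * \<bar>Y\<bar> / \<epsilon>" using \<epsilon> by (auto simp: u abs_if divide_simps split: if_splits)
    moreover have "\<bar>Y\<bar> / k \<le> 2 * \<bar>Y\<bar> / \<epsilon>" using k0 re \<epsilon> by (intro frac_le) auto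
    ultimately show ?thesis by simp
  next
    case False
    then have "\<bar>u\<bar> = 1" by (auto simp: u abs_if max_def min_def split: if_splits)
    then show ?thesis using Yk k0 by simp
  qed
  have udef: "(1 - \<bar>u\<bar>) * \<bar>Y\<bar> \<le> \<epsilon> / 2"
  proof (cases "\<bar>2 * Y / \<epsilon>\<bar> \<le> 1")
    case True
    then have "\<bar>Y\<bar> \<le> \<epsilon> / 2" using \<epsilon> by (simp add: abs_mult divide_simps)
    then have "(1 - \<bar>u\<bar>) * \<bar>Y\<bar> \<le> 1 * (\<epsilon> / 2)" using u1 by (intro mult_mono) auto
    then show ?thesis by simp
  next
    case False
    then have "\<bar>u\<bar> = 1" by (auto simp: u abs_if max_def min_def split: if_splits)
    then show ?thesis using \<epsilon> by simp
  qed
  have a0: "0 \<le> a" using b by linarith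
  have a3: "\<epsilon> / 2 * a \<le> 3 / 2 * r"
  proof -
    have "2 / 3 * r \<le> sqrt (1 - k\<^sup>2)"
      using k1 r \<epsilon>(1) by (intro real_le_rsqrt) (simp add: power_mult_distrib power2_eq_square)
    moreover have "k\<^sup>2 < 1" using k1 \<epsilon>(1) by linarith
    ultimately have "2 / sqrt (1 - k\<^sup>2) \<le> 2 / (2 / 3 * r)" using r by (intro divide_left_mono) (auto intro!: mult_pos_pos)
    then have "a \<le> 3 / r" using a by simp
    then have "\<epsilon> / 2 * a \<le> \<epsilon> / 2 * (3 / r)" using \<epsilon> by (intro mult_left_mono) auto
    also have "\<dots> = 3 / 2 * r" using r by (simp add: power2_eq_square field_simps flip: r(2))
    finally show ?thesis .
  qed
  have 1: "u * Y * a + C * Y * b \<le> 3 / 2 * r"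
  proof -
    have "C * Y * b \<le> \<bar>C * Y * b\<bar>" by simp
    also have "\<dots> = C * (\<bar>Y\<bar> * \<bar>b\<bar>)" using C by (simp add: abs_mult)
    also have "\<dots> \<le> 1 * (\<bar>Y\<bar> * a)" using C C1 b by (intro mult_mono) auto
    finally have "u * Y * a + C * Y * b \<le> (1 - \<bar>u\<bar>) * \<bar>Y\<bar> * a" unfolding uY by (simp add: algebra_simps)
    also have "\<dots> \<le> \<epsilon> / 2 * a" by (intro mult_right_mono udef a0)
    finally show ?thesis using a3 by linarith
  qed
  have 2: "\<epsilon> * u * X * C / (2 * (1 - k\<^sup>2)) \<le> \<bar>X\<bar> * C"
  proof -
    have "\<epsilon> / (2 * (1 - k\<^sup>2)) \<le> 1" using k1 \<epsilon> by (simp add: divide_simps)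
    then have le: "\<epsilon> / (2 * (1 - k\<^sup>2)) * (\<bar>u\<bar> * (\<bar>X\<bar> * C)) \<le> 1 * (1 * (\<bar>X\<bar> * C))"
      using u1 C k1 \<epsilon> by (intro mult_mono) auto
    have "\<epsilon> * u * X * C / (2 * (1 - k\<^sup>2)) \<le> \<bar>\<epsilon> * u * X * C / (2 * (1 - k\<^sup>2))\<bar>" by (rule abs_ge_self)
    also have "\<dots> = \<epsilon> / (2 * (1 - k\<^sup>2)) * (\<bar>u\<bar> * (\<bar>X\<bar> * C))"
      using \<epsilon> C k1 by (simp add: abs_mult)
    also note le
    finally show ?thesis by simp
  qed
  \<comment> \<open>With s = |Y| / k the first term is at most - 2 s^2 and the second equals C (2
    s^2 - 1); C \<le> 1 finishes.\<close>
  have 3: "2 * u * Y / k + C * (Y\<^sup>2 - X\<^sup>2) / k\<^sup>2 \<le> - C"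
  proof -
    define s where "s = \<bar>Y\<bar> / k"
    have s2: "s\<^sup>2 = Y\<^sup>2 / k\<^sup>2" by (simp add: s_def power_divide)
    have "2 * u * Y / k = - 2 * \<bar>u\<bar> * s" unfolding mult.assoc[of 2 u Y] uY s_def by simp
    moreover have "s * s \<le> \<bar>u\<bar> * s" using us k0 by (intro mult_right_mono) (auto simp: s_def)
    ultimately have p: "2 * u * Y / k \<le> - 2 * s\<^sup>2" by (simp add: power2_eq_square)
    have "Y\<^sup>2 - X\<^sup>2 = 2 * Y\<^sup>2 - k\<^sup>2" using k(1) by simp
    then have "(Y\<^sup>2 - X\<^sup>2) / k\<^sup>2 = (2 * Y\<^sup>2 - k\<^sup>2) / k\<^sup>2" by (simp only:)
    also have "\<dots> = 2 * s\<^sup>2 - 1" using k0 unfolding s2 by (simp add: diff_divide_distrib)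
    finally have "(Y\<^sup>2 - X\<^sup>2) / k\<^sup>2 = 2 * s\<^sup>2 - 1" .
    then have "C * (Y\<^sup>2 - X\<^sup>2) / k\<^sup>2 = C * (2 * s\<^sup>2 - 1)" by (metis times_divide_eq_right)
    moreover have "2 * s\<^sup>2 * C \<le> 2 * s\<^sup>2 * 1" using C1 by (intro mult_left_mono) auto
    ultimately show ?thesis using p by (simp add: algebra_simps)
  qed
  have 4: "\<epsilon> * u * X / (2 * k\<^sup>2) - X * Y * (\<epsilon> * u * Y) / k ^ 4 \<le> 3 / 2 * r"
  proof -
    have ek: "\<epsilon> / k \<le> r"
    proof -
      have "\<epsilon> / k \<le> \<epsilon> / r" using k0 r \<epsilon> by (intro divide_left_mono) auto
      also have "\<dots> = r" using r by (simp add: power2_eq_square field_simps flip: r(2))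
      finally show ?thesis .
    qed
    have xk: "\<bar>X / k\<bar> \<le> 1" "\<bar>Y / k\<bar> \<le> 1" using Xk Yk k0 by simp_all
    have e1: "\<epsilon> * u * X / (2 * k\<^sup>2) = \<epsilon> / k * (u * (X / k)) / 2"
      using k0 by (simp add: power2_eq_square field_simps)
    have e2: "X * Y * (\<epsilon> * u * Y) / k ^ 4 = \<epsilon> / k * (u * (X / k) * ((Y / k) * (Y / k)))"
      using k0 by (simp add: power4_eq_xxxx field_simps)
    have b1: "\<bar>u * (X / k)\<bar> \<le> 1" using mult_mono[OF u1 xk(1)] by (simp add: abs_mult)
    have b2: "\<bar>u * (X / k) * ((Y / k) * (Y / k))\<bar> \<le> 1"
      using mult_mono[OF b1 mult_mono[OF xk(2) xk(2)]] by (simp add: abs_mult)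
    have p: "0 \<le> \<epsilon> / k" using \<epsilon> k0 by simp
    have "\<epsilon> / k * (u * (X / k)) \<le> \<epsilon> / k * 1" by (intro mult_left_mono p order_trans[OF abs_ge_self b1])
    moreover have "\<epsilon> / k * (- (u * (X / k) * ((Y / k) * (Y / k)))) \<le> \<epsilon> / k * 1" by (intro mult_left_mono p order_trans[OF abs_ge_minus_self b2])
    moreover have "a / 2 - b \<le> 3 / 2 * r" if "a \<le> \<epsilon> / k * 1" "\<epsilon> / k * (- c) \<le> \<epsilon> / k * 1" "b = \<epsilon> / k * c" for a b c
      using that ek by simp
    ultimately show ?thesis unfolding e1 e2 by blast
  qed
  have 5: "\<bar>X\<bar> * C - C - X\<^sup>2 \<le> - 1 / 2"
  proof -
    define v where "v = 1 - \<bar>X\<bar>"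
    have v: "0 \<le> v" "v \<le> 1" using X1 by (auto simp: v_def)
    have "X\<^sup>2 = (1 - v)\<^sup>2" by (simp add: v_def)
    then have "C\<^sup>2 = v * (2 - v)" using C(2) by (simp add: power2_eq_square algebra_simps)
    moreover have "v\<^sup>2 \<le> v * (2 - v)" using v mult_left_mono[of v "2 - v" v] by (simp add: power2_eq_square)
    ultimately have "v\<^sup>2 \<le> C\<^sup>2" by simp
    then have "v \<le> C" using C(1) by (rule power2_le_imp_le[OF _ less_imp_le])
    then have "v * v \<le> C * v" using v by (intro mult_right_mono) auto
    moreover have "1 / 2 \<le> v * v + (1 - v)\<^sup>2" using zero_le_power2[of "2 * v - 1"] by (simp add: power2_eq_square algebra_simps)
    moreover have "\<bar>X\<bar> * C - C = - (C * v)" by (simp add: v_def algebra_simps)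
    ultimately show ?thesis using \<open>X\<^sup>2 = (1 - v)\<^sup>2\<close> by linarith
  qed
  have "p + (q - x + t) + z + (w + v - s) \<le> - 1 / 4"
    if "p + q \<le> 3 / 2 * r" "t \<le> m" "z + w \<le> - C" "v - s \<le> 3 / 2 * r" "m - C - x \<le> - 1 / 2"
    for p q x t z w v s m :: real
    using that r(3) by linarith
  from this[OF 1 2 3 4 5] show ?thesis .
qed

text \<open>The primitive of 2 k artanh k that vanishes at 0. Near the separatrix artanh k grows
  logarithmically, as the half period does, but its primitive stays bounded; hence the damping time
  is O(1 / \<epsilon>) all the way up to k = 1.\<close>

definition L1 :: "real \<Rightarrow> real" where "L1 k = k - (1 - k\<^sup>2) * artanh k"

lemma L1_deriv: "\<bar>k\<bar> < 1 \<Longrightarrow> (L1 has_real_derivative 2 * k * artanh k) (at k)"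
proof -
  assume k: "\<bar>k\<bar> < 1"
  then have "1 - k\<^sup>2 \<noteq> 0" using abs_square_less_1[of k] by auto
  then show ?thesis
    unfolding L1_def[abs_def] using k by (auto intro!: derivative_eq_intros)
qed

text \<open>The third bound keeps \<open>L1\<close> within O(sqrt (1 - k)) of its limit 1, so that
  the layer between 1 - \<delta> and 1 costs only O(sqrt \<delta>).\<close>

lemma L1_bounds:
  assumes "0 \<le> k" "k < 1"
  shows "0 \<le> L1 k" "L1 k \<le> k" "1 - 2 * sqrt (1 - k\<^sup>2) - (1 - k) \<le> L1 k"
proof -
  have k2: "0 < 1 - k\<^sup>2" using assms by (simp add: abs_square_less_1)
  have "0 * (k - 0) \<le> L1 k - L1 0"
  proof (rule increment_ge[of "{}"])
    show "continuous_on {0..k} L1"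
      by (intro continuous_at_imp_continuous_on) (use assms in \<open>auto intro!: DERIV_isCont[OF L1_deriv]\<close>)
    show "(L1 has_real_derivative 2 * t * artanh t) (at t)" if "t \<in> {0<..<k} - {}" for t
      using that assms by (intro L1_deriv) auto
    show "0 \<le> 2 * t * artanh t" if "t \<in> {0<..<k} - {}" for t
      using that assms artanh_bounds(1)[of t] by auto
  qed (use assms in auto)
  then show "0 \<le> L1 k" by (simp add: L1_def)
  show "L1 k \<le> k" using artanh_bounds(1)[OF assms] k2 by (simp add: L1_def)
  have "(1 - k\<^sup>2) * artanh k \<le> (1 - k\<^sup>2) * (2 / sqrt (1 - k\<^sup>2))"
    using artanh_bounds(2)[OF assms] k2 by (intro mult_left_mono) auto
  also have "\<dots> = 2 * ((1 - k\<^sup>2) / sqrt (1 - k\<^sup>2))" by simp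
  also have "\<dots> = 2 * sqrt (1 - k\<^sup>2)" using k2 by (subst real_div_sqrt) auto
  finally show "1 - 2 * sqrt (1 - k\<^sup>2) - (1 - k) \<le> L1 k" by (simp add: L1_def)
qed

text \<open>Damping by - sgn y is replaced by its saturated linear version of slope 1 / \<epsilon>,
  which is Lipschitz, so that Picard's theorem supplies the trajectory; control is lost only where
  |y| < \<epsilon>. The bound \<open>k0\<close> keeps a distance from the separatrix, where artanh k
  blows up.\<close>

locale damped =
  fixes \<epsilon> B :: real and x y :: "real \<Rightarrow> real"
  assumes eps: "0 < \<epsilon>" "144 * \<epsilon> \<le> 1"
    and cx: "continuous_on UNIV x" and cy: "continuous_on UNIV y"
    and dx: "\<And>t. t \<in> {0<..<B} \<Longrightarrow> (x has_real_derivative y t) (at t)"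
    and dy: "\<And>t. t \<in> {0<..<B} \<Longrightarrow> (y has_real_derivative - sin (x t) + \<epsilon> * (- max (-1) (min 1 (y t / \<epsilon>)))) (at t)"
    and x0: "\<bar>x 0\<bar> < pi" and k0: "(sin (x 0 / 2))\<^sup>2 + (y 0 / 2)\<^sup>2 \<le> 1 - \<epsilon> / 2"
begin

definition "u t = - max (-1) (min 1 (y t / \<epsilon>))"
definition "X t = sin (x t / 2)"
definition "Y t = y t / 2"
definition "C t = cos (x t / 2)"
definition "k t = sqrt ((X t)\<^sup>2 + (Y t)\<^sup>2)"

lemma u_eq: "u t = - max (-1) (min 1 (2 * Y t / \<epsilon>))" by (simp add: u_def Y_def)

lemma k_sq: "(k t)\<^sup>2 = (X t)\<^sup>2 + (Y t)\<^sup>2" and k_nonneg: "0 \<le> k t" by (simp_all add: k_def)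

lemma XC: "(X t)\<^sup>2 + (C t)\<^sup>2 = 1" by (simp add: X_def C_def)

lemma cont: "continuous_on A X" "continuous_on A Y" "continuous_on A C" "continuous_on A k"
proof -
  have a: "continuous_on A x" "continuous_on A y" using cx cy continuous_on_subset by blast+
  show "continuous_on A X" "continuous_on A Y" "continuous_on A C" "continuous_on A k"
    unfolding k_def X_def Y_def C_def by (intro continuous_intros a; simp)+
qed

lemma u_le: "\<bar>u t\<bar> \<le> 1" by (auto simp: u_def)

lemma uY: "u t * Y t \<le> 0"
proof (cases "0 \<le> Y t")
  case True
  then have "0 \<le> 2 * Y t / \<epsilon>" using eps by simp
  then have "u t \<le> 0" unfolding u_eq by linarith
  then show ?thesis using True by (simp add: mult_nonpos_nonneg)
next
  case False
  then have "2 * Y t / \<epsilon> \<le> 0" using eps by (simp add: divide_simps)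
  then have "0 \<le> u t" unfolding u_eq by linarith
  then show ?thesis using False by (simp add: mult_nonneg_nonpos)
qed

lemma derivs:
  assumes t: "t \<in> {0<..<B}"
  shows "(X has_real_derivative C t * Y t) (at t)" "(C has_real_derivative - X t * Y t) (at t)"
    "(Y has_real_derivative - C t * X t + \<epsilon> * u t / 2) (at t)"
proof -
  show "(X has_real_derivative C t * Y t) (at t)" "(C has_real_derivative - X t * Y t) (at t)"
    unfolding X_def[abs_def] C_def[abs_def] Y_def using dx[OF t] by (auto intro!: derivative_eq_intros)
  have "sin (x t) = 2 * X t * C t" using sin_double[of "x t / 2"] by (simp add: X_def C_def)
  then show "(Y has_real_derivative - C t * X t + \<epsilon> * u t / 2) (at t)"
    unfolding Y_def[abs_def] using dy[OF t] by (auto intro!: derivative_eq_intros simp: field_simps u_def)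
qed

lemma k_sq_deriv:
  assumes t: "t \<in> {0<..<B}"
  shows "((\<lambda>t. (k t)\<^sup>2) has_real_derivative \<epsilon> * u t * Y t) (at t)"
  unfolding k_sq using derivs(1,3)[OF t] by (auto intro!: derivative_eq_intros simp: algebra_simps)

lemma k_mono:
  assumes "0 \<le> s" "s \<le> t" "t \<le> B"
  shows "k t \<le> k s"
proof -
  have "(k t)\<^sup>2 - (k s)\<^sup>2 \<le> 0 * (t - s)"
  proof (rule increment_le[of "{}" s t "\<lambda>t. (k t)\<^sup>2" "\<lambda>t. \<epsilon> * u t * Y t" 0])
    fix r assume r: "r \<in> {s<..<t} - {}"
    show "((\<lambda>t. (k t)\<^sup>2) has_real_derivative \<epsilon> * u r * Y r) (at r)"
      by (rule k_sq_deriv) (use r assms in auto)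
    show "\<epsilon> * u r * Y r \<le> 0"
      using mult_nonneg_nonpos[of \<epsilon> "u r * Y r"] uY eps by (simp add: mult.assoc)
  qed (use assms in \<open>auto intro!: continuous_intros cont\<close>)
  then have "(k t)\<^sup>2 \<le> (k s)\<^sup>2" by simp
  then show ?thesis by (rule power2_le_imp_le[OF _ k_nonneg])
qed

lemma k_le:
  assumes t: "t \<in> {0..B}"
  shows "(k t)\<^sup>2 \<le> 1 - \<epsilon> / 2"
proof -
  have "k t \<le> k 0" using k_mono[of 0 t] t by auto
  then have "(k t)\<^sup>2 \<le> (k 0)\<^sup>2" by (rule power_mono[OF _ k_nonneg])
  also have "(k 0)\<^sup>2 = (X 0)\<^sup>2 + (Y 0)\<^sup>2" by (rule k_sq)
  also have "\<dots> \<le> 1 - \<epsilon> / 2" using k0 by (simp only: X_def Y_def)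
  finally show ?thesis .
qed

lemma k_less: "t \<in> {0..B} \<Longrightarrow> k t < 1"
proof -
  assume "t \<in> {0..B}"
  from k_le[OF this] eps have "(k t)\<^sup>2 < 1" by linarith
  then show ?thesis by (simp add: abs_square_less_1)
qed

text \<open>At |x| = \<pi> one has X^2 = 1, hence k \<ge> 1, against \<open>k_le\<close>.\<close>

lemma abs_x_less: "t \<in> {0..B} \<Longrightarrow> \<bar>x t\<bar> < pi"
proof (rule ccontr)
  assume t: "t \<in> {0..B}" and "\<not> \<bar>x t\<bar> < pi"
  then have "\<exists>s. 0 \<le> s \<and> s \<le> t \<and> \<bar>x s\<bar> = pi"
    using x0 continuous_on_subset[OF cx]
    by (intro IVT'[of "\<lambda>t. \<bar>x t\<bar>" 0 pi t]) (auto intro!: continuous_intros)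
  then obtain s where s: "0 \<le> s" "s \<le> t" "\<bar>x s\<bar> = pi" by blast
  have "(X s)\<^sup>2 = 1" using s(3) by (auto simp: X_def abs_if split: if_splits) (metis minus_minus minus_divide_left power2_minus sin_minus sin_pi_half one_power2)
  then have "1 \<le> (k s)\<^sup>2" by (simp add: k_sq)
  then show False using k_le[of s] s t eps by auto
qed

lemma C_pos: "t \<in> {0..B} \<Longrightarrow> 0 < C t"
  unfolding C_def using abs_x_less[of t] by (intro cos_gt_zero_pi) (auto simp: abs_less_iff)

lemma u_deficit: "(1 - \<bar>u t\<bar>) * \<bar>Y t\<bar> \<le> \<epsilon> / 2"
proof (cases "\<bar>2 * Y t / \<epsilon>\<bar> \<le> 1")
  case True
  then have "\<bar>Y t\<bar> \<le> \<epsilon> / 2" using eps by (simp add: abs_mult divide_simps)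
  then have "(1 - \<bar>u t\<bar>) * \<bar>Y t\<bar> \<le> 1 * (\<epsilon> / 2)" using u_le by (intro mult_mono) auto
  then show ?thesis by simp
next
  case False
  then have "\<bar>u t\<bar> = 1" by (auto simp: u_eq abs_if max_def min_def split: if_splits)
  then show ?thesis using eps by simp
qed

text \<open>Along the free motion artanh (Y / C) has derivative - X, and it is bounded by artanh k.
  Its product with X therefore compensates the large factor artanh k in the derivative of
  \<open>L1\<close>.\<close>

definition "\<beta> t = artanh (Y t / C t)"

lemma CY: "(C t)\<^sup>2 - (Y t)\<^sup>2 = 1 - (k t)\<^sup>2" using k_sq[of t] XC[of t] by linarith

lemma YC_less: assumes "t \<in> {0..B}" shows "\<bar>Y t / C t\<bar> \<le> k t" "\<bar>Y t / C t\<bar> < 1"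
proof -
  have "(Y t)\<^sup>2 \<le> (k t * C t)\<^sup>2"
  proof -
    have "(k t * C t)\<^sup>2 - (Y t)\<^sup>2 = (X t)\<^sup>2 * (1 - (k t)\<^sup>2)"
      using k_sq[of t] XC[of t] by algebra
    moreover have "0 \<le> (X t)\<^sup>2 * (1 - (k t)\<^sup>2)" using k_le[OF assms] eps by (intro mult_nonneg_nonneg) auto
    ultimately show ?thesis by linarith
  qed
  then have "\<bar>Y t\<bar>\<^sup>2 \<le> (k t * C t)\<^sup>2" by simp
  then have "\<bar>Y t\<bar> \<le> k t * C t"
    by (rule power2_le_imp_le) (intro mult_nonneg_nonneg k_nonneg less_imp_le[OF C_pos[OF assms]])
  then show "\<bar>Y t / C t\<bar> \<le> k t" using C_pos[OF assms] by (simp add: divide_simps)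
  then show "\<bar>Y t / C t\<bar> < 1" using k_less[OF assms] by simp
qed

lemma abs_\<beta>_le: assumes "t \<in> {0..B}" shows "\<bar>\<beta> t\<bar> \<le> artanh (k t)"
proof -
  have "artanh \<bar>Y t / C t\<bar> \<le> artanh (k t)"
    by (intro artanh_mono) (use YC_less[OF assms] k_less[OF assms] abs_ge_zero[of "Y t / C t"] in linarith)+
  moreover have "\<bar>artanh q\<bar> = artanh \<bar>q\<bar>" if "\<bar>q\<bar> < 1" for q :: real
    using that artanh_bounds(1)[of "\<bar>q\<bar>"] by (cases "0 \<le> q") (auto simp: artanh_minus_real)
  from this[OF YC_less(2)[OF assms]] have "\<bar>\<beta> t\<bar> = artanh \<bar>Y t / C t\<bar>" by (simp only: \<beta>_def)
  ultimately show ?thesis by (simp only:)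
qed

lemma \<beta>_deriv:
  assumes t: "t \<in> {0<..<B}"
  shows "(\<beta> has_real_derivative - X t + \<epsilon> * u t * C t / (2 * (1 - (k t)\<^sup>2))) (at t)"
proof -
  have t': "t \<in> {0..B}" using t by auto
  have C: "C t \<noteq> 0" using C_pos[OF t'] by simp
  have k: "1 - (k t)\<^sup>2 > 0" using k_le[OF t'] eps by auto
  have "((\<lambda>t. Y t / C t) has_real_derivative ((- C t * X t + \<epsilon> * u t / 2) * C t - Y t * (- X t * Y t)) / (C t * C t)) (at t)"
    by (intro DERIV_divide derivs[OF t] C)
  then have "(\<beta> has_real_derivative 1 / (1 - (Y t / C t)\<^sup>2) * (((- C t * X t + \<epsilon> * u t / 2) * C t - Y t * (- X t * Y t)) / (C t * C t))) (at t)"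
    unfolding \<beta>_def[abs_def]
    by (intro DERIV_chain2[OF artanh_real_has_field_derivative]) (use YC_less(2)[OF t'] in auto)
  also have "1 / (1 - (Y t / C t)\<^sup>2) * (((- C t * X t + \<epsilon> * u t / 2) * C t - Y t * (- X t * Y t)) / (C t * C t))
     = ((- C t * X t + \<epsilon> * u t / 2) * C t - Y t * (- X t * Y t)) / ((C t)\<^sup>2 - (Y t)\<^sup>2)"
    using C by (simp add: divide_simps power2_eq_square) 
  also have "\<dots> = (- X t * (1 - (k t)\<^sup>2) + \<epsilon> * u t * C t / 2) / (1 - (k t)\<^sup>2)"
    unfolding CY[symmetric] by (simp add: algebra_simps power2_eq_square)
  also have "\<dots> = - X t + \<epsilon> * u t * C t / (2 * (1 - (k t)\<^sup>2))" using k by (simp add: field_simps)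
  finally show ?thesis .
qed

text \<open>
  A Lyapunov function whose derivative is at most \<open>- \<epsilon> / 4\<close>; the corrections to \<open>L1\<close> compensate for
  the phases in which \<open>y\<close>, and hence the damping, is small.
\<close>

definition "\<Lambda> t = L1 (k t) + \<epsilon> * (X t * \<beta> t) + 4 * k t + \<epsilon> * (X t * Y t / (k t)\<^sup>2)"

lemma k_deriv:
  assumes t: "t \<in> {0<..<B}" and k: "0 < k t"
  shows "(k has_real_derivative \<epsilon> * u t * Y t / (2 * k t)) (at t)"
proof -
  have "((\<lambda>t. sqrt ((k t)\<^sup>2)) has_real_derivative inverse (sqrt ((k t)\<^sup>2)) / 2 * (\<epsilon> * u t * Y t)) (at t)"
    by (rule DERIV_chain2[OF DERIV_real_sqrt k_sq_deriv[OF t]]) (use k in auto)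
  then show ?thesis using k_nonneg k by (simp add: field_simps)
qed

lemma \<Lambda>_deriv:
  assumes t: "t \<in> {0<..<B}" and k: "sqrt \<epsilon> \<le> k t"
  shows "\<exists>D. (\<Lambda> has_real_derivative D) (at t) \<and> D \<le> - (\<epsilon> / 4)"
proof -
  have t': "t \<in> {0..B}" using t by auto
  have kp: "0 < k t" using k eps by (smt (verit) real_sqrt_gt_zero)
  have k1: "\<bar>k t\<bar> < 1" using k_less[OF t'] kp by simp
  note dk = k_deriv[OF t kp] and d = derivs[OF t] and db = \<beta>_deriv[OF t]
  \<comment> \<open>The derivative of the Lyapunov function divided by \<epsilon>, grouped as in
    \<open>lyapunov_bound\<close>; the four groups belong to the four summands of
    \<open>\<Lambda>\<close>.\<close>
  define G where "G = u t * Y t * artanh (k t) + (C t * Y t * \<beta> t - (X t)\<^sup>2 + \<epsilon> * u t * X t * C t / (2 * (1 - (k t)\<^sup>2))) + 2 * u t * Y t / k t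
     + (C t * ((Y t)\<^sup>2 - (X t)\<^sup>2) / (k t)\<^sup>2 + \<epsilon> * u t * X t / (2 * (k t)\<^sup>2) - X t * Y t * (\<epsilon> * u t * Y t) / k t ^ 4)"
  have d1: "((\<lambda>t. L1 (k t)) has_real_derivative 2 * k t * artanh (k t) * (\<epsilon> * u t * Y t / (2 * k t))) (at t)"
    by (rule DERIV_chain2[OF L1_deriv[OF k1] dk])
  have d2: "((\<lambda>t. X t * \<beta> t) has_real_derivative C t * Y t * \<beta> t + (- X t + \<epsilon> * u t * C t / (2 * (1 - (k t)\<^sup>2))) * X t) (at t)"
    by (rule DERIV_mult[OF d(1) db])
  have d4: "((\<lambda>t. X t * Y t / (k t)\<^sup>2) has_real_derivative
      ((C t * Y t * Y t + (- C t * X t + \<epsilon> * u t / 2) * X t) * (k t)\<^sup>2 - X t * Y t * (\<epsilon> * u t * Y t)) / ((k t)\<^sup>2 * (k t)\<^sup>2)) (at t)"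
    by (intro DERIV_divide DERIV_mult d k_sq_deriv[OF t]) (use kp in auto)
  have e1: "2 * k t * artanh (k t) * (\<epsilon> * u t * Y t / (2 * k t)) = \<epsilon> * (u t * Y t * artanh (k t))"
    using kp by simp
  have e3: "4 * (\<epsilon> * u t * Y t / (2 * k t)) = \<epsilon> * (2 * u t * Y t / k t)" by simp
  have e4: "((C t * Y t * Y t + (- C t * X t + \<epsilon> * u t / 2) * X t) * (k t)\<^sup>2 - X t * Y t * (\<epsilon> * u t * Y t)) / ((k t)\<^sup>2 * (k t)\<^sup>2)
     = C t * ((Y t)\<^sup>2 - (X t)\<^sup>2) / (k t)\<^sup>2 + \<epsilon> * u t * X t / (2 * (k t)\<^sup>2) - X t * Y t * (\<epsilon> * u t * Y t) / k t ^ 4"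
  proof -
    have gen: "(p * q - r) / (q * q) = p / q - r / (q * q)" if "q \<noteq> 0" for p q r :: real
      using that by (simp add: diff_divide_distrib)
    have k4: "k t ^ 4 = (k t)\<^sup>2 * (k t)\<^sup>2" by (simp flip: power_add)
    have eq: "(C t * Y t * Y t + (- C t * X t + \<epsilon> * u t / 2) * X t) / (k t)\<^sup>2 =
       C t * ((Y t)\<^sup>2 - (X t)\<^sup>2) / (k t)\<^sup>2 + \<epsilon> * u t * X t / (2 * (k t)\<^sup>2)"
      using kp by (simp add: field_simps power2_eq_square)
    show ?thesis unfolding k4 eq[symmetric] by (rule gen) (use kp in simp)
  qed
  have "(\<Lambda> has_real_derivative (2 * k t * artanh (k t) * (\<epsilon> * u t * Y t / (2 * k t))
      + \<epsilon> * (C t * Y t * \<beta> t + (- X t + \<epsilon> * u t * C t / (2 * (1 - (k t)\<^sup>2))) * X t)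
      + 4 * (\<epsilon> * u t * Y t / (2 * k t))
      + \<epsilon> * (((C t * Y t * Y t + (- C t * X t + \<epsilon> * u t / 2) * X t) * (k t)\<^sup>2 - X t * Y t * (\<epsilon> * u t * Y t)) / ((k t)\<^sup>2 * (k t)\<^sup>2)))) (at t)"
    unfolding \<Lambda>_def[abs_def] by (intro DERIV_add DERIV_cmult d1 d2 d4 dk)
  also have "2 * k t * artanh (k t) * (\<epsilon> * u t * Y t / (2 * k t))
      + \<epsilon> * (C t * Y t * \<beta> t + (- X t + \<epsilon> * u t * C t / (2 * (1 - (k t)\<^sup>2))) * X t)
      + 4 * (\<epsilon> * u t * Y t / (2 * k t))
      + \<epsilon> * (((C t * Y t * Y t + (- C t * X t + \<epsilon> * u t / 2) * X t) * (k t)\<^sup>2 - X t * Y t * (\<epsilon> * u t * Y t)) / ((k t)\<^sup>2 * (k t)\<^sup>2)) = \<epsilon> * G"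
    unfolding e1 e3 e4 G_def by (simp add: algebra_simps power2_eq_square)
  finally have "(\<Lambda> has_real_derivative \<epsilon> * G) (at t)" .
  moreover have "G \<le> - 1 / 4" unfolding G_def
    by (rule lyapunov_bound[OF eps C_pos[OF t'] XC k_sq k _ u_eq abs_\<beta>_le[OF t']])
      (use k_le[OF t'] artanh_bounds(2)[of "k t"] kp k1 in auto)
  then have "\<epsilon> * G \<le> \<epsilon> * (- 1 / 4)" using eps by (intro mult_left_mono) auto
  ultimately show ?thesis by auto
qed

text \<open>\<open>\<Lambda>\<close> differs from L1 (k) + 4 k by at most 7 / 2 sqrt \<epsilon>,
  because the margin below the separatrix gives artanh k \<le> 3 / sqrt \<epsilon>; the two ends
  make 7. The constant 1 / 4 is not sharp, so the bound serves for short layers of k and for an a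
  priori bound on the time.\<close>

lemma crude_time_bound:
  assumes st: "0 \<le> s" "s \<le> t" "t \<le> B" and k: "sqrt \<epsilon> \<le> k t"
  shows "\<epsilon> / 4 * (t - s) \<le> L1 (k s) - L1 (k t) + 4 * (k s - k t) + 7 * sqrt \<epsilon>"
proof -
  have kr: "sqrt \<epsilon> \<le> k r" if "r \<in> {s..t}" for r using k_mono[of r t] that st k by auto
  have kp: "0 < k r" if "r \<in> {s..t}" for r using kr[OF that] eps by (smt (verit) real_sqrt_gt_zero)
  have rB: "r \<in> {0..B}" if "r \<in> {s..t}" for r using that st by auto
  have c\<beta>: "continuous_on {s..t} \<beta>" unfolding \<beta>_def[abs_def]
  proof (rule continuous_on_compose2[of "{-1<..<1}" artanh])
    show "continuous_on {-1<..<1} (artanh :: real \<Rightarrow> real)"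
      by (intro continuous_at_imp_continuous_on) (auto intro!: DERIV_isCont[OF artanh_real_has_field_derivative])
    have "\<forall>r\<in>{s..t}. C r \<noteq> 0"
    proof
      fix r assume "r \<in> {s..t}"
      from C_pos[OF rB[OF this]] show "C r \<noteq> 0" by simp
    qed
    then show "continuous_on {s..t} (\<lambda>t. Y t / C t)" by (intro continuous_intros cont)
    show "(\<lambda>t. Y t / C t) ` {s..t} \<subseteq> {-1<..<1}"
    proof (rule image_subsetI)
      fix r assume "r \<in> {s..t}"
      from YC_less(2)[OF rB[OF this]] show "Y r / C r \<in> {-1<..<1}"
        unfolding greaterThanLessThan_iff by linarith
    qed
  qed
  have cL: "continuous_on {s..t} (\<lambda>t. L1 (k t))"
  proof (rule continuous_on_compose2[of "{-1<..<1}" L1])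
    show "continuous_on {-1<..<1} L1"
      by (intro continuous_at_imp_continuous_on) (auto intro!: DERIV_isCont[OF L1_deriv])
    show "k ` {s..t} \<subseteq> {-1<..<1}"
    proof (rule image_subsetI)
      fix r assume "r \<in> {s..t}"
      from kp[OF this] k_less[OF rB[OF this]] show "k r \<in> {-1<..<1}"
        unfolding greaterThanLessThan_iff by linarith
    qed
  qed (rule cont)
  have "\<forall>r\<in>{s..t}. (k r)\<^sup>2 \<noteq> 0"
  proof
    fix r assume "r \<in> {s..t}"
    from kp[OF this] show "(k r)\<^sup>2 \<noteq> 0" by simp
  qed
  then have c\<Lambda>: "continuous_on {s..t} \<Lambda>" unfolding \<Lambda>_def[abs_def]
    by (intro continuous_intros cont c\<beta> cL)
  define D where "D r = (SOME D. (\<Lambda> has_real_derivative D) (at r) \<and> D \<le> - (\<epsilon> / 4))" for r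
  have D: "(\<Lambda> has_real_derivative D r) (at r) \<and> D r \<le> - (\<epsilon> / 4)" if "r \<in> {s<..<t}" for r
    unfolding D_def by (rule someI_ex, rule \<Lambda>_deriv) (use that st kr in auto)
  have "\<Lambda> t - \<Lambda> s \<le> - (\<epsilon> / 4) * (t - s)"
    by (rule increment_le[of "{}", OF _ st(2) c\<Lambda>]) (use D in auto)
  moreover have "\<bar>\<Lambda> r - (L1 (k r) + 4 * k r)\<bar> \<le> 7 / 2 * sqrt \<epsilon>" if r: "r \<in> {s..t}" for r
  proof -
    have q: "sqrt \<epsilon> * sqrt \<epsilon> = \<epsilon>" "0 < sqrt \<epsilon>" using eps by auto
    have "2 / 3 * sqrt \<epsilon> \<le> sqrt (1 - (k r)\<^sup>2)"
      using k_le[OF rB[OF r]] eps by (intro real_le_rsqrt) (simp add: power_mult_distrib power2_eq_square)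
    moreover have "(k r)\<^sup>2 < 1" using k_le[OF rB[OF r]] eps by linarith
    ultimately have "2 / sqrt (1 - (k r)\<^sup>2) \<le> 2 / (2 / 3 * sqrt \<epsilon>)"
      using q by (intro divide_left_mono) (auto intro!: mult_pos_pos)
    then have "artanh (k r) \<le> 3 / sqrt \<epsilon>"
      using artanh_bounds(2)[of "k r"] k_nonneg[of r] k_less[OF rB[OF r]] by simp
    then have b: "\<bar>\<beta> r\<bar> \<le> 3 / sqrt \<epsilon>" using abs_\<beta>_le[OF rB[OF r]] by linarith
    have X1: "\<bar>X r\<bar> \<le> 1" by (simp add: X_def)
    have m: "\<bar>X r\<bar> * \<bar>\<beta> r\<bar> \<le> 1 * (3 / sqrt \<epsilon>)" using X1 b by (intro mult_mono) auto
    have "\<bar>\<epsilon> * (X r * \<beta> r)\<bar> = \<epsilon> * (\<bar>X r\<bar> * \<bar>\<beta> r\<bar>)" using eps by (simp add: abs_mult)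
    also have "\<dots> \<le> \<epsilon> * (1 * (3 / sqrt \<epsilon>))" by (rule mult_left_mono[OF m]) (use eps in simp)
    also have "\<dots> = 3 * sqrt \<epsilon>" using q by (simp add: field_simps)
    finally have 1: "\<bar>\<epsilon> * (X r * \<beta> r)\<bar> \<le> 3 * sqrt \<epsilon>" .
    have "2 * \<bar>X r * Y r\<bar> \<le> (k r)\<^sup>2"
      using sum_squares_bound[of "\<bar>X r\<bar>" "\<bar>Y r\<bar>"] by (simp add: k_sq abs_mult)
    then have "\<bar>X r * Y r / (k r)\<^sup>2\<bar> \<le> 1 / 2" using kp[OF r] by (simp add: divide_simps)
    then have "\<bar>\<epsilon> * (X r * Y r / (k r)\<^sup>2)\<bar> \<le> \<epsilon> * (1 / 2)"
      using eps unfolding abs_mult by (intro mult_mono) auto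
    moreover have "\<epsilon> \<le> sqrt \<epsilon>"
    proof -
      have "sqrt \<epsilon> \<le> sqrt 1" using eps by (intro real_sqrt_le_mono) auto
      then show ?thesis using q mult_right_mono[of "sqrt \<epsilon>" 1 "sqrt \<epsilon>"] by simp
    qed
    ultimately have 2: "\<bar>\<epsilon> * (X r * Y r / (k r)\<^sup>2)\<bar> \<le> sqrt \<epsilon> / 2" by linarith
    have "\<Lambda> r - (L1 (k r) + 4 * k r) = \<epsilon> * (X r * \<beta> r) + \<epsilon> * (X r * Y r / (k r)\<^sup>2)" by (simp add: \<Lambda>_def)
    also have "\<bar>\<dots>\<bar> \<le> 3 * sqrt \<epsilon> + sqrt \<epsilon> / 2"
      by (rule order_trans[OF abs_triangle_ineq add_mono[OF 1 2]])
    finally show ?thesis by simp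
  qed
  from this[of s] this[of t] have "\<bar>\<Lambda> s - (L1 (k s) + 4 * k s)\<bar> \<le> 7 / 2 * sqrt \<epsilon>" "\<bar>\<Lambda> t - (L1 (k t) + 4 * k t)\<bar> \<le> 7 / 2 * sqrt \<epsilon>"
    using st by auto
  moreover have "q \<le> ls - lt + 4 * (ks - kt) + 7 * r"
    if "l' - l \<le> - (\<epsilon> / 4) * (t - s)" "\<bar>l - (ls + 4 * ks)\<bar> \<le> 7 / 2 * r" "\<bar>l' - (lt + 4 * kt)\<bar> \<le> 7 / 2 * r"
      "q = \<epsilon> / 4 * (t - s)" for l l' ls lt ks kt q r
  proof -
    have "l' - l \<le> - q" using that by simp
    moreover have "l - (ls + 4 * ks) \<le> 7 / 2 * r" "- (l' - (lt + 4 * kt)) \<le> 7 / 2 * r"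
      using that(2,3) abs_ge_self abs_ge_minus_self order_trans by blast+
    ultimately show ?thesis by argo
  qed
  ultimately show ?thesis by blast
qed

end

text \<open>For full damping the averaged drift is exactly - \<epsilon>; saturation changes it by
  O(\<epsilon>^2). The crude bound first gives \<epsilon> (t - s) \<le> 24, which turns every error
  \<epsilon>^2 (t - s) into O(\<epsilon>).\<close>

lemma damped_time_bound:
  assumes \<delta>: "0 < \<delta>" "\<delta> < 1 / 2"
  obtains K where "0 \<le> K"
    "\<And>\<epsilon> B x y s t. \<lbrakk>damped \<epsilon> B x y; \<epsilon> < \<delta>\<^sup>2; 0 \<le> s; s \<le> t; t \<le> B;
       \<delta> \<le> damped.k x y t; damped.k x y s \<le> 1 - \<delta>\<rbrakk> \<Longrightarrow>
      \<epsilon> * (t - s) \<le> energy_potential 1 0 \<delta> (damped.k x y s) - energy_potential 1 0 \<delta> (damped.k x y t) + K * \<epsilon>"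
proof -
  obtain K where K0: "0 \<le> K" and K: "\<And>\<epsilon> t0 t1 \<kappa> \<theta> u S c. \<lbrakk>0 < \<epsilon>; t0 \<le> t1; finite S; continuous_on {t0..t1} \<kappa>; continuous_on {t0..t1} \<theta>;
       \<And>t. t \<in> {t0..t1} \<Longrightarrow> \<kappa> t \<in> {\<delta>..1 - \<delta>} \<and> 0 < \<theta> t;
       \<And>t. t \<in> {t0<..<t1} - S \<Longrightarrow> \<bar>u t\<bar> \<le> 1 \<and>
          (\<kappa> has_real_derivative \<epsilon> * u t * cos (\<theta> t) / 2) (at t) \<and>
          (\<theta> has_real_derivative sqrt (1 - (\<kappa> t)\<^sup>2 * (sin (\<theta> t))\<^sup>2) - \<epsilon> * u t * sin (\<theta> t) / (2 * \<kappa> t)) (at t)\<rbrakk>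
     \<Longrightarrow> ((\<forall>t\<in>{t0<..<t1} - S. c \<le> energy_weight 1 0 (\<kappa> t) * (u t * cos (\<theta> t) + \<bar>cos (\<theta> t)\<bar>) / 2) \<longrightarrow>
           \<epsilon> * (c - 1) * (t1 - t0) - K * \<epsilon>\<^sup>2 * (t1 - t0) - K * \<epsilon> \<le>
           energy_potential 1 0 \<delta> (\<kappa> t1) - energy_potential 1 0 \<delta> (\<kappa> t0) - \<epsilon> * 0 * (\<theta> t1 - \<theta> t0)) \<and>
         ((\<forall>t\<in>{t0<..<t1} - S. energy_weight 1 0 (\<kappa> t) * (u t * cos (\<theta> t) + \<bar>cos (\<theta> t)\<bar>) / 2 \<le> c) \<longrightarrow>
           energy_potential 1 0 \<delta> (\<kappa> t1) - energy_potential 1 0 \<delta> (\<kappa> t0) - \<epsilon> * 0 * (\<theta> t1 - \<theta> t0) \<le>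
           \<epsilon> * (c - 1) * (t1 - t0) + K * \<epsilon>\<^sup>2 * (t1 - t0) + K * \<epsilon>)"
    using averaging[OF \<delta>, of 1 0] by blast
  obtain W where W: "\<And>k. k \<in> {\<delta>..1 - \<delta>} \<Longrightarrow> energy_weight 1 0 k \<le> W"
  proof -
    have "continuous_on {\<delta>..1 - \<delta>} (energy_weight 1 0)"
      by (rule continuous_on_subset[OF continuous_energy_weight]) (use \<delta> in auto)
    from continuous_attains_sup[OF compact_Icc _ this] \<delta> obtain m where
      "\<forall>k\<in>{\<delta>..1 - \<delta>}. energy_weight 1 0 k \<le> energy_weight 1 0 m" by auto
    then show ?thesis by (intro that[of "energy_weight 1 0 m"]) auto
  qed
  have W0: "0 \<le> W" using W[of \<delta>] energy_weight_nonneg[of \<delta> 1 0] \<delta> by auto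
  define K' where "K' = K + 24 * (W / (4 * \<delta>) + K)"
  have K'0: "0 \<le> K'" using K0 W0 \<delta> by (auto simp: K'_def)
  show thesis
  proof (rule that[OF K'0])
    fix \<epsilon> B x y s t
    assume D: "damped \<epsilon> B x y" and small: "\<epsilon> < \<delta>\<^sup>2" and st: "0 \<le> s" "s \<le> t" "t \<le> B"
      and kt: "\<delta> \<le> damped.k x y t" and ks: "damped.k x y s \<le> 1 - \<delta>"
    interpret damped \<epsilon> B x y by (rule D)
    have sq: "sqrt \<epsilon> \<le> \<delta>" using small \<delta> eps by (intro real_le_lsqrt) auto
    have sq12: "sqrt \<epsilon> \<le> 1 / 12" using eps by (intro real_le_lsqrt) (auto simp: power2_eq_square)
    have rB: "r \<in> {0..B}" if "r \<in> {s..t}" for r using that st by auto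
    have kr: "k r \<in> {\<delta>..1 - \<delta>}" if "r \<in> {s..t}" for r
      using k_mono[of s r] k_mono[of r t] that st kt ks by auto
    have kp: "0 < k r" if "r \<in> {s..t}" for r using kr[OF that] \<delta> by auto
    have time: "\<epsilon> * (t - s) \<le> 24"
    proof -
      have "\<epsilon> / 4 * (t - s) \<le> L1 (k s) - L1 (k t) + 4 * (k s - k t) + 7 * sqrt \<epsilon>"
        by (rule crude_time_bound) (use st sq kt in auto)
      moreover have "L1 (k s) \<le> 1" "0 \<le> L1 (k t)" "k s \<le> 1" "0 \<le> k t"
        using L1_bounds(2)[of "k s"] L1_bounds(1)[of "k t"] k_less[of s] k_less[of t] k_nonneg[of s] k_nonneg[of t] st by auto
      ultimately have "\<epsilon> / 4 * (t - s) \<le> 6" using sq12 by argo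
      then show ?thesis by simp
    qed
    have cxy: "continuous_on {s..t} x" "continuous_on {s..t} y" using cx cy continuous_on_subset by blast+
    obtain \<kappa> \<theta> where p: "continuous_on {s..t} \<kappa>" "continuous_on {s..t} \<theta>"
      "\<And>r. r \<in> {s..t} \<Longrightarrow> 0 < \<theta> r"
      "\<And>r. \<kappa> r = sqrt ((sin (x r / 2))\<^sup>2 + (y r / 2)\<^sup>2)"
      "\<And>r. r \<in> {s..t} \<Longrightarrow> sin (x r / 2) = \<kappa> r * sin (\<theta> r) \<and> y r / 2 = \<kappa> r * cos (\<theta> r)"
      "\<And>r. r \<in> {s<..<t} - {} \<Longrightarrow>
         (\<kappa> has_real_derivative \<epsilon> * u r * cos (\<theta> r) / 2) (at r) \<and>
         (\<theta> has_real_derivative sqrt (1 - (\<kappa> r)\<^sup>2 * (sin (\<theta> r))\<^sup>2) - \<epsilon> * u r * sin (\<theta> r) / (2 * \<kappa> r)) (at r)"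
    proof (rule polar_lift[OF st(2) cxy, of "{}" \<epsilon> u])
      show "0 < cos (x r / 2)" if "r \<in> {s..t}" for r using C_pos[OF rB[OF that]] by (simp add: C_def)
      show "0 < (sin (x r / 2))\<^sup>2 + (y r / 2)\<^sup>2" if "r \<in> {s..t}" for r
      proof -
        have "0 < (k r)\<^sup>2" using kp[OF that] by simp
        then show ?thesis by (simp only: k_sq X_def Y_def)
      qed
      show "(x has_real_derivative y r) (at r) \<and> (y has_real_derivative - sin (x r) + \<epsilon> * u r) (at r)"
        if "r \<in> {s<..<t} - {}" for r
        using dx[of r] dy[of r] that st by (auto simp: u_def)
    qed (rule that)
    have \<kappa>k: "\<kappa> r = k r" for r by (simp add: p(4) k_def X_def Y_def)
    \<comment> \<open>Multiplied by k, the bracket is (1 - |u|) |Y|, at most \<epsilon> / 2 by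
      \<open>u_deficit\<close>; then k \<ge> \<delta>.\<close>
    have w: "energy_weight 1 0 (\<kappa> r) * (u r * cos (\<theta> r) + \<bar>cos (\<theta> r)\<bar>) / 2 \<le> W * \<epsilon> / (4 * \<delta>)"
      if r: "r \<in> {s<..<t} - {}" for r
    proof -
      have r': "r \<in> {s..t}" using r by auto
      have Y: "Y r = k r * cos (\<theta> r)" using p(5)[OF r'] by (simp add: Y_def \<kappa>k)
      have "k r * (u r * cos (\<theta> r) + \<bar>cos (\<theta> r)\<bar>) = u r * Y r + \<bar>Y r\<bar>"
        using kp[OF r'] by (simp add: Y abs_mult algebra_simps)
      also have "u r * Y r = - (\<bar>u r\<bar> * \<bar>Y r\<bar>)" using uY[of r] by (simp flip: abs_mult)
      also have "- (\<bar>u r\<bar> * \<bar>Y r\<bar>) + \<bar>Y r\<bar> = (1 - \<bar>u r\<bar>) * \<bar>Y r\<bar>" by (simp add: algebra_simps)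
      also have "\<dots> \<le> \<epsilon> / 2" by (rule u_deficit)
      finally have "u r * cos (\<theta> r) + \<bar>cos (\<theta> r)\<bar> \<le> \<epsilon> / 2 / k r" using kp[OF r'] by (simp add: field_simps)
      also have "\<dots> \<le> \<epsilon> / 2 / \<delta>" using kr[OF r'] \<delta> eps by (intro divide_left_mono) auto
      finally have le: "u r * cos (\<theta> r) + \<bar>cos (\<theta> r)\<bar> \<le> \<epsilon> / 2 / \<delta>" .
      have w0: "0 \<le> energy_weight 1 0 (\<kappa> r)" unfolding \<kappa>k using kr[OF r'] \<delta> by (intro energy_weight_nonneg) auto
      have "energy_weight 1 0 (\<kappa> r) * (u r * cos (\<theta> r) + \<bar>cos (\<theta> r)\<bar>) \<le> energy_weight 1 0 (\<kappa> r) * (\<epsilon> / 2 / \<delta>)"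
        by (rule mult_left_mono[OF le w0])
      also have "\<dots> \<le> W * (\<epsilon> / 2 / \<delta>)" using W[OF kr[OF r']] eps \<delta> by (intro mult_right_mono) (auto simp: \<kappa>k)
      finally show ?thesis by simp
    qed
    have "energy_potential 1 0 \<delta> (\<kappa> t) - energy_potential 1 0 \<delta> (\<kappa> s) - \<epsilon> * 0 * (\<theta> t - \<theta> s) \<le>
           \<epsilon> * (W * \<epsilon> / (4 * \<delta>) - 1) * (t - s) + K * \<epsilon>\<^sup>2 * (t - s) + K * \<epsilon>"
      using K[of \<epsilon> s t "{}" \<kappa> \<theta> u "W * \<epsilon> / (4 * \<delta>)"] eps st p kr u_le w by (auto simp: \<kappa>k)
    then have "\<epsilon> * (t - s) \<le> energy_potential 1 0 \<delta> (k s) - energy_potential 1 0 \<delta> (k t) + K * \<epsilon>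
       + \<epsilon> * ((W / (4 * \<delta>) + K) * (\<epsilon> * (t - s)))"
      by (simp add: \<kappa>k algebra_simps power2_eq_square)
    also have "\<epsilon> * ((W / (4 * \<delta>) + K) * (\<epsilon> * (t - s))) \<le> \<epsilon> * ((W / (4 * \<delta>) + K) * 24)"
      using time eps W0 K0 \<delta> by (intro mult_left_mono) auto
    finally show "\<epsilon> * (t - s) \<le> energy_potential 1 0 \<delta> (k s) - energy_potential 1 0 \<delta> (k t) + K' * \<epsilon>"
      by (simp add: K'_def algebra_simps)
  qed
qed

lemma arcsin_le_double:
  fixes z :: real assumes "0 \<le> z" "z \<le> 1 / 2" shows "arcsin z \<le> 2 * z"
proof -
  have "arcsin z - arcsin 0 \<le> 2 * (z - 0)"
  proof (rule increment_le[of "{}" 0 z arcsin "\<lambda>z. inverse (sqrt (1 - z\<^sup>2))"])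
    show "continuous_on {0..z} arcsin" using assms by (intro continuous_intros) auto
    show "(arcsin has_real_derivative inverse (sqrt (1 - t\<^sup>2))) (at t)" if "t \<in> {0<..<z} - {}" for t
      using that assms by (intro DERIV_arcsin) auto
    show "inverse (sqrt (1 - t\<^sup>2)) \<le> 2" if "t \<in> {0<..<z} - {}" for t
    proof -
      have "t\<^sup>2 \<le> (1 / 2)\<^sup>2" using that assms by (intro power_mono) auto
      then have "1 / 2 \<le> sqrt (1 - t\<^sup>2)" by (intro real_le_rsqrt) (auto simp: power2_eq_square)
      then show ?thesis using le_imp_inverse_le[of "1 / 2" "sqrt (1 - t\<^sup>2)"] by simp
    qed
  qed (use assms in auto)
  then show ?thesis by simp
qed

text \<open>Projects a modulus to the range in which the potential is evaluated; what is cut off is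
  paid for by the \<delta>-terms of the time bounds.\<close>

definition clamp_modulus :: "real \<Rightarrow> real \<Rightarrow> real" where
  "clamp_modulus \<delta> k = max \<delta> (min k (1 - \<delta>))"

text \<open>The budget: the crude bound from k(0) down to 1 - \<delta> costs 8 sqrt (2 \<delta>) +
  20 \<delta>, the averaged bound down to \<delta> costs the potential difference, the crude bound
  from \<delta> to sqrt \<epsilon> costs 20 \<delta>, and the capture O(sqrt \<epsilon>). Each crude
  stage adds 28 sqrt \<epsilon>.\<close>

lemma damped_steering:
  assumes \<delta>: "0 < \<delta>" "\<delta> < 1 / 2"
  obtains K \<epsilon>1 where "0 \<le> K" "0 < \<epsilon>1"
    "\<And>\<epsilon> x0 y0. \<lbrakk>0 < \<epsilon>; \<epsilon> < \<epsilon>1; \<bar>x0\<bar> < pi; (sin (x0 / 2))\<^sup>2 + (y0 / 2)\<^sup>2 \<le> 1 - \<epsilon> / 2\<rbrakk> \<Longrightarrow>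
      \<exists>T u x y. pw_trajectory \<epsilon> T u x y \<and> x 0 = x0 \<and> y 0 = y0 \<and> x T = 0 \<and> y T = 0 \<and>
        \<epsilon> * T \<le> energy_potential 1 0 \<delta> (clamp_modulus \<delta> (sqrt ((sin (x0 / 2))\<^sup>2 + (y0 / 2)\<^sup>2)))
          - energy_potential 1 0 \<delta> \<delta> + 8 * sqrt (2 * \<delta>) + 40 * \<delta> + K * sqrt \<epsilon>"
proof -
  obtain K where K0: "0 \<le> K" and K: "\<And>\<epsilon> B x y s t. \<lbrakk>damped \<epsilon> B x y; \<epsilon> < \<delta>\<^sup>2; 0 \<le> s; s \<le> t; t \<le> B;
       \<delta> \<le> damped.k x y t; damped.k x y s \<le> 1 - \<delta>\<rbrakk> \<Longrightarrow>
      \<epsilon> * (t - s) \<le> energy_potential 1 0 \<delta> (damped.k x y s) - energy_potential 1 0 \<delta> (damped.k x y t) + K * \<epsilon>"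
    using damped_time_bound[OF \<delta>] by blast
  define \<epsilon>1 where "\<epsilon>1 = min (\<delta>\<^sup>2) ((1 / 50)\<^sup>2)"
  have e1: "0 < \<epsilon>1" using \<delta> by (simp add: \<epsilon>1_def)
  show thesis
  proof (rule that[of "K + 150" \<epsilon>1])
    fix \<epsilon> x0 y0 :: real
    assume \<epsilon>: "0 < \<epsilon>" "\<epsilon> < \<epsilon>1" and x0: "\<bar>x0\<bar> < pi" and k0: "(sin (x0 / 2))\<^sup>2 + (y0 / 2)\<^sup>2 \<le> 1 - \<epsilon> / 2"
    define r where "r = sqrt \<epsilon>"
    have r: "0 < r" "r * r = \<epsilon>" "r < \<delta>" "r < 1 / 50"
    proof -
      have "\<epsilon> < \<delta>\<^sup>2" "\<epsilon> < (1 / 50)\<^sup>2" using \<epsilon> by (auto simp: \<epsilon>1_def)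
      then have "sqrt \<epsilon> < sqrt (\<delta>\<^sup>2)" "sqrt \<epsilon> < sqrt ((1 / 50)\<^sup>2)" by (simp_all only: real_sqrt_less_iff)
      then show "r < \<delta>" "r < 1 / 50" using \<delta> by (simp_all add: r_def)
    qed (use \<epsilon> in \<open>auto simp: r_def\<close>)
    have er: "\<epsilon> \<le> r" using r mult_right_mono[of r 1 r] by simp
    have eps: "144 * \<epsilon> \<le> 1" using \<epsilon> by (simp add: \<epsilon>1_def power2_eq_square)
    have e\<delta>: "\<epsilon> < \<delta>\<^sup>2" using \<epsilon> by (simp add: \<epsilon>1_def)
    \<comment> \<open>Longer than the damping can last: if k stayed above sqrt \<epsilon> up to
      \<open>B\<close>, the crude bound would give 25 / 4 \<le> 1 + 4 + 7 / 50.\<close>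
    define B where "B = 25 / \<epsilon>"
    have B: "0 < B" using \<epsilon> by (simp add: B_def)
    have lip: "\<bar>- max (- 1) (min 1 (b / \<epsilon>)) - - max (- 1) (min 1 (b' / \<epsilon>))\<bar> \<le> 1 / \<epsilon> * (\<bar>a - a'\<bar> + \<bar>b - b'\<bar>)" for a b a' b' :: real
    proof -
      have "\<bar>- max (-1) (min 1 p) - - max (-1) (min 1 q)\<bar> \<le> \<bar>p - q\<bar>" for p q :: real
        by (auto simp: max_def min_def)
      from this[of "b / \<epsilon>" "b' / \<epsilon>"]
      have "\<bar>- max (- 1) (min 1 (b / \<epsilon>)) - - max (- 1) (min 1 (b' / \<epsilon>))\<bar> \<le> \<bar>b / \<epsilon> - b' / \<epsilon>\<bar>" .
      also have "\<dots> = 1 / \<epsilon> * \<bar>b - b'\<bar>" using \<epsilon> by (simp add: diff_divide_distrib[symmetric])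
      also have "\<dots> \<le> 1 / \<epsilon> * (\<bar>a - a'\<bar> + \<bar>b - b'\<bar>)" using \<epsilon> by (intro mult_left_mono) auto
      finally show ?thesis .
    qed
    have bd: "\<bar>- max (- 1) (min 1 (b / \<epsilon>))\<bar> \<le> 1" for b by (auto simp: max_def min_def)
    obtain x y where
      cx: "continuous_on UNIV x" and cy: "continuous_on UNIV y" and xy0: "x 0 = x0" "y 0 = y0" and
      d: "\<And>t. t \<in> {0<..<B} \<Longrightarrow> (x has_real_derivative y t) (at t)"
      "\<And>t. t \<in> {0<..<B} \<Longrightarrow> (y has_real_derivative - sin (x t) + \<epsilon> * (- max (-1) (min 1 (y t / \<epsilon>)))) (at t)" and
      pw: "pw_trajectory \<epsilon> B (\<lambda>t. - max (-1) (min 1 (y t / \<epsilon>))) x y"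
      by (rule feedback_trajectory[of \<epsilon> B "1 / \<epsilon>" "\<lambda>a b. - max (-1) (min 1 (b / \<epsilon>))" x0 y0,
            OF \<epsilon>(1) less_imp_le[OF B] _ bd lip]) (use \<epsilon> in simp, rule that)
    interpret damped \<epsilon> B x y
      by unfold_locales (use \<epsilon> eps cx cy d x0 k0 xy0 in auto)
    have k0_eq: "k 0 = sqrt ((sin (x0 / 2))\<^sup>2 + (y0 / 2)\<^sup>2)" by (simp add: k_def X_def Y_def xy0)
    define cl where "cl = clamp_modulus \<delta> (k 0)"
    have k01: "k 0 < 1" using k_less[of 0] B by simp
    define E where "E = energy_potential 1 0 \<delta>"
    have ecl: "0 \<le> E cl - E \<delta>"
    proof -
      have cl: "\<delta> \<le> cl" "cl < 1" using \<delta> k01 by (auto simp: cl_def clamp_modulus_def)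
      have "0 * (cl - \<delta>) \<le> E cl - E \<delta>"
      proof (rule increment_ge[of "{}" \<delta> cl E "energy_weight 1 0"])
        show "continuous_on {\<delta>..cl} E" unfolding E_def
          by (intro continuous_at_imp_continuous_on) (use \<delta> cl in \<open>auto intro!: DERIV_isCont[OF energy_potential_has_derivative]\<close>)
        show "(E has_real_derivative energy_weight 1 0 t) (at t)" if "t \<in> {\<delta><..<cl} - {}" for t
          unfolding E_def using that \<delta> cl by (intro energy_potential_has_derivative) auto
        show "0 \<le> energy_weight 1 0 t" if "t \<in> {\<delta><..<cl} - {}" for t
          using that \<delta> cl by (intro energy_weight_nonneg) auto
      qed (use cl in auto)
      then show ?thesis by simp
    qed
    have L1k: "0 \<le> L1 (k s)" "L1 (k s) \<le> k s" "k s < 1" "0 \<le> k s" if "s \<in> {0..B}" for s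
      using L1_bounds[of "k s"] k_less[OF that] k_nonneg by auto
    have hit: "\<exists>s. a \<le> s \<and> s \<le> b \<and> k s = c" if "k b \<le> c" "c \<le> k a" "a \<le> b" for a b c
      using IVT2'[of k b c a] that cont(4) by auto
    obtain t0 where t0: "0 \<le> t0" "t0 \<le> B" "k t0 \<le> r" and
      t0E: "\<epsilon> * t0 \<le> E cl - E \<delta> + 8 * sqrt (2 * \<delta>) + 40 * \<delta> + (56 + K) * r"
    proof (cases "k 0 \<le> r")
      case True
      show ?thesis
        by (rule that[of 0]) (use True B ecl \<delta> r K0 in auto)
    next
      case False
      have "\<not> r < k B"
      proof
        assume k: "r < k B"
        have "\<epsilon> / 4 * (B - 0) \<le> L1 (k 0) - L1 (k B) + 4 * (k 0 - k B) + 7 * sqrt \<epsilon>"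
          by (rule crude_time_bound) (use B k in \<open>auto simp: r_def\<close>)
        then have "\<epsilon> / 4 * B \<le> L1 (k 0) - L1 (k B) + 4 * (k 0 - k B) + 7 * r" by (simp add: r_def)
        moreover have "L1 (k 0) \<le> 1" "0 \<le> L1 (k B)" "k 0 \<le> 1" "0 \<le> k B"
          using L1k[of 0] L1k[of B] B by auto
        ultimately have "\<epsilon> / 4 * B \<le> 1 + 4 + 7 * (1 / 50)" using r(4) by argo
        moreover have "\<epsilon> / 4 * B = 25 / 4" using \<epsilon> by (simp add: B_def)
        ultimately have "25 / 4 \<le> 1 + 4 + 7 * (1 / 50 :: real)" by (simp only:)
        then show False by simp
      qed
      then obtain t0 where t0: "0 \<le> t0" "t0 \<le> B" "k t0 = r" using hit[of B r 0] False B by auto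
      obtain a where a: "0 \<le> a" "a \<le> t0" "k a \<le> 1 - \<delta>" "\<epsilon> * a \<le> 8 * sqrt (2 * \<delta>) + 20 * \<delta> + 28 * r" "k a = min (k 0) (1 - \<delta>)"
      proof (cases "k 0 \<le> 1 - \<delta>")
        case True
        then show ?thesis using t0 \<delta> r by (intro that[of 0]) auto
      next
        case False
        then obtain a where a: "0 \<le> a" "a \<le> t0" "k a = 1 - \<delta>" using hit[of t0 "1 - \<delta>" 0] t0 r \<delta> by auto
        have "\<epsilon> / 4 * (a - 0) \<le> L1 (k 0) - L1 (k a) + 4 * (k 0 - k a) + 7 * sqrt \<epsilon>"
          by (rule crude_time_bound) (use a t0 r \<delta> in \<open>auto simp: r_def[symmetric]\<close>)
        moreover have "L1 (k 0) \<le> 1" "k 0 \<le> 1" using L1k[of 0] B by auto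
        moreover have "1 - 2 * sqrt (2 * \<delta>) - \<delta> \<le> L1 (1 - \<delta>)"
        proof -
          have "sqrt (1 - (1 - \<delta>)\<^sup>2) \<le> sqrt (2 * \<delta>)" by (intro real_sqrt_le_mono) (simp add: power2_eq_square algebra_simps)
          moreover have "1 - 2 * sqrt (1 - (1 - \<delta>)\<^sup>2) - (1 - (1 - \<delta>)) \<le> L1 (1 - \<delta>)"
            by (rule L1_bounds(3)) (use \<delta> in auto)
          ultimately show ?thesis by argo
        qed
        ultimately have "\<epsilon> / 4 * a \<le> 2 * sqrt (2 * \<delta>) + 5 * \<delta> + 7 * r"
          unfolding a(3) r_def[symmetric] by (simp add: algebra_simps)
        then have "\<epsilon> * a \<le> 8 * sqrt (2 * \<delta>) + 20 * \<delta> + 28 * r" by simp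
        then show ?thesis using a False by (intro that[of a]) auto
      qed
      obtain b where b: "a \<le> b" "b \<le> t0" "k b \<le> \<delta>" "\<epsilon> * (b - a) \<le> E cl - E \<delta> + K * \<epsilon>"
      proof (cases "k a \<le> \<delta>")
        case True
        then show ?thesis using a ecl K0 \<epsilon> by (intro that[of a]) auto
      next
        case False
        have "\<exists>s. a \<le> s \<and> s \<le> t0 \<and> k s = \<delta>" by (rule hit) (use False a(2) t0 r in linarith)+
        then obtain b where b: "a \<le> b" "b \<le> t0" "k b = \<delta>" by blast
        have "\<epsilon> * (b - a) \<le> E (k a) - E (k b) + K * \<epsilon>"
          unfolding E_def by (rule K[OF damped_axioms e\<delta>]) (use a b t0 in auto)
        moreover have "k a = cl" using False a(5) by (auto simp: cl_def clamp_modulus_def)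
        ultimately show ?thesis using b by (intro that[of b]) auto
      qed
      have "\<epsilon> / 4 * (t0 - b) \<le> L1 (k b) - L1 (k t0) + 4 * (k b - k t0) + 7 * sqrt \<epsilon>"
        by (rule crude_time_bound) (use a b t0 in \<open>auto simp: r_def\<close>)
      moreover have "L1 (k b) \<le> \<delta>" "0 \<le> L1 (k t0)" "0 \<le> k t0" using L1k[of b] L1k[of t0] a b t0 by auto
      ultimately have "\<epsilon> / 4 * (t0 - b) \<le> \<delta> + 4 * \<delta> + 7 * r" using b(3) unfolding r_def[symmetric] by argo
      then have "\<epsilon> * (t0 - b) \<le> 20 * \<delta> + 28 * r" by simp
      moreover have "\<epsilon> * t0 = \<epsilon> * a + \<epsilon> * (b - a) + \<epsilon> * (t0 - b)" by (simp add: algebra_simps)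
      moreover have "K * \<epsilon> \<le> K * r" using K0 er by (intro mult_left_mono) auto
      ultimately have "\<epsilon> * t0 \<le> E cl - E \<delta> + 8 * sqrt (2 * \<delta>) + 40 * \<delta> + (56 + K) * r"
        using a(4) b(4) unfolding distrib_right by argo
      then show ?thesis using t0 by (intro that[of t0]) simp_all
    qed
    \<comment> \<open>At \<open>t0\<close> one has |x| \<le> 4 r and |y| \<le> 2 r, and 16 + 4 \<le>
      25. The restriction r < 1 / 50 makes A^3 = 125 r \<epsilon> at most 3 \<epsilon>.\<close>
    define A where "A = 5 * r"
    have small: "(x t0)\<^sup>2 + (y t0)\<^sup>2 \<le> A\<^sup>2"
    proof -
      have t0B: "t0 \<in> {0..B}" using t0 by auto
      have "(X t0)\<^sup>2 + (Y t0)\<^sup>2 \<le> r\<^sup>2" using power_mono[OF t0(3) k_nonneg, of 2] by (simp only: k_sq)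
      then have "\<bar>X t0\<bar>\<^sup>2 \<le> r\<^sup>2" "\<bar>Y t0\<bar>\<^sup>2 \<le> r\<^sup>2"
        using zero_le_power2[of "X t0"] zero_le_power2[of "Y t0"] unfolding power2_abs by linarith+
      then have Xr: "\<bar>X t0\<bar> \<le> r" and Yr: "\<bar>Y t0\<bar> \<le> r"
        using power2_le_imp_le[OF _ less_imp_le[OF r(1)]] by blast+
      have "\<bar>x t0\<bar> / 2 = arcsin (sin (\<bar>x t0\<bar> / 2))" using abs_x_less[OF t0B] by (subst arcsin_sin) auto
      also have "sin (\<bar>x t0\<bar> / 2) = \<bar>X t0\<bar>"
        using abs_x_less[OF t0B] sin_ge_zero[of "\<bar>x t0\<bar> / 2"] by (cases "0 \<le> x t0") (auto simp: X_def)
      also have "arcsin \<bar>X t0\<bar> \<le> 2 * \<bar>X t0\<bar>" using Xr r by (intro arcsin_le_double) auto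
      finally have "\<bar>x t0\<bar> \<le> 4 * r" using Xr by simp
      then have "\<bar>x t0\<bar>\<^sup>2 \<le> (4 * r)\<^sup>2" by (intro power_mono) auto
      moreover have "\<bar>y t0\<bar>\<^sup>2 \<le> (2 * r)\<^sup>2" using Yr by (intro power_mono) (auto simp: Y_def)
      moreover have "(4 * r)\<^sup>2 + (2 * r)\<^sup>2 \<le> A\<^sup>2" using r(1) by (simp add: A_def power2_eq_square)
      ultimately show ?thesis by simp
    qed
    define L where "L = 1 + 18 * A / \<epsilon>"
    obtain u' x' y' where c: "pw_trajectory \<epsilon> L u' x' y'" "x' 0 = x t0" "y' 0 = y t0" "x' L = 0" "y' L = 0"
    proof (rule capture_trajectory[OF \<epsilon>(1) _ small _ L_def])
      show "0 < A" using r by (simp add: A_def)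
      have "A ^ 3 = 125 * r * \<epsilon>" by (simp add: A_def power3_eq_cube r(2)[symmetric])
      also have "\<dots> \<le> 3 * \<epsilon>" using r \<epsilon> by (intro mult_right_mono) auto
      finally show "A ^ 3 \<le> 3 * \<epsilon>" .
    qed (rule that)
    have L0: "0 \<le> L" using \<epsilon> r by (auto simp: L_def A_def)
    have eL: "\<epsilon> * L \<le> 91 * r"
    proof -
      have "\<epsilon> * L = \<epsilon> + 90 * r" using \<epsilon> by (simp add: L_def A_def algebra_simps)
      then show ?thesis using er by simp
    qed
    have "pw_trajectory \<epsilon> t0 (\<lambda>t. - max (-1) (min 1 (y t / \<epsilon>))) x y"
      by (rule pw_trajectory_restrict[OF pw]) (use t0 in auto)
    from pw_trajectory_concat[OF this c(1)] c t0 L0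
    have "pw_trajectory \<epsilon> (t0 + L) (\<lambda>t. if t \<le> t0 then - max (-1) (min 1 (y t / \<epsilon>)) else u' (t - t0))
      (\<lambda>t. if t \<le> t0 then x t else x' (t - t0)) (\<lambda>t. if t \<le> t0 then y t else y' (t - t0))" by simp
    moreover have "(if t0 + L \<le> t0 then x (t0 + L) else x' (t0 + L - t0)) = 0"
      "(if t0 + L \<le> t0 then y (t0 + L) else y' (t0 + L - t0)) = 0"
      using c L0 by auto
    moreover have "\<epsilon> * (t0 + L) \<le> E cl - E \<delta> + 8 * sqrt (2 * \<delta>) + 40 * \<delta> + (K + 150) * r"
      using t0E eL r by (simp add: algebra_simps)
    ultimately show "\<exists>T u x y. pw_trajectory \<epsilon> T u x y \<and> x 0 = x0 \<and> y 0 = y0 \<and> x T = 0 \<and> y T = 0 \<and>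
        \<epsilon> * T \<le> energy_potential 1 0 \<delta> (clamp_modulus \<delta> (sqrt ((sin (x0 / 2))\<^sup>2 + (y0 / 2)\<^sup>2)))
          - energy_potential 1 0 \<delta> \<delta> + 8 * sqrt (2 * \<delta>) + 40 * \<delta> + (K + 150) * sqrt \<epsilon>"
      unfolding E_def cl_def k0_eq r_def using t0(1) xy0 by (intro exI conjI) (assumption | simp)+
  qed (use e1 K0 in auto)
qed

section \<open>Departure from the upper equilibrium\<close>

lemma continuous_hitting_time:
  fixes f :: "real \<Rightarrow> real"
  assumes ab: "a \<le> b" and f: "continuous_on {a..b} f" and fa: "c \<le> f a" and fb: "f b \<le> c"
  obtains s where "s \<in> {a..b}" "f s = c" "\<And>r. r \<in> {a..<s} \<Longrightarrow> c < f r"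
proof -
  define Z where "Z = {s \<in> {a..b}. f s = c}"
  have Zne: "Z \<noteq> {}" using IVT2'[of f b c a] assms unfolding Z_def by fastforce
  have "closed Z"
  proof -
    have "Z = {a..b} \<inter> f -` {c}" by (auto simp: Z_def)
    then show ?thesis using continuous_closed_preimage[OF f, of "{c}"] by simp
  qed
  moreover have "bounded Z" by (rule bounded_subset[of "{a..b}"]) (auto simp: Z_def)
  ultimately have "compact Z" by (simp add: compact_eq_bounded_closed)
  then obtain s where s: "s \<in> Z" "\<And>r. r \<in> Z \<Longrightarrow> s \<le> r" using compact_attains_inf[OF _ Zne] by blast
  show thesis
  proof (rule that[of s])
    fix r assume r: "r \<in> {a..<s}"
    show "c < f r"
    proof (rule ccontr)
      assume "\<not> c < f r"
      then have "\<exists>q\<ge>a. q \<le> r \<and> f q = c"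
        using r s(1) fa by (intro IVT2') (auto simp: Z_def intro: continuous_on_subset[OF f])
      then obtain q where "a \<le> q" "q \<le> r" "f q = c" by blast
      then have "q \<in> Z" using r s(1) by (auto simp: Z_def)
      then show False using s(2)[of q] \<open>q \<le> r\<close> r by auto
    qed
  qed (use s(1) in \<open>auto simp: Z_def\<close>)
qed

text \<open>
  The control \<open>u = cos x\<close> conserves \<open>y\<^sup>2 / 2 - cos x - \<epsilon> sin x\<close> and drives the pendulum away from the
  upper equilibrium in time \<open>O(1 / sqrt \<epsilon>)\<close>, which is negligible compared with \<open>1 / \<epsilon>\<close>.
\<close>

lemma saddle_departure:
  assumes \<epsilon>: "0 < \<epsilon>" "\<epsilon> \<le> 1 / 6" and x0: "pi / 2 \<le> x0" "x0 \<le> pi" and c0: "(cos (x0 / 2))\<^sup>2 \<le> \<epsilon> / 2"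
  obtains T u x y where "pw_trajectory \<epsilon> T u x y" "x 0 = x0" "y 0 = 0" "x T = - pi / 2"
    "(sin (x T / 2))\<^sup>2 + (y T / 2)\<^sup>2 \<le> 1 - \<epsilon> / 2" "T \<le> 2 / sqrt \<epsilon> + 4"
proof -
  \<comment> \<open>Chosen so that the drift \<epsilon> \<tau>^2 / 2 equals 2, which brings x from
    at most \<pi> below \<pi> / 2, as \<pi> < 4.\<close>
  define \<tau> where "\<tau> = 2 / sqrt \<epsilon>"
  define B where "B = \<tau> + 4"
  have \<tau>: "0 < \<tau>" "\<epsilon> * \<tau>\<^sup>2 = 4" using \<epsilon> by (auto simp: \<tau>_def power_divide)
  have bd: "\<bar>cos a\<bar> \<le> 1" for a :: real by simp
  have lip: "\<bar>cos a - cos a'\<bar> \<le> 1 * (\<bar>a - a'\<bar> + \<bar>b - b'\<bar>)" for a a' b b' :: real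
  proof -
    have "\<bar>cos a - cos a'\<bar> = 2 * (\<bar>sin ((a + a') / 2)\<bar> * \<bar>sin ((a' - a) / 2)\<bar>)"
      by (simp add: cos_diff_cos abs_mult)
    also have "\<dots> \<le> 2 * (1 * \<bar>(a' - a) / 2\<bar>)"
      by (intro mult_left_mono mult_mono abs_sin_x_le_abs_x) auto
    finally show ?thesis by simp
  qed
  obtain x y where
    cx: "continuous_on UNIV x" and cy: "continuous_on UNIV y" and xy0: "x 0 = x0" "y 0 = 0" and
    dx: "\<And>t. t \<in> {0<..<B} \<Longrightarrow> (x has_real_derivative y t) (at t)" and
    dy: "\<And>t. t \<in> {0<..<B} \<Longrightarrow> (y has_real_derivative - sin (x t) + \<epsilon> * cos (x t)) (at t)" and
    pw: "pw_trajectory \<epsilon> B (\<lambda>t. cos (x t)) x y"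
    by (rule feedback_trajectory[of \<epsilon> B 1 "\<lambda>a b. cos a" x0 0, OF \<epsilon>(1) _ _ bd lip])
      (use \<tau> in \<open>simp add: B_def\<close>, simp, rule that)
  have cx': "continuous_on A x" and cy': "continuous_on A y" for A
    using cx cy continuous_on_subset by blast+
  define h where "h z = cos z + \<epsilon> * sin z" for z
  have energy: "(y t)\<^sup>2 / 2 = h (x t) - h x0" if t: "t \<in> {0..B}" for t
  proof -
    have "((y t)\<^sup>2 / 2 - h (x t)) - ((y 0)\<^sup>2 / 2 - h (x 0)) = 0 * (t - 0)"
    proof (rule increment_eq[of "{}"])
      show "continuous_on {0..t} (\<lambda>t. (y t)\<^sup>2 / 2 - h (x t))" unfolding h_def
        by (intro continuous_intros cx' cy') auto
      show "((\<lambda>t. (y t)\<^sup>2 / 2 - h (x t)) has_real_derivative 0) (at s)" if "s \<in> {0<..<t} - {}" for s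
        unfolding h_def using that t dx[of s] dy[of s]
        by (auto intro!: derivative_eq_intros simp: field_simps)
    qed (use t in auto)
    then show ?thesis by (simp add: xy0)
  qed
  have cos0: "cos x0 \<le> \<epsilon> - 1" using c0 cos_double_cos[of "x0 / 2"] by simp
  have sin0: "0 \<le> sin x0" "sin x0 \<le> 1" using x0 by (auto intro!: sin_ge_zero)
  have h0: "h x0 \<le> 2 * \<epsilon> - 1"
  proof -
    have "\<epsilon> * sin x0 \<le> \<epsilon> * 1" by (rule mult_left_mono[OF sin0(2)]) (use \<epsilon> in simp)
    then show ?thesis using cos0 by (simp add: h_def)
  qed
  have dh0: "- sin x0 + \<epsilon> * cos x0 < 0"
  proof -
    have "\<epsilon> * cos x0 \<le> \<epsilon> * (\<epsilon> - 1)" using cos0 \<epsilon> by (intro mult_left_mono) auto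
    also have "\<dots> < 0" using \<epsilon> by (intro mult_pos_neg) auto
    finally show ?thesis using sin0 by linarith
  qed
  \<comment> \<open>Just to the right of \<open>x0\<close> the function \<open>h\<close> is smaller
    than at \<open>x0\<close>, which the energy identity forbids along the trajectory.\<close>
  have le_x0: "x t \<le> x0" if t: "t \<in> {0..B}" for t
  proof (rule ccontr)
    assume "\<not> x t \<le> x0"
    then have gt: "x0 < x t" by simp
    have "(h has_real_derivative - sin x0 + \<epsilon> * cos x0) (at x0)"
      unfolding h_def[abs_def] by (auto intro!: derivative_eq_intros)
    from DERIV_neg_dec_right[OF this dh0] obtain d where d: "0 < d" "\<And>r. 0 < r \<Longrightarrow> r < d \<Longrightarrow> h (x0 + r) < h x0" by blast
    define z where "z = min (x t) (x0 + d / 2)"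
    have z: "x0 < z" "z \<le> x t" "z - x0 < d" using gt d by (auto simp: z_def)
    have "\<exists>s\<ge>0. s \<le> t \<and> x s = z"
      using z t xy0 by (intro IVT' cx') auto
    then obtain s where s: "0 \<le> s" "s \<le> t" "x s = z" by blast
    have "h z < h x0" using d(2)[of "z - x0"] z by simp
    moreover have "0 \<le> h z - h x0" using energy[of s] s t by (metis atLeastAtMost_iff order_trans zero_le_power2 divide_nonneg_nonneg zero_le_numeral)
    ultimately show False by simp
  qed
  \<comment> \<open>In the second quadrant sin z - cos z \<ge> 1, so the force pushes to the left
    with strength at least \<epsilon> even at the equilibrium itself.\<close>
  have acc: "- sin z + \<epsilon> * cos z \<le> - \<epsilon>" if z: "pi / 2 \<le> z" "z \<le> pi" for z
  proof -
    have s: "0 \<le> sin z" "sin z \<le> 1" using z by (auto intro!: sin_ge_zero)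
    have c: "cos z \<le> 0" "-1 \<le> cos z" using cos_ge_zero[of "pi - z"] z by auto
    have "(sin z)\<^sup>2 \<le> sin z" using s by (simp add: power2_eq_square mult_left_le)
    moreover have "(cos z)\<^sup>2 \<le> - cos z" using mult_right_mono_neg[OF c(2,1)] by (simp add: power2_eq_square)
    ultimately have "1 \<le> sin z - cos z" using sin_cos_squared_add[of z] by linarith
    then have "\<epsilon> * 1 \<le> \<epsilon> * (sin z - cos z)" using \<epsilon> by (intro mult_left_mono) auto
    moreover have "\<epsilon> * sin z \<le> 1 * sin z" using \<epsilon> s by (intro mult_right_mono) auto
    ultimately show ?thesis by (simp add: algebra_simps)
  qed
  have slow: "y t \<le> - \<epsilon> * t \<and> x t \<le> x0 - \<epsilon> * t\<^sup>2 / 2"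
    if t: "t \<in> {0..B}" and gt: "\<And>s. s \<in> {0<..<t} \<Longrightarrow> pi / 2 < x s" for t
  proof -
    have yle: "y s \<le> - \<epsilon> * s" if s: "s \<in> {0..t}" for s
    proof -
      have "y s - y 0 \<le> - \<epsilon> * (s - 0)"
      proof (rule increment_le[of "{}" 0 s y "\<lambda>t. - sin (x t) + \<epsilon> * cos (x t)"])
        fix r assume r: "r \<in> {0<..<s} - {}"
        show "(y has_real_derivative - sin (x r) + \<epsilon> * cos (x r)) (at r)" by (rule dy) (use r s t in auto)
        have "pi / 2 < x r" by (rule gt) (use r s in auto)
        moreover have "x r \<le> pi" using le_x0[of r] x0 r s t by auto
        ultimately show "- sin (x r) + \<epsilon> * cos (x r) \<le> - \<epsilon>" by (intro acc) auto
      qed (use s in \<open>auto intro!: cy'\<close>)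
      then show ?thesis by (simp add: xy0)
    qed
    have "(x t + \<epsilon> * t\<^sup>2 / 2) - (x 0 + \<epsilon> * 0\<^sup>2 / 2) \<le> 0 * (t - 0)"
    proof (rule increment_le[of "{}" 0 t _ "\<lambda>t. y t + \<epsilon> * t"])
      show "continuous_on {0..t} (\<lambda>t. x t + \<epsilon> * t\<^sup>2 / 2)" by (intro continuous_intros cx') auto
      show "((\<lambda>t. x t + \<epsilon> * t\<^sup>2 / 2) has_real_derivative y s + \<epsilon> * s) (at s)" if "s \<in> {0<..<t} - {}" for s
        using that t dx[of s] by (auto intro!: derivative_eq_intros)
      show "y s + \<epsilon> * s \<le> 0" if "s \<in> {0<..<t} - {}" for s using yle[of s] that by auto
    qed (use t in auto)
    then show ?thesis using yle[of t] t by (auto simp: xy0)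
  qed
  have "x \<tau> \<le> pi / 2 \<or> (\<exists>s\<in>{0<..<\<tau>}. x s \<le> pi / 2)"
  proof (rule ccontr)
    assume n: "\<not> (x \<tau> \<le> pi / 2 \<or> (\<exists>s\<in>{0<..<\<tau>}. x s \<le> pi / 2))"
    then have "x \<tau> \<le> x0 - \<epsilon> * \<tau>\<^sup>2 / 2" using \<tau> slow[of \<tau>] by (auto simp: B_def not_le)
    then have "x \<tau> \<le> pi - 2" using x0 \<tau> by simp
    moreover have "pi < 4" using pi_less_4 .
    ultimately show False using n by auto
  qed
  then have "\<exists>t'. 0 \<le> t' \<and> t' \<le> \<tau> \<and> x t' \<le> pi / 2"
    using \<tau>(1) by (metis greaterThanLessThan_iff less_imp_le order_refl)
  then obtain t' where t': "0 \<le> t'" "t' \<le> \<tau>" "x t' \<le> pi / 2" by blast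
  obtain t1 where t1: "t1 \<in> {0..t'}" "x t1 = pi / 2" "\<And>r. r \<in> {0..<t1} \<Longrightarrow> pi / 2 < x r"
    using continuous_hitting_time[OF t'(1) cx' _ t'(3)] x0 xy0 by auto
  have t1B: "0 \<le> t1" "t1 \<le> \<tau>" using t1 t' by auto
  \<comment> \<open>The gap in \<open>h\<close> is at least 1 - 3 \<epsilon>, hence at least 1 / 2
    for \<epsilon> \<le> 1 / 6. With |y| \<ge> 1 the interval of length \<pi> < 4 is crossed within
    4 units of time.\<close>
  have hlow: "1 \<le> (y t)\<^sup>2" if "t \<in> {0..B}" "\<bar>x t\<bar> \<le> pi / 2" for t
  proof -
    have "0 \<le> cos (x t)" using that(2) by (intro cos_ge_zero) auto
    moreover have "- \<epsilon> \<le> \<epsilon> * sin (x t)" using mult_left_mono[of "-1" "sin (x t)" \<epsilon>] \<epsilon> by simp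
    ultimately have "1 / 2 \<le> h (x t) - h x0" using h0 \<epsilon> unfolding h_def by linarith
    then show ?thesis using energy[OF that(1)] by simp
  qed
  have yt1: "y t1 < 0"
  proof -
    have "y t1 \<le> - \<epsilon> * t1" using slow[of t1] t1 t1B by (auto simp: B_def)
    then have "y t1 \<le> 0" using \<epsilon> t1B by (smt (verit) mult_nonneg_nonneg mult_minus_left)
    moreover have "y t1 \<noteq> 0" using hlow[of t1] t1 t1B by (auto simp: B_def)
    ultimately show ?thesis by simp
  qed
  have "\<exists>s\<in>{t1..t1 + 4}. x s \<le> - pi / 2"
  proof (rule ccontr)
    assume "\<not> ?thesis"
    then have gt: "- pi / 2 < x s" if "s \<in> {t1..t1 + 4}" for s using that by (meson not_le)
    have dec: "x s \<le> pi / 2" if "s \<in> {t1..t1 + 4}" "\<And>r. r \<in> {t1<..<s} \<Longrightarrow> y r \<le> 0" for s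
    proof -
      have "x s - x t1 \<le> 0 * (s - t1)"
        by (rule increment_le[of "{}" t1 s x y]) (use that t1B in \<open>auto intro!: cx' dx simp: B_def\<close>)
      then show ?thesis using t1 by simp
    qed
    have neg: "y s < 0" if s: "s \<in> {t1..t1 + 4}" for s
    proof (rule ccontr)
      assume "\<not> y s < 0"
      then have "- y s \<le> 0" by simp
      obtain q where q: "q \<in> {t1..s}" "- y q = 0" "\<And>r. r \<in> {t1..<q} \<Longrightarrow> 0 < - y r"
        by (rule continuous_hitting_time[of t1 s "\<lambda>t. - y t" 0])
          (use s yt1 \<open>- y s \<le> 0\<close> that in \<open>auto intro!: continuous_intros cy'\<close>)
      have "x q \<le> pi / 2" by (rule dec) (use q s in \<open>auto intro: less_imp_le\<close>)
      moreover have "- pi / 2 < x q" using gt[of q] q s by auto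
      ultimately have "1 \<le> (y q)\<^sup>2" using q s t1B by (intro hlow) (auto simp: B_def)
      then show False using q by simp
    qed
    have "x (t1 + 4) - x t1 \<le> - 1 * (t1 + 4 - t1)"
    proof (rule increment_le[of "{}" t1 "t1 + 4" x y])
      show "(x has_real_derivative y s) (at s)" if "s \<in> {t1<..<t1 + 4} - {}" for s
        using that t1B by (intro dx) (auto simp: B_def)
      show "y s \<le> - 1" if s: "s \<in> {t1<..<t1 + 4} - {}" for s
      proof -
        have "x s \<le> pi / 2" by (rule dec) (use s neg in \<open>auto intro: less_imp_le\<close>)
        moreover have "- pi / 2 < x s" using gt[of s] s by auto
        ultimately have "1\<^sup>2 \<le> \<bar>y s\<bar>\<^sup>2" using s t1B hlow[of s] by (auto simp: B_def)
        then have "1 \<le> \<bar>y s\<bar>" by (rule power2_le_imp_le) simp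
        then show ?thesis using neg[of s] s by auto
      qed
    qed (auto intro!: cx')
    then have "x (t1 + 4) \<le> pi / 2 - 4" using t1 by simp
    moreover have "- pi / 2 < x (t1 + 4)" using gt[of "t1 + 4"] by simp
    ultimately show False using pi_less_4 by linarith
  qed
  then obtain s where s: "s \<in> {t1..t1 + 4}" "x s \<le> - pi / 2" by blast
  have "\<exists>T\<ge>t1. T \<le> s \<and> x T = - pi / 2"
  proof (rule IVT2')
    show "- pi / 2 \<le> x t1" unfolding t1(2) using pi_ge_zero by simp
  qed (use s cx' in auto)
  then obtain T where T: "t1 \<le> T" "T \<le> s" "x T = - pi / 2" by blast
  have TB: "T \<in> {0..B}" "T \<le> \<tau> + 4" using T s t1B by (auto simp: B_def)
  \<comment> \<open>At x = - \<pi> / 2 the term \<epsilon> sin x has its least value - \<epsilon>;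
    this loss of energy produces precisely the margin \<epsilon> / 2 that
    \<open>damped_steering\<close> asks for.\<close>
  have "(sin (x T / 2))\<^sup>2 + (y T / 2)\<^sup>2 \<le> 1 - \<epsilon> / 2"
  proof -
    have "(sin (x T / 2))\<^sup>2 = (1 - cos (x T)) / 2" using cos_double_sin[of "x T / 2"] by simp
    also have "cos (x T) = 0" unfolding T(3) using cos_minus[of "pi / 2"] by (simp del: cos_minus)
    finally have 1: "(sin (x T / 2))\<^sup>2 = 1 / 2" by simp
    have "sin (x T) = - 1" unfolding T(3) using sin_minus[of "pi / 2"] by (simp del: sin_minus)
    then have "(y T)\<^sup>2 / 2 = - \<epsilon> - h x0" using energy[OF TB(1)] \<open>cos (x T) = 0\<close> by (simp add: h_def)
    also have "\<dots> \<le> - \<epsilon> + 1" using sin0 \<epsilon> by (simp add: h_def) (smt (verit) cos_ge_minus_one mult_nonneg_nonneg)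
    finally show ?thesis using 1 by (simp add: power_divide)
  qed
  moreover have "pw_trajectory \<epsilon> T (\<lambda>t. cos (x t)) x y"
    by (rule pw_trajectory_restrict[OF pw]) (use TB in auto)
  ultimately show thesis using xy0 T(3) TB(2) by (intro that[of T "\<lambda>t. cos (x t)" x y]) (simp_all only: \<tau>_def)
qed

lemma energy_potential_mono:
  assumes \<delta>: "0 < \<delta>" and k: "\<delta> \<le> k" "k \<le> k'" "k' < 1"
  shows "energy_potential 1 0 \<delta> k \<le> energy_potential 1 0 \<delta> k'"
proof -
  have "0 * (k' - k) \<le> energy_potential 1 0 \<delta> k' - energy_potential 1 0 \<delta> k"
  proof (rule increment_ge[of "{}" k k' _ "energy_weight 1 0"])
    show "continuous_on {k..k'} (energy_potential 1 0 \<delta>)"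
      by (intro continuous_at_imp_continuous_on) (use \<delta> k in \<open>auto intro!: DERIV_isCont[OF energy_potential_has_derivative]\<close>)
    show "(energy_potential 1 0 \<delta> has_real_derivative energy_weight 1 0 t) (at t)" if "t \<in> {k<..<k'} - {}" for t
      using that \<delta> k by (intro energy_potential_has_derivative) auto
    show "0 \<le> energy_weight 1 0 t" if "t \<in> {k<..<k'} - {}" for t
      using that \<delta> k by (intro energy_weight_nonneg) auto
  qed (use k in auto)
  then show ?thesis by simp
qed

text \<open>Reflection and shifts by 2 \<pi> reduce to initial angles in \<open>{0..pi}\<close>.
  Below the margin damping starts at once; closer to the upper equilibrium the departure comes
  first, and \<epsilon> times its duration is at most 6 sqrt \<epsilon>.\<close>

lemma steering_from_turning_point:
  assumes \<delta>: "0 < \<delta>" "\<delta> < 1 / 2"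
  obtains K \<epsilon>1 where "0 \<le> K" "0 < \<epsilon>1"
    "\<And>\<epsilon> x1. \<lbrakk>0 < \<epsilon>; \<epsilon> < \<epsilon>1\<rbrakk> \<Longrightarrow>
      \<exists>T u x y. pw_trajectory \<epsilon> T u x y \<and> x 0 = x1 \<and> y 0 = 0 \<and> [x T = 0] (rmod 2 * pi) \<and> y T = 0 \<and>
        \<epsilon> * T \<le> energy_potential 1 0 \<delta> (clamp_modulus \<delta> \<bar>sin (x1 / 2)\<bar>)
          - energy_potential 1 0 \<delta> \<delta> + 8 * sqrt (2 * \<delta>) + 40 * \<delta> + K * sqrt \<epsilon>"
proof -
  obtain K \<epsilon>0 where K: "0 \<le> K" "0 < \<epsilon>0" and st:
    "\<And>\<epsilon> x0 y0. \<lbrakk>0 < \<epsilon>; \<epsilon> < \<epsilon>0; \<bar>x0\<bar> < pi; (sin (x0 / 2))\<^sup>2 + (y0 / 2)\<^sup>2 \<le> 1 - \<epsilon> / 2\<rbrakk> \<Longrightarrow>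
      \<exists>T u x y. pw_trajectory \<epsilon> T u x y \<and> x 0 = x0 \<and> y 0 = y0 \<and> x T = 0 \<and> y T = 0 \<and>
        \<epsilon> * T \<le> energy_potential 1 0 \<delta> (clamp_modulus \<delta> (sqrt ((sin (x0 / 2))\<^sup>2 + (y0 / 2)\<^sup>2)))
          - energy_potential 1 0 \<delta> \<delta> + 8 * sqrt (2 * \<delta>) + 40 * \<delta> + K * sqrt \<epsilon>"
    using damped_steering[OF \<delta>] by blast
  define \<epsilon>1 where "\<epsilon>1 = min \<epsilon>0 (min (1 / 6) \<delta>)"
  define E where "E = energy_potential 1 0 \<delta>"
  define S where "S \<epsilon> x1 \<longleftrightarrow> (\<exists>T u x y. pw_trajectory \<epsilon> T u x y \<and> x 0 = x1 \<and> y 0 = 0 \<and> [x T = 0] (rmod 2 * pi) \<and> y T = 0 \<and>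
        \<epsilon> * T \<le> E (clamp_modulus \<delta> \<bar>sin (x1 / 2)\<bar>) - E \<delta> + 8 * sqrt (2 * \<delta>) + 40 * \<delta> + (K + 6) * sqrt \<epsilon>)" for \<epsilon> x1
  have main: "S \<epsilon> x1" if \<epsilon>: "0 < \<epsilon>" "\<epsilon> < \<epsilon>1" and x1: "0 \<le> x1" "x1 \<le> pi" for \<epsilon> x1
  proof -
    have e: "\<epsilon> < \<epsilon>0" "\<epsilon> \<le> 1 / 6" "\<epsilon> < \<delta>" using \<epsilon> by (auto simp: \<epsilon>1_def)
    show ?thesis
    proof (cases "(sin (x1 / 2))\<^sup>2 \<le> 1 - \<epsilon> / 2")
      case True
      have "x1 \<noteq> pi" using True \<epsilon> by auto
      then have "\<bar>x1\<bar> < pi" using x1 by auto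
      from st[OF \<epsilon>(1) e(1) this, of 0] True obtain T u x y where t:
        "pw_trajectory \<epsilon> T u x y" "x 0 = x1" "y 0 = 0" "x T = 0" "y T = 0"
        "\<epsilon> * T \<le> E (clamp_modulus \<delta> \<bar>sin (x1 / 2)\<bar>) - E \<delta> + 8 * sqrt (2 * \<delta>) + 40 * \<delta> + K * sqrt \<epsilon>"
        unfolding E_def by auto
      have "K * sqrt \<epsilon> \<le> (K + 6) * sqrt \<epsilon>" using \<epsilon> by (intro mult_right_mono) auto
      with t show ?thesis unfolding S_def by (intro exI[of _ T] exI[of _ u] exI[of _ x] exI[of _ y]) auto
    next
      case False
      have c0: "(cos (x1 / 2))\<^sup>2 \<le> \<epsilon> / 2" using False sin_cos_squared_add[of "x1 / 2"] by linarith
      have "cos x1 \<le> \<epsilon> - 1" using c0 cos_double_cos[of "x1 / 2"] by simp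
      then have "cos x1 < 0" using e by linarith
      then have x1': "pi / 2 \<le> x1" using cos_ge_zero[of x1] x1 by (meson less_eq_real_def minus_pi_half_less_zero not_le order_trans)
      obtain T1 u1 x1' y1 where 1: "pw_trajectory \<epsilon> T1 u1 x1' y1" "x1' 0 = x1" "y1 0 = 0" "x1' T1 = - pi / 2"
        "(sin (x1' T1 / 2))\<^sup>2 + (y1 T1 / 2)\<^sup>2 \<le> 1 - \<epsilon> / 2" "T1 \<le> 2 / sqrt \<epsilon> + 4"
        by (rule saddle_departure[OF \<epsilon>(1) e(2) x1' x1(2) c0]) (rule that)
      have "\<bar>x1' T1\<bar> < pi" unfolding 1(4) by simp
      from st[OF \<epsilon>(1) e(1) this 1(5)] obtain T2 u2 x2 y2 where 2:
        "pw_trajectory \<epsilon> T2 u2 x2 y2" "x2 0 = x1' T1" "y2 0 = y1 T1" "x2 T2 = 0" "y2 T2 = 0"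
        "\<epsilon> * T2 \<le> E (clamp_modulus \<delta> (sqrt ((sin (x1' T1 / 2))\<^sup>2 + (y1 T1 / 2)\<^sup>2))) - E \<delta> + 8 * sqrt (2 * \<delta>) + 40 * \<delta> + K * sqrt \<epsilon>"
        unfolding E_def by blast
      have T0: "0 \<le> T1" "0 \<le> T2" using 1(1) 2(1) by (auto simp: pw_trajectory_def)
      \<comment> \<open>Since \<epsilon> < \<delta>, a start this close to the upper equilibrium is
        clamped to the top value 1 - \<delta>, so the potential at the point where damping takes
        over cannot exceed the one claimed.\<close>
      have cl: "clamp_modulus \<delta> \<bar>sin (x1 / 2)\<bar> = 1 - \<delta>"
      proof -
        have "(1 - \<delta>)\<^sup>2 \<le> 1 - \<delta>" using \<delta> by (simp add: power2_eq_square mult_left_le)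
        also have "\<dots> \<le> 1 - \<epsilon> / 2" using e \<delta> by simp
        also have "\<dots> \<le> \<bar>sin (x1 / 2)\<bar>\<^sup>2" using False by simp
        finally have "1 - \<delta> \<le> \<bar>sin (x1 / 2)\<bar>" by (rule power2_le_imp_le) simp
        then show ?thesis using \<delta> by (simp add: clamp_modulus_def)
      qed
      have "E (clamp_modulus \<delta> (sqrt ((sin (x1' T1 / 2))\<^sup>2 + (y1 T1 / 2)\<^sup>2))) \<le> E (1 - \<delta>)"
        unfolding E_def by (rule energy_potential_mono) (use \<delta> in \<open>auto simp: clamp_modulus_def\<close>)
      moreover have "\<epsilon> * T1 \<le> 6 * sqrt \<epsilon>"
      proof -
        have s: "0 < sqrt \<epsilon>" "sqrt \<epsilon> * sqrt \<epsilon> = \<epsilon>" using \<epsilon> by auto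
        have "\<epsilon> * T1 \<le> \<epsilon> * (2 / sqrt \<epsilon> + 4)" using 1(6) \<epsilon> by (intro mult_left_mono) auto
        also have "\<dots> = 2 * sqrt \<epsilon> + 4 * \<epsilon>" using s by (simp add: field_simps)
        finally have 1: "\<epsilon> * T1 \<le> 2 * sqrt \<epsilon> + 4 * \<epsilon>" .
        have "sqrt \<epsilon> \<le> sqrt 1" using e by (intro real_sqrt_le_mono) auto
        then have "sqrt \<epsilon> * sqrt \<epsilon> \<le> 1 * sqrt \<epsilon>" using s by (intro mult_right_mono) auto
        then show ?thesis using s 1 by simp
      qed
      ultimately have le: "\<epsilon> * (T1 + T2) \<le> E (clamp_modulus \<delta> \<bar>sin (x1 / 2)\<bar>) - E \<delta> + 8 * sqrt (2 * \<delta>) + 40 * \<delta> + (K + 6) * sqrt \<epsilon>"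
        unfolding cl using 2(6) by (simp add: algebra_simps)
      let ?u = "\<lambda>t. if t \<le> T1 then u1 t else u2 (t - T1)"
      let ?x = "\<lambda>t. if t \<le> T1 then x1' t else x2 (t - T1)"
      let ?y = "\<lambda>t. if t \<le> T1 then y1 t else y2 (t - T1)"
      have pw: "pw_trajectory \<epsilon> (T1 + T2) ?u ?x ?y"
        by (rule pw_trajectory_concat) (use 1 2 in auto)
      have end1: "?x (T1 + T2) = 0" "?y (T1 + T2) = 0"
        using 2 T0 by (cases "T2 = 0"; simp)+
      have beg: "?x 0 = x1" "?y 0 = 0" using 1 T0 by auto
      show ?thesis unfolding S_def
        by (intro exI[of _ "T1 + T2"] exI[of _ ?u] exI[of _ ?x] exI[of _ ?y] conjI pw beg le) (use end1 in auto)
    qed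
  qed
  have refl: "S \<epsilon> (- x1)" if "S \<epsilon> x1" for \<epsilon> x1
  proof -
    from that obtain T u x y where t: "pw_trajectory \<epsilon> T u x y" "x 0 = x1" "y 0 = 0" "[x T = 0] (rmod 2 * pi)" "y T = 0"
      "\<epsilon> * T \<le> E (clamp_modulus \<delta> \<bar>sin (x1 / 2)\<bar>) - E \<delta> + 8 * sqrt (2 * \<delta>) + 40 * \<delta> + (K + 6) * sqrt \<epsilon>"
      unfolding S_def by blast
    show ?thesis unfolding S_def
      using pw_trajectory_reflect[OF t(1)] t(2-6) rcong_uminus[OF t(4)]
      by (intro exI[of _ T] exI[of _ "\<lambda>t. - u t"] exI[of _ "\<lambda>t. - x t"] exI[of _ "\<lambda>t. - y t"]) auto
  qed
  have shift: "S \<epsilon> (x1 + of_int n * (2 * pi))" if "S \<epsilon> x1" for \<epsilon> x1 n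
  proof -
    from that obtain T u x y where t: "pw_trajectory \<epsilon> T u x y" "x 0 = x1" "y 0 = 0" "[x T = 0] (rmod 2 * pi)" "y T = 0"
      "\<epsilon> * T \<le> E (clamp_modulus \<delta> \<bar>sin (x1 / 2)\<bar>) - E \<delta> + 8 * sqrt (2 * \<delta>) + 40 * \<delta> + (K + 6) * sqrt \<epsilon>"
      unfolding S_def by blast
    have "\<bar>sin ((x1 + of_int n * (2 * pi)) / 2)\<bar> = \<bar>sin (x1 / 2)\<bar>"
    proof -
      have eq: "(x1 + of_int n * (2 * pi)) / 2 = x1 / 2 + of_int n * pi" by (simp add: field_simps)
      moreover have s0: "sin (of_int n * pi) = 0" using sin_npi_int[of n] by (simp add: mult.commute)
      moreover have "\<bar>cos (of_int n * pi)\<bar> = 1"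
        using sin_cos_squared_add[of "of_int n * pi"] s0 by (auto simp: power2_eq_1_iff)
      ultimately show ?thesis unfolding eq sin_add s0 by (simp add: abs_mult)
    qed
    moreover have "[x T + of_int n * (2 * pi) = 0] (rmod 2 * pi)"
      using t(4) rcong_add[OF t(4), of "of_int n * (2 * pi)" 0] by (simp add: rcong_intros)
    ultimately show ?thesis unfolding S_def
      using pw_trajectory_shift[OF t(1), of n] t(2-6)
      by (intro exI[of _ T] exI[of _ u] exI[of _ "\<lambda>t. x t + of_int n * (2 * pi)"] exI[of _ y]) auto
  qed
  have all: "S \<epsilon> x1" if \<epsilon>: "0 < \<epsilon>" "\<epsilon> < \<epsilon>1" for \<epsilon> x1
  proof -
    define n where "n = \<lfloor>(x1 + pi) / (2 * pi)\<rfloor>"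
    define x0 where "x0 = x1 - of_int n * (2 * pi)"
    have "of_int n \<le> (x1 + pi) / (2 * pi)" "(x1 + pi) / (2 * pi) < of_int n + 1"
      unfolding n_def by linarith+
    then have "of_int n * (2 * pi) \<le> x1 + pi" "x1 + pi < (of_int n + 1) * (2 * pi)"
      using pi_gt_zero by (simp_all add: pos_le_divide_eq pos_divide_less_eq)
    then have "- pi \<le> x0" "x0 \<le> pi" by (simp_all add: x0_def algebra_simps)
    then have "S \<epsilon> x0" using main[OF \<epsilon>, of x0] refl[OF main[OF \<epsilon>, of "- x0"]] by (cases "0 \<le> x0") auto
    from shift[OF this, of n] show ?thesis by (simp add: x0_def)
  qed
  show thesis
    by (rule that[of "K + 6" \<epsilon>1]) (use K \<delta> all in \<open>auto simp: \<epsilon>1_def S_def E_def\<close>)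
qed

section \<open>Zeros of the adjoint variable\<close>

text \<open>Spacing \<open>L\<close> makes the index obtained by rounding (t - a) / L down strictly
  increasing on \<open>Z\<close>, and the indices run from 0 to the floor of (b - a) / L.\<close>

lemma spaced_finite_card:
  fixes Z :: "real set"
  assumes Z: "Z \<subseteq> {a..b}" and ab: "a \<le> b" and L: "0 < L"
    and sp: "\<And>s t. s \<in> Z \<Longrightarrow> t \<in> Z \<Longrightarrow> s < t \<Longrightarrow> L \<le> t - s"
  shows "finite Z" "real (card Z) \<le> (b - a) / L + 1"
proof -
  define f where "f t = nat \<lfloor>(t - a) / L\<rfloor>" for t
  have lt: "f s < f t" if "s \<in> Z" "t \<in> Z" "s < t" for s t
  proof -
    have "(s - a) / L + 1 = (s - a + L) / L" using L by (simp add: add_divide_distrib)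
    also have "\<dots> \<le> (t - a) / L" using sp[OF that] L by (intro divide_right_mono) auto
    finally have "(s - a) / L + 1 \<le> (t - a) / L" .
    then have "\<lfloor>(s - a) / L\<rfloor> + 1 \<le> \<lfloor>(t - a) / L\<rfloor>" by linarith
    moreover have "0 \<le> \<lfloor>(s - a) / L\<rfloor>" using Z that L by auto
    ultimately show ?thesis unfolding f_def zless_nat_conj by (intro conjI; linarith)
  qed
  have inj: "inj_on f Z" using lt by (metis inj_onI less_irrefl linorder_neqE_linordered_idom)
  have sub: "f ` Z \<subseteq> {0..nat \<lfloor>(b - a) / L\<rfloor>}"
  proof
    fix n assume "n \<in> f ` Z"
    then obtain t where t: "t \<in> Z" "n = f t" by blast
    then have "(t - a) / L \<le> (b - a) / L" using Z L by (intro divide_right_mono) auto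
    then show "n \<in> {0..nat \<lfloor>(b - a) / L\<rfloor>}" using t by (auto simp: f_def intro!: nat_mono floor_mono)
  qed
  show "finite Z" using inj_on_finite[OF inj sub] by simp
  have "card Z \<le> card {0..nat \<lfloor>(b - a) / L\<rfloor>}" by (rule card_inj_on_le[OF inj sub]) simp
  then have "real (card Z) \<le> real (nat \<lfloor>(b - a) / L\<rfloor>) + 1" by simp
  also have "real (nat \<lfloor>(b - a) / L\<rfloor>) \<le> (b - a) / L" using ab L by (simp add: of_nat_nat)
  finally show "real (card Z) \<le> (b - a) / L + 1" by simp
qed

text \<open>Sturm comparison with a sine of frequency 1, as \<psi>'' = - q \<psi> with q \<le> 1.
  Zeros are simple by \<open>nz\<close>, so \<psi> keeps one sign up to its first zero after
  \<open>t1\<close>, and \<phi> = - \<psi>' has opposite signs at the two. The zero found may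
  precede \<open>t2\<close>.\<close>

lemma next_zero:
  fixes \<phi> \<psi> q :: "real \<Rightarrow> real"
  assumes d\<phi>: "\<And>t. t \<in> {0..T} \<Longrightarrow> (\<phi> has_real_derivative q t * \<psi> t) (at t within {0..T})"
    and d\<psi>: "\<And>t. t \<in> {0..T} \<Longrightarrow> (\<psi> has_real_derivative - \<phi> t) (at t within {0..T})"
    and q: "\<And>t. q t \<le> 1"
    and nz: "\<And>t. t \<in> {0..T} \<Longrightarrow> \<psi> t = 0 \<Longrightarrow> \<phi> t \<noteq> 0"
    and t12: "t1 \<in> {0..T}" "t2 \<in> {0..T}" "t1 < t2" "\<psi> t1 = 0" "\<psi> t2 = 0"
  obtains s where "t1 < s" "s \<le> t2" "\<psi> s = 0" "\<phi> t1 * \<phi> s < 0" "pi \<le> s - t1"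
proof -
  \<comment> \<open>The symmetry (\<phi>, \<psi>) -> (- \<phi>, - \<psi>) leaves only the case in
    which \<psi> increases at \<open>t1\<close>.\<close>
  have main: "\<exists>s. t1 < s \<and> s \<le> t2 \<and> \<psi> s = 0 \<and> \<phi> t1 * \<phi> s < 0 \<and> pi \<le> s - t1"
    if d\<phi>: "\<And>t. t \<in> {0..T} \<Longrightarrow> (\<phi> has_real_derivative q t * \<psi> t) (at t within {0..T})"
    and d\<psi>: "\<And>t. t \<in> {0..T} \<Longrightarrow> (\<psi> has_real_derivative - \<phi> t) (at t within {0..T})"
    and nz: "\<And>t. t \<in> {0..T} \<Longrightarrow> \<psi> t = 0 \<Longrightarrow> \<phi> t \<noteq> 0"
    and z: "\<psi> t1 = 0" "\<psi> t2 = 0" and neg: "\<phi> t1 < 0" for \<phi> \<psi> :: "real \<Rightarrow> real"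
  proof -
    have c\<psi>: "continuous_on {0..T} \<psi>" unfolding continuous_on_eq_continuous_within by (intro ballI DERIV_continuous[OF d\<psi>])
    have c\<phi>: "continuous_on {0..T} \<phi>" unfolding continuous_on_eq_continuous_within by (intro ballI DERIV_continuous[OF d\<phi>])
    obtain d where d: "0 < d" "\<And>h. 0 < h \<Longrightarrow> t1 + h \<in> {0..T} \<Longrightarrow> h < d \<Longrightarrow> \<psi> t1 < \<psi> (t1 + h)"
      using has_real_derivative_pos_inc_right[OF d\<psi>[OF t12(1)]] neg by auto
    define e where "e = min (d / 2) ((t2 - t1) / 2)"
    have e: "0 < e" "e < d" "t1 + e < t2" using d t12(3) by (auto simp: e_def min_def field_simps)
    have pos: "0 < \<psi> (t1 + h)" if "0 < h" "h \<le> e" for h using d(2)[of h] that e t12 z by auto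
    obtain s where s: "s \<in> {t1 + e..t2}" "\<psi> s = 0" "\<And>r. r \<in> {t1 + e..<s} \<Longrightarrow> 0 < \<psi> r"
    proof (rule continuous_hitting_time[of "t1 + e" t2 \<psi> 0])
      show "continuous_on {t1 + e..t2} \<psi>" by (rule continuous_on_subset[OF c\<psi>]) (use t12 e in auto)
      show "0 \<le> \<psi> (t1 + e)" using pos[of e] e by simp
    qed (use e z in auto)
    have sT: "s \<in> {0..T}" "t1 < s" using s(1) t12 e by auto
    have pos': "0 < \<psi> r" if "r \<in> {t1<..<s}" for r
      using pos[of "r - t1"] s(3)[of r] that by (cases "r \<le> t1 + e") auto
    have \<phi>s: "0 < \<phi> s"
    proof (rule ccontr)
      assume "\<not> 0 < \<phi> s"
      then have "0 < - \<phi> s" using nz[OF sT(1) s(2)] by auto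
      then obtain d' where d': "0 < d'" "\<And>h. 0 < h \<Longrightarrow> s - h \<in> {0..T} \<Longrightarrow> h < d' \<Longrightarrow> \<psi> (s - h) < \<psi> s"
        using has_real_derivative_pos_inc_left[OF d\<psi>[OF sT(1)]] by auto
      define h where "h = min (d' / 2) ((s - t1) / 2)"
      have h: "0 < h" "h < d'" "t1 < s - h" using d' sT by (auto simp: h_def min_def field_simps)
      then have "\<psi> (s - h) < 0" using d'(2)[of h] s(2) sT t12 by auto
      then show False using pos'[of "s - h"] h by auto
    qed
    have "pi \<le> s - t1"
    proof (rule ccontr)
      assume "\<not> pi \<le> s - t1"
      then have lt: "s - t1 < pi" by simp
      \<comment> \<open>The Wronskian of \<psi> and sin (t - t1). It starts at 0 and cannot decrease
        while \<psi> > 0 and t - t1 < \<pi>, but at a zero \<open>s\<close> nearer than \<pi> it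
        would equal - \<phi> s sin (s - t1) < 0.\<close>
      define w where "w t = - \<phi> t * sin (t - t1) - \<psi> t * cos (t - t1)" for t
      have "0 * (s - t1) \<le> w s - w t1"
      proof (rule increment_ge[of "{}" t1 s w "\<lambda>t. (1 - q t) * \<psi> t * sin (t - t1)"])
        show "continuous_on {t1..s} w" unfolding w_def
          using sT t12 by (intro continuous_intros continuous_on_subset[OF c\<phi>] continuous_on_subset[OF c\<psi>]) auto
        fix t assume t: "t \<in> {t1<..<s} - {}"
        have tT: "t \<in> {0..T}" and w: "at t within {0..T} = at t" using t sT t12 by (auto intro!: at_within_Icc_at)
        have "(\<phi> has_real_derivative q t * \<psi> t) (at t)" "(\<psi> has_real_derivative - \<phi> t) (at t)"
          using d\<phi>[OF tT] d\<psi>[OF tT] unfolding w .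
        then show "(w has_real_derivative (1 - q t) * \<psi> t * sin (t - t1)) (at t)"
          unfolding w_def[abs_def] by (auto intro!: derivative_eq_intros simp: algebra_simps)
        show "0 \<le> (1 - q t) * \<psi> t * sin (t - t1)"
          using q[of t] pos'[of t] t lt by (intro mult_nonneg_nonneg sin_ge_zero) auto
      qed (use sT in auto)
      then have "0 \<le> - (\<phi> s * sin (s - t1))" using s(2) z by (simp add: w_def)
      moreover have "0 < \<phi> s * sin (s - t1)" using \<phi>s sT lt by (intro mult_pos_pos sin_gt_zero) auto
      ultimately show False by simp
    qed
    then show ?thesis using s sT \<phi>s neg by (intro exI[of _ s]) (auto simp: mult_neg_pos)
  qed
  have "\<exists>s. t1 < s \<and> s \<le> t2 \<and> \<psi> s = 0 \<and> \<phi> t1 * \<phi> s < 0 \<and> pi \<le> s - t1"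
  proof (cases "\<phi> t1 < 0")
    case True
    then show ?thesis using main[OF d\<phi> d\<psi> nz t12(4,5)] by blast
  next
    case False
    then have "- \<phi> t1 < 0" using nz[OF t12(1,4)] by auto
    moreover have "((\<lambda>t. - \<phi> t) has_real_derivative q t * (- \<psi> t)) (at t within {0..T})" if "t \<in> {0..T}" for t
      using DERIV_minus[OF d\<phi>[OF that]] by simp
    moreover have "((\<lambda>t. - \<psi> t) has_real_derivative - (- \<phi> t)) (at t within {0..T})" if "t \<in> {0..T}" for t
      using DERIV_minus[OF d\<psi>[OF that]] by simp
    ultimately show ?thesis using main[of "\<lambda>t. - \<phi> t" "\<lambda>t. - \<psi> t"] nz t12(4,5) by auto
  qed
  then show thesis using that by blast
qed

lemma zeros_spaced:
  fixes \<phi> \<psi> q :: "real \<Rightarrow> real"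
  assumes "\<And>t. t \<in> {0..T} \<Longrightarrow> (\<phi> has_real_derivative q t * \<psi> t) (at t within {0..T})"
    and "\<And>t. t \<in> {0..T} \<Longrightarrow> (\<psi> has_real_derivative - \<phi> t) (at t within {0..T})"
    and "\<And>t. q t \<le> 1"
    and "\<And>t. t \<in> {0..T} \<Longrightarrow> \<psi> t = 0 \<Longrightarrow> \<phi> t \<noteq> 0"
    and "s \<in> {0..T}" "t \<in> {0..T}" "s < t" "\<psi> s = 0" "\<psi> t = 0"
  shows "pi \<le> t - s"
  by (rule next_zero[OF assms(1-4) assms(5-9)]) auto

section \<open>Existence of optimal trajectories and the maximum principle\<close>

text \<open>
  Trajectories leaving the origin, that is, reversed in time. The Lipschitz function \<open>W\<close> stands for the integral of
  the control, so that compactness of the set of controls is the theorem of Arzela and Ascoli.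
\<close>

definition relaxed_trajectory ::
  "real \<Rightarrow> real \<Rightarrow> (real \<Rightarrow> real) \<Rightarrow> (real \<Rightarrow> real) \<Rightarrow> (real \<Rightarrow> real) \<Rightarrow> bool"
  where "relaxed_trajectory \<epsilon> T W x y \<longleftrightarrow>
    0 \<le> T \<and> (\<forall>s\<in>{0..T}. \<forall>t\<in>{0..T}. \<bar>W s - W t\<bar> \<le> \<bar>s - t\<bar>) \<and> W 0 = 0 \<and>
    continuous_on {0..T} x \<and> continuous_on {0..T} y \<and>
    (\<forall>t\<in>{0..T}. x t = integral {0..t} y \<and> y t = \<epsilon> * W t - integral {0..t} (\<lambda>s. sin (x s)))"

lemma lipschitz_continuous_on:
  fixes W :: "real \<Rightarrow> real"
  assumes "\<And>s t. s \<in> A \<Longrightarrow> t \<in> A \<Longrightarrow> \<bar>W s - W t\<bar> \<le> \<bar>s - t\<bar>"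
  shows "continuous_on A W"
  by (rule lipschitz_on_continuous_on[of 1]) (use assms in \<open>auto intro!: lipschitz_onI simp: dist_real_def\<close>)

lemma abs_sin_diff_le: "\<bar>sin a - sin b\<bar> \<le> \<bar>a - b\<bar>" for a b :: real
proof -
  have "\<bar>sin a - sin b\<bar> = 2 * \<bar>sin ((a - b) / 2)\<bar> * \<bar>cos ((a + b) / 2)\<bar>"
    by (simp add: sin_diff_sin abs_mult)
  also have "\<dots> \<le> 2 * \<bar>(a - b) / 2\<bar> * 1"
    by (intro mult_mono abs_sin_x_le_abs_x) auto
  finally show ?thesis by simp
qed

lemma relaxed_trajectoryD:
  assumes "relaxed_trajectory \<epsilon> T W x y"
  shows "0 \<le> T" "\<And>s t. s \<in> {0..T} \<Longrightarrow> t \<in> {0..T} \<Longrightarrow> \<bar>W s - W t\<bar> \<le> \<bar>s - t\<bar>" "W 0 = 0"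
    "continuous_on {0..T} x" "continuous_on {0..T} y"
  using assms unfolding relaxed_trajectory_def by blast+

lemma relaxed_trajectory_exists:
  assumes T: "0 \<le> T" and W: "\<And>s t. s \<in> {0..T} \<Longrightarrow> t \<in> {0..T} \<Longrightarrow> \<bar>W s - W t\<bar> \<le> \<bar>s - t\<bar>" "W 0 = 0"
  obtains x y where "relaxed_trajectory \<epsilon> T W x y"
proof -
  define F where "F t z = (snd z, - sin (fst z))" for t :: real and z :: "real \<times> real"
  have cW: "continuous_on {0..T} W" by (rule lipschitz_continuous_on[OF W(1)])
  have lipF: "norm (F t z - F t w) \<le> 2 * norm (z - w)" if "t \<in> {0..T}" for t z w
  proof -
    have "norm (F t z - F t w) \<le> norm (snd z - snd w) + norm (- sin (fst z) - (- sin (fst w)))"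
      unfolding F_def diff_Pair by (rule norm_Pair_le)
    also have "\<dots> \<le> norm (z - w) + norm (z - w)"
      using abs_fst_snd_le_norm[of "z - w"] abs_sin_diff_le[of "fst w" "fst z"] by (intro add_mono) auto
    finally show ?thesis by simp
  qed
  have cF': "continuous_on ({0..T} \<times> UNIV) (\<lambda>(t, z). F t z)"
    unfolding split_beta F_def by (intro continuous_intros)
  have ch: "continuous_on {0..T} (\<lambda>t. (0 :: real, \<epsilon> * W t))" by (intro continuous_intros cW)
  obtain z where z: "continuous_on {0..T} z"
    "\<And>t. t \<in> {0..T} \<Longrightarrow> z t = (0, \<epsilon> * W t) + integral {0..t} (\<lambda>s. F s (z s))"
    using picard_existence[OF T zero_less_numeral ch cF' lipF] by blast
  have cF: "continuous_on {0..T} (\<lambda>s. F s (z s))" unfolding F_def by (intro continuous_intros z)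
  have i1: "integral {0..t} (\<lambda>s. F s (z s)) = (integral {0..t} (\<lambda>s. snd (z s)), integral {0..t} (\<lambda>s. - sin (fst (z s))))"
    if "t \<in> {0..T}" for t
  proof -
    have "(\<lambda>s. F s (z s)) integrable_on {0..t}"
      using that by (intro integrable_continuous_real continuous_on_subset[OF cF]) auto
    from integral_linear[OF this bounded_linear_fst] integral_linear[OF this bounded_linear_snd]
    show ?thesis by (simp add: F_def o_def prod_eq_iff)
  qed
  show thesis
  proof (rule that[of "\<lambda>t. fst (z t)" "\<lambda>t. snd (z t)"])
    show "relaxed_trajectory \<epsilon> T W (\<lambda>t. fst (z t)) (\<lambda>t. snd (z t))"
      unfolding relaxed_trajectory_def
      using T W z i1 by (auto intro!: continuous_intros simp: prod_eq_iff)
  qed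
qed

lemma relaxed_trajectory_restrict:
  "relaxed_trajectory \<epsilon> T W x y \<Longrightarrow> 0 \<le> S \<Longrightarrow> S \<le> T \<Longrightarrow> relaxed_trajectory \<epsilon> S W x y"
  unfolding relaxed_trajectory_def by (auto intro: continuous_on_subset)

text \<open>Gronwall for the sum of the two deviations. Only the uniform distance of the primitives
  \<open>W\<close> and \<open>V\<close> enters, not that of the controls, so uniform limits from
  Arzela-Ascoli suffice. The case \<eta> = 0 is uniqueness.\<close>

lemma relaxed_trajectory_stable:
  assumes \<epsilon>: "0 \<le> \<epsilon>" and 1: "relaxed_trajectory \<epsilon> T W x y" and 2: "relaxed_trajectory \<epsilon> T V x' y'"
    and \<eta>: "\<And>t. t \<in> {0..T} \<Longrightarrow> \<bar>W t - V t\<bar> \<le> \<eta>" and t: "t \<in> {0..T}"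
  shows "\<bar>x t - x' t\<bar> + \<bar>y t - y' t\<bar> \<le> \<epsilon> * \<eta> * exp T"
proof -
  have c: "continuous_on {0..T} x" "continuous_on {0..T} y" "continuous_on {0..T} x'" "continuous_on {0..T} y'"
    using 1 2 by (auto simp: relaxed_trajectory_def)
  define v where "v t = \<bar>x t - x' t\<bar> + \<bar>y t - y' t\<bar>" for t
  have cv: "continuous_on {0..T} v" unfolding v_def by (intro continuous_intros c)
  have "v t \<le> \<epsilon> * \<eta> * exp (1 * t)"
  proof (rule gronwall_integral[OF cv _ _ t])
    fix t assume t: "t \<in> {0..T}"
    have ct: "continuous_on {0..t} f" if "continuous_on {0..T} f" for f :: "real \<Rightarrow> real"
      using t by (intro continuous_on_subset[OF that]) auto
    note ints = integrable_continuous_real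
    have "x t - x' t = integral {0..t} (\<lambda>s. y s - y' s)"
      using 1 2 t by (subst integral_diff) (auto simp: relaxed_trajectory_def intro!: ints ct c)
    also have "\<bar>\<dots>\<bar> \<le> integral {0..t} (\<lambda>s. \<bar>y s - y' s\<bar>)"
      unfolding real_norm_def[symmetric]
      by (intro integral_norm_bound_integral ints continuous_intros ct c) auto
    finally have a: "\<bar>x t - x' t\<bar> \<le> integral {0..t} (\<lambda>s. \<bar>y s - y' s\<bar>)" .
    have "y t - y' t = \<epsilon> * (W t - V t) - integral {0..t} (\<lambda>s. sin (x s) - sin (x' s))"
      using 1 2 t by (subst integral_diff) (auto simp: relaxed_trajectory_def algebra_simps intro!: ints ct c continuous_intros)
    then have "\<bar>y t - y' t\<bar> \<le> \<bar>\<epsilon> * (W t - V t)\<bar> + \<bar>integral {0..t} (\<lambda>s. sin (x s) - sin (x' s))\<bar>" by linarith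
    also have "\<dots> \<le> \<epsilon> * \<eta> + integral {0..t} (\<lambda>s. \<bar>x s - x' s\<bar>)"
    proof (rule add_mono)
      show "\<bar>\<epsilon> * (W t - V t)\<bar> \<le> \<epsilon> * \<eta>" using \<eta>[OF t] \<epsilon> by (auto simp: abs_mult intro!: mult_left_mono)
      show "\<bar>integral {0..t} (\<lambda>s. sin (x s) - sin (x' s))\<bar> \<le> integral {0..t} (\<lambda>s. \<bar>x s - x' s\<bar>)"
        unfolding real_norm_def[symmetric]
        by (intro integral_norm_bound_integral ints continuous_intros ct c) (use abs_sin_diff_le in auto)
    qed
    finally have b: "\<bar>y t - y' t\<bar> \<le> \<epsilon> * \<eta> + integral {0..t} (\<lambda>s. \<bar>x s - x' s\<bar>)" .
    have "integral {0..t} v = integral {0..t} (\<lambda>s. \<bar>x s - x' s\<bar>) + integral {0..t} (\<lambda>s. \<bar>y s - y' s\<bar>)"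
      unfolding v_def by (intro integral_add ints continuous_intros ct c)
    then show "v t \<le> \<epsilon> * \<eta> + 1 * integral {0..t} v" using a b by (simp add: v_def)
  qed auto
  also have "\<dots> \<le> \<epsilon> * \<eta> * exp T"
  proof -
    have "0 \<le> \<eta>" using \<eta>[OF t] by linarith
    then show ?thesis using \<epsilon> t by (intro mult_left_mono) auto
  qed
  finally show ?thesis by (simp add: v_def)
qed

text \<open>\<open>y\<close> inherits only Lipschitz regularity from \<open>W\<close>, but y -
  \<epsilon> W is differentiable everywhere; the calculus below works with this difference.\<close>

lemma relaxed_trajectory_derivs:
  assumes "relaxed_trajectory \<epsilon> T W x y" "t \<in> {0..T}"
  shows "(x has_real_derivative y t) (at t within {0..T})"
    "((\<lambda>t. y t - \<epsilon> * W t) has_real_derivative - sin (x t)) (at t within {0..T})"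
proof -
  have c: "continuous_on {0..T} x" "continuous_on {0..T} y" and
    e: "\<And>t. t \<in> {0..T} \<Longrightarrow> x t = integral {0..t} y" "\<And>t. t \<in> {0..T} \<Longrightarrow> y t = \<epsilon> * W t - integral {0..t} (\<lambda>s. sin (x s))"
    using assms(1) by (auto simp: relaxed_trajectory_def)
  have "((\<lambda>t. integral {0..t} y) has_real_derivative y t) (at t within {0..T})"
    by (intro integral_has_real_derivative c assms)
  then show "(x has_real_derivative y t) (at t within {0..T})"
    by (rule has_field_derivative_transform_within[of _ _ _ _ 1]) (use assms(2) e in auto)
  have "((\<lambda>t. integral {0..t} (\<lambda>s. sin (x s))) has_real_derivative sin (x t)) (at t within {0..T})"
    by (intro integral_has_real_derivative continuous_intros c assms)
  from DERIV_minus[OF this] show "((\<lambda>t. y t - \<epsilon> * W t) has_real_derivative - sin (x t)) (at t within {0..T})"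
    by (rule has_field_derivative_transform_within[of _ _ _ _ 1]) (use assms(2) e in auto)
qed

text \<open>In reversed time all competitors leave the same state and only their ends differ, which
  suits a problem with free end. \<open>W\<close> is found by solving the velocity equation for it;
  the \<epsilon>-scaled Lipschitz bound is |u| \<le> 1 integrated. Subtracting \<open>x T\<close>, a
  multiple of 2 \<pi>, makes the lift start at 0.\<close>

lemma controlled_pendulum_reverse_relaxed:
  assumes \<epsilon>: "0 < \<epsilon>" and cp: "controlled_pendulum \<epsilon> T u x y" and end0: "y T = 0"
    and s0: "sin (x T) = 0" "cos (x T) = 1"
  obtains W where "relaxed_trajectory \<epsilon> T W (\<lambda>t. x (T - t) - x T) (\<lambda>t. - y (T - t))"
proof -
  have T: "0 \<le> T" and u: "\<And>t. t \<in> {0..T} \<Longrightarrow> \<bar>u t\<bar> \<le> 1"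
    and ix: "\<And>t. t \<in> {0..T} \<Longrightarrow> (y has_integral (x t - x 0)) {0..t}"
    and iy: "\<And>t. t \<in> {0..T} \<Longrightarrow> ((\<lambda>s. - sin (x s) + \<epsilon> * u s) has_integral (y t - y 0)) {0..t}"
    using cp by (auto simp: controlled_pendulum_def)
  note cx = controlled_pendulum_continuous(1)[OF cp] and cy = controlled_pendulum_continuous(2)[OF cp]
  have cr: "continuous_on {0..T} (\<lambda>t. f (T - t))" if "continuous_on {0..T} f" for f :: "real \<Rightarrow> real"
    by (rule continuous_on_compose2[OF that]) (auto intro!: continuous_intros)
  have drev: "((\<lambda>t. f (T - t)) has_real_derivative - f' (T - t)) (at t)"
    if "(f has_real_derivative f' (T - t)) (at (T - t))" for f f' :: "real \<Rightarrow> real" and t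
  proof -
    have "((\<lambda>t. T - t) has_real_derivative - 1) (at t)" by (auto intro!: derivative_eq_intros)
    from DERIV_chain'[OF this that] show ?thesis by simp
  qed
  have dx: "(x has_real_derivative y t) (at t)" if "t \<in> {0<..<T}" for t
    by (rule has_real_derivative_of_has_integral[OF ix that])
      (use that cy in \<open>auto intro: continuous_on_interior\<close>)
  define I where "I t = integral {0..t} (\<lambda>s. sin (x s))" for t
  have cI: "continuous_on {0..T} I" unfolding I_def
    by (intro indefinite_integral_continuous_1 integrable_continuous_real continuous_intros cx)
  have dI: "(I has_real_derivative sin (x t)) (at t)" if "t \<in> {0<..<T}" for t
  proof -
    have "(I has_real_derivative sin (x t)) (at t within {0..T})"
      unfolding I_def using that by (intro integral_has_real_derivative continuous_intros cx) auto
    then show ?thesis using that by (simp add: at_within_Icc_at)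
  qed
  define W where "W t = (- y (T - t) + (I T - I (T - t))) / \<epsilon>" for t
  have key: "\<bar>(y b - y a) + (I b - I a)\<bar> \<le> \<epsilon> * (b - a)" if ab: "0 \<le> a" "a \<le> b" "b \<le> T" for a b
  proof -
    have isx: "((\<lambda>s. sin (x s)) has_integral I t) {0..t}" if "t \<in> {0..T}" for t
      unfolding I_def using that
      by (intro integrable_integral integrable_continuous_real continuous_intros continuous_on_subset[OF cx]) auto
    have iu: "((\<lambda>s. \<epsilon> * u s) has_integral ((y t - y 0) + I t)) {0..t}" if "t \<in> {0..T}" for t
      using has_integral_add[OF iy[OF that] isx[OF that]] by simp
    have b0: "b \<in> {0..T}" and a0: "a \<in> {0..T}" using ab by auto
    have int0: "(\<lambda>s. \<epsilon> * u s) integrable_on {0..b}" by (rule has_integral_integrable[OF iu[OF b0]])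
    have int: "(\<lambda>s. \<epsilon> * u s) integrable_on {a..b}"
      by (rule integrable_subinterval_real[OF int0]) (use ab in auto)
    have "integral {0..a} (\<lambda>s. \<epsilon> * u s) + integral {a..b} (\<lambda>s. \<epsilon> * u s) = integral {0..b} (\<lambda>s. \<epsilon> * u s)"
      by (rule Henstock_Kurzweil_Integration.integral_combine[OF _ _ int0]) (use ab in auto)
    then have "integral {a..b} (\<lambda>s. \<epsilon> * u s) = (y b - y a) + (I b - I a)"
      using integral_unique[OF iu[OF a0]] integral_unique[OF iu[OF b0]] by simp
    moreover have "norm (integral {a..b} (\<lambda>s. \<epsilon> * u s)) \<le> integral {a..b} (\<lambda>_. \<epsilon>)"
      by (rule integral_norm_bound_integral[OF int]) (use u ab \<epsilon> in \<open>auto simp: abs_mult mult_left_le\<close>)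
    ultimately show ?thesis using ab by (simp add: mult.commute)
  qed
  show thesis
  proof (rule that)
    have sh: "sin (z - x T) = sin z" for z using s0 by (simp add: sin_diff)
    have Wl: "\<bar>W s - W t\<bar> \<le> \<bar>s - t\<bar>" if st: "s \<in> {0..T}" "t \<in> {0..T}" "s \<le> t" for s t
    proof -
      have eW: "\<epsilon> * W r = - y (T - r) + (I T - I (T - r))" for r using \<epsilon> by (simp add: W_def)
      have "\<epsilon> * (W s - W t) = - ((y (T - s) - y (T - t)) + (I (T - s) - I (T - t)))"
        by (simp add: right_diff_distrib eW)
      then have "\<bar>\<epsilon> * (W s - W t)\<bar> = \<bar>(y (T - s) - y (T - t)) + (I (T - s) - I (T - t))\<bar>"
        by (simp only: abs_minus_cancel)
      also have "\<dots> \<le> \<epsilon> * \<bar>s - t\<bar>" using key[of "T - t" "T - s"] st by simp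
      finally show ?thesis using \<epsilon> by (simp add: abs_mult)
    qed
    have X: "x (T - t) - x T = integral {0..t} (\<lambda>t. - y (T - t))" if t: "t \<in> {0..T}" for t
    proof -
      have "((\<lambda>t. - y (T - t)) has_integral (x (T - t) - x (T - 0))) {0..t}"
      proof (rule fundamental_theorem_of_calculus_interior_strong[of "{}"])
        show "continuous_on {0..t} (\<lambda>t. x (T - t))" using t by (intro continuous_on_subset[OF cr[OF cx]]) auto
        show "((\<lambda>t. x (T - t)) has_vector_derivative - y (T - s)) (at s)" if "s \<in> {0<..<t} - {}" for s
          using drev[of x y s, OF dx] that t by (auto simp: has_real_derivative_iff_has_vector_derivative)
      qed (use t in auto)
      from integral_unique[OF this] show ?thesis by simp
    qed
    have IT: "integral {0..t} (\<lambda>s. sin (x (T - s) - x T)) = I T - I (T - t)" if t: "t \<in> {0..T}" for t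
    proof -
      have "((\<lambda>s. sin (x (T - s) - x T)) has_integral (- I (T - t) - - I (T - 0))) {0..t}"
      proof (rule fundamental_theorem_of_calculus_interior_strong[of "{}"])
        show "continuous_on {0..t} (\<lambda>t. - I (T - t))" using t by (intro continuous_intros continuous_on_subset[OF cr[OF cI]]) auto
        show "((\<lambda>t. - I (T - t)) has_vector_derivative sin (x (T - s) - x T)) (at s)" if "s \<in> {0<..<t} - {}" for s
          using DERIV_minus[OF drev[of I "\<lambda>t. sin (x t)" s, OF dI]] that t by (auto simp: sh has_real_derivative_iff_has_vector_derivative)
      qed (use t in auto)
      from integral_unique[OF this] show ?thesis by simp
    qed
    show "relaxed_trajectory \<epsilon> T W (\<lambda>t. x (T - t) - x T) (\<lambda>t. - y (T - t))"
      unfolding relaxed_trajectory_def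
    proof (intro conjI ballI)
      show "0 \<le> T" by (rule T)
      show "\<bar>W s - W t\<bar> \<le> \<bar>s - t\<bar>" if "s \<in> {0..T}" "t \<in> {0..T}" for s t
        using Wl[of s t] Wl[of t s] that by (cases "s \<le> t") (auto simp: abs_minus_commute)
      show "W 0 = 0" by (simp add: W_def end0)
      show "continuous_on {0..T} (\<lambda>t. x (T - t) - x T)" by (intro continuous_intros cr cx)
      show "continuous_on {0..T} (\<lambda>t. - y (T - t))" by (intro continuous_intros cr cy)
      fix t assume t: "t \<in> {0..T}"
      show "x (T - t) - x T = integral {0..t} (\<lambda>t. - y (T - t))" by (rule X[OF t])
      show "- y (T - t) = \<epsilon> * W t - integral {0..t} (\<lambda>s. sin (x (T - s) - x T))"
        using \<epsilon> by (simp add: IT[OF t] W_def)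
    qed
  qed
qed

section \<open>The adjoint equation, variations and existence of a minimiser\<close>

lemma linear_adjoint_exists:
  fixes q :: "real \<Rightarrow> real"
  assumes T: "0 \<le> T" and q: "continuous_on {0..T} q" "\<And>t. \<bar>q t\<bar> \<le> 1"
  obtains \<phi> \<psi> where "\<phi> T = a" "\<psi> T = b"
    "\<And>t. t \<in> {0..T} \<Longrightarrow> (\<phi> has_real_derivative q t * \<psi> t) (at t within {0..T})"
    "\<And>t. t \<in> {0..T} \<Longrightarrow> (\<psi> has_real_derivative - \<phi> t) (at t within {0..T})"
proof -
  define F where "F t z = (- q (T - t) * snd z, fst z)" for t :: real and z :: "real \<times> real"
  have cq: "continuous_on {0..T} (\<lambda>t. q (T - t))"
    by (rule continuous_on_compose2[OF q(1)]) (auto intro!: continuous_intros)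
  have lipF: "norm (F t z - F t w) \<le> 2 * norm (z - w)" if "t \<in> {0..T}" for t z w
  proof -
    have "norm (F t z - F t w) \<le> norm (- q (T - t) * snd z - (- q (T - t) * snd w)) + norm (fst z - fst w)"
      unfolding F_def diff_Pair by (rule norm_Pair_le)
    also have "- q (T - t) * snd z - (- q (T - t) * snd w) = - q (T - t) * snd (z - w)" by (simp add: algebra_simps)
    also have "norm (- q (T - t) * snd (z - w)) + norm (fst z - fst w) \<le> 1 * norm (z - w) + norm (z - w)"
    proof (rule add_mono)
      show "norm (- q (T - t) * snd (z - w)) \<le> 1 * norm (z - w)"
        unfolding norm_mult by (rule mult_mono) (use abs_fst_snd_le_norm[of "z - w"] q(2)[of "T - t"] in auto)
    qed (use abs_fst_snd_le_norm[of "z - w"] in auto)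
    finally show ?thesis by simp
  qed
  have cF: "continuous_on ({0..T} \<times> UNIV) (\<lambda>(t, z). F t z)"
    unfolding split_beta F_def
    by (intro continuous_intros continuous_on_compose2[OF cq]) auto
  have ch: "continuous_on {0..T} (\<lambda>t. (a, b))" by (intro continuous_intros)
  obtain z where z: "continuous_on {0..T} z"
    "\<And>t. t \<in> {0..T} \<Longrightarrow> z t = (a, b) + integral {0..t} (\<lambda>s. F s (z s))"
    using picard_existence[OF T zero_less_numeral ch cF lipF] by blast
  have cFz: "continuous_on {0..T} (\<lambda>s. F s (z s))" unfolding F_def by (intro continuous_intros cq z)
  have dz: "(z has_vector_derivative F t (z t)) (at t within {0..T})" if t: "t \<in> {0..T}" for t
  proof -
    have "((\<lambda>t. integral {0..t} (\<lambda>s. F s (z s))) has_vector_derivative F t (z t)) (at t within {0..T})"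
      using t by (intro integral_has_vector_derivative cFz) auto
    then have "((\<lambda>t. (a, b) + integral {0..t} (\<lambda>s. F s (z s))) has_vector_derivative F t (z t)) (at t within {0..T})"
      by (auto intro!: derivative_eq_intros)
    then show ?thesis
      by (rule has_vector_derivative_transform_within[of _ _ _ _ 1]) (use t z(2) in auto)
  qed
  have d: "((\<lambda>t. f (z t)) has_real_derivative f (F t (z t))) (at t within {0..T})"
    if "bounded_linear f" "t \<in> {0..T}" for f :: "real \<times> real \<Rightarrow> real" and t
    using bounded_linear.has_vector_derivative[OF that(1) dz[OF that(2)]]
    by (simp add: has_real_derivative_iff_has_vector_derivative)
  have im: "(\<lambda>t. T - t) ` {0..T} = {0..T}"
  proof (intro equalityI subsetI)
    fix t assume "t \<in> {0..T}" then show "t \<in> (\<lambda>t. T - t) ` {0..T}" by (intro image_eqI[of _ _ "T - t"]) auto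
  qed auto
  have dr: "((\<lambda>t. f (z (T - t))) has_real_derivative - f (F (T - t) (z (T - t)))) (at t within {0..T})"
    if "bounded_linear f" "t \<in> {0..T}" for f :: "real \<times> real \<Rightarrow> real" and t
  proof -
    have 1: "((\<lambda>t. f (z t)) has_real_derivative f (F (T - t) (z (T - t)))) (at (T - t) within (\<lambda>t. T - t) ` {0..T})"
      unfolding im by (rule d[OF that(1)]) (use that in auto)
    have 2: "((\<lambda>t. T - t) has_real_derivative - 1) (at t within {0..T})" by (auto intro!: derivative_eq_intros)
    show ?thesis using DERIV_image_chain[OF 1 2] by (simp add: o_def)
  qed
  show thesis
  proof (rule that[of "\<lambda>t. fst (z (T - t))" "\<lambda>t. snd (z (T - t))"])
    show "fst (z (T - T)) = a" "snd (z (T - T)) = b" using z(2)[of 0] T by auto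
    show "((\<lambda>t. fst (z (T - t))) has_real_derivative q t * snd (z (T - t))) (at t within {0..T})" if "t \<in> {0..T}" for t
      using dr[OF bounded_linear_fst that] by (simp add: F_def)
    show "((\<lambda>t. snd (z (T - t))) has_real_derivative - fst (z (T - t))) (at t within {0..T})" if "t \<in> {0..T}" for t
      using dr[OF bounded_linear_snd that] by (simp add: F_def)
  qed
qed

lemma abs_sin_taylor_le: "\<bar>sin (a + d) - sin a - d * cos a\<bar> \<le> d\<^sup>2" for a d :: real
proof -
  have pos: "\<bar>sin (a + d) - sin a - d * cos a\<bar> \<le> d\<^sup>2" if d: "0 \<le> d" for a d :: real
  proof -
    have der: "((\<lambda>s. sin (a + s) - s * cos a) has_real_derivative cos (a + s) - cos a) (at s)" for s
      by (auto intro!: derivative_eq_intros)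
    have cd: "\<bar>cos (a + s) - cos a\<bar> \<le> d" if "s \<in> {0<..<d}" for s
      using abs_sin_diff_le[of "pi / 2 - (a + s)" "pi / 2 - a"] that by (simp add: sin_diff)
    have c: "continuous_on {0..d} (\<lambda>s. sin (a + s) - s * cos a)" by (intro continuous_intros)
    have "(sin (a + d) - d * cos a) - (sin (a + 0) - 0 * cos a) \<le> d * (d - 0)"
      by (rule increment_le[OF _ d c der]) (use cd in \<open>auto simp: abs_le_iff\<close>)
    moreover have "- d * (d - 0) \<le> (sin (a + d) - d * cos a) - (sin (a + 0) - 0 * cos a)"
      by (rule increment_ge[OF _ d c der]) (use cd in \<open>fastforce simp: abs_le_iff\<close>)+
    ultimately show ?thesis by (simp add: power2_eq_square abs_le_iff)
  qed
  show ?thesis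
  proof (cases "0 \<le> d")
    case True then show ?thesis by (rule pos)
  next
    case False
    then have "\<bar>sin (- a + - d) - sin (- a) - (- d) * cos (- a)\<bar> \<le> (- d)\<^sup>2" by (intro pos) auto
    moreover have "sin (- a + - d) = - sin (a + d)" using sin_minus[of "a + d"] by (simp del: sin_minus)
    ultimately show ?thesis by (simp add: abs_minus_commute)
  qed
qed

lemma cos_taylor_le: "2 * cos a - 2 * cos (a + d) \<le> 2 * d * sin a + 2 * d\<^sup>2" for a d :: real
  using abs_sin_taylor_le[of "pi / 2 + a" d] by (simp add: sin_add cos_add abs_le_iff algebra_simps)

text \<open>The pairing of adjoint and linearised state. The control enters through \<psi>(T) (V -
  W)(T) plus the integral of \<phi> (V - W), which is the integral of \<psi> against d(V - W) after
  integration by parts; thus no derivative of \<open>V\<close> or \<open>W\<close> is needed. The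
  error is the quadratic Taylor remainder of sin along the path.\<close>

lemma adjoint_variation:
  assumes \<epsilon>: "0 \<le> \<epsilon>" and 1: "relaxed_trajectory \<epsilon> T W x y" and 2: "relaxed_trajectory \<epsilon> T V x' y'"
    and d\<phi>: "\<And>t. t \<in> {0..T} \<Longrightarrow> (\<phi> has_real_derivative cos (x t) * \<psi> t) (at t within {0..T})"
    and d\<psi>: "\<And>t. t \<in> {0..T} \<Longrightarrow> (\<psi> has_real_derivative - \<phi> t) (at t within {0..T})"
    and K: "\<And>t. t \<in> {0..T} \<Longrightarrow> \<bar>\<psi> t\<bar> \<le> K" and \<eta>: "\<And>t. t \<in> {0..T} \<Longrightarrow> \<bar>x' t - x t\<bar> \<le> \<eta>"
  shows "\<bar>\<phi> T * (x' T - x T) + \<psi> T * (y' T - y T)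
     - \<epsilon> * (\<psi> T * (V T - W T) + integral {0..T} (\<lambda>t. \<phi> t * (V t - W t)))\<bar> \<le> K * \<eta>\<^sup>2 * T"
proof -
  have T: "0 \<le> T" using 1 by (simp add: relaxed_trajectory_def)
  have cW: "continuous_on {0..T} W" by (rule lipschitz_continuous_on) (use 1 in \<open>auto simp: relaxed_trajectory_def\<close>)
  have cV: "continuous_on {0..T} V" by (rule lipschitz_continuous_on) (use 2 in \<open>auto simp: relaxed_trajectory_def\<close>)
  have cs: "continuous_on {0..T} f" if "\<And>t. t \<in> {0..T} \<Longrightarrow> (f has_real_derivative f' t) (at t within {0..T})" for f f'
    unfolding continuous_on_eq_continuous_within by (intro ballI DERIV_continuous[OF that])
  have c\<phi>: "continuous_on {0..T} \<phi>" by (rule cs[OF d\<phi>])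
  have c\<psi>: "continuous_on {0..T} \<psi>" by (rule cs[OF d\<psi>])
  have c: "continuous_on {0..T} x" "continuous_on {0..T} y" "continuous_on {0..T} x'" "continuous_on {0..T} y'"
    using 1 2 by (auto simp: relaxed_trajectory_def)
  have cD: "continuous_on {0..T} (\<lambda>t. \<phi> t * (V t - W t))" by (intro continuous_intros c\<phi> cV cW)
  \<comment> \<open>\<epsilon> W and \<epsilon> V are taken out of the velocities so that every
    factor is differentiable; the first-order terms then cancel in the derivative.\<close>
  define G where "G t = \<phi> t * (x' t - x t) + \<psi> t * ((y' t - \<epsilon> * V t) - (y t - \<epsilon> * W t))
     - \<epsilon> * integral {0..t} (\<lambda>t. \<phi> t * (V t - W t))" for t
  define G' where "G' t = - \<psi> t * (sin (x' t) - sin (x t) - (x' t - x t) * cos (x t))" for t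
  have cG: "continuous_on {0..T} G" unfolding G_def
    by (intro continuous_intros c c\<phi> c\<psi> cV cW indefinite_integral_continuous_1 integrable_continuous_real)
  have dG: "(G has_real_derivative G' t) (at t)" if t: "t \<in> {0<..<T}" for t
  proof -
    have t': "t \<in> {0..T}" using t by auto
    have w: "at t within {0..T} = at t" using t by (intro at_within_Icc_at) auto
    note d = relaxed_trajectory_derivs[OF 1 t', unfolded w] relaxed_trajectory_derivs[OF 2 t', unfolded w]
      d\<phi>[OF t', unfolded w] d\<psi>[OF t', unfolded w]
    have di: "((\<lambda>t. integral {0..t} (\<lambda>t. \<phi> t * (V t - W t))) has_real_derivative \<phi> t * (V t - W t)) (at t)"
      using integral_has_real_derivative[OF cD t'] w by simp
    have "(G has_real_derivative (cos (x t) * \<psi> t * (x' t - x t) + (y' t - y t) * \<phi> t)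
        + (- \<phi> t * ((y' t - \<epsilon> * V t) - (y t - \<epsilon> * W t)) + (- sin (x' t) - - sin (x t)) * \<psi> t)
        - \<epsilon> * (\<phi> t * (V t - W t))) (at t)"
      unfolding G_def by (intro DERIV_diff DERIV_add DERIV_mult DERIV_cmult d di)
    also have "(cos (x t) * \<psi> t * (x' t - x t) + (y' t - y t) * \<phi> t)
        + (- \<phi> t * ((y' t - \<epsilon> * V t) - (y t - \<epsilon> * W t)) + (- sin (x' t) - - sin (x t)) * \<psi> t)
        - \<epsilon> * (\<phi> t * (V t - W t)) = G' t"
      by (simp add: G'_def algebra_simps)
    finally show ?thesis .
  qed
  have G'b: "\<bar>G' t\<bar> \<le> K * \<eta>\<^sup>2" if t: "t \<in> {0..T}" for t
  proof -
    have "\<bar>sin (x' t) - sin (x t) - (x' t - x t) * cos (x t)\<bar> \<le> (x' t - x t)\<^sup>2"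
      using abs_sin_taylor_le[of "x t" "x' t - x t"] by simp
    also have "\<dots> = \<bar>x' t - x t\<bar>\<^sup>2" by simp
    also have "\<dots> \<le> \<eta>\<^sup>2" by (rule power_mono[OF \<eta>[OF t]]) simp
    finally show ?thesis using K[OF t] unfolding G'_def abs_mult abs_minus_cancel by (intro mult_mono) auto
  qed
  have "G T - G 0 \<le> K * \<eta>\<^sup>2 * (T - 0)"
  proof (rule increment_le[of "{}" 0 T G G'])
    show "G' t \<le> K * \<eta>\<^sup>2" if "t \<in> {0<..<T} - {}" for t
      using G'b[of t] that abs_le_D1 by auto
  qed (use T cG dG in auto)
  moreover have "- (K * \<eta>\<^sup>2) * (T - 0) \<le> G T - G 0"
  proof (rule increment_ge[of "{}" 0 T G G'])
    show "- (K * \<eta>\<^sup>2) \<le> G' t" if "t \<in> {0<..<T} - {}" for t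
      using abs_le_D2[OF G'b[of t]] that by auto
  qed (use T cG dG in auto)
  moreover have "G 0 = 0"
    using 1 2 T by (simp add: G_def relaxed_trajectory_def)
  moreover have "G T = \<phi> T * (x' T - x T) + \<psi> T * (y' T - y T)
     - \<epsilon> * (\<psi> T * (V T - W T) + integral {0..T} (\<lambda>t. \<phi> t * (V t - W t)))"
    by (simp add: G_def algebra_simps)
  ultimately show ?thesis by (simp add: abs_le_iff)
qed

lemma abs_clamp_diff_le: "\<bar>max a (min b s) - max a (min b t)\<bar> \<le> \<bar>s - t\<bar>" for a b s t :: real
proof -
  have 1: "\<bar>max a p - max a q\<bar> \<le> \<bar>p - q\<bar>" for p q :: real
    by (cases "a \<le> p"; cases "a \<le> q") (simp_all add: max_def)
  have 2: "\<bar>min b p - min b q\<bar> \<le> \<bar>p - q\<bar>" for p q :: real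
    by (cases "b \<le> p"; cases "b \<le> q") (simp_all add: min_def)
  show ?thesis by (rule order_trans[OF 1 2])
qed

text \<open>The direct method. The cost bounds the time, so a minimising sequence lives on one
  interval once each \<open>W\<close> is frozen after its own final time. Arzela-Ascoli and
  compactness of the times give a limit that is again 1-Lipschitz, and stability carries the end
  states along. The penalty is the squared distance to the point (xh, 0) when the cylinder is
  embedded in space as (cos x, sin x, y).\<close>

lemma relaxed_minimizer:
  fixes \<epsilon> M xh :: real
  defines "J \<equiv> \<lambda>T x y. T + M * (2 - 2 * cos (x T - xh) + (y T)\<^sup>2)"
  assumes \<epsilon>: "0 \<le> \<epsilon>" and M: "0 \<le> M"
  obtains T W x y where "relaxed_trajectory \<epsilon> T W x y"
    "\<And>T' W' x' y'. relaxed_trajectory \<epsilon> T' W' x' y' \<Longrightarrow> J T x y \<le> J T' x' y'"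
proof -
  define S where "S = {J T x y | T W x y. relaxed_trajectory \<epsilon> T W x y}"
  have T0: "T \<le> J T x y" for T x y
  proof -
    have "0 \<le> 2 - 2 * cos (x T - xh) + (y T)\<^sup>2" by (intro add_nonneg_nonneg) auto
    then show ?thesis using M by (simp add: J_def)
  qed
  have bdd: "bdd_below S"
  proof (rule bdd_belowI[of _ 0])
    fix j assume "j \<in> S"
    then obtain T W x y where j: "j = J T x y" "relaxed_trajectory \<epsilon> T W x y" unfolding S_def by blast
    then have "0 \<le> T" using relaxed_trajectoryD(1) by blast
    then show "0 \<le> j" using T0[of T x y] j by linarith
  qed
  have ne: "S \<noteq> {}"
  proof -
    have "relaxed_trajectory \<epsilon> 0 (\<lambda>_. 0) (\<lambda>_. 0) (\<lambda>_. 0)" by (simp add: relaxed_trajectory_def)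
    then show ?thesis unfolding S_def by blast
  qed
  define m where "m = Inf S"
  have low: "m \<le> J T x y" if "relaxed_trajectory \<epsilon> T W x y" for T W x y
    unfolding m_def by (rule cInf_lower[OF _ bdd]) (use that in \<open>auto simp: S_def\<close>)
  define B where "B = m + 1"
  have "\<exists>T W x y. relaxed_trajectory \<epsilon> T W x y \<and> J T x y < m + inverse (real (Suc n))" for n
  proof -
    have "Inf S < m + inverse (real (Suc n))" by (simp add: m_def)
    then obtain j where "j \<in> S" "j < m + inverse (real (Suc n))" using cInf_lessD[OF ne] by blast
    then show ?thesis unfolding S_def by blast
  qed
  then obtain Tn Wn xn yn where
    rel: "\<And>n. relaxed_trajectory \<epsilon> (Tn n) (Wn n) (xn n) (yn n)" and
    Jn: "\<And>n. J (Tn n) (xn n) (yn n) < m + inverse (real (Suc n))" by metis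
  have TB: "0 \<le> Tn n" "Tn n \<le> B" for n
  proof -
    show "0 \<le> Tn n" by (rule relaxed_trajectoryD(1)[OF rel])
    have "inverse (real (Suc n)) \<le> 1" by (simp add: field_simps)
    then show "Tn n \<le> B" using T0[of "Tn n" "xn n" "yn n"] Jn[of n] unfolding B_def by linarith
  qed
  have B0: "0 \<le> B" using TB[of 0] by linarith
  define V where "V n t = Wn n (max 0 (min (Tn n) t))" for n t
  have Vl: "\<bar>V n s - V n t\<bar> \<le> \<bar>s - t\<bar>" for n s t
  proof -
    have "\<bar>V n s - V n t\<bar> \<le> \<bar>max 0 (min (Tn n) s) - max 0 (min (Tn n) t)\<bar>"
    proof -
      have m: "max 0 (min (Tn n) s) \<in> {0..Tn n}" for s using TB(1)[of n] by simp
      have "\<forall>s\<in>{0..Tn n}. \<forall>t\<in>{0..Tn n}. \<bar>Wn n s - Wn n t\<bar> \<le> \<bar>s - t\<bar>"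
        using rel[of n] unfolding relaxed_trajectory_def by blast
      then show ?thesis unfolding V_def using m by blast
    qed
    also have "\<dots> \<le> \<bar>s - t\<bar>" by (rule abs_clamp_diff_le)
    finally show ?thesis .
  qed
  have V0: "V n 0 = 0" for n using relaxed_trajectoryD(3)[OF rel[of n]] TB(1)[of n] by (simp add: V_def)
  have "\<exists>X Y. relaxed_trajectory \<epsilon> B (V n) X Y" for n
    by (rule relaxed_trajectory_exists[OF B0, of "V n" \<epsilon>]) (rule Vl, rule V0, blast)
  then obtain X Y where XY: "\<And>n. relaxed_trajectory \<epsilon> B (V n) (X n) (Y n)" by metis
  \<comment> \<open>Stability with distance 0: freezing the control primitive after
    \<open>Tn n\<close> does not change the trajectory before.\<close>
  have agree: "X n (Tn n) = xn n (Tn n)" "Y n (Tn n) = yn n (Tn n)" for n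
  proof -
    have "\<bar>X n (Tn n) - xn n (Tn n)\<bar> + \<bar>Y n (Tn n) - yn n (Tn n)\<bar> \<le> \<epsilon> * 0 * exp (Tn n)"
    proof (rule relaxed_trajectory_stable[OF \<epsilon> relaxed_trajectory_restrict[OF XY TB] rel])
      show "\<bar>V n t - Wn n t\<bar> \<le> 0" if "t \<in> {0..Tn n}" for t using that by (simp add: V_def)
    qed (use TB in auto)
    then show "X n (Tn n) = xn n (Tn n)" "Y n (Tn n) = yn n (Tn n)" by auto
  qed
  obtain g :: "real \<Rightarrow> real" and k where g: "continuous_on {0..B} g" and k: "strict_mono (k :: nat \<Rightarrow> nat)" and
    unif: "\<And>e. 0 < e \<Longrightarrow> \<exists>N. \<forall>n x. n \<ge> N \<and> x \<in> {0..B} \<longrightarrow> norm (V (k n) x - g x) < e"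
  proof (rule Arzela_Ascoli[of "{0..B}" V B])
    show "norm (V n t) \<le> B" if "t \<in> {0..B}" for n t using Vl[of n t 0] V0[of n] that by simp
    show "\<exists>d>0. \<forall>n y. y \<in> {0..B} \<and> norm (t - y) < d \<longrightarrow> norm (V n t - V n y) < e"
      if "t \<in> {0..B}" "0 < e" for t e
      using Vl that by (intro exI[of _ e]) (auto intro: le_less_trans)
  qed (auto intro: that)
  have "\<forall>n. Tn (k n) \<in> {0..B}" using TB by auto
  from seq_compactE[OF compact_imp_seq_compact[OF compact_Icc] this] obtain T r where
    T: "T \<in> {0..B}" and r: "strict_mono (r :: nat \<Rightarrow> nat)" and lim: "((\<lambda>n. Tn (k n)) \<circ> r) \<longlonglongrightarrow> T" by blast
  define j where "j n = k (r n)" for n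
  have Tj: "(\<lambda>n. Tn (j n)) \<longlonglongrightarrow> T" using lim by (simp add: o_def j_def)
  have jn: "n \<le> j n" for n
    using strict_mono_imp_increasing[OF strict_mono_o[OF k r]] by (simp add: j_def)
  have unif': "\<exists>N. \<forall>n\<ge>N. \<forall>t\<in>{0..B}. \<bar>V (j n) t - g t\<bar> < e" if e: "0 < e" for e
  proof -
    obtain N where N: "\<And>n t. n \<ge> N \<Longrightarrow> t \<in> {0..B} \<Longrightarrow> norm (V (k n) t - g t) < e" using unif[OF e] by blast
    show ?thesis
    proof (intro exI[of _ N] allI impI ballI)
      fix n t assume "N \<le> n" "t \<in> {0..B}"
      then show "\<bar>V (j n) t - g t\<bar> < e"
        using N[of "r n" t] strict_mono_imp_increasing[OF r, of n] by (simp add: j_def)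
    qed
  qed
  have ptw: "(\<lambda>n. V (j n) t) \<longlonglongrightarrow> g t" if "t \<in> {0..B}" for t
    unfolding LIMSEQ_iff using unif' that by (fastforce simp: real_norm_def)
  have gl: "\<bar>g s - g t\<bar> \<le> \<bar>s - t\<bar>" if "s \<in> {0..B}" "t \<in> {0..B}" for s t
    by (rule LIMSEQ_le_const2[OF tendsto_rabs[OF tendsto_diff[OF ptw[OF that(1)] ptw[OF that(2)]]]]) (use Vl in auto)
  have g0: "g 0 = 0"
    using LIMSEQ_unique[OF ptw[of 0]] B0 V0 by auto
  obtain x y where xy: "relaxed_trajectory \<epsilon> B g x y"
    by (rule relaxed_trajectory_exists[OF B0 gl g0])
  have conv0: "(\<lambda>n. \<bar>X (j n) (Tn (j n)) - x (Tn (j n))\<bar> + \<bar>Y (j n) (Tn (j n)) - y (Tn (j n))\<bar>) \<longlonglongrightarrow> 0"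
  proof (rule LIMSEQ_I)
    fix e :: real assume e: "0 < e"
    define e' where "e' = e / (2 * (\<epsilon> + 1) * exp B)"
    have e': "0 < e'" using e \<epsilon> by (auto simp: e'_def intro!: divide_pos_pos mult_pos_pos)
    obtain N where N: "\<And>n t. n \<ge> N \<Longrightarrow> t \<in> {0..B} \<Longrightarrow> \<bar>V (j n) t - g t\<bar> < e'" using unif'[OF e'] by blast
    have "norm (\<bar>X (j n) (Tn (j n)) - x (Tn (j n))\<bar> + \<bar>Y (j n) (Tn (j n)) - y (Tn (j n))\<bar> - 0) < e" if n: "N \<le> n" for n
    proof -
      have "\<bar>X (j n) (Tn (j n)) - x (Tn (j n))\<bar> + \<bar>Y (j n) (Tn (j n)) - y (Tn (j n))\<bar> \<le> \<epsilon> * e' * exp B"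
        by (rule relaxed_trajectory_stable[OF \<epsilon> XY xy]) (use N[OF n] TB in \<open>auto intro: less_imp_le\<close>)
      also have "\<dots> \<le> (\<epsilon> + 1) * e' * exp B" using e' by (intro mult_right_mono) auto
      also have "\<dots> = e / 2"
      proof -
        have gen: "p * (e / (2 * p * q)) * q = e / 2" if "p \<noteq> 0" "q \<noteq> 0" for p q :: real using that by simp
        show ?thesis unfolding e'_def by (rule gen) (use \<epsilon> in auto)
      qed
      also have "\<dots> < e" using e by simp
      finally show ?thesis by simp
    qed
    then show "\<exists>N. \<forall>n\<ge>N. norm (\<bar>X (j n) (Tn (j n)) - x (Tn (j n))\<bar> + \<bar>Y (j n) (Tn (j n)) - y (Tn (j n))\<bar> - 0) < e" by blast
  qed
  have cxy: "continuous_on {0..B} x" "continuous_on {0..B} y" using relaxed_trajectoryD(4,5)[OF xy] .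
  have X0: "(\<lambda>n. X (j n) (Tn (j n)) - x (Tn (j n))) \<longlonglongrightarrow> 0"
    by (rule tendsto_rabs_zero_cancel, rule tendsto_sandwich[OF _ _ tendsto_const conv0]) auto
  have Y0: "(\<lambda>n. Y (j n) (Tn (j n)) - y (Tn (j n))) \<longlonglongrightarrow> 0"
    by (rule tendsto_rabs_zero_cancel, rule tendsto_sandwich[OF _ _ tendsto_const conv0]) auto
  have xT: "(\<lambda>n. x (Tn (j n))) \<longlonglongrightarrow> x T" "(\<lambda>n. y (Tn (j n))) \<longlonglongrightarrow> y T"
    using continuous_on_tendsto_compose[OF cxy(1) Tj T] continuous_on_tendsto_compose[OF cxy(2) Tj T] TB by auto
  have XT: "(\<lambda>n. xn (j n) (Tn (j n))) \<longlonglongrightarrow> x T"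
    using tendsto_add[OF X0 xT(1)] by (simp add: agree)
  have YT: "(\<lambda>n. yn (j n) (Tn (j n))) \<longlonglongrightarrow> y T"
    using tendsto_add[OF Y0 xT(2)] by (simp add: agree)
  have Jlim: "(\<lambda>n. J (Tn (j n)) (xn (j n)) (yn (j n))) \<longlonglongrightarrow> J T x y"
    unfolding J_def by (intro tendsto_intros Tj XT YT)
  have "(\<lambda>n. m + inverse (real (Suc n))) \<longlonglongrightarrow> m + 0"
    by (intro tendsto_intros LIMSEQ_inverse_real_of_nat)
  moreover have "J (Tn (j n)) (xn (j n)) (yn (j n)) \<le> m + inverse (real (Suc n))" for n
  proof -
    have "inverse (real (Suc (j n))) \<le> inverse (real (Suc n))" using jn[of n] by (intro le_imp_inverse_le) auto
    then show ?thesis using Jn[of "j n"] by linarith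
  qed
  ultimately have "J T x y \<le> m + 0" using Jlim by (intro LIMSEQ_le[OF Jlim]) auto
  then have "J T x y \<le> J T' x' y'" if "relaxed_trajectory \<epsilon> T' W' x' y'" for T' W' x' y'
    using low[OF that] by simp
  moreover have "relaxed_trajectory \<epsilon> T g x y" by (rule relaxed_trajectory_restrict[OF xy]) (use T in auto)
  ultimately show thesis by (rule that[rotated])
qed

section \<open>The maximum principle for the penalised problem\<close>

lemma relaxed_trajectory_y_lipschitz:
  assumes \<epsilon>: "0 \<le> \<epsilon>" and rel: "relaxed_trajectory \<epsilon> T W x y" and s: "s \<in> {0..T}" and t: "t \<in> {0..T}"
  shows "\<bar>y s - y t\<bar> \<le> (1 + \<epsilon>) * \<bar>s - t\<bar>"
proof -
  have main: "\<bar>y s - y t\<bar> \<le> (1 + \<epsilon>) * \<bar>s - t\<bar>" if "s \<le> t" "s \<in> {0..T}" "t \<in> {0..T}" for s t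
  proof -
    define h where "h r = y r - \<epsilon> * W r" for r
    have cW: "continuous_on {0..T} W" by (rule lipschitz_continuous_on[OF relaxed_trajectoryD(2)[OF rel]])
    have ch: "continuous_on {s..t} h" unfolding h_def
      using that by (intro continuous_intros continuous_on_subset[OF cW] continuous_on_subset[OF relaxed_trajectoryD(5)[OF rel]]) auto
    have dh: "(h has_real_derivative - sin (x r)) (at r)" if r: "r \<in> {s<..<t} - {}" for r
    proof -
      have "r \<in> {0..T}" "at r within {0..T} = at r" using r that \<open>s \<in> {0..T}\<close> \<open>t \<in> {0..T}\<close> by (auto intro!: at_within_Icc_at)
      then show ?thesis using relaxed_trajectory_derivs(2)[OF rel, of r] by (simp add: h_def[abs_def])
    qed
    have "h t - h s \<le> 1 * (t - s)" by (rule increment_le[OF _ that(1) ch dh]) auto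
    moreover have "- 1 * (t - s) \<le> h t - h s"
      by (rule increment_ge[OF _ that(1) ch dh]) auto
    moreover have "\<bar>\<epsilon> * (W t - W s)\<bar> \<le> \<epsilon> * (t - s)"
      using relaxed_trajectoryD(2)[OF rel, of t s] that \<epsilon> by (simp add: abs_mult mult_left_mono)
    moreover have "\<bar>p + q\<bar> \<le> r + v" if "p \<le> 1 * r" "- 1 * r \<le> p" "\<bar>q\<bar> \<le> v" for p q r v :: real
      using that by linarith
    ultimately have "\<bar>(h t - h s) + \<epsilon> * (W t - W s)\<bar> \<le> (t - s) + \<epsilon> * (t - s)" by blast
    moreover have "y s - y t = - ((h t - h s) + \<epsilon> * (W t - W s))" by (simp add: h_def algebra_simps)
    ultimately show ?thesis using that by (simp add: algebra_simps)
  qed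
  show ?thesis using main[of s t] main[of t s] s t by (cases "s \<le> t") (auto simp: abs_minus_commute)
qed

lemma has_real_derivative_min_at_left_end:
  fixes f :: "real \<Rightarrow> real"
  assumes d: "(f has_real_derivative D) (at a within {a..b})" and ab: "a < b"
    and min: "\<And>t. t \<in> {a..b} \<Longrightarrow> f a \<le> f t"
  shows "0 \<le> D"
proof -
  have "((\<lambda>t. (f t - f a) / (t - a)) \<longlongrightarrow> D) (at a within {a..b})"
    using d by (simp add: has_field_derivative_iff)
  moreover have "\<forall>\<^sub>F t in at a within {a..b}. 0 \<le> (f t - f a) / (t - a)"
    using min by (auto simp: eventually_at_filter intro!: always_eventually divide_nonneg_nonneg)
  moreover have "at a within {a..b} \<noteq> bot" using ab by (simp add: at_within_Icc_at_right trivial_limit_at_right_real)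
  ultimately show ?thesis using tendsto_lowerbound by blast
qed

lemma has_real_derivative_min_at_right_end:
  fixes f :: "real \<Rightarrow> real"
  assumes d: "(f has_real_derivative D) (at b within {a..b})" and ab: "a < b"
    and min: "\<And>t. t \<in> {a..b} \<Longrightarrow> f b \<le> f t"
  shows "D \<le> 0"
proof -
  have "((\<lambda>t. (f t - f b) / (t - b)) \<longlongrightarrow> D) (at b within {a..b})"
    using d by (simp add: has_field_derivative_iff)
  moreover have "\<forall>\<^sub>F t in at b within {a..b}. (f t - f b) / (t - b) \<le> 0"
    using min by (auto simp: eventually_at_filter intro!: always_eventually divide_nonneg_nonpos)
  moreover have "at b within {a..b} \<noteq> bot" using ab by (simp add: at_within_Icc_at_left trivial_limit_at_left_real)
  ultimately show ?thesis using tendsto_upperbound by blast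
qed

lemma has_real_derivative_zero_of_quadratic:
  fixes f :: "real \<Rightarrow> real"
  assumes "\<And>t. t \<in> A \<Longrightarrow> \<bar>f t\<bar> \<le> C * (t - a)\<^sup>2" "a \<in> A"
  shows "(f has_real_derivative 0) (at a within A)"
proof -
  have fa: "f a = 0" using assms(1)[OF assms(2)] by simp
  have lim: "((\<lambda>t. C * \<bar>t - a\<bar>) \<longlongrightarrow> C * \<bar>a - a\<bar>) (at a within A)" by (intro tendsto_intros)
  have "((\<lambda>t. (f t - f a) / (t - a)) \<longlongrightarrow> 0) (at a within A)"
  proof (rule tendsto_0_le[of "\<lambda>t. C * \<bar>t - a\<bar>" _ _ 1])
    show "((\<lambda>t. C * \<bar>t - a\<bar>) \<longlongrightarrow> 0) (at a within A)" using lim by simp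
    have "norm ((f t - f a) / (t - a)) \<le> norm (C * \<bar>t - a\<bar>) * 1" if t: "t \<in> A" "t \<noteq> a" for t
    proof -
      have "\<bar>f t\<bar> / \<bar>t - a\<bar> \<le> C * (t - a)\<^sup>2 / \<bar>t - a\<bar>" using assms(1)[OF t(1)] by (intro divide_right_mono) auto
      also have "(t - a)\<^sup>2 = \<bar>t - a\<bar> * \<bar>t - a\<bar>" by (simp add: power2_eq_square)
      also have "C * (\<bar>t - a\<bar> * \<bar>t - a\<bar>) / \<bar>t - a\<bar> = C * \<bar>t - a\<bar>"
      proof -
        have gen: "C * (r * r) / r = C * r" if "r \<noteq> 0" for r :: real using that by simp
        show ?thesis by (rule gen) (use t in simp)
      qed
      also have "\<dots> \<le> \<bar>C * \<bar>t - a\<bar>\<bar>" by (rule abs_ge_self)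
      finally show ?thesis by (simp add: fa)
    qed
    then show "\<forall>\<^sub>F t in at a within A. norm ((f t - f a) / (t - a)) \<le> norm (C * \<bar>t - a\<bar>) * 1"
      by (auto simp: eventually_at_filter intro!: always_eventually)
  qed
  then show ?thesis by (simp add: has_field_derivative_iff)
qed

text \<open>\<phi> and \<psi> end in the gradient of the penalty term with respect to the end state,
  so to first order a change of the end state changes the cost at fixed time by its pairing with the
  adjoint.\<close>

locale minimizer =
  fixes \<epsilon> M xh T :: real and W x y \<phi> \<psi> :: "real \<Rightarrow> real"
  assumes eps: "0 < \<epsilon>" and M: "0 < M" and T: "0 < T"
    and rel: "relaxed_trajectory \<epsilon> T W x y"
    and min: "\<And>T' W' x' y'. relaxed_trajectory \<epsilon> T' W' x' y' \<Longrightarrow>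
      T + M * (2 - 2 * cos (x T - xh) + (y T)\<^sup>2) \<le> T' + M * (2 - 2 * cos (x' T' - xh) + (y' T')\<^sup>2)"
    and \<phi>T: "\<phi> T = 2 * M * sin (x T - xh)" and \<psi>T: "\<psi> T = 2 * M * y T"
    and d\<phi>: "\<And>t. t \<in> {0..T} \<Longrightarrow> (\<phi> has_real_derivative cos (x t) * \<psi> t) (at t within {0..T})"
    and d\<psi>: "\<And>t. t \<in> {0..T} \<Longrightarrow> (\<psi> has_real_derivative - \<phi> t) (at t within {0..T})"
begin

lemma cont: "continuous_on {0..T} \<phi>" "continuous_on {0..T} \<psi>" "continuous_on {0..T} W"
  "continuous_on {0..T} x" "continuous_on {0..T} y"
proof -
  show "continuous_on {0..T} \<phi>" unfolding continuous_on_eq_continuous_within by (intro ballI DERIV_continuous[OF d\<phi>])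
  show "continuous_on {0..T} \<psi>" unfolding continuous_on_eq_continuous_within by (intro ballI DERIV_continuous[OF d\<psi>])
  show "continuous_on {0..T} W" by (rule lipschitz_continuous_on[OF relaxed_trajectoryD(2)[OF rel]])
qed (rule relaxed_trajectoryD[OF rel])+

lemma bounds: obtains K where "0 < K" "\<And>t. t \<in> {0..T} \<Longrightarrow> \<bar>\<phi> t\<bar> \<le> K" "\<And>t. t \<in> {0..T} \<Longrightarrow> \<bar>\<psi> t\<bar> \<le> K"
proof -
  have "bounded (\<phi> ` {0..T})" "bounded (\<psi> ` {0..T})"
    using compact_continuous_image[OF cont(1)] compact_continuous_image[OF cont(2)] compact_imp_bounded by blast+
  then obtain a b where "\<forall>t\<in>{0..T}. \<bar>\<phi> t\<bar> \<le> a" "\<forall>t\<in>{0..T}. \<bar>\<psi> t\<bar> \<le> b" by (auto simp: bounded_iff)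
  then show ?thesis using that[of "max 1 (max a b)"] by fastforce
qed

text \<open>The 1-Lipschitz functions vanishing at 0 form a convex set, so W + l (V - W) competes
  for every l up to 1. At fixed time its cost exceeds the minimum by at most l \<epsilon> times the
  expression claimed plus a term of order l^2; then l tends to 0.\<close>

lemma first_variation:
  assumes V: "\<And>s t. s \<in> {0..T} \<Longrightarrow> t \<in> {0..T} \<Longrightarrow> \<bar>V s - V t\<bar> \<le> \<bar>s - t\<bar>" "V 0 = 0"
  shows "0 \<le> \<psi> T * (V T - W T) + integral {0..T} (\<lambda>t. \<phi> t * (V t - W t))" (is "0 \<le> ?I")
proof -
  obtain K where K: "0 < K" "\<And>t. t \<in> {0..T} \<Longrightarrow> \<bar>\<psi> t\<bar> \<le> K" using bounds by metis
  note W = relaxed_trajectoryD(2,3)[OF rel]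
  define c where "c = \<epsilon> * (2 * T) * exp T"
  \<comment> \<open>The second-order errors: the sine remainder from
    \<open>adjoint_variation\<close> and the quadratic part of the penalty, for a state deviation of
    at most c l.\<close>
  define C where "C = K * c\<^sup>2 * T + 3 * M * c\<^sup>2"
  have Dle: "\<bar>V t - W t\<bar> \<le> 2 * T" if "t \<in> {0..T}" for t
    using V(1)[of t 0] W(1)[of t 0] V(2) W(2) that T by auto
  have main: "- C * l \<le> \<epsilon> * ?I" if l: "0 < l" "l \<le> 1" for l
  proof -
    define Wl where "Wl t = W t + l * (V t - W t)" for t
    have "\<bar>Wl s - Wl t\<bar> \<le> \<bar>s - t\<bar>" if st: "s \<in> {0..T}" "t \<in> {0..T}" for s t
    proof -
      have "Wl s - Wl t = (1 - l) * (W s - W t) + l * (V s - V t)" by (simp add: Wl_def algebra_simps)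
      also have "\<bar>\<dots>\<bar> \<le> (1 - l) * \<bar>W s - W t\<bar> + l * \<bar>V s - V t\<bar>"
        using l abs_triangle_ineq[of "(1 - l) * (W s - W t)" "l * (V s - V t)"] by (simp add: abs_mult)
      also have "\<dots> \<le> (1 - l) * \<bar>s - t\<bar> + l * \<bar>s - t\<bar>"
        using l V(1)[OF st] W(1)[OF st] by (intro add_mono mult_left_mono) auto
      finally show ?thesis by (simp add: algebra_simps)
    qed
    moreover have "Wl 0 = 0" using V(2) W(2) by (simp add: Wl_def)
    ultimately obtain x' y' where rel': "relaxed_trajectory \<epsilon> T Wl x' y'"
      using relaxed_trajectory_exists[OF less_imp_le[OF T], of Wl \<epsilon> thesis] by blast
    have stab: "\<bar>x' t - x t\<bar> + \<bar>y' t - y t\<bar> \<le> c * l" if t: "t \<in> {0..T}" for t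
    proof -
      have "\<bar>x' t - x t\<bar> + \<bar>y' t - y t\<bar> \<le> \<epsilon> * (l * (2 * T)) * exp T"
      proof (rule relaxed_trajectory_stable[OF less_imp_le[OF eps] rel' rel _ t])
        show "\<bar>Wl t - W t\<bar> \<le> l * (2 * T)" if "t \<in> {0..T}" for t
          using Dle[OF that] l by (simp add: Wl_def abs_mult)
      qed
      then show ?thesis by (simp add: c_def mult_ac)
    qed
    define dx where "dx = x' T - x T"
    define dy where "dy = y' T - y T"
    have TT: "T \<in> {0..T}" using T by simp
    have "0 \<le> c * l" using eps T l by (simp add: c_def)
    then have sq: "dx\<^sup>2 \<le> (c * l)\<^sup>2" "dy\<^sup>2 \<le> (c * l)\<^sup>2"
      using stab[OF TT] unfolding dx_def[symmetric] dy_def[symmetric]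
      by (auto intro!: power2_le_iff_abs_le[THEN iffD2])
    have "\<bar>\<phi> T * dx + \<psi> T * dy - \<epsilon> * (\<psi> T * (Wl T - W T) + integral {0..T} (\<lambda>t. \<phi> t * (Wl t - W t)))\<bar> \<le> K * (c * l)\<^sup>2 * T"
      unfolding dx_def dy_def
    proof (rule adjoint_variation[OF less_imp_le[OF eps] rel rel' d\<phi> d\<psi> K(2)])
      show "\<bar>x' t - x t\<bar> \<le> c * l" if "t \<in> {0..T}" for t using stab[OF that] by linarith
    qed
    moreover have "\<psi> T * (Wl T - W T) + integral {0..T} (\<lambda>t. \<phi> t * (Wl t - W t)) = l * ?I"
      by (simp add: Wl_def algebra_simps flip: integral_mult_right)
    ultimately have v: "\<phi> T * dx + \<psi> T * dy \<le> \<epsilon> * (l * ?I) + K * (c * l)\<^sup>2 * T" by (simp add: abs_le_iff)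
    have "0 \<le> M * (2 * cos (x T - xh) - 2 * cos (x' T - xh) + ((y' T)\<^sup>2 - (y T)\<^sup>2))"
      using min[OF rel'] by (simp add: algebra_simps)
    also have "\<dots> \<le> M * ((2 * dx * sin (x T - xh) + 2 * dx\<^sup>2) + (2 * y T * dy + dy\<^sup>2))"
    proof -
      have "2 * cos (x T - xh) - 2 * cos (x' T - xh) \<le> 2 * dx * sin (x T - xh) + 2 * dx\<^sup>2"
        using cos_taylor_le[of "x T - xh" dx] by (simp add: dx_def)
      moreover have "(y' T)\<^sup>2 - (y T)\<^sup>2 = 2 * y T * dy + dy\<^sup>2" by (simp add: dy_def power2_eq_square algebra_simps)
      ultimately show ?thesis using M by (intro mult_left_mono) auto
    qed
    also have "\<dots> = \<phi> T * dx + \<psi> T * dy + M * (2 * dx\<^sup>2 + dy\<^sup>2)" by (simp add: \<phi>T \<psi>T algebra_simps)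
    also have "M * (2 * dx\<^sup>2 + dy\<^sup>2) \<le> M * (2 * (c * l)\<^sup>2 + (c * l)\<^sup>2)" using sq M by (intro mult_left_mono) auto
    finally have "0 \<le> \<epsilon> * (l * ?I) + K * (c * l)\<^sup>2 * T + M * (2 * (c * l)\<^sup>2 + (c * l)\<^sup>2)" using v by simp
    also have "\<dots> = l * (\<epsilon> * ?I + C * l)" by (simp add: C_def power2_eq_square algebra_simps)
    finally show ?thesis using l by (simp add: zero_le_mult_iff)
  qed
  have lim: "((\<lambda>l. - C * l) \<longlongrightarrow> - C * 0) (at_right 0)" by (intro tendsto_intros)
  have "\<forall>\<^sub>F l in at_right 0. l \<in> {0<..<1::real}" by (rule eventually_at_right_real) simp
  then have "\<forall>\<^sub>F l in at_right 0. - C * l \<le> \<epsilon> * ?I"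
    by (rule eventually_mono) (use main in auto)
  then have "- C * 0 \<le> \<epsilon> * ?I" by (rule tendsto_upperbound[OF lim]) simp
  then have "0 \<le> \<epsilon> * ?I" by simp
  then show ?thesis using eps by (simp add: zero_le_mult_iff)
qed


text \<open>
  Compares \<open>W\<close> with the function \<open>V\<close> that has slope \<open>- \<sigma>\<close> on \<open>{a..b}\<close> and the increments of \<open>W\<close>
  elsewhere; on a short interval the sign of \<open>\<psi>\<close> decides the sign of the first variation.
\<close>

lemma bang_interval:
  assumes \<sigma>: "\<sigma> = 1 \<or> \<sigma> = - 1" and ab: "0 \<le> a" "a < b" "b \<le> T"
    and c: "\<And>t. t \<in> {a..b} \<Longrightarrow> c \<le> \<sigma> * \<psi> t"
    and K: "\<And>t. t \<in> {0..T} \<Longrightarrow> \<bar>\<phi> t\<bar> \<le> K" and Kc: "K * (b - a) < c"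
  shows "W b - W a = - \<sigma> * (b - a)"
proof -
  note W = relaxed_trajectoryD(2,3)[OF rel]
  have \<sigma>1: "\<bar>\<sigma>\<bar> = 1" "\<sigma> * \<sigma> = 1" using \<sigma> by auto
  define V where "V t = W (min t a) - \<sigma> * (max a (min t b) - a) + (W (max t b) - W b)" for t
  have Vle: "\<bar>V s - V t\<bar> \<le> \<bar>s - t\<bar>" if st: "s \<in> {0..T}" "t \<in> {0..T}" "s \<le> t" for s t
  proof -
    have "V s - V t = (W (min s a) - W (min t a)) + (\<sigma> * (max a (min t b) - max a (min s b))) + (W (max s b) - W (max t b))"
      by (simp add: V_def algebra_simps)
    also have "\<bar>\<dots>\<bar> \<le> \<bar>W (min s a) - W (min t a)\<bar> + \<bar>\<sigma> * (max a (min t b) - max a (min s b))\<bar> + \<bar>W (max s b) - W (max t b)\<bar>"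
      by (rule order_trans[OF abs_triangle_ineq add_right_mono[OF abs_triangle_ineq]])
    also have "\<dots> \<le> (min t a - min s a) + (max a (min t b) - max a (min s b)) + (max t b - max s b)"
    proof (intro add_mono)
      have "\<bar>W (min s a) - W (min t a)\<bar> \<le> \<bar>min s a - min t a\<bar>" by (rule W(1)) (use st ab in auto)
      also have "\<dots> = min t a - min s a" using st(3) by (auto simp: min_def)
      finally show "\<bar>W (min s a) - W (min t a)\<bar> \<le> min t a - min s a" .
      have "min s b \<le> min t b" using st(3) by (auto simp: min_def)
      then have "max a (min s b) \<le> max a (min t b)" by (auto simp: max_def)
      then show "\<bar>\<sigma> * (max a (min t b) - max a (min s b))\<bar> \<le> max a (min t b) - max a (min s b)"
        by (simp add: abs_mult \<sigma>1)
      have "\<bar>W (max s b) - W (max t b)\<bar> \<le> \<bar>max s b - max t b\<bar>" by (rule W(1)) (use st ab in auto)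
      also have "\<dots> = max t b - max s b" using st(3) by (auto simp: max_def)
      finally show "\<bar>W (max s b) - W (max t b)\<bar> \<le> max t b - max s b" .
    qed
    also have "\<dots> = \<bar>s - t\<bar>"
    proof -
      have "min r a + max a (min r b) + max r b = r + a + b" for r
      proof -
        consider "r \<le> a" | "a \<le> r" "r \<le> b" | "b \<le> r" by linarith
        then show ?thesis using ab(2) by cases (simp_all add: min_def max_def)
      qed
      from this[of t] this[of s] st(3) show ?thesis by simp
    qed
    finally show ?thesis .
  qed
  have V1: "V t = W t" if "t \<le> a" for t using that ab by (simp add: V_def min_def max_def)
  have V2: "V t = W a - \<sigma> * (t - a)" if "t \<in> {a..b}" for t using that ab by (cases "t = a") (auto simp: V_def min_def max_def)
  have V3: "V t = W t + (V b - W b)" if "b \<le> t" for t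
    using that ab by (auto simp add: V_def min_def max_def)
  have Vl: "\<bar>V s - V t\<bar> \<le> \<bar>s - t\<bar>" if "s \<in> {0..T}" "t \<in> {0..T}" for s t
    using Vle[of s t] Vle[of t s] that by (cases "s \<le> t") (auto simp: abs_minus_commute)
  have cV: "continuous_on {0..T} V" by (rule lipschitz_continuous_on[OF Vl])
  define D where "D t = V t - W t" for t
  have cD: "continuous_on {0..T} (\<lambda>t. \<phi> t * D t)" unfolding D_def by (intro continuous_intros cont cV)
  have int: "(\<lambda>t. \<phi> t * D t) integrable_on {p..q}" if "0 \<le> p" "q \<le> T" for p q
    by (rule integrable_continuous_real, rule continuous_on_subset[OF cD]) (use that in auto)
  \<comment> \<open>The defect of \<open>W\<close> against slope - \<sigma> on the interval; it is
    not negative since \<open>W\<close> is 1-Lipschitz. The first variation is at most (K (b - a) -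
    c) d, whose bracket is negative, so d = 0.\<close>
  define d where "d = (b - a) + \<sigma> * (W b - W a)"
  have Db: "D b = - \<sigma> * d" using V2[of b] ab \<sigma> by (auto simp: D_def d_def)
  have dm: "0 \<le> (t - a) + \<sigma> * (W t - W a) \<and> (t - a) + \<sigma> * (W t - W a) \<le> d" if t: "t \<in> {a..b}" for t
  proof -
    have "\<bar>\<sigma> * (W t - W a)\<bar> \<le> t - a" using W(1)[of t a] t ab by (simp add: abs_mult \<sigma>1)
    moreover have "\<bar>\<sigma> * (W b - W t)\<bar> \<le> b - t" using W(1)[of b t] t ab by (simp add: abs_mult \<sigma>1)
    moreover have "d = ((t - a) + \<sigma> * (W t - W a)) + ((b - t) + \<sigma> * (W b - W t))" by (simp add: d_def algebra_simps)
    ultimately show ?thesis by linarith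
  qed
  have d0: "0 \<le> d" using dm[of b] ab by auto
  have Dab: "\<bar>D t\<bar> \<le> d" if t: "t \<in> {a..b}" for t
  proof -
    have "\<sigma> * D t = - ((t - a) + \<sigma> * (W t - W a))" using V2[OF t] \<sigma> by (auto simp: D_def)
    then have "\<bar>\<sigma> * D t\<bar> \<le> d" using dm[OF t] by simp
    then show ?thesis by (simp add: abs_mult \<sigma>1)
  qed
  have fv: "0 \<le> \<psi> T * (V T - W T) + integral {0..T} (\<lambda>t. \<phi> t * (V t - W t))"
    by (rule first_variation[OF Vl]) (use V1[of 0] ab W(2) in auto)
  have I: "0 \<le> \<psi> T * D b + integral {0..T} (\<lambda>t. \<phi> t * D t)" 
  proof -
    have "V T - W T = D b" using V3[OF ab(3)] unfolding D_def by linarith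
    then show ?thesis using fv by (simp only: D_def)
  qed
  have "integral {0..T} (\<lambda>t. \<phi> t * D t) = integral {0..a} (\<lambda>t. \<phi> t * D t) + integral {a..b} (\<lambda>t. \<phi> t * D t) + integral {b..T} (\<lambda>t. \<phi> t * D t)"
  proof -
    have a0T: "0 \<le> a" "a \<le> T" "a \<le> b" using ab by auto
    have "integral {0..a} (\<lambda>t. \<phi> t * D t) + integral {a..T} (\<lambda>t. \<phi> t * D t) = integral {0..T} (\<lambda>t. \<phi> t * D t)"
      by (rule Henstock_Kurzweil_Integration.integral_combine[OF a0T(1,2) int[OF order_refl order_refl]])
    moreover have "integral {a..b} (\<lambda>t. \<phi> t * D t) + integral {b..T} (\<lambda>t. \<phi> t * D t) = integral {a..T} (\<lambda>t. \<phi> t * D t)"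
      by (rule Henstock_Kurzweil_Integration.integral_combine[OF a0T(3) ab(3) int[OF ab(1) order_refl]])
    ultimately show ?thesis by simp
  qed
  moreover have "integral {0..a} (\<lambda>t. \<phi> t * D t) = 0"
  proof -
    have "integral {0..a} (\<lambda>t. \<phi> t * D t) = integral {0..a} (\<lambda>t. 0)"
    proof (rule Henstock_Kurzweil_Integration.integral_cong)
      fix t assume "t \<in> {0..a}"
      then have "t \<le> a" by simp
      from V1[OF this] show "\<phi> t * D t = 0" by (simp only: D_def diff_self mult_zero_right)
    qed
    then show ?thesis by simp
  qed
  moreover have "integral {b..T} (\<lambda>t. \<phi> t * D t) = D b * (\<psi> b - \<psi> T)"
  proof -
    have hi: "((\<lambda>t. \<phi> t * D b) has_integral (- \<psi> T * D b - - \<psi> b * D b)) {b..T}"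
    proof (rule fundamental_theorem_of_calculus)
      fix t assume t: "t \<in> {b..T}"
      have "(\<psi> has_real_derivative - \<phi> t) (at t within {b..T})"
        by (rule DERIV_subset[OF d\<psi>]) (use t ab in auto)
      then have "((\<lambda>t. - \<psi> t * D b) has_real_derivative \<phi> t * D b) (at t within {b..T})"
        by (auto intro!: derivative_eq_intros)
      then show "((\<lambda>t. - \<psi> t * D b) has_vector_derivative \<phi> t * D b) (at t within {b..T})"
        by (simp add: has_real_derivative_iff_has_vector_derivative)
    qed (use ab in auto)
    have eq: "integral {b..T} (\<lambda>t. \<phi> t * D t) = integral {b..T} (\<lambda>t. \<phi> t * D b)"
    proof (rule Henstock_Kurzweil_Integration.integral_cong)
      fix t assume "t \<in> {b..T}"
      then have "b \<le> t" by simp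
      from V3[OF this] have "D t = D b" unfolding D_def by linarith
      then show "\<phi> t * D t = \<phi> t * D b" by (simp only:)
    qed
    show ?thesis unfolding eq integral_unique[OF hi] by (simp add: algebra_simps)
  qed
  ultimately have I': "0 \<le> \<psi> b * D b + integral {a..b} (\<lambda>t. \<phi> t * D t)" using I by (simp add: algebra_simps)
  have "norm (integral {a..b} (\<lambda>t. \<phi> t * D t)) \<le> integral {a..b} (\<lambda>t. K * d)"
  proof (rule integral_norm_bound_integral[OF int])
    fix t assume t: "t \<in> {a..b}"
    have "\<bar>\<phi> t\<bar> * \<bar>D t\<bar> \<le> K * d" using K[of t] Dab[OF t] t ab by (intro mult_mono) auto
    then show "norm (\<phi> t * D t) \<le> K * d" by (simp add: abs_mult)
  qed (use ab in auto)
  then have "integral {a..b} (\<lambda>t. \<phi> t * D t) \<le> K * (b - a) * d" using ab by (simp add: abs_le_iff algebra_simps)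
  moreover have "\<psi> b * D b \<le> - c * d"
  proof -
    have "c * d \<le> (\<sigma> * \<psi> b) * d" using c[of b] ab d0 by (intro mult_right_mono) auto
    then show ?thesis by (simp add: Db mult_ac)
  qed
  ultimately have "0 \<le> (K * (b - a) - c) * d" using I' by (simp add: algebra_simps)
  then have "d \<le> 0" using Kc by (simp add: zero_le_mult_iff)
  then have "\<sigma> * (W b - W a) = - (b - a)" using d0 by (simp add: d_def)
  with \<sigma> show ?thesis by auto
qed

text \<open>Around \<open>t\<close> the sign of \<psi> is constant with a positive margin, and
  intervals from \<open>t\<close> to nearby points are short enough for
  \<open>bang_interval\<close>; hence \<open>W\<close> is affine near \<open>t\<close>.\<close>

lemma W_deriv:
  assumes t: "t \<in> {0..T}" and nz: "\<psi> t \<noteq> 0"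
  shows "(W has_real_derivative - sgn (\<psi> t)) (at t within {0..T})"
proof -
  obtain K where K: "0 < K" "\<And>t. t \<in> {0..T} \<Longrightarrow> \<bar>\<phi> t\<bar> \<le> K" using bounds by metis
  define \<sigma> where "\<sigma> = sgn (\<psi> t)"
  define c where "c = \<bar>\<psi> t\<bar> / 2"
  have \<sigma>: "\<sigma> = 1 \<or> \<sigma> = - 1" and c: "0 < c" "\<sigma> * \<psi> t = 2 * c" using nz by (auto simp: \<sigma>_def c_def sgn_if)
  obtain r where r: "0 < r" "\<And>s. s \<in> {0..T} \<Longrightarrow> \<bar>s - t\<bar> < r \<Longrightarrow> \<bar>\<psi> s - \<psi> t\<bar> < c"
    using cont(2) t c(1) unfolding continuous_on_iff dist_real_def by metis
  have low: "c \<le> \<sigma> * \<psi> s" if "s \<in> {0..T}" "\<bar>s - t\<bar> < r" for s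
  proof -
    have "\<bar>\<sigma> * (\<psi> s - \<psi> t)\<bar> < c" using r(2)[OF that] \<sigma> by (auto simp: abs_mult)
    then show ?thesis using c(2) by (simp add: right_diff_distrib)
  qed
  define r' where "r' = min r (c / (2 * K))"
  have r': "0 < r'" using r c K by (simp add: r'_def)
  have Kr: "K * p < c" if "p < r'" for p
  proof -
    have "K * p < K * (c / (2 * K))" using that K by (intro mult_strict_left_mono) (auto simp: r'_def)
    then show ?thesis using K c by simp
  qed
  have eq: "W s = W t - \<sigma> * (s - t)" if s: "s \<in> {0..T}" "dist s t < r'" for s
  proof -
    have sr: "\<bar>s - t\<bar> < r" "\<bar>s - t\<bar> < r'" using s by (auto simp: dist_real_def r'_def)
    consider "s = t" | "t < s" | "s < t" by linarith
    then show ?thesis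
    proof cases
      case 2
      have "W s - W t = - \<sigma> * (s - t)"
        by (rule bang_interval[OF \<sigma> _ 2 _ _ K(2), of c]) (use s t sr Kr 2 in \<open>auto intro!: low\<close>)
      then show ?thesis by simp
    next
      case 3
      have "W t - W s = - \<sigma> * (t - s)"
        by (rule bang_interval[OF \<sigma> _ 3 _ _ K(2), of c]) (use s t sr Kr 3 in \<open>auto intro!: low\<close>)
      then show ?thesis by (simp add: algebra_simps)
    qed simp
  qed
  have "((\<lambda>s. W t - \<sigma> * (s - t)) has_real_derivative - \<sigma>) (at t within {0..T})"
    by (auto intro!: derivative_eq_intros)
  then show ?thesis unfolding \<sigma>_def[symmetric]
    by (rule has_field_derivative_transform_within[OF _ r' t]) (use eq in auto)
qed

text \<open>Optimality with respect to the terminal time: stopping earlier gives one inequality,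
  going on with the control - sgn (\<psi> T) the other.\<close>

lemma hamiltonian_end: "\<phi> T * y T - \<psi> T * sin (x T) - \<epsilon> * \<bar>\<psi> T\<bar> = - 1"
proof (rule antisym)
  note W = relaxed_trajectoryD(2,3)[OF rel]
  have TT: "T \<in> {0..T}" using T by simp
  define j where "j t = t + M * (2 - 2 * cos (x t - xh) + (y t)\<^sup>2)" for t
  have jmin: "j T \<le> j t" if "t \<in> {0..T}" for t
    using min[OF relaxed_trajectory_restrict[OF rel, of t]] that by (simp add: j_def)
  have dx: "(x has_real_derivative y T) (at T within {0..T})" by (rule relaxed_trajectory_derivs(1)[OF rel TT])
  have dy2: "((\<lambda>t. (y t)\<^sup>2) has_real_derivative 2 * y T * (- sin (x T) - \<epsilon> * sgn (\<psi> T))) (at T within {0..T})"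
  proof (cases "\<psi> T = 0")
    case True
    \<comment> \<open>Where \<psi> vanishes \<open>W\<close> may lack a derivative at
      \<open>T\<close>. But the terminal value of \<psi> is a multiple of y T, so y T = 0, and by
      the Lipschitz bound y^2 is of second order in t - T.\<close>
    then have yT: "y T = 0" using \<psi>T M by simp
    have "((\<lambda>t. (y t)\<^sup>2) has_real_derivative 0) (at T within {0..T})"
    proof (rule has_real_derivative_zero_of_quadratic[OF _ TT])
      show "\<bar>(y t)\<^sup>2\<bar> \<le> (1 + \<epsilon>)\<^sup>2 * (t - T)\<^sup>2" if "t \<in> {0..T}" for t
      proof -
        have "\<bar>y t - y T\<bar> \<le> (1 + \<epsilon>) * \<bar>t - T\<bar>"
          by (rule relaxed_trajectory_y_lipschitz[OF less_imp_le[OF eps] rel that TT])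
        then have "\<bar>y t\<bar>\<^sup>2 \<le> ((1 + \<epsilon>) * \<bar>t - T\<bar>)\<^sup>2" unfolding yT by (intro power_mono) auto
        then show ?thesis by (simp add: power_mult_distrib)
      qed
    qed
    then show ?thesis by (simp add: yT)
  next
    case False
    have "((\<lambda>t. (y t - \<epsilon> * W t) + \<epsilon> * W t) has_real_derivative - sin (x T) + \<epsilon> * (- sgn (\<psi> T))) (at T within {0..T})"
      by (intro DERIV_add DERIV_cmult relaxed_trajectory_derivs(2)[OF rel TT] W_deriv TT False)
    then have "(y has_real_derivative - sin (x T) - \<epsilon> * sgn (\<psi> T)) (at T within {0..T})" by simp
    then show ?thesis by (auto intro!: derivative_eq_intros)
  qed
  have dc: "((\<lambda>t. 2 - 2 * cos (x t - xh)) has_real_derivative 2 * sin (x T - xh) * y T) (at T within {0..T})"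
    using dx by (auto intro!: derivative_eq_intros)
  have "(j has_real_derivative 1 + M * (2 * sin (x T - xh) * y T + 2 * y T * (- sin (x T) - \<epsilon> * sgn (\<psi> T)))) (at T within {0..T})"
    unfolding j_def[abs_def] by (rule DERIV_add[OF DERIV_ident DERIV_cmult[OF DERIV_add[OF dc dy2]]])
  from has_real_derivative_min_at_right_end[OF this T jmin]
  have "1 + M * (2 * sin (x T - xh) * y T + 2 * y T * (- sin (x T) - \<epsilon> * sgn (\<psi> T))) \<le> 0" .
  also have "1 + M * (2 * sin (x T - xh) * y T + 2 * y T * (- sin (x T) - \<epsilon> * sgn (\<psi> T)))
     = 1 + (\<phi> T * y T - \<psi> T * sin (x T) - \<epsilon> * (\<psi> T * sgn (\<psi> T)))" by (simp add: \<phi>T \<psi>T algebra_simps)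
  also have "\<psi> T * sgn (\<psi> T) = \<bar>\<psi> T\<bar>" by (simp add: abs_sgn)
  finally show "\<phi> T * y T - \<psi> T * sin (x T) - \<epsilon> * \<bar>\<psi> T\<bar> \<le> - 1" by simp
next
  note W = relaxed_trajectoryD(2,3)[OF rel]
  define v where "v = - sgn (\<psi> T)"
  have v: "\<bar>v\<bar> \<le> 1" by (simp add: v_def sgn_if)
  define V where "V t = W (Orderings.min t T) + v * (max t T - T)" for t
  have Vle: "\<bar>V s - V t\<bar> \<le> \<bar>s - t\<bar>" if st: "0 \<le> s" "s \<le> t" for s t
  proof -
    have "V s - V t = (W (Orderings.min s T) - W (Orderings.min t T)) + v * (max s T - max t T)"
      by (simp add: V_def algebra_simps)
    also have "\<bar>\<dots>\<bar> \<le> \<bar>W (Orderings.min s T) - W (Orderings.min t T)\<bar> + \<bar>v * (max s T - max t T)\<bar>" by (rule abs_triangle_ineq)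
    also have "\<dots> \<le> (Orderings.min t T - Orderings.min s T) + (max t T - max s T)"
    proof (rule add_mono)
      have "\<bar>W (Orderings.min s T) - W (Orderings.min t T)\<bar> \<le> \<bar>Orderings.min s T - Orderings.min t T\<bar>"
        by (rule W(1)) (use st T in auto)
      also have "\<dots> = Orderings.min t T - Orderings.min s T" using st by (auto simp: min_def)
      finally show "\<bar>W (Orderings.min s T) - W (Orderings.min t T)\<bar> \<le> Orderings.min t T - Orderings.min s T" .
      have "\<bar>v * (max s T - max t T)\<bar> \<le> 1 * \<bar>max s T - max t T\<bar>" unfolding abs_mult by (intro mult_right_mono v) auto
      also have "\<dots> = max t T - max s T" using st by (auto simp: max_def)
      finally show "\<bar>v * (max s T - max t T)\<bar> \<le> max t T - max s T" .
    qed
    also have "\<dots> = \<bar>s - t\<bar>"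
    proof -
      have "Orderings.min r T + max r T = r + T" for r by (simp add: min_def max_def)
      from this[of t] this[of s] st show ?thesis by simp
    qed
    finally show ?thesis .
  qed
  have V: "\<bar>V s - V t\<bar> \<le> \<bar>s - t\<bar>" if "s \<in> {0..T + 1}" "t \<in> {0..T + 1}" for s t
    using Vle[of s t] Vle[of t s] that by (cases "s \<le> t") (auto simp: abs_minus_commute)
  have V0: "V 0 = 0" using T W(2) by (simp add: V_def)
  have T1: "0 \<le> T + 1" using T by simp
  obtain x' y' where rel': "relaxed_trajectory \<epsilon> (T + 1) V x' y'"
    by (rule relaxed_trajectory_exists[OF T1 V V0])
  have ag: "x' T = x T" "y' T = y T"
  proof -
    have "\<bar>x' T - x T\<bar> + \<bar>y' T - y T\<bar> \<le> \<epsilon> * 0 * exp T"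
    proof (rule relaxed_trajectory_stable[OF less_imp_le[OF eps] relaxed_trajectory_restrict[OF rel'] rel])
      show "\<bar>V t - W t\<bar> \<le> 0" if "t \<in> {0..T}" for t using that by (simp add: V_def)
    qed (use T in auto)
    then show "x' T = x T" "y' T = y T" by auto
  qed
  have TT: "T \<in> {0..T + 1}" "{T..T + 1} \<subseteq> {0..T + 1}" using T by auto
  define j where "j t = t + M * (2 - 2 * cos (x' t - xh) + (y' t)\<^sup>2)" for t
  have jmin: "j T \<le> j t" if t: "t \<in> {T..T + 1}" for t
  proof -
    have "relaxed_trajectory \<epsilon> t V x' y'" by (rule relaxed_trajectory_restrict[OF rel']) (use t T in auto)
    from min[OF this] show ?thesis by (simp add: j_def ag)
  qed
  have dx: "(x' has_real_derivative y' T) (at T within {T..T + 1})"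
    by (rule DERIV_subset[OF relaxed_trajectory_derivs(1)[OF rel' TT(1)] TT(2)])
  have dh: "((\<lambda>t. y' t - \<epsilon> * V t) has_real_derivative - sin (x' T)) (at T within {T..T + 1})"
    by (rule DERIV_subset[OF relaxed_trajectory_derivs(2)[OF rel' TT(1)] TT(2)])
  have dV: "(V has_real_derivative v) (at T within {T..T + 1})"
  proof -
    have "((\<lambda>t. W T + v * (t - T)) has_real_derivative v) (at T within {T..T + 1})" by (auto intro!: derivative_eq_intros)
    then show ?thesis by (rule has_field_derivative_transform_within[of _ _ _ _ 1]) (auto simp: V_def)
  qed
  have "((\<lambda>t. (y' t - \<epsilon> * V t) + \<epsilon> * V t) has_real_derivative - sin (x' T) + \<epsilon> * v) (at T within {T..T + 1})"
    by (intro DERIV_add DERIV_cmult dh dV)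
  then have dy: "(y' has_real_derivative - sin (x' T) + \<epsilon> * v) (at T within {T..T + 1})" by simp
  have "(j has_real_derivative 1 + M * (2 * sin (x' T - xh) * y' T + 2 * y' T * (- sin (x' T) + \<epsilon> * v))) (at T within {T..T + 1})"
    unfolding j_def[abs_def] using dx dy by (auto intro!: derivative_eq_intros)
  from has_real_derivative_min_at_left_end[OF this _ jmin]
  have "0 \<le> 1 + M * (2 * sin (x' T - xh) * y' T + 2 * y' T * (- sin (x' T) + \<epsilon> * v))" by simp
  also have "\<dots> = 1 + (\<phi> T * y T - \<psi> T * sin (x T) - \<epsilon> * (\<psi> T * sgn (\<psi> T)))" by (simp add: \<phi>T \<psi>T ag v_def algebra_simps)
  also have "\<psi> T * sgn (\<psi> T) = \<bar>\<psi> T\<bar>" by (simp add: abs_sgn)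
  finally show "- 1 \<le> \<phi> T * y T - \<psi> T * sin (x T) - \<epsilon> * \<bar>\<psi> T\<bar>" by simp
qed

end

lemma DERIV_abs:
  fixes f :: "real \<Rightarrow> real"
  assumes f: "(f has_real_derivative d) (at s)" and nz: "f s \<noteq> 0"
  shows "((\<lambda>t. \<bar>f t\<bar>) has_real_derivative sgn (f s) * d) (at s)"
proof -
  have "(f \<longlongrightarrow> f s) (nhds s)" using DERIV_isCont[OF f] by (simp add: isCont_def tendsto_at_iff_tendsto_nhds)
  then have "((\<lambda>t. sgn (f s) * f t) \<longlongrightarrow> sgn (f s) * f s) (nhds s)" by (intro tendsto_intros)
  moreover have "0 < sgn (f s) * f s" using nz by (simp add: sgn_if)
  ultimately have "\<forall>\<^sub>F t in nhds s. 0 < sgn (f s) * f t" by (rule order_tendstoD(1))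
  then have "\<forall>\<^sub>F t in nhds s. \<bar>f t\<bar> = sgn (f s) * f t"
    by eventually_elim (auto simp: sgn_if split: if_splits)
  moreover have "((\<lambda>t. sgn (f s) * f t) has_real_derivative sgn (f s) * d) (at s)" by (rule DERIV_cmult[OF f])
  ultimately show ?thesis by (simp cong: DERIV_cong_ev)
qed


context minimizer
begin

text \<open>The weighted square norm \<open>q\<close> does not increase, so a common zero of \<phi>
  and \<psi> would persist up to \<open>T\<close> and make the terminal Hamiltonian 0 instead of -
  1.\<close>

lemma adjoint_nontrivial:
  assumes t: "t \<in> {0..T}" and z: "\<psi> t = 0"
  shows "\<phi> t \<noteq> 0"
proof
  assume \<phi>0: "\<phi> t = 0"
  define q where "q s = exp (- 2 * s) * ((\<phi> s)\<^sup>2 + (\<psi> s)\<^sup>2)" for s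
  have "q T - q t \<le> 0 * (T - t)"
  proof (rule increment_le[of "{}" t T q "\<lambda>s. exp (- 2 * s) * (2 * (\<phi> s * \<psi> s) * (cos (x s) - 1) - 2 * ((\<phi> s)\<^sup>2 + (\<psi> s)\<^sup>2))"])
    show "continuous_on {t..T} q" unfolding q_def
      using t by (intro continuous_intros continuous_on_subset[OF cont(1)] continuous_on_subset[OF cont(2)]) auto
    fix s assume s: "s \<in> {t<..<T} - {}"
    have sT: "s \<in> {0..T}" and w: "at s within {0..T} = at s" using s t by (auto intro!: at_within_Icc_at)
    have "(\<phi> has_real_derivative cos (x s) * \<psi> s) (at s)" "(\<psi> has_real_derivative - \<phi> s) (at s)"
      using d\<phi>[OF sT] d\<psi>[OF sT] unfolding w .
    then show "(q has_real_derivative exp (- 2 * s) * (2 * (\<phi> s * \<psi> s) * (cos (x s) - 1) - 2 * ((\<phi> s)\<^sup>2 + (\<psi> s)\<^sup>2))) (at s)"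
      unfolding q_def[abs_def] by (auto intro!: derivative_eq_intros simp: algebra_simps)
    have "2 * (\<phi> s * \<psi> s) * (cos (x s) - 1) \<le> \<bar>2 * (\<phi> s * \<psi> s)\<bar> * \<bar>cos (x s) - 1\<bar>"
      by (rule order_trans[OF abs_ge_self]) (simp only: abs_mult)
    also have "\<dots> \<le> ((\<phi> s)\<^sup>2 + (\<psi> s)\<^sup>2) * 2"
    proof (rule mult_mono)
      show "\<bar>2 * (\<phi> s * \<psi> s)\<bar> \<le> (\<phi> s)\<^sup>2 + (\<psi> s)\<^sup>2"
        using sum_squares_bound[of "\<bar>\<phi> s\<bar>" "\<bar>\<psi> s\<bar>"] by (simp add: abs_mult)
      show "\<bar>cos (x s) - 1\<bar> \<le> 2" using cos_ge_minus_one[of "x s"] cos_le_one[of "x s"] by linarith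
    qed auto
    finally have "2 * (\<phi> s * \<psi> s) * (cos (x s) - 1) - 2 * ((\<phi> s)\<^sup>2 + (\<psi> s)\<^sup>2) \<le> 0" by simp
    then show "exp (- 2 * s) * (2 * (\<phi> s * \<psi> s) * (cos (x s) - 1) - 2 * ((\<phi> s)\<^sup>2 + (\<psi> s)\<^sup>2)) \<le> 0"
      by (intro mult_nonneg_nonpos) auto
  qed (use t in auto)
  then have "exp (- 2 * T) * ((\<phi> T)\<^sup>2 + (\<psi> T)\<^sup>2) \<le> 0" by (simp add: q_def z \<phi>0)
  then have "(\<phi> T)\<^sup>2 + (\<psi> T)\<^sup>2 \<le> 0" by (simp add: mult_le_0_iff)
  then have "\<phi> T = 0" "\<psi> T = 0" by (simp_all add: sum_power2_le_zero_iff)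
  then show False using hamiltonian_end by simp
qed

lemma zeros_finite: "finite {t \<in> {0..T}. \<psi> t = 0}"
proof (rule spaced_finite_card(1))
  show "{t \<in> {0..T}. \<psi> t = 0} \<subseteq> {0..T}" by blast
  show "0 \<le> T" using T by simp
  show "0 < pi" by simp
  fix s t assume "s \<in> {t \<in> {0..T}. \<psi> t = 0}" "t \<in> {t \<in> {0..T}. \<psi> t = 0}" "s < t"
  then have st: "s \<in> {0..T}" "t \<in> {0..T}" "s < t" "\<psi> s = 0" "\<psi> t = 0" by blast+
  show "pi \<le> t - s"
    by (rule zeros_spaced[OF d\<phi> d\<psi> cos_le_one adjoint_nontrivial st])
qed

lemma y_deriv:
  assumes t: "t \<in> {0<..<T}" and nz: "\<psi> t \<noteq> 0"
  shows "(x has_real_derivative y t) (at t)" "(y has_real_derivative - sin (x t) - \<epsilon> * sgn (\<psi> t)) (at t)"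
proof -
  have tT: "t \<in> {0..T}" and w: "at t within {0..T} = at t" using t by (auto intro!: at_within_Icc_at)
  show "(x has_real_derivative y t) (at t)" using relaxed_trajectory_derivs(1)[OF rel tT] unfolding w .
  have "((\<lambda>t. (y t - \<epsilon> * W t) + \<epsilon> * W t) has_real_derivative - sin (x t) + \<epsilon> * (- sgn (\<psi> t))) (at t within {0..T})"
    by (intro DERIV_add DERIV_cmult relaxed_trajectory_derivs(2)[OF rel tT] W_deriv tT nz)
  then show "(y has_real_derivative - sin (x t) - \<epsilon> * sgn (\<psi> t)) (at t)" unfolding w by simp
qed

text \<open>Off the finitely many zeros of \<psi> all factors, |\<psi>| included, are differentiable
  and the derivative cancels; continuity bridges the zeros.\<close>

lemma hamiltonian: 
  assumes t: "t \<in> {0..T}"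
  shows "\<phi> t * y t - \<psi> t * sin (x t) - \<epsilon> * \<bar>\<psi> t\<bar> = - 1"
proof -
  define h where "h t = \<phi> t * y t - \<psi> t * sin (x t) - \<epsilon> * \<bar>\<psi> t\<bar>" for t
  have "h T - h t = 0 * (T - t)"
  proof (rule increment_eq[OF zeros_finite])
    show "continuous_on {t..T} h" unfolding h_def
      using t by (intro continuous_intros continuous_on_subset[OF cont(1)] continuous_on_subset[OF cont(2)]
          continuous_on_subset[OF cont(4)] continuous_on_subset[OF cont(5)]) auto
    fix s assume s: "s \<in> {t<..<T} - {t \<in> {0..T}. \<psi> t = 0}"
    have sT: "s \<in> {0..T}" "s \<in> {0<..<T}" and w: "at s within {0..T} = at s" and nz: "\<psi> s \<noteq> 0"
      using s t by (auto intro!: at_within_Icc_at)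
    have d1: "(\<phi> has_real_derivative cos (x s) * \<psi> s) (at s)" "(\<psi> has_real_derivative - \<phi> s) (at s)"
      using d\<phi>[OF sT(1)] d\<psi>[OF sT(1)] unfolding w .
    note d2 = y_deriv[OF sT(2) nz]
    have d3: "((\<lambda>t. \<bar>\<psi> t\<bar>) has_real_derivative sgn (\<psi> s) * (- \<phi> s)) (at s)"
      by (rule DERIV_abs[OF d1(2) nz])
    have "(h has_real_derivative (cos (x s) * \<psi> s * y s + (- sin (x s) - \<epsilon> * sgn (\<psi> s)) * \<phi> s)
        - (- \<phi> s * sin (x s) + cos (x s) * y s * \<psi> s) - \<epsilon> * (sgn (\<psi> s) * (- \<phi> s))) (at s)"
      unfolding h_def[abs_def]
      by (intro DERIV_diff DERIV_mult DERIV_cmult d1 d2 d3 DERIV_fun_sin)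
    also have "(cos (x s) * \<psi> s * y s + (- sin (x s) - \<epsilon> * sgn (\<psi> s)) * \<phi> s)
        - (- \<phi> s * sin (x s) + cos (x s) * y s * \<psi> s) - \<epsilon> * (sgn (\<psi> s) * (- \<phi> s)) = 0"
      by (simp add: algebra_simps)
    finally show "(h has_real_derivative 0) (at s)" .
  qed (use t in auto)
  then show ?thesis using hamiltonian_end by (simp add: h_def)
qed

text \<open>Back in forward time \<psi> and y change sign and \<phi> does not. The control - sgn
  \<psi> becomes the sign of the new \<psi>, and the value - 1 of the Hamiltonian becomes the
  normalisation in \<open>adjoint_variables\<close>.\<close>

lemma reversed_adjoint:
  obtains u where
    "pw_trajectory \<epsilon> T u (\<lambda>t. x (T - t)) (\<lambda>t. - y (T - t))"
    "adjoint_variables \<epsilon> T u (\<lambda>t. x (T - t)) (\<lambda>t. - y (T - t)) (\<lambda>t. \<phi> (T - t)) (\<lambda>t. - \<psi> (T - t))"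
proof -
  \<comment> \<open>Clamping the time makes \<psi> continuous on the whole line, so its sign is a
    total Borel control.\<close>
  define \<psi>c where "\<psi>c t = \<psi> (max 0 (Orderings.min T t))" for t
  have c\<psi>c: "continuous_on UNIV \<psi>c" unfolding \<psi>c_def
    by (rule continuous_on_compose2[OF cont(2)]) (use T in \<open>auto intro!: continuous_intros\<close>)
  have \<psi>c: "\<psi>c t = \<psi> t" if "t \<in> {0..T}" for t using that by (simp add: \<psi>c_def)
  define u where "u t = - sgn (\<psi>c t)" for t
  have pw: "pw_trajectory \<epsilon> T u x y"
  proof (rule pw_trajectoryI[OF _ _ _ cont(4,5) zeros_finite])
    have [measurable]: "\<psi>c \<in> borel_measurable borel" by (rule borel_measurable_continuous_onI[OF c\<psi>c])
    have "(\<lambda>t. if 0 < \<psi>c t then - 1 else if \<psi>c t < 0 then 1 else (0::real)) \<in> borel_measurable borel" by measurable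
    moreover have "u = (\<lambda>t. if 0 < \<psi>c t then - 1 else if \<psi>c t < 0 then 1 else (0::real))"
      by (auto simp: u_def sgn_if fun_eq_iff)
    ultimately show "u \<in> borel_measurable borel" by simp
    show "\<bar>u t\<bar> \<le> 1" for t by (simp add: u_def sgn_if)
    fix t assume t: "t \<in> {0<..<T} - {t \<in> {0..T}. \<psi> t = 0}"
    then have nz: "\<psi> t \<noteq> 0" and t': "t \<in> {0<..<T}" by auto
    show "(x has_real_derivative y t) (at t)" by (rule y_deriv(1)[OF t' nz])
    show "(y has_real_derivative - sin (x t) + \<epsilon> * u t) (at t)"
      using y_deriv(2)[OF t' nz] \<psi>c[of t] t' by (simp add: u_def)
  qed (use T in auto)
  have im: "(\<lambda>t. T - t) ` {0..T} = {0..T}"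
  proof (intro equalityI subsetI)
    fix t assume "t \<in> {0..T}" then show "t \<in> (\<lambda>t. T - t) ` {0..T}" by (intro image_eqI[of _ _ "T - t"]) auto
  qed auto
  have dr: "((\<lambda>t. f (T - t)) has_real_derivative - f' (T - t)) (at t within {0..T})"
    if f: "\<And>t. t \<in> {0..T} \<Longrightarrow> (f has_real_derivative f' t) (at t within {0..T})" and t: "t \<in> {0..T}" for f f' :: "real \<Rightarrow> real" and t
  proof -
    have 1: "(f has_real_derivative f' (T - t)) (at (T - t) within (\<lambda>t. T - t) ` {0..T})"
      unfolding im by (rule f) (use t in auto)
    have 2: "((\<lambda>t. T - t) has_real_derivative - 1) (at t within {0..T})" by (auto intro!: derivative_eq_intros)
    show ?thesis using DERIV_image_chain[OF 1 2] by (simp add: o_def)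
  qed
  show thesis
  proof (rule that)
    show "pw_trajectory \<epsilon> T (\<lambda>t. u (T - t)) (\<lambda>t. x (T - t)) (\<lambda>t. - y (T - t))"
      by (rule pw_trajectory_reverse[OF pw])
    show "adjoint_variables \<epsilon> T (\<lambda>t. u (T - t)) (\<lambda>t. x (T - t)) (\<lambda>t. - y (T - t)) (\<lambda>t. \<phi> (T - t)) (\<lambda>t. - \<psi> (T - t))"
      unfolding adjoint_variables_def
    proof (intro ballI conjI impI)
      fix t assume t: "t \<in> {0..T}"
      then have t': "T - t \<in> {0..T}" by auto
      show "((\<lambda>t. \<phi> (T - t)) has_real_derivative cos (x (T - t)) * - \<psi> (T - t)) (at t within {0..T})"
        using dr[of \<phi> "\<lambda>t. cos (x t) * \<psi> t", OF d\<phi> t] by simp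
      show "((\<lambda>t. - \<psi> (T - t)) has_real_derivative - \<phi> (T - t)) (at t within {0..T})"
        using DERIV_minus[OF dr[of \<psi> "\<lambda>t. - \<phi> t", OF d\<psi> t]] by simp
      show "u (T - t) = sgn (- \<psi> (T - t))" by (simp add: u_def \<psi>c[OF t'] sgn_if)
      have "u (T - t) * - \<psi> (T - t) = \<bar>\<psi> (T - t)\<bar>" by (simp add: u_def \<psi>c[OF t'] sgn_if)
      then show "- y (T - t) * \<phi> (T - t) + (- sin (x (T - t)) + \<epsilon> * u (T - t)) * - \<psi> (T - t) - 1 = 0"
        using hamiltonian[OF t'] by (simp add: algebra_simps)
    qed
  qed
qed

end

lemma rcong_zero_sin_cos:
  assumes "[z = 0] (rmod 2 * pi)"
  shows "sin z = 0" "cos z = 1"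
proof -
  obtain n where "0 = z + of_int n * (2 * pi)" using assms unfolding rcong_altdef by blast
  then have z: "z = 2 * pi * of_int (- n)" by (simp add: mult.commute)
  show "sin z = 0" unfolding z by (rule sin_int_2pin)
  show "cos z = 1" unfolding z by (rule cos_int_2pin)
qed

text \<open>Trajectories with the same reversed end state pay the same penalty, so a minimiser of
  time plus penalty is time-optimal for the point at which it ends, which is the initial point after
  reversal. Where this point lies is known only up to \<eta>.\<close>

theorem optimal_trajectory_near:
  assumes \<epsilon>: "0 < \<epsilon>" and st: "steers_to_origin \<epsilon> (xh, 0) Th uh x1 y1"
    and \<eta>: "0 < \<eta>" "\<eta> < 2 - 2 * cos xh"
  obtains p T u x y \<phi> \<psi> where "time_optimal \<epsilon> p T u x y" "adjoint_variables \<epsilon> T u x y \<phi> \<psi>"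
    "2 - 2 * cos (x 0 - xh) + (y 0)\<^sup>2 \<le> \<eta>"
proof -
  \<comment> \<open>The given steering trajectory has cost \<open>Th\<close> and penalty 0, so M
    times the penalty of the minimiser is at most Th \<le> M \<eta>; the summand 1 keeps
    \<open>M\<close> positive when \<open>Th\<close> is 0.\<close>
  define M where "M = (Th + 1) / \<eta>"
  have Th: "0 \<le> Th" and cph: "controlled_pendulum \<epsilon> Th uh x1 y1"
    using st by (auto simp: steers_to_origin_def controlled_pendulum_def)
  have M: "0 < M" using Th \<eta> by (simp add: M_def)
  obtain T W x y where rel: "relaxed_trajectory \<epsilon> T W x y" and
    min: "\<And>T' W' x' y'. relaxed_trajectory \<epsilon> T' W' x' y' \<Longrightarrow>
      T + M * (2 - 2 * cos (x T - xh) + (y T)\<^sup>2) \<le> T' + M * (2 - 2 * cos (x' T' - xh) + (y' T')\<^sup>2)"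
    using relaxed_minimizer[OF less_imp_le[OF \<epsilon>] less_imp_le[OF M], of xh] by blast
  have T0: "0 \<le> T" by (rule relaxed_trajectoryD(1)[OF rel])
  have near: "2 - 2 * cos (x T - xh) + (y T)\<^sup>2 \<le> \<eta>"
  proof -
    have h: "[x1 0 = xh] (rmod 2 * pi)" "y1 0 = 0" "[x1 Th = 0] (rmod 2 * pi)" "y1 Th = 0"
      using st by (auto simp: steers_to_origin_def)
    obtain W' where rel': "relaxed_trajectory \<epsilon> Th W' (\<lambda>t. x1 (Th - t) - x1 Th) (\<lambda>t. - y1 (Th - t))"
      by (rule controlled_pendulum_reverse_relaxed[OF \<epsilon> cph h(4) rcong_zero_sin_cos[OF h(3)]])
    have "[x1 0 - x1 Th - xh = 0] (rmod 2 * pi)"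
      using rcong_diff[OF rcong_diff[OF h(1) h(3)] rcong_refl[of xh]] by simp
    then have "cos (x1 0 - x1 Th - xh) = 1" by (rule rcong_zero_sin_cos)
    then have "T + M * (2 - 2 * cos (x T - xh) + (y T)\<^sup>2) \<le> Th"
      using min[OF rel'] h(2) by simp
    then have "M * (2 - 2 * cos (x T - xh) + (y T)\<^sup>2) \<le> M * \<eta>" using T0 \<eta> by (simp add: M_def)
    then show ?thesis using M by simp
  qed
  \<comment> \<open>The upper bound on \<eta> rules out the minimiser that stays at the origin,
    whose penalty is 2 - 2 cos xh.\<close>
  have Tpos: "0 < T"
  proof (rule ccontr)
    assume "\<not> 0 < T"
    then have "T = 0" using T0 by simp
    moreover have "x 0 = 0" "y 0 = 0" using rel T0 by (auto simp: relaxed_trajectory_def)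
    ultimately show False using near \<eta> by simp
  qed
  obtain \<phi> \<psi> where adj: "\<phi> T = 2 * M * sin (x T - xh)" "\<psi> T = 2 * M * y T"
    "\<And>t. t \<in> {0..T} \<Longrightarrow> (\<phi> has_real_derivative cos (x t) * \<psi> t) (at t within {0..T})"
    "\<And>t. t \<in> {0..T} \<Longrightarrow> (\<psi> has_real_derivative - \<phi> t) (at t within {0..T})"
  proof (rule linear_adjoint_exists[OF T0])
    show "continuous_on {0..T} (\<lambda>t. cos (x t))" by (intro continuous_intros relaxed_trajectoryD(4)[OF rel])
  qed (simp, rule that)
  interpret minimizer \<epsilon> M xh T W x y \<phi> \<psi>
    by unfold_locales (use \<epsilon> M Tpos rel min adj in auto)
  obtain u where pw: "pw_trajectory \<epsilon> T u (\<lambda>t. x (T - t)) (\<lambda>t. - y (T - t))"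
    and av: "adjoint_variables \<epsilon> T u (\<lambda>t. x (T - t)) (\<lambda>t. - y (T - t)) (\<lambda>t. \<phi> (T - t)) (\<lambda>t. - \<psi> (T - t))"
    by (rule reversed_adjoint)
  have xy0: "x 0 = 0" "y 0 = 0" using rel T0 by (auto simp: relaxed_trajectory_def)
  have "time_optimal \<epsilon> (x T, - y T) T u (\<lambda>t. x (T - t)) (\<lambda>t. - y (T - t))"
    unfolding time_optimal_def
  proof (intro conjI allI impI)
    show "steers_to_origin \<epsilon> (x T, - y T) T u (\<lambda>t. x (T - t)) (\<lambda>t. - y (T - t))"
      using pw_trajectory_controlled_pendulum[OF pw] xy0 by (simp add: steers_to_origin_def)
    fix T' u' x' y'
    assume st': "steers_to_origin \<epsilon> (x T, - y T) T' u' x' y'"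
    then have cp: "controlled_pendulum \<epsilon> T' u' x' y'" and h: "[x' 0 = x T] (rmod 2 * pi)" "y' 0 = - y T" "[x' T' = 0] (rmod 2 * pi)" "y' T' = 0"
      by (auto simp: steers_to_origin_def)
    obtain W' where rel': "relaxed_trajectory \<epsilon> T' W' (\<lambda>t. x' (T' - t) - x' T') (\<lambda>t. - y' (T' - t))"
      by (rule controlled_pendulum_reverse_relaxed[OF \<epsilon> cp h(4) rcong_zero_sin_cos[OF h(3)]])
    have "[x' 0 - x' T' - x T = 0] (rmod 2 * pi)"
      using rcong_diff[OF rcong_diff[OF h(1) h(3)] rcong_refl[of "x T"]] by simp
    then have sc: "sin (x' 0 - x' T' - x T) = 0" "cos (x' 0 - x' T' - x T) = 1" by (rule rcong_zero_sin_cos)+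
    have "cos (x' 0 - x' T' - xh) = cos ((x' 0 - x' T' - x T) + (x T - xh))"
      by (rule arg_cong[of _ _ cos]) linarith
    also have "\<dots> = cos (x T - xh)" unfolding cos_add sc by simp
    finally show "T \<le> T'" using min[OF rel'] h(2) by simp
  qed
  then show thesis by (rule that[OF _ av]) (use near in simp)
qed

section \<open>Extremals and the upper bound\<close>

locale extremal =
  fixes \<epsilon> T :: real and p :: "real \<times> real" and u x y \<phi> \<psi> :: "real \<Rightarrow> real"
  assumes eps: "0 < \<epsilon>" and opt: "time_optimal \<epsilon> p T u x y" and adj: "adjoint_variables \<epsilon> T u x y \<phi> \<psi>"
begin

definition Z :: "real set" where "Z = {t \<in> {0..T}. \<psi> t = 0}"

lemma steers: "steers_to_origin \<epsilon> p T u x y" using opt by (simp add: time_optimal_def)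

lemma pendulum: "controlled_pendulum \<epsilon> T u x y" using steers by (simp add: steers_to_origin_def)

lemma T_nonneg: "0 \<le> T" using pendulum by (simp add: controlled_pendulum_def)

lemma end_state: "[x T = 0] (rmod 2 * pi)" "y T = 0" using steers by (simp_all add: steers_to_origin_def)

lemma adjoint_derivs:
  assumes "t \<in> {0..T}"
  shows "(\<phi> has_real_derivative cos (x t) * \<psi> t) (at t within {0..T})"
    "(\<psi> has_real_derivative - \<phi> t) (at t within {0..T})"
  using adj assms unfolding adjoint_variables_def by blast+

lemma control_eq: "t \<in> {0..T} \<Longrightarrow> \<psi> t \<noteq> 0 \<Longrightarrow> u t = sgn (\<psi> t)"
  using adj unfolding adjoint_variables_def by blast

lemma velocity_at_zero:
  assumes "t \<in> {0..T}" "\<psi> t = 0"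
  shows "y t * \<phi> t = 1"
  using adj assms unfolding adjoint_variables_def by force

lemma adjoint_nonzero: "t \<in> {0..T} \<Longrightarrow> \<psi> t = 0 \<Longrightarrow> \<phi> t \<noteq> 0"
  using velocity_at_zero[of t] by auto

lemma continuous_state: "continuous_on {0..T} x" "continuous_on {0..T} y" "continuous_on {0..T} \<psi>"
proof -
  show "continuous_on {0..T} x" "continuous_on {0..T} y" by (rule controlled_pendulum_continuous[OF pendulum])+
  show "continuous_on {0..T} \<psi>"
    using DERIV_continuous[OF adjoint_derivs(2)] by (simp add: continuous_on_eq_continuous_within)
qed

lemma Z_spaced:
  assumes "s \<in> Z" "t \<in> Z" "s < t"
  shows "pi \<le> t - s"
proof -
  have st: "s \<in> {0..T}" "t \<in> {0..T}" "s < t" "\<psi> s = 0" "\<psi> t = 0" using assms by (auto simp: Z_def)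
  show ?thesis by (rule zeros_spaced[OF adjoint_derivs cos_le_one adjoint_nonzero st])
qed

lemma Z_finite: "finite Z"
proof (rule spaced_finite_card(1))
  show "Z \<subseteq> {0..T}" "0 \<le> T" "0 < pi" using T_nonneg by (auto simp: Z_def)
qed (rule Z_spaced)

lemma Z_card_interval:
  assumes "a \<le> b"
  shows "real (card (Z \<inter> {a..b})) \<le> (b - a) / pi + 1"
proof (rule spaced_finite_card(2))
  show "Z \<inter> {a..b} \<subseteq> {a..b}" "a \<le> b" "0 < pi" using assms by auto
  fix s t assume "s \<in> Z \<inter> {a..b}" "t \<in> Z \<inter> {a..b}" "s < t"
  then show "pi \<le> t - s" using Z_spaced by blast
qed

lemma velocity_alternates:
  assumes "s \<in> Z" "t \<in> Z" "s < t"
  obtains r where "s < r" "r \<le> t" "r \<in> Z" "y s * y r < 0"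
proof -
  have st: "s \<in> {0..T}" "t \<in> {0..T}" "s < t" "\<psi> s = 0" "\<psi> t = 0" using assms by (auto simp: Z_def)
  obtain r where r: "s < r" "r \<le> t" "\<psi> r = 0" "\<phi> s * \<phi> r < 0"
    by (rule next_zero[OF adjoint_derivs cos_le_one adjoint_nonzero st])
  have rT: "r \<in> {0..T}" using r st by auto
  have "(y s * \<phi> s) * (y r * \<phi> r) = 1"
    using velocity_at_zero[OF st(1,4)] velocity_at_zero[OF rT r(3)] by simp
  then have e: "(y s * y r) * (\<phi> s * \<phi> r) = 1" by (simp add: mult_ac)
  have "y s * y r < 0"
  proof (rule ccontr)
    assume "\<not> y s * y r < 0"
    then have "(y s * y r) * (\<phi> s * \<phi> r) \<le> 0" using r(4) mult_nonneg_nonpos[of "y s * y r" "\<phi> s * \<phi> r"] by linarith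
    then show False using e by simp
  qed
  then show thesis using that[OF r(1,2)] r(3) rT by (simp add: Z_def)
qed

text \<open>The control is only measurable, but around an instant outside \<open>Z\<close> it equals
  the locally constant sign of \<psi>, so the integrated equations can be differentiated
  there.\<close>

lemma state_derivs:
  assumes t: "t \<in> {0<..<T} - Z"
  shows "(x has_real_derivative y t) (at t)" "(y has_real_derivative - sin (x t) + \<epsilon> * sgn (\<psi> t)) (at t)"
proof -
  have tT: "t \<in> {0<..<T}" and tT': "t \<in> {0..T}" and nz: "\<psi> t \<noteq> 0" using t by (auto simp: Z_def)
  have i: "isCont x t" "isCont y t" "isCont \<psi> t"
    using continuous_state tT by (auto simp: continuous_on_interior interior_atLeastAtMost_real)
  have ix: "(y has_integral (x r - x 0)) {0..r}" and iy: "((\<lambda>s. - sin (x s) + \<epsilon> * u s) has_integral (y r - y 0)) {0..r}"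
    if "r \<in> {0..T}" for r using pendulum that by (auto simp: controlled_pendulum_def)
  show "(x has_real_derivative y t) (at t)" by (rule has_real_derivative_of_has_integral[OF ix tT i(2)])
  have "(\<psi> \<longlongrightarrow> \<psi> t) (nhds t)" using i(3) by (simp add: isCont_def tendsto_at_iff_tendsto_nhds)
  then have "((\<lambda>s. sgn (\<psi> t) * \<psi> s) \<longlongrightarrow> sgn (\<psi> t) * \<psi> t) (nhds t)" by (intro tendsto_intros)
  moreover have "0 < sgn (\<psi> t) * \<psi> t" using nz by (simp add: sgn_if)
  ultimately have "\<forall>\<^sub>F s in nhds t. 0 < sgn (\<psi> t) * \<psi> s" by (rule order_tendstoD(1))
  moreover have "\<forall>\<^sub>F s in nhds t. s \<in> {0<..<T}" using tT by (intro eventually_nhds_in_open) auto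
  ultimately have "\<forall>\<^sub>F s in nhds t. u s = sgn (\<psi> t)"
  proof eventually_elim
    case (elim s)
    have "u s = sgn (\<psi> s)" by (rule control_eq) (use elim in auto)
    also have "\<dots> = sgn (\<psi> t)" using elim(1) by (auto simp: sgn_if split: if_splits)
    finally show ?case .
  qed
  moreover have "isCont (\<lambda>s. sgn (\<psi> t)) t" by simp
  ultimately have iu: "isCont u t" by (simp cong: isCont_cong)
  have "(y has_real_derivative - sin (x t) + \<epsilon> * u t) (at t)"
    by (rule has_real_derivative_of_has_integral[OF iy tT]) (use i iu in \<open>auto intro!: continuous_intros\<close>)
  then show "(y has_real_derivative - sin (x t) + \<epsilon> * sgn (\<psi> t)) (at t)" by (simp only: control_eq[OF tT' nz])
qed

lemma pw_control:
  obtains v where "pw_trajectory \<epsilon> T v x y"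
proof -
  define \<psi>c where "\<psi>c t = \<psi> (max 0 (Orderings.min T t))" for t
  have c\<psi>c: "continuous_on UNIV \<psi>c" unfolding \<psi>c_def
    by (rule continuous_on_compose2[OF continuous_state(3)]) (use T_nonneg in \<open>auto intro!: continuous_intros\<close>)
  show thesis
  proof (rule that[OF pw_trajectoryI[OF T_nonneg _ _ continuous_state(1,2) Z_finite state_derivs(1)]])
    have [measurable]: "\<psi>c \<in> borel_measurable borel" by (rule borel_measurable_continuous_onI[OF c\<psi>c])
    have "(\<lambda>t. if 0 < \<psi>c t then 1 else if \<psi>c t < 0 then - 1 else (0::real)) \<in> borel_measurable borel" by measurable
    moreover have "(\<lambda>t. sgn (\<psi>c t)) = (\<lambda>t. if 0 < \<psi>c t then 1 else if \<psi>c t < 0 then - 1 else (0::real))"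
      by (auto simp: sgn_if fun_eq_iff)
    ultimately show "(\<lambda>t. sgn (\<psi>c t)) \<in> borel_measurable borel" by simp
    show "\<bar>sgn (\<psi>c t)\<bar> \<le> 1" for t by (simp add: sgn_if)
    fix t assume t: "t \<in> {0<..<T} - Z"
    then show "(y has_real_derivative - sin (x t) + \<epsilon> * sgn (\<psi>c t)) (at t)"
      using state_derivs(2)[OF t] by (simp add: \<psi>c_def)
  qed
qed

text \<open>Replacing everything after \<open>s\<close> by the given trajectory yields a competitor
  for the whole problem.\<close>

lemma remaining_time_le:
  assumes s: "s \<in> {0..T}" and pw: "pw_trajectory \<epsilon> \<tau> u' x' y'" and i: "x' 0 = x s" "y' 0 = y s"
    and e: "[x' \<tau> = 0] (rmod 2 * pi)" "y' \<tau> = 0"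
  shows "T - s \<le> \<tau>"
proof -
  obtain v where "pw_trajectory \<epsilon> T v x y" by (rule pw_control)
  then have r: "pw_trajectory \<epsilon> s v x y" by (rule pw_trajectory_restrict) (use s in auto)
  have \<tau>: "0 \<le> \<tau>" using pw by (rule pw_trajectoryE)
  note c = pw_trajectory_controlled_pendulum[OF pw_trajectory_concat[OF r pw i]]
  have "\<tau> = 0 \<Longrightarrow> x s = x' \<tau> \<and> y s = y' \<tau>" using i by simp
  then have "steers_to_origin \<epsilon> p (s + \<tau>) (\<lambda>t. if t \<le> s then v t else u' (t - s))
      (\<lambda>t. if t \<le> s then x t else x' (t - s)) (\<lambda>t. if t \<le> s then y t else y' (t - s))"
    using c steers e s \<tau> unfolding steers_to_origin_def by auto
  then have "T \<le> s + \<tau>" using opt unfolding time_optimal_def by blast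
  then show ?thesis by simp
qed

end

text \<open>The cells are the intervals of length \<pi> centred at the multiples n \<pi>; on each of
  them cos has the sign of cos (n \<pi>) or vanishes.\<close>

lemma cos_same_cell:
  fixes a b :: real
  assumes "\<lfloor>a / pi + 1 / 2\<rfloor> = \<lfloor>b / pi + 1 / 2\<rfloor>"
  shows "0 \<le> cos a * cos b"
proof -
  define n where "n = \<lfloor>a / pi + 1 / 2\<rfloor>"
  have *: "0 \<le> cos (c - of_int n * pi) \<and> cos c = cos (of_int n * pi) * cos (c - of_int n * pi)"
    if n: "n = \<lfloor>c / pi + 1 / 2\<rfloor>" for c
  proof
    have "of_int n \<le> c / pi + 1 / 2" "c / pi + 1 / 2 < of_int n + 1" using n by linarith+
    then have "of_int n - 1 / 2 \<le> c / pi" "c / pi \<le> of_int n + 1 / 2" by linarith+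
    then have "(of_int n - 1 / 2) * pi \<le> c" "c \<le> (of_int n + 1 / 2) * pi" by (simp_all add: field_simps)
    then have "- (pi / 2) \<le> c - of_int n * pi" "c - of_int n * pi \<le> pi / 2" by (simp_all add: algebra_simps)
    then show "0 \<le> cos (c - of_int n * pi)" by (intro cos_ge_zero) auto
    have "cos c = cos (of_int n * pi + (c - of_int n * pi))" by simp
    also have "\<dots> = cos (of_int n * pi) * cos (c - of_int n * pi)"
      unfolding cos_add by (simp add: sin_times_pi_eq_0)
    finally show "cos c = cos (of_int n * pi) * cos (c - of_int n * pi)" .
  qed
  have "n = \<lfloor>a / pi + 1 / 2\<rfloor>" "n = \<lfloor>b / pi + 1 / 2\<rfloor>" using assms by (simp_all add: n_def)
  from this[THEN *] obtain A B where h: "0 \<le> A" "0 \<le> B" "cos a = cos (of_int n * pi) * A" "cos b = cos (of_int n * pi) * B"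
    by blast
  have "cos a * cos b = (cos (of_int n * pi))\<^sup>2 * (A * B)" unfolding h(3,4) power2_eq_square by (simp add: mult_ac)
  then show ?thesis using h(1,2) by simp
qed

lemma strict_mono_int_card:
  fixes f :: "real \<Rightarrow> int"
  assumes f: "\<And>s t. s \<in> A \<Longrightarrow> t \<in> A \<Longrightarrow> s < t \<Longrightarrow> f s < f t" and r: "f ` A \<subseteq> {m..n}"
    and mn: "m \<le> n + 1"
  shows "int (card A) \<le> n - m + 1"
proof -
  have "inj_on f A"
  proof (rule inj_onI)
    fix s t assume "s \<in> A" "t \<in> A" "f s = f t"
    then show "s = t" using f[of s t] f[of t s] by (cases s t rule: linorder_cases) auto
  qed
  then have "card A = card (f ` A)" by (simp add: card_image)
  also have "\<dots> \<le> card {m..n}" using r by (intro card_mono) auto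
  finally show ?thesis using mn by simp
qed

context extremal
begin

text \<open>Opposite velocities at consecutive zeros mean opposite signs of cos \<theta>; as
  \<theta> is monotone, each zero lies in a later cell than the one before. Rounding at the two ends
  accounts for the summand 2.\<close>

lemma zeros_le_angle:
  assumes sub: "0 \<le> t0" "t0 \<le> t1" "t1 \<le> T"
    and k: "\<And>t. t \<in> {t0..t1} \<Longrightarrow> 0 < \<kappa> t \<and> y t / 2 = \<kappa> t * cos (\<theta> t)"
    and mono: "\<And>s t. t0 \<le> s \<Longrightarrow> s \<le> t \<Longrightarrow> t \<le> t1 \<Longrightarrow> \<theta> s \<le> \<theta> t"
  shows "real (card (Z \<inter> {t0..t1})) \<le> (\<theta> t1 - \<theta> t0) / pi + 2"
proof -
  define f where "f t = \<lfloor>\<theta> t / pi + 1 / 2\<rfloor>" for t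
  have fm: "f s \<le> f t" if "t0 \<le> s" "s \<le> t" "t \<le> t1" for s t
    unfolding f_def using mono[OF that] by (intro floor_mono add_right_mono divide_right_mono) auto
  have "int (card (Z \<inter> {t0..t1})) \<le> f t1 - f t0 + 1"
  proof (rule strict_mono_int_card[where f = f])
    fix s t assume s: "s \<in> Z \<inter> {t0..t1}" and t: "t \<in> Z \<inter> {t0..t1}" and st: "s < t"
    obtain r where r: "s < r" "r \<le> t" "r \<in> Z" "y s * y r < 0" using velocity_alternates[of s t] s t st by blast
    have "f s \<noteq> f r"
    proof
      assume "f s = f r"
      then have c: "0 \<le> cos (\<theta> s) * cos (\<theta> r)" unfolding f_def by (rule cos_same_cell)
      have ks: "0 < \<kappa> s" "y s = 2 * (\<kappa> s * cos (\<theta> s))" using k[of s] s by auto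
      have kr: "0 < \<kappa> r" "y r = 2 * (\<kappa> r * cos (\<theta> r))" using k[of r] s t r by auto
      have "y s * y r = 4 * ((\<kappa> s * \<kappa> r) * (cos (\<theta> s) * cos (\<theta> r)))" unfolding ks(2) kr(2) by (simp add: mult_ac)
      moreover have "0 \<le> (\<kappa> s * \<kappa> r) * (cos (\<theta> s) * cos (\<theta> r))" by (rule mult_nonneg_nonneg[OF less_imp_le[OF mult_pos_pos[OF ks(1) kr(1)]] c])
      ultimately show False using r(4) by linarith
    qed
    moreover have "f s \<le> f r" "f r \<le> f t" using s t r by (auto intro!: fm)
    ultimately show "f s < f t" by linarith
  next
    show "f ` (Z \<inter> {t0..t1}) \<subseteq> {f t0..f t1}" using fm by auto
    show "f t0 \<le> f t1 + 1" using fm[of t0 t1] sub by auto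
  qed
  then have "real (card (Z \<inter> {t0..t1})) \<le> of_int (f t1) - of_int (f t0) + 1" by linarith
  also have "\<dots> \<le> (\<theta> t1 / pi + 1 / 2) - (\<theta> t0 / pi + 1 / 2 - 1) + 1"
    unfolding f_def by linarith
  finally show ?thesis by (simp add: diff_divide_distrib)
qed

text \<open>The velocity changes sign between the first two zeros, so there is an instant of rest in
  between, and discarding the time before it loses only the first zero. A state at rest is what
  \<open>steering_from_turning_point\<close> starts from.\<close>

lemma turning_point:
  assumes "2 \<le> card Z"
  obtains s where "s \<in> {0..T}" "y s = 0" "card Z \<le> 1 + card (Z \<inter> {s..T})"
proof -
  have ne: "Z \<noteq> {}" using assms by auto
  define t1 where "t1 = Min Z"
  have t1: "t1 \<in> Z" "\<And>t. t \<in> Z \<Longrightarrow> t1 \<le> t" using Z_finite ne by (auto simp: t1_def)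
  have c1: "card (Z - {t1}) = card Z - 1" using t1 Z_finite by (simp add: card_Diff_singleton)
  then have ne': "Z - {t1} \<noteq> {}" using assms by fastforce
  define t2 where "t2 = Min (Z - {t1})"
  have "t2 \<in> Z - {t1}" unfolding t2_def by (rule Min_in) (use Z_finite ne' in auto)
  then have t2: "t2 \<in> Z" "t2 \<noteq> t1" by auto
  have t2m: "t2 \<le> t" if "t \<in> Z" "t \<noteq> t1" for t
    unfolding t2_def by (rule Min_le) (use Z_finite that in auto)
  have lt: "t1 < t2" using t1(2)[OF t2(1)] t2(2) by linarith
  obtain r where r: "t1 < r" "r \<le> t2" "r \<in> Z" "y t1 * y r < 0" by (rule velocity_alternates[OF t1(1) t2(1) lt])
  have sub: "{t1..r} \<subseteq> {0..T}" using t1 r by (auto simp: Z_def)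
  have cy: "continuous_on {t1..r} y" by (rule continuous_on_subset[OF continuous_state(2) sub])
  have "\<exists>s\<in>{t1..r}. y s = 0"
  proof (cases "y t1 < 0")
    case True
    then have "0 \<le> y r" using r(4) by (smt (verit) mult_neg_neg)
    then show ?thesis using IVT'[of y t1 0 r] True cy r(1) by fastforce
  next
    case False
    then have "y r \<le> 0" "0 \<le> y t1" using r(4) by (smt (verit) mult_nonneg_nonneg)+
    then show ?thesis using IVT2'[of y r 0 t1] cy r(1) by fastforce
  qed
  then obtain s where s: "s \<in> {t1..r}" "y s = 0" by blast
  have sT: "s \<in> {0..T}" using s sub by auto
  have "Z \<subseteq> insert t1 (Z \<inter> {s..T})"
  proof
    fix t assume t: "t \<in> Z"
    show "t \<in> insert t1 (Z \<inter> {s..T})"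
    proof (cases "t = t1")
      case False
      then have "t2 \<le> t" by (rule t2m[OF t])
      then have "s \<le> t" using s r by auto
      then show ?thesis using t by (auto simp: Z_def)
    qed simp
  qed
  then have "card Z \<le> card (insert t1 (Z \<inter> {s..T}))" using Z_finite by (intro card_mono) auto
  also have "\<dots> \<le> 1 + card (Z \<inter> {s..T})" using Z_finite by (simp add: card_insert_if)
  finally show thesis using that[OF sT s(2)] by simp
qed


definition modulus :: "real \<Rightarrow> real" where "modulus t = sqrt ((sin (x t / 2))\<^sup>2 + (y t / 2)\<^sup>2)"

lemma modulus_sq: "(modulus t)\<^sup>2 = (sin (x t / 2))\<^sup>2 + (y t / 2)\<^sup>2" by (simp add: modulus_def)

lemma continuous_on_modulus: "continuous_on {0..T} modulus"
  unfolding modulus_def using continuous_state by (intro continuous_intros) auto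

lemma modulus_end: "modulus T = 0"
proof -
  obtain n where "0 = x T + of_int n * (2 * pi)" using end_state(1) unfolding rcong_altdef by blast
  then have "x T / 2 = - (of_int n * pi)" by simp
  then have "sin (x T / 2) = 0" by (simp only: sin_minus) (simp add: sin_times_pi_eq_0)
  then show ?thesis by (simp add: modulus_def end_state(2))
qed

text \<open>Where the modulus stays below 1 the lift of the angle can be shifted so that it stays in
  \<open>{-pi<..<pi}\<close>.\<close>
lemma polar:
  assumes sub: "0 \<le> t0" "t0 \<le> t1" "t1 \<le> T" and k: "\<And>t. t \<in> {t0..t1} \<Longrightarrow> 0 < modulus t \<and> modulus t < 1"
  obtains \<theta> v where "continuous_on {t0..t1} \<theta>" "\<And>t. t \<in> {t0..t1} \<Longrightarrow> 0 < \<theta> t"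
    "\<And>t. t \<in> {t0..t1} \<Longrightarrow> y t / 2 = modulus t * cos (\<theta> t)"
    "\<And>t. t \<in> {t0<..<t1} - Z \<Longrightarrow> \<bar>v t\<bar> \<le> 1 \<and>
       (modulus has_real_derivative \<epsilon> * v t * cos (\<theta> t) / 2) (at t) \<and>
       (\<theta> has_real_derivative sqrt (1 - (modulus t)\<^sup>2 * (sin (\<theta> t))\<^sup>2) - \<epsilon> * v t * sin (\<theta> t) / (2 * modulus t)) (at t)"
proof -
  have sb: "{t0..t1} \<subseteq> {0..T}" using sub by auto
  note cx = continuous_on_subset[OF continuous_state(1) sb] and cy = continuous_on_subset[OF continuous_state(2) sb]
  have nz: "cos (x t / 2) \<noteq> 0" if "t \<in> {t0..t1}" for t
  proof
    assume "cos (x t / 2) = 0"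
    then have "(sin (x t / 2))\<^sup>2 = 1" using sin_cos_squared_add[of "x t / 2"] by simp
    then have "1 \<le> (modulus t)\<^sup>2" unfolding modulus_sq by simp
    moreover have "(modulus t)\<^sup>2 < 1" using k[OF that] by (simp add: power_less_one_iff abs_square_less_1)
    ultimately show False by simp
  qed
  \<comment> \<open>Modulus below 1 keeps cos (x / 2) away from 0, so it has one sign on the
    interval; shifting x by 2 \<pi> reverses that sign if necessary.\<close>
  obtain m :: int where m: "\<And>t. t \<in> {t0..t1} \<Longrightarrow> 0 < cos ((x t + of_int m * (2 * pi)) / 2)"
  proof (cases "0 < cos (x t0 / 2)")
    case True
    have "0 < cos ((x t + of_int 0 * (2 * pi)) / 2)" if t: "t \<in> {t0..t1}" for t
    proof (rule ccontr)
      assume "\<not> 0 < cos ((x t + of_int 0 * (2 * pi)) / 2)"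
      then have c: "cos (x t / 2) \<le> 0" by simp
      have "continuous_on {t0..t} (\<lambda>t. cos (x t / 2))"
        by (intro continuous_intros continuous_on_subset[OF cx]) (use t in auto)
      from IVT2'[OF c _ _ this] True t obtain r where "r \<in> {t0..t1}" "cos (x r / 2) = 0" by fastforce
      then show False using nz by blast
    qed
    then show thesis by (rule that)
  next
    case False
    have "0 < cos ((x t + of_int 1 * (2 * pi)) / 2)" if t: "t \<in> {t0..t1}" for t
    proof (rule ccontr)
      assume "\<not> 0 < cos ((x t + of_int 1 * (2 * pi)) / 2)"
      then have c: "0 \<le> cos (x t / 2)" by (simp add: add_divide_distrib)
      have "continuous_on {t0..t} (\<lambda>t. cos (x t / 2))"
        by (intro continuous_intros continuous_on_subset[OF cx]) (use t in auto)
      from IVT'[OF _ c _ this] False t obtain r where "r \<in> {t0..t1}" "cos (x r / 2) = 0" by fastforce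
      then show False using nz by blast
    qed
    then show thesis by (rule that)
  qed
  define x' where "x' t = x t + of_int m * (2 * pi)" for t
  have s: "sin (x' t) = sin (x t)" for t
  proof -
    have "x' t = x t + 2 * pi * of_int m" by (simp add: x'_def)
    also have "sin \<dots> = sin (x t)" unfolding sin_add by (simp only: sin_int_2pin cos_int_2pin)
    finally show ?thesis .
  qed
  have s2: "(sin (x' t / 2))\<^sup>2 = (sin (x t / 2))\<^sup>2" for t
  proof -
    have e: "x' t / 2 = x t / 2 + of_int m * pi" by (simp add: x'_def add_divide_distrib)
    have z: "sin (of_int m * pi) = 0" by (simp add: sin_times_pi_eq_0)
    then have c: "(cos (of_int m * pi))\<^sup>2 = 1" using sin_cos_squared_add[of "of_int m * pi"] by simp
    show ?thesis unfolding e sin_add z power_mult_distrib c by (simp add: power_mult_distrib c)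
  qed
  have ksq: "0 < (sin (x' t / 2))\<^sup>2 + (y t / 2)\<^sup>2" if "t \<in> {t0..t1}" for t
    using k[OF that] unfolding s2 modulus_sq[symmetric] by simp
  have d: "(x' has_real_derivative y t) (at t) \<and> (y has_real_derivative - sin (x' t) + \<epsilon> * sgn (\<psi> t)) (at t)"
    if t: "t \<in> {t0<..<t1} - Z" for t
  proof
    have t': "t \<in> {0<..<T} - Z" using t sub by auto
    show "(x' has_real_derivative y t) (at t)" unfolding x'_def[abs_def] 
      using DERIV_add[OF state_derivs(1)[OF t'] DERIV_const] by simp
    show "(y has_real_derivative - sin (x' t) + \<epsilon> * sgn (\<psi> t)) (at t)" unfolding s by (rule state_derivs(2)[OF t'])
  qed
  have cx': "continuous_on {t0..t1} x'" unfolding x'_def by (intro continuous_intros cx)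
  have m': "0 < cos (x' t / 2)" if "t \<in> {t0..t1}" for t using m[OF that] by (simp add: x'_def)
  obtain \<kappa> \<theta> where "continuous_on {t0..t1} \<kappa>" and pl: "continuous_on {t0..t1} \<theta>"
    "\<And>t. t \<in> {t0..t1} \<Longrightarrow> 0 < \<theta> t"
    "\<And>t. \<kappa> t = sqrt ((sin (x' t / 2))\<^sup>2 + (y t / 2)\<^sup>2)"
    "\<And>t. t \<in> {t0..t1} \<Longrightarrow> sin (x' t / 2) = \<kappa> t * sin (\<theta> t) \<and> y t / 2 = \<kappa> t * cos (\<theta> t)"
    "\<And>t. t \<in> {t0<..<t1} - Z \<Longrightarrow>
       (\<kappa> has_real_derivative \<epsilon> * sgn (\<psi> t) * cos (\<theta> t) / 2) (at t) \<and>
       (\<theta> has_real_derivative sqrt (1 - (\<kappa> t)\<^sup>2 * (sin (\<theta> t))\<^sup>2) - \<epsilon> * sgn (\<psi> t) * sin (\<theta> t) / (2 * \<kappa> t)) (at t)"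
    by (rule polar_lift[OF sub(2) cx' cy m' ksq d], assumption+, rule that)
  have k\<kappa>: "\<kappa> = modulus" unfolding fun_eq_iff pl(3) modulus_def s2 by simp
  show thesis
  proof (rule that[OF pl(1,2)])
    show "y t / 2 = modulus t * cos (\<theta> t)" if "t \<in> {t0..t1}" for t using pl(4)[OF that] unfolding k\<kappa> by blast
    show "\<bar>sgn (\<psi> t)\<bar> \<le> 1 \<and>
       (modulus has_real_derivative \<epsilon> * sgn (\<psi> t) * cos (\<theta> t) / 2) (at t) \<and>
       (\<theta> has_real_derivative sqrt (1 - (modulus t)\<^sup>2 * (sin (\<theta> t))\<^sup>2) - \<epsilon> * sgn (\<psi> t) * sin (\<theta> t) / (2 * modulus t)) (at t)"
      if "t \<in> {t0<..<t1} - Z" for t using pl(5)[OF that] unfolding k\<kappa> by (simp add: sgn_if)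
  qed
qed

text \<open>Averaging with a = b = 1 and c = 0. Since u cos \<theta> + |cos \<theta>| \<ge> 0 for
  every admissible control, the rotation is at most the elapsed time minus the drop of the potential
  for (1, 1), whatever the optimal control does. The hypothesis \<open>small\<close> makes \<theta>
  monotone, as \<open>zeros_le_angle\<close> requires.\<close>

lemma middle_zeros:
  fixes \<delta> K
  assumes avg: "\<And>t0 t1 \<kappa> \<theta> u S c. \<lbrakk>0 < \<epsilon>; t0 \<le> t1; finite S; continuous_on {t0..t1} \<kappa>; continuous_on {t0..t1} \<theta>;
       \<And>t. t \<in> {t0..t1} \<Longrightarrow> \<kappa> t \<in> {\<delta>..1 - \<delta>} \<and> 0 < \<theta> t;
       \<And>t. t \<in> {t0<..<t1} - S \<Longrightarrow> \<bar>u t\<bar> \<le> 1 \<and>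
          (\<kappa> has_real_derivative \<epsilon> * u t * cos (\<theta> t) / 2) (at t) \<and>
          (\<theta> has_real_derivative sqrt (1 - (\<kappa> t)\<^sup>2 * (sin (\<theta> t))\<^sup>2) - \<epsilon> * u t * sin (\<theta> t) / (2 * \<kappa> t)) (at t)\<rbrakk>
     \<Longrightarrow> (\<forall>t\<in>{t0<..<t1} - S. c \<le> energy_weight 1 1 (\<kappa> t) * (u t * cos (\<theta> t) + \<bar>cos (\<theta> t)\<bar>) / 2) \<longrightarrow>
           \<epsilon> * (c - 1) * (t1 - t0) - K * \<epsilon>\<^sup>2 * (t1 - t0) - K * \<epsilon> \<le>
           energy_potential 1 1 \<delta> (\<kappa> t1) - energy_potential 1 1 \<delta> (\<kappa> t0) - \<epsilon> * 1 * (\<theta> t1 - \<theta> t0)"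
    and \<delta>: "0 < \<delta>" "\<delta> < 1 / 2" and small: "\<epsilon> \<le> 2 * \<delta>\<^sup>2"
    and sub: "0 \<le> t0" "t0 \<le> t1" "t1 \<le> T" and k: "\<And>t. t \<in> {t0..t1} \<Longrightarrow> modulus t \<in> {\<delta>..1 - \<delta>}"
  shows "\<epsilon> * pi * real (card (Z \<inter> {t0..t1})) \<le> \<epsilon> * (t1 - t0) + K * \<epsilon>\<^sup>2 * (t1 - t0) + K * \<epsilon> + 2 * pi * \<epsilon>
    + (energy_potential 1 1 \<delta> (modulus t1) - energy_potential 1 1 \<delta> (modulus t0))"
proof -
  have k': "0 < modulus t \<and> modulus t < 1" if "t \<in> {t0..t1}" for t using k[OF that] \<delta> by auto
  obtain \<theta> v where p: "continuous_on {t0..t1} \<theta>" "\<And>t. t \<in> {t0..t1} \<Longrightarrow> 0 < \<theta> t"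
    "\<And>t. t \<in> {t0..t1} \<Longrightarrow> y t / 2 = modulus t * cos (\<theta> t)"
    "\<And>t. t \<in> {t0<..<t1} - Z \<Longrightarrow> \<bar>v t\<bar> \<le> 1 \<and>
       (modulus has_real_derivative \<epsilon> * v t * cos (\<theta> t) / 2) (at t) \<and>
       (\<theta> has_real_derivative sqrt (1 - (modulus t)\<^sup>2 * (sin (\<theta> t))\<^sup>2) - \<epsilon> * v t * sin (\<theta> t) / (2 * modulus t)) (at t)"
    by (rule polar[OF sub k'], assumption+, rule that)
  have mono: "\<theta> s \<le> \<theta> t" if st: "t0 \<le> s" "s \<le> t" "t \<le> t1" for s t
  proof -
    have "0 * (t - s) \<le> \<theta> t - \<theta> s"
    proof (rule increment_ge[OF Z_finite st(2)])
      show "continuous_on {s..t} \<theta>" by (rule continuous_on_subset[OF p(1)]) (use st in auto)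
      fix r assume r: "r \<in> {s<..<t} - Z"
      then have r': "r \<in> {t0<..<t1} - Z" "r \<in> {t0..t1}" using st by auto
      show "(\<theta> has_real_derivative sqrt (1 - (modulus r)\<^sup>2 * (sin (\<theta> r))\<^sup>2) - \<epsilon> * v r * sin (\<theta> r) / (2 * modulus r)) (at r)"
        using p(4)[OF r'(1)] by blast
      have kr: "\<delta> \<le> modulus r" "modulus r \<le> 1 - \<delta>" using k[OF r'(2)] by auto
      have "(modulus r)\<^sup>2 * (sin (\<theta> r))\<^sup>2 \<le> (1 - \<delta>)\<^sup>2 * 1"
        using kr \<delta> by (intro mult_mono power_mono) (auto simp: abs_square_le_1)
      moreover have "\<delta>\<^sup>2 + (1 - \<delta>)\<^sup>2 \<le> 1"
      proof -
        have "1 - (\<delta>\<^sup>2 + (1 - \<delta>)\<^sup>2) = 2 * (\<delta> * (1 - \<delta>))" by (simp add: power2_eq_square algebra_simps)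
        moreover have "0 \<le> \<delta> * (1 - \<delta>)" using \<delta> by simp
        ultimately show ?thesis by linarith
      qed
      ultimately have "\<delta> \<le> sqrt (1 - (modulus r)\<^sup>2 * (sin (\<theta> r))\<^sup>2)" by (intro real_le_rsqrt) linarith
      moreover have "\<epsilon> * v r * sin (\<theta> r) / (2 * modulus r) \<le> \<delta>"
      proof -
        have "\<epsilon> * v r * sin (\<theta> r) \<le> \<bar>\<epsilon> * v r * sin (\<theta> r)\<bar>" by simp
        also have "\<dots> = \<epsilon> * (\<bar>v r\<bar> * \<bar>sin (\<theta> r)\<bar>)" using eps by (simp add: abs_mult)
        also have "\<dots> \<le> \<epsilon> * (1 * 1)" using p(4)[OF r'(1)] eps by (intro mult_left_mono mult_mono) auto
        also have "\<dots> \<le> \<delta> * (2 * \<delta>)" using small by (simp add: power2_eq_square)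
        also have "\<dots> \<le> \<delta> * (2 * modulus r)" using kr \<delta> by (intro mult_left_mono) auto
        finally show ?thesis using kr \<delta> by (simp add: divide_le_eq)
      qed
      ultimately show "0 \<le> sqrt (1 - (modulus r)\<^sup>2 * (sin (\<theta> r))\<^sup>2) - \<epsilon> * v r * sin (\<theta> r) / (2 * modulus r)" by linarith
    qed
    then show ?thesis by simp
  qed
  have ck: "continuous_on {t0..t1} modulus" by (rule continuous_on_subset[OF continuous_on_modulus]) (use sub in auto)
  have pr: "0 \<le> energy_weight 1 1 (modulus t) * (v t * cos (\<theta> t) + \<bar>cos (\<theta> t)\<bar>) / 2" if t: "t \<in> {t0<..<t1} - Z" for t
  proof -
    have "\<bar>v t\<bar> * \<bar>cos (\<theta> t)\<bar> \<le> 1 * \<bar>cos (\<theta> t)\<bar>" using p(4)[OF t] by (intro mult_right_mono) auto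
    then have "0 \<le> v t * cos (\<theta> t) + \<bar>cos (\<theta> t)\<bar>" unfolding abs_mult[symmetric] by linarith
    moreover have "0 \<le> energy_weight 1 1 (modulus t)" using k'[of t] t by (intro energy_weight_nonneg) auto
    ultimately show ?thesis by simp
  qed
  have "\<epsilon> * (0 - 1) * (t1 - t0) - K * \<epsilon>\<^sup>2 * (t1 - t0) - K * \<epsilon> \<le>
           energy_potential 1 1 \<delta> (modulus t1) - energy_potential 1 1 \<delta> (modulus t0) - \<epsilon> * 1 * (\<theta> t1 - \<theta> t0)"
    using avg[of t0 t1 Z modulus \<theta> v 0, OF eps sub(2) Z_finite ck p(1) _ p(4)] k p(2) pr by blast
  moreover have "\<epsilon> * pi * real (card (Z \<inter> {t0..t1})) \<le> \<epsilon> * (\<theta> t1 - \<theta> t0) + 2 * pi * \<epsilon>"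
  proof -
    have "real (card (Z \<inter> {t0..t1})) \<le> (\<theta> t1 - \<theta> t0) / pi + 2"
      by (rule zeros_le_angle[OF sub _ mono, of modulus]) (use k' p(3) in auto)
    then have "(\<epsilon> * pi) * real (card (Z \<inter> {t0..t1})) \<le> (\<epsilon> * pi) * ((\<theta> t1 - \<theta> t0) / pi + 2)"
      using eps by (intro mult_left_mono) auto
    also have "\<dots> = \<epsilon> * (\<theta> t1 - \<theta> t0) + 2 * pi * \<epsilon>" by (simp add: field_simps)
    finally show ?thesis .
  qed
  ultimately show ?thesis by (simp add: algebra_simps)
qed


text \<open>Let \<open>tb\<close> be the last time with modulus 1 - \<delta> (or the turning point,
  if that level is not reached afterwards) and \<open>tc\<close> the first later time with modulus
  \<delta>. Zeros are counted by time outside and by rotation between them. The elapsed times add up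
  to T - s, which steering bounds by the drop of the potential for (1, 0); minus the drop for (1, 1)
  this is \<pi> times a part of the swing integral.\<close>

lemma zeros_bound:
  fixes \<delta> K K2
  assumes avg: "\<And>t0 t1 \<kappa> \<theta> u S c. \<lbrakk>0 < \<epsilon>; t0 \<le> t1; finite S; continuous_on {t0..t1} \<kappa>; continuous_on {t0..t1} \<theta>;
       \<And>t. t \<in> {t0..t1} \<Longrightarrow> \<kappa> t \<in> {\<delta>..1 - \<delta>} \<and> 0 < \<theta> t;
       \<And>t. t \<in> {t0<..<t1} - S \<Longrightarrow> \<bar>u t\<bar> \<le> 1 \<and>
          (\<kappa> has_real_derivative \<epsilon> * u t * cos (\<theta> t) / 2) (at t) \<and>
          (\<theta> has_real_derivative sqrt (1 - (\<kappa> t)\<^sup>2 * (sin (\<theta> t))\<^sup>2) - \<epsilon> * u t * sin (\<theta> t) / (2 * \<kappa> t)) (at t)\<rbrakk>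
     \<Longrightarrow> (\<forall>t\<in>{t0<..<t1} - S. c \<le> energy_weight 1 1 (\<kappa> t) * (u t * cos (\<theta> t) + \<bar>cos (\<theta> t)\<bar>) / 2) \<longrightarrow>
           \<epsilon> * (c - 1) * (t1 - t0) - K * \<epsilon>\<^sup>2 * (t1 - t0) - K * \<epsilon> \<le>
           energy_potential 1 1 \<delta> (\<kappa> t1) - energy_potential 1 1 \<delta> (\<kappa> t0) - \<epsilon> * 1 * (\<theta> t1 - \<theta> t0)"
    and steer: "\<And>x1. \<exists>T u x y. pw_trajectory \<epsilon> T u x y \<and> x 0 = x1 \<and> y 0 = 0 \<and> [x T = 0] (rmod 2 * pi) \<and> y T = 0 \<and>
        \<epsilon> * T \<le> energy_potential 1 0 \<delta> (clamp_modulus \<delta> \<bar>sin (x1 / 2)\<bar>) - energy_potential 1 0 \<delta> \<delta> + R"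
    and K: "0 \<le> K" and R: "0 \<le> R"
    and \<delta>: "0 < \<delta>" "\<delta> < 1 / 2" and small: "\<epsilon> \<le> 2 * \<delta>\<^sup>2"
  shows "\<epsilon> * pi * real (card Z) \<le> pi * swing_integral pi + R + (5 * pi + K) * \<epsilon>
    + K * \<epsilon> * (energy_potential 1 0 \<delta> (1 - \<delta>) - energy_potential 1 0 \<delta> \<delta> + R)"
proof -
  define A where "A = energy_potential 1 0 \<delta> (1 - \<delta>) - energy_potential 1 0 \<delta> \<delta> + R"
  have mono: "energy_potential 1 0 \<delta> k \<le> energy_potential 1 0 \<delta> k'" if "\<delta> \<le> k" "k \<le> k'" "k' \<le> 1 - \<delta>" for k k'
    using energy_potential_mono[of \<delta> k k'] that \<delta> by simp
  have A0: "0 \<le> A" using mono[of \<delta> "1 - \<delta>"] \<delta> R by (simp add: A_def)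
  have sw0: "0 \<le> swing_integral pi" using swing_integral_diff(1)[of 0 pi] by (simp add: swing_integral_0)
  have KA: "0 \<le> K * \<epsilon> * A" using K A0 eps by simp
  have K\<epsilon>: "0 \<le> K * \<epsilon>" using K eps by simp
  have ep: "0 < \<epsilon> * pi" using eps by simp
  have psw: "0 \<le> pi * swing_integral pi" using sw0 by simp
  have goal: ?thesis if "\<epsilon> * pi * real (card Z) \<le> pi * swing_integral pi + R + (5 * pi + K) * \<epsilon> + K * \<epsilon> * A"
    using that unfolding A_def .
  show ?thesis
  proof (cases "2 \<le> card Z")
    case False
    then have "(\<epsilon> * pi) * real (card Z) \<le> (\<epsilon> * pi) * 1" using ep by (intro mult_left_mono) auto
    moreover have "(5 * pi + K) * \<epsilon> = 5 * (\<epsilon> * pi) + K * \<epsilon>" by (simp add: algebra_simps)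
    ultimately show ?thesis using R KA K\<epsilon> psw ep by (intro goal) linarith
  next
    case True
    then obtain s where s: "s \<in> {0..T}" "y s = 0" "card Z \<le> 1 + card (Z \<inter> {s..T})" by (rule turning_point)
    have ms: "modulus s = \<bar>sin (x s / 2)\<bar>" by (simp add: modulus_def s(2))
    obtain \<tau> u' x' y' where st: "pw_trajectory \<epsilon> \<tau> u' x' y'" "x' 0 = x s" "y' 0 = 0" "[x' \<tau> = 0] (rmod 2 * pi)" "y' \<tau> = 0"
        "\<epsilon> * \<tau> \<le> energy_potential 1 0 \<delta> (clamp_modulus \<delta> (modulus s)) - energy_potential 1 0 \<delta> \<delta> + R"
      using steer[of "x s"] unfolding ms by blast
    have "T - s \<le> \<tau>" by (rule remaining_time_le[OF s(1) st(1,2) _ st(4,5)]) (simp add: st(3) s(2))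
    then have "\<epsilon> * (T - s) \<le> \<epsilon> * \<tau>" using eps by simp
    then have time: "\<epsilon> * (T - s) \<le> energy_potential 1 0 \<delta> (clamp_modulus \<delta> (modulus s)) - energy_potential 1 0 \<delta> \<delta> + R"
      using st(6) by linarith
    have cl: "\<delta> \<le> clamp_modulus \<delta> k" "clamp_modulus \<delta> k \<le> 1 - \<delta>" for k using \<delta> by (auto simp: clamp_modulus_def)
    have timeA: "\<epsilon> * (T - s) \<le> A" using time mono[OF cl(1) cl(2) order_refl, of "modulus s"] unfolding A_def by linarith
    \<comment> \<open>The comparison of clamped moduli lets the time bound, which is known at
      \<open>s\<close>, be expressed by the modulus at \<open>tb\<close>, where the middle stretch
      begins.\<close>
    obtain tb where tb: "s \<le> tb" "tb \<le> T" "clamp_modulus \<delta> (modulus s) \<le> clamp_modulus \<delta> (modulus tb)"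
      "\<And>t. t \<in> {tb..T} \<Longrightarrow> modulus t \<le> 1 - \<delta>"
    proof (cases "\<exists>r\<in>{s..T}. 1 - \<delta> \<le> modulus r")
      case False
      then show thesis using that[of s] s(1) by force
    next
      case True
      then obtain r where r: "r \<in> {s..T}" "1 - \<delta> \<le> modulus r" by blast
      \<comment> \<open>The last time at the level 1 - \<delta> is the first one when time runs
        backwards.\<close>
      have "continuous_on {- T..- r} (\<lambda>t. - modulus (- t))"
        by (intro continuous_intros continuous_on_compose2[OF continuous_on_modulus]) (use s(1) r(1) in auto)
      moreover have "- (1 - \<delta>) \<le> - modulus (- (- T))" using modulus_end \<delta> by simp
      ultimately obtain t where t: "t \<in> {- T..- r}" "- modulus (- t) = - (1 - \<delta>)" "\<And>q. q \<in> {- T..<t} \<Longrightarrow> - (1 - \<delta>) < - modulus (- q)"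
        using continuous_hitting_time[of "- T" "- r" "\<lambda>t. - modulus (- t)" "- (1 - \<delta>)"] r by auto
      show thesis
      proof (rule that[of "- t"])
        have "clamp_modulus \<delta> (modulus (- t)) = 1 - \<delta>" using t(2) \<delta> by (simp add: clamp_modulus_def)
        then show "clamp_modulus \<delta> (modulus s) \<le> clamp_modulus \<delta> (modulus (- t))" using cl(2) by simp
        show "modulus q \<le> 1 - \<delta>" if q: "q \<in> {- t..T}" for q
          using t(2) t(3)[of "- q"] q by (cases "q = - t") auto
      qed (use t(1) r(1) in auto)
    qed
    have scale: "\<epsilon> * pi * real (card (Z \<inter> {a..b})) \<le> \<epsilon> * (b - a) + pi * \<epsilon>" if "a \<le> b" for a b
    proof -
      have "(\<epsilon> * pi) * real (card (Z \<inter> {a..b})) \<le> (\<epsilon> * pi) * ((b - a) / pi + 1)"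
        using Z_card_interval[OF that] ep by (intro mult_left_mono) auto
      also have "\<dots> = \<epsilon> * (b - a) + pi * \<epsilon>" by (simp add: field_simps)
      finally show ?thesis .
    qed
    have tbT: "tb \<in> {0..T}" using tb s(1) by auto
    show ?thesis
    proof (cases "modulus tb \<le> \<delta>")
      case True
      then have "clamp_modulus \<delta> (modulus tb) = \<delta>" using \<delta> by (simp add: clamp_modulus_def)
      then have "clamp_modulus \<delta> (modulus s) = \<delta>" using tb(3) cl(1)[of "modulus s"] by linarith
      \<comment> \<open>Both clamped moduli equal \<delta>, so the potential difference vanishes and
        the whole remaining time is covered by the error \<open>R\<close>.\<close>
      then have tR: "\<epsilon> * (T - s) \<le> R" using time by simp
      have "(\<epsilon> * pi) * real (card Z) \<le> (\<epsilon> * pi) * (1 + real (card (Z \<inter> {s..T})))"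
        using ep s(3) by (intro mult_left_mono) linarith+
      also have "\<dots> = \<epsilon> * pi + \<epsilon> * pi * real (card (Z \<inter> {s..T}))" by (simp add: algebra_simps)
      also have "\<dots> \<le> \<epsilon> * pi + (\<epsilon> * (T - s) + pi * \<epsilon>)" using scale[of s T] s(1) by simp
      finally have "\<epsilon> * pi * real (card Z) \<le> 2 * (\<epsilon> * pi) + R" using tR by (simp add: mult.commute)
      moreover have "(5 * pi + K) * \<epsilon> = 5 * (\<epsilon> * pi) + K * \<epsilon>" by (simp add: algebra_simps)
      ultimately show ?thesis using R KA K\<epsilon> psw ep by (intro goal) linarith
    next
      case False
      have ctb: "continuous_on {tb..T} modulus" by (rule continuous_on_subset[OF continuous_on_modulus]) (use tbT in auto)
      obtain tc where tc: "tc \<in> {tb..T}" "modulus tc = \<delta>" "\<And>r. r \<in> {tb..<tc} \<Longrightarrow> \<delta> < modulus r"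
        using continuous_hitting_time[OF tb(2) ctb, of \<delta>] False modulus_end \<delta> by auto
      define kb where "kb = modulus tb"
      have kb: "\<delta> \<le> kb" "kb \<le> 1 - \<delta>" using False tb(2) tb(4)[of tb] by (auto simp: kb_def)
      have clkb: "clamp_modulus \<delta> (modulus tb) = kb" using kb by (simp add: clamp_modulus_def kb_def)
      have mid: "\<epsilon> * pi * real (card (Z \<inter> {tb..tc})) \<le> \<epsilon> * (tc - tb) + K * \<epsilon>\<^sup>2 * (tc - tb) + K * \<epsilon> + 2 * pi * \<epsilon>
         + (energy_potential 1 1 \<delta> (modulus tc) - energy_potential 1 1 \<delta> (modulus tb))"
      proof (rule middle_zeros[OF avg \<delta> small])
        show "modulus t \<in> {\<delta>..1 - \<delta>}" if "t \<in> {tb..tc}" for t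
          using tc(2) tc(3)[of t] tb(4)[of t] that tc(1) by (cases "t = tc") auto
      qed (use tbT tc(1) in auto)
      have pot: "(energy_potential 1 0 \<delta> kb - energy_potential 1 0 \<delta> \<delta>) - (energy_potential 1 1 \<delta> kb - energy_potential 1 1 \<delta> \<delta>)
          \<le> pi * swing_integral pi"
      proof -
        have a: "0 \<le> arcsin \<delta>" "0 \<le> arcsin kb" "2 * arcsin \<delta> \<le> pi" "2 * arcsin kb \<le> pi"
          using arcsin_gt_zero[of \<delta>] arcsin_gt_zero[of kb] arcsin_ubound[of \<delta>] arcsin_ubound[of kb] \<delta> kb by auto
        have "swing_integral (2 * arcsin kb) \<le> swing_integral pi" "0 \<le> swing_integral (2 * arcsin \<delta>)"
          using swing_integral_diff(1)[of "2 * arcsin kb" pi] swing_integral_diff(1)[of 0 "2 * arcsin \<delta>"] a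
          by (auto simp: swing_integral_0)
        then have "swing_integral (2 * arcsin kb) - swing_integral (2 * arcsin \<delta>) \<le> swing_integral pi" by linarith
        then have "pi * (swing_integral (2 * arcsin kb) - swing_integral (2 * arcsin \<delta>)) \<le> pi * swing_integral pi"
          by (intro mult_left_mono) auto
        then show ?thesis using energy_potential_diff[of \<delta> \<delta> kb] \<delta> kb by simp
      qed
      have "K * \<epsilon>\<^sup>2 * (tc - tb) = K * \<epsilon> * (\<epsilon> * (tc - tb))" by (simp add: power2_eq_square)
      also have "\<dots> \<le> K * \<epsilon> * A"
      proof (rule mult_left_mono[OF _ K\<epsilon>])
        have "\<epsilon> * (tc - tb) \<le> \<epsilon> * (T - s)" using eps tc(1) tb(1) by (intro mult_left_mono) auto
        then show "\<epsilon> * (tc - tb) \<le> A" using timeA by linarith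
      qed
      finally have quad: "K * \<epsilon>\<^sup>2 * (tc - tb) \<le> K * \<epsilon> * A" .
      have tim: "\<epsilon> * (T - s) \<le> energy_potential 1 0 \<delta> kb - energy_potential 1 0 \<delta> \<delta> + R"
        using time mono[OF cl(1)[of "modulus s"] tb(3)[unfolded clkb] kb(2)] by linarith
      have sub: "Z \<inter> {s..T} \<subseteq> (Z \<inter> {s..tb}) \<union> ((Z \<inter> {tb..tc}) \<union> (Z \<inter> {tc..T}))" by auto
      have "card (Z \<inter> {s..T}) \<le> card ((Z \<inter> {s..tb}) \<union> ((Z \<inter> {tb..tc}) \<union> (Z \<inter> {tc..T})))"
        by (rule card_mono[OF _ sub]) (use Z_finite in auto)
      also have "\<dots> \<le> card (Z \<inter> {s..tb}) + (card (Z \<inter> {tb..tc}) + card (Z \<inter> {tc..T}))"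
        by (rule order_trans[OF card_Un_le add_left_mono[OF card_Un_le]])
      finally have "real (card Z) \<le> 1 + (real (card (Z \<inter> {s..tb})) + (real (card (Z \<inter> {tb..tc})) + real (card (Z \<inter> {tc..T}))))"
        using s(3) by linarith
      then have "(\<epsilon> * pi) * real (card Z) \<le> (\<epsilon> * pi) * (1 + (real (card (Z \<inter> {s..tb})) + (real (card (Z \<inter> {tb..tc})) + real (card (Z \<inter> {tc..T})))))"
        using ep by (intro mult_left_mono) auto
      also have "\<dots> = \<epsilon> * pi + \<epsilon> * pi * real (card (Z \<inter> {s..tb})) + \<epsilon> * pi * real (card (Z \<inter> {tb..tc})) + \<epsilon> * pi * real (card (Z \<inter> {tc..T}))"
        by (simp only: ring_distribs mult_1_right add.assoc)
      \<comment> \<open>Five times \<pi> \<epsilon> in all: the zero before \<open>s\<close>, one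
        for each outer stretch, and two from the cells of the angle.\<close>
      also have "\<dots> \<le> \<epsilon> * pi + (\<epsilon> * (tb - s) + pi * \<epsilon>) + (\<epsilon> * (tc - tb) + K * \<epsilon> * A + K * \<epsilon> + 2 * pi * \<epsilon>
         + (energy_potential 1 1 \<delta> \<delta> - energy_potential 1 1 \<delta> kb)) + (\<epsilon> * (T - tc) + pi * \<epsilon>)"
        using scale[of s tb] scale[of tc T] tb(1) tc(1) mid quad unfolding tc(2) kb_def[symmetric]
        by (intro add_mono order_refl) auto
      also have "\<dots> = \<epsilon> * (T - s) + (5 * pi + K) * \<epsilon> + K * \<epsilon> * A - (energy_potential 1 1 \<delta> kb - energy_potential 1 1 \<delta> \<delta>)"
        by (simp add: algebra_simps)
      also have "\<dots> \<le> pi * swing_integral pi + R + (5 * pi + K) * \<epsilon> + K * \<epsilon> * A" using tim pot by linarith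
      finally show ?thesis by (rule goal)
    qed
  qed
qed

end

theorem switchings_le:
  assumes \<delta>: "0 < \<delta>" "\<delta> < 1 / 2"
  obtains K \<epsilon>1 where "0 < \<epsilon>1"
    "\<And>\<epsilon> p T u x y \<phi> \<psi>. \<lbrakk>0 < \<epsilon>; \<epsilon> < \<epsilon>1; time_optimal \<epsilon> p T u x y; adjoint_variables \<epsilon> T u x y \<phi> \<psi>\<rbrakk> \<Longrightarrow>
      finite {t \<in> {0..T}. \<psi> t = 0} \<and>
      \<epsilon> * pi * real (card {t \<in> {0..T}. \<psi> t = 0}) \<le> pi * swing_integral pi + 8 * sqrt (2 * \<delta>) + 40 * \<delta> + K * sqrt \<epsilon>"
proof -
  obtain K where K: "0 \<le> K" and avg: "\<And>\<epsilon> t0 t1 \<kappa> \<theta> u S c. \<lbrakk>0 < \<epsilon>; t0 \<le> t1; finite S; continuous_on {t0..t1} \<kappa>; continuous_on {t0..t1} \<theta>;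
       \<And>t. t \<in> {t0..t1} \<Longrightarrow> \<kappa> t \<in> {\<delta>..1 - \<delta>} \<and> 0 < \<theta> t;
       \<And>t. t \<in> {t0<..<t1} - S \<Longrightarrow> \<bar>u t\<bar> \<le> 1 \<and>
          (\<kappa> has_real_derivative \<epsilon> * u t * cos (\<theta> t) / 2) (at t) \<and>
          (\<theta> has_real_derivative sqrt (1 - (\<kappa> t)\<^sup>2 * (sin (\<theta> t))\<^sup>2) - \<epsilon> * u t * sin (\<theta> t) / (2 * \<kappa> t)) (at t)\<rbrakk>
     \<Longrightarrow> ((\<forall>t\<in>{t0<..<t1} - S. c \<le> energy_weight 1 1 (\<kappa> t) * (u t * cos (\<theta> t) + \<bar>cos (\<theta> t)\<bar>) / 2) \<longrightarrow>
           \<epsilon> * (c - 1) * (t1 - t0) - K * \<epsilon>\<^sup>2 * (t1 - t0) - K * \<epsilon> \<le>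
           energy_potential 1 1 \<delta> (\<kappa> t1) - energy_potential 1 1 \<delta> (\<kappa> t0) - \<epsilon> * 1 * (\<theta> t1 - \<theta> t0))"
  proof (rule averaging[OF \<delta>, of 1 1], goal_cases)
    case (1 K)
    show ?case by (rule 1(1)[OF 1(2)]) (rule conjunct1[OF 1(3)]; assumption)
  qed
  obtain K2 \<epsilon>2 where K2: "0 \<le> K2" "0 < \<epsilon>2" and steer: "\<And>\<epsilon> x1. \<lbrakk>0 < \<epsilon>; \<epsilon> < \<epsilon>2\<rbrakk> \<Longrightarrow>
      \<exists>T u x y. pw_trajectory \<epsilon> T u x y \<and> x 0 = x1 \<and> y 0 = 0 \<and> [x T = 0] (rmod 2 * pi) \<and> y T = 0 \<and>
        \<epsilon> * T \<le> energy_potential 1 0 \<delta> (clamp_modulus \<delta> \<bar>sin (x1 / 2)\<bar>)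
          - energy_potential 1 0 \<delta> \<delta> + 8 * sqrt (2 * \<delta>) + 40 * \<delta> + K2 * sqrt \<epsilon>"
    by (rule steering_from_turning_point[OF \<delta>]) (rule that)
  define B where "B = energy_potential 1 0 \<delta> (1 - \<delta>) - energy_potential 1 0 \<delta> \<delta> + (8 * sqrt (2 * \<delta>) + 40 * \<delta>)"
  have B0: "0 \<le> B" using energy_potential_mono[of \<delta> \<delta> "1 - \<delta>"] \<delta> by (simp add: B_def)
  define K3 where "K3 = K2 + (5 * pi + K) + K * (B + K2)"
  define \<epsilon>1 where "\<epsilon>1 = Orderings.min 1 (Orderings.min \<epsilon>2 (2 * \<delta>\<^sup>2))"
  show thesis
  proof (rule that[of \<epsilon>1 K3])
    show "0 < \<epsilon>1" using K2 \<delta> by (simp add: \<epsilon>1_def)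
    fix \<epsilon> p T u x y \<phi> \<psi>
    assume e: "0 < \<epsilon>" "\<epsilon> < \<epsilon>1" and o: "time_optimal \<epsilon> p T u x y" "adjoint_variables \<epsilon> T u x y \<phi> \<psi>"
    then interpret extremal \<epsilon> T p u x y \<phi> \<psi> by unfold_locales
    have e': "\<epsilon> < \<epsilon>2" "\<epsilon> \<le> 2 * \<delta>\<^sup>2" "\<epsilon> < 1" using e by (auto simp: \<epsilon>1_def)
    define R where "R = 8 * sqrt (2 * \<delta>) + 40 * \<delta> + K2 * sqrt \<epsilon>"
    have R: "0 \<le> R" using K2 \<delta> e by (simp add: R_def)
    have "\<epsilon> * pi * real (card Z) \<le> pi * swing_integral pi + R + (5 * pi + K) * \<epsilon>
      + K * \<epsilon> * (energy_potential 1 0 \<delta> (1 - \<delta>) - energy_potential 1 0 \<delta> \<delta> + R)"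
    proof (rule zeros_bound[OF avg _ K R \<delta> e'(2)])
      fix x1
      show "\<exists>T u x y. pw_trajectory \<epsilon> T u x y \<and> x 0 = x1 \<and> y 0 = 0 \<and> [x T = 0] (rmod 2 * pi) \<and> y T = 0 \<and>
        \<epsilon> * T \<le> energy_potential 1 0 \<delta> (clamp_modulus \<delta> \<bar>sin (x1 / 2)\<bar>) - energy_potential 1 0 \<delta> \<delta> + R"
        using steer[OF e(1) e'(1), of x1] unfolding R_def add.assoc .
    qed
    also have "\<dots> \<le> pi * swing_integral pi + R + (5 * pi + K) * sqrt \<epsilon> + K * (B + K2) * sqrt \<epsilon>"
    proof -
      have "\<epsilon> * \<epsilon> \<le> 1 * \<epsilon>" using e(1) e'(3) by (intro mult_right_mono) auto
      then have se: "\<epsilon> \<le> sqrt \<epsilon>" "sqrt \<epsilon> \<le> 1" using e'(3) by (auto intro!: real_le_rsqrt simp: power2_eq_square)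
      have "(5 * pi + K) * \<epsilon> \<le> (5 * pi + K) * sqrt \<epsilon>" using K se by (intro mult_left_mono) auto
      moreover have "K2 * sqrt \<epsilon> \<le> K2 * 1" using K2 se by (intro mult_left_mono) auto
      then have "energy_potential 1 0 \<delta> (1 - \<delta>) - energy_potential 1 0 \<delta> \<delta> + R \<le> B + K2" by (simp add: B_def R_def)
      then have "K * \<epsilon> * (energy_potential 1 0 \<delta> (1 - \<delta>) - energy_potential 1 0 \<delta> \<delta> + R) \<le> K * \<epsilon> * (B + K2)"
        using K e by (intro mult_left_mono) auto
      moreover have "K * \<epsilon> * (B + K2) \<le> K * sqrt \<epsilon> * (B + K2)" using K K2 B0 se by (intro mult_right_mono mult_left_mono) auto
      ultimately show ?thesis by (simp add: mult_ac)
    qed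
    also have "\<dots> = pi * swing_integral pi + 8 * sqrt (2 * \<delta>) + 40 * \<delta> + K3 * sqrt \<epsilon>"
      by (simp add: R_def K3_def algebra_simps)
    finally show "finite {t \<in> {0..T}. \<psi> t = 0} \<and>
      \<epsilon> * pi * real (card {t \<in> {0..T}. \<psi> t = 0}) \<le> pi * swing_integral pi + 8 * sqrt (2 * \<delta>) + 40 * \<delta> + K3 * sqrt \<epsilon>"
      using Z_finite unfolding Z_def by blast
  qed
qed

section \<open>The lower bound\<close>

text \<open>Put d = max b \<delta>. On \<open>{d..a}\<close> the factor 1 / (2 s) is at most 1 / (2
  d), so the integral is at most (cos d - cos a) / (2 d), hence at most \<epsilon> (a + d) / (2 d),
  which is \<epsilon> plus \<epsilon> (a - d) / (2 d). The gap a - d is O(\<epsilon>) because sin is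
  at least sin \<delta> on \<open>{\<delta>..pi - \<delta>}\<close>. Truncation at \<delta> is what
  keeps both this slope and d away from 0.\<close>

lemma swing_step:
  fixes a b \<delta> \<epsilon> :: real
  assumes \<delta>: "0 < \<delta>" "\<delta> < pi / 2" and \<epsilon>: "0 < \<epsilon>"
    and a: "0 \<le> a" "a \<le> pi - \<delta>" and b: "0 \<le> b" "b \<le> pi - \<delta>"
    and step: "\<bar>cos a - cos b\<bar> \<le> \<epsilon> * (a + b)"
  shows "swing_integral (max a \<delta>) - swing_integral (max b \<delta>) \<le> \<epsilon> * (1 + pi / (\<delta> * sin \<delta>) * \<epsilon>)"
proof -
  define d where "d = max b \<delta>"
  have s\<delta>: "0 < sin \<delta>" using \<delta> by (intro sin_gt_zero) auto
  have pos: "0 \<le> \<epsilon> * (1 + pi / (\<delta> * sin \<delta>) * \<epsilon>)" using \<epsilon> \<delta> s\<delta> by (intro mult_nonneg_nonneg add_nonneg_nonneg) auto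
  show ?thesis
  proof (cases "a \<le> d")
    case True
    then have "max a \<delta> \<le> max b \<delta>" by (simp add: d_def)
    then have "swing_integral (max a \<delta>) \<le> swing_integral (max b \<delta>)"
      using swing_integral_diff(1)[of "max a \<delta>" "max b \<delta>"] b \<delta> by simp
    then show ?thesis using pos by linarith
  next
    case False
    then have da: "\<delta> \<le> d" "b \<le> d" "d < a" "max a \<delta> = a" by (auto simp: d_def)
    have cosd: "cos d \<le> cos b" using da a b \<delta> by (intro cos_monotone_0_pi_le) auto
    have ci: "cos d - cos a \<le> \<epsilon> * (a + d)"
    proof -
      have "\<epsilon> * (a + b) \<le> \<epsilon> * (a + d)" using \<epsilon> da by (intro mult_left_mono) auto
      then show ?thesis using step cosd by linarith
    qed
    have "sin \<delta> * (a - d) \<le> - cos a - (- cos d)"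
    proof (rule increment_ge[of "{}" d a "\<lambda>s. - cos s" sin])
      fix s assume s: "s \<in> {d<..<a} - {}"
      show "((\<lambda>s. - cos s) has_real_derivative sin s) (at s)" by (auto intro!: derivative_eq_intros)
      show "sin \<delta> \<le> sin s"
      proof (cases "s \<le> pi / 2")
        case True
        then show ?thesis using s da \<delta> by (intro sin_monotone_2pi_le) auto
      next
        case False
        have "sin \<delta> \<le> sin (pi - s)" using False s a da \<delta> by (intro sin_monotone_2pi_le) auto
        then show ?thesis by simp
      qed
    qed (use da in \<open>auto intro!: continuous_intros\<close>)
    then have "sin \<delta> * (a - d) \<le> \<epsilon> * (a + d)" using ci by simp
    also have "\<dots> \<le> \<epsilon> * (2 * pi)" using \<epsilon> a da \<delta> by (intro mult_left_mono) auto
    finally have gap: "a - d \<le> \<epsilon> * (2 * pi) / sin \<delta>" using s\<delta> by (simp add: pos_le_divide_eq mult.commute)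
    have "0 * (a - d) \<le> (- cos a / (2 * d) - swing_integral a) - (- cos d / (2 * d) - swing_integral d)"
    proof (rule increment_ge[of "{}" d a "\<lambda>s. - cos s / (2 * d) - swing_integral s" "\<lambda>s. sin s / (2 * d) - sin s / (2 * s)"])
      have D: "((\<lambda>s. - cos s / (2 * d) - swing_integral s) has_real_derivative sin s / (2 * d) - sin s / (2 * s)) (at s)" if "0 < s" for s
        by (rule DERIV_diff[OF DERIV_cdivide swing_integral_has_derivative[OF that]]) (auto intro!: derivative_eq_intros)
      show "continuous_on {d..a} (\<lambda>s. - cos s / (2 * d) - swing_integral s)"
        by (intro continuous_at_imp_continuous_on ballI DERIV_isCont[OF D]) (use da \<delta> in auto)
      fix s assume s: "s \<in> {d<..<a} - {}"
      show "((\<lambda>s. - cos s / (2 * d) - swing_integral s) has_real_derivative sin s / (2 * d) - sin s / (2 * s)) (at s)"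
        by (rule D) (use s da \<delta> in auto)
      have "0 \<le> sin s" using s da a \<delta> by (intro sin_ge_zero) auto
      then have "sin s / (2 * s) \<le> sin s / (2 * d)" using s da \<delta> by (intro divide_left_mono mult_pos_pos) auto
      then show "0 \<le> sin s / (2 * d) - sin s / (2 * s)" by simp
    qed (use da in auto)
    then have "swing_integral a - swing_integral d \<le> (cos d - cos a) / (2 * d)" by (simp add: diff_divide_distrib)
    also have "\<dots> \<le> \<epsilon> * (a + d) / (2 * d)" using ci da \<delta> by (intro divide_right_mono) auto
    also have "\<dots> = \<epsilon> * (1 + (a - d) / (2 * d))" using da \<delta> by (simp add: field_simps)
    also have "\<dots> \<le> \<epsilon> * (1 + pi / (\<delta> * sin \<delta>) * \<epsilon>)"
    proof -
      have "(a - d) / (2 * d) \<le> (a - d) / (2 * \<delta>)" using da \<delta> by (intro divide_left_mono) auto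
      also have "\<dots> \<le> (\<epsilon> * (2 * pi) / sin \<delta>) / (2 * \<delta>)" using gap \<delta> by (intro divide_right_mono) auto
      also have "\<dots> = pi / (\<delta> * sin \<delta>) * \<epsilon>" using \<delta> s\<delta> by (simp add: field_simps)
      finally show ?thesis using \<epsilon> by (intro mult_left_mono) auto
    qed
    finally show ?thesis unfolding da(4) d_def .
  qed
qed

context extremal
begin

definition energy :: "real \<Rightarrow> real" where "energy t = (y t)\<^sup>2 / 2 + (1 - cos (x t))"

text \<open>The turning angle of the free pendulum with the present energy, meaningful below the
  separatrix energy 2.\<close>

definition amplitude :: "real \<Rightarrow> real" where "amplitude t = arccos (1 - energy t)"

lemma energy_nonneg: "0 \<le> energy t" by (simp add: energy_def)

lemma continuous_energy: "continuous_on {0..T} energy"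
  unfolding energy_def using continuous_state by (intro continuous_intros) auto

lemma energy_end: "energy T = 0"
  using rcong_zero_sin_cos(2)[OF end_state(1)] by (simp add: energy_def end_state(2))

lemma energy_increment:
  assumes ab: "0 \<le> a" "a \<le> b" "b \<le> T" and no: "Z \<inter> {a<..<b} = {}"
  shows "\<bar>energy b - energy a\<bar> \<le> \<epsilon> * \<bar>x b - x a\<bar>"
proof (cases "a < b")
  case False
  then show ?thesis using ab by simp
next
  case True
  define \<sigma> where "\<sigma> = sgn (\<psi> ((a + b) / 2))"
  have sb: "{a<..<b} \<subseteq> {0..T}" using ab by auto
  have sg: "sgn (\<psi> t) = \<sigma>" if t: "t \<in> {a<..<b}" for t
  proof (rule ccontr)
    assume ne: "sgn (\<psi> t) \<noteq> \<sigma>"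
    define m where "m = (a + b) / 2"
    have m: "m \<in> {a<..<b}" "(a + b) / 2 = m" using True by (auto simp: m_def)
    have nz: "\<psi> r \<noteq> 0" if "r \<in> {a<..<b}" for r using no sb that unfolding Z_def by blast
    have con: "connected (\<psi> ` {a<..<b})"
      by (intro connected_continuous_image continuous_on_subset[OF continuous_state(3) sb]) auto
    have "0 \<in> \<psi> ` {a<..<b}"
    proof (cases "\<psi> t < 0")
      case True
      then have "0 \<le> \<psi> m" using ne nz[OF m(1)] unfolding \<sigma>_def m(2) by (auto simp: sgn_if split: if_splits)
      then show ?thesis using connectedD_interval[OF con, of "\<psi> t" "\<psi> m" 0] True t m by auto
    next
      case False
      then have "\<psi> m \<le> 0" using ne nz[OF t] unfolding \<sigma>_def m(2) by (auto simp: sgn_if split: if_splits)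
      then show ?thesis using connectedD_interval[OF con, of "\<psi> m" "\<psi> t" 0] False t m by auto
    qed
    then show False using nz by auto
  qed
  \<comment> \<open>A constant control \<sigma> acts as a constant force with potential - \<epsilon>
    \<sigma> x, so the corrected energy is conserved.\<close>
  have "(energy b - \<epsilon> * \<sigma> * x b) - (energy a - \<epsilon> * \<sigma> * x a) = 0 * (b - a)"
  proof (rule increment_eq[of "{}"])
    show "continuous_on {a..b} (\<lambda>t. energy t - \<epsilon> * \<sigma> * x t)"
      by (intro continuous_intros continuous_on_subset[OF continuous_energy] continuous_on_subset[OF continuous_state(1)]) (use ab in auto)
    fix t assume t: "t \<in> {a<..<b} - {}"
    then have t': "t \<in> {0<..<T} - Z" using ab no by auto
    have s: "sgn (\<psi> t) = \<sigma>" using sg t by simp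
    have d: "(x has_real_derivative y t) (at t)" "(y has_real_derivative - sin (x t) + \<epsilon> * \<sigma>) (at t)"
      using state_derivs[OF t'] unfolding s by blast+
    show "((\<lambda>t. energy t - \<epsilon> * \<sigma> * x t) has_real_derivative 0) (at t)"
      unfolding energy_def[abs_def] by (auto intro!: derivative_eq_intros d simp: field_simps)
  qed (use ab in auto)
  then have "energy b - energy a = \<epsilon> * \<sigma> * (x b - x a)" by (simp add: algebra_simps)
  also have "\<bar>\<dots>\<bar> = \<epsilon> * \<bar>\<sigma>\<bar> * \<bar>x b - x a\<bar>" using eps by (simp add: abs_mult)
  also have "\<dots> \<le> \<epsilon> * 1 * \<bar>x b - x a\<bar>" using eps by (intro mult_right_mono mult_left_mono) (auto simp: \<sigma>_def sgn_if)
  finally show ?thesis by simp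
qed

text \<open>Below the energy 2 the lift cannot meet \<open>x T\<close> \<plusminus> \<pi>, so it
  stays on the branch around its final value. There |x - x T| is the arccos of cos x, and 1 - cos x
  is at most the energy.\<close>

lemma angle_le_amplitude:
  assumes tb: "0 \<le> tb" "tb \<le> T" and e: "\<And>t. t \<in> {tb..T} \<Longrightarrow> energy t < 2" and t: "t \<in> {tb..T}"
  shows "\<bar>x t - x T\<bar> \<le> amplitude t"
proof -
  have c: "cos (x r - x T) = cos (x r)" for r
    unfolding cos_diff using rcong_zero_sin_cos[OF end_state(1)] by simp
  have nz: "\<bar>x r - x T\<bar> \<noteq> pi" if r: "r \<in> {tb..T}" for r
  proof
    assume "\<bar>x r - x T\<bar> = pi"
    then have "cos (x r) = - 1" unfolding c[symmetric] by (metis cos_abs_real cos_pi)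
    then have "2 \<le> energy r" by (simp add: energy_def)
    then show False using e[OF r] by simp
  qed
  have lt: "\<bar>x t - x T\<bar> \<le> pi"
  proof (rule ccontr)
    assume "\<not> \<bar>x t - x T\<bar> \<le> pi"
    moreover have "continuous_on {t..T} (\<lambda>t. \<bar>x t - x T\<bar>)"
      by (intro continuous_intros continuous_on_subset[OF continuous_state(1)]) (use t tb in auto)
    ultimately obtain r where "r \<in> {t..T}" "\<bar>x r - x T\<bar> = pi"
      using IVT2'[of "\<lambda>t. \<bar>x t - x T\<bar>" T pi t] t by auto
    then show False using nz[of r] t by auto
  qed
  have "\<bar>x t - x T\<bar> = arccos (cos (x t))"
    using arccos_cos[of "\<bar>x t - x T\<bar>"] lt by (simp add: c)
  also have "\<dots> \<le> arccos (1 - energy t)"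
  proof (rule arccos_le_arccos)
    show "- 1 \<le> 1 - energy t" using e[OF t] by simp
    show "1 - energy t \<le> cos (x t)" by (simp add: energy_def)
  qed simp
  finally show ?thesis unfolding amplitude_def .
qed

text \<open>One application of \<open>swing_step\<close> for each arc between consecutive zeros, by
  induction on the number of zeros ahead. The extra 1 is the last arc: it ends in the origin, where
  the amplitude is 0 and its truncation \<delta>.\<close>

lemma amplitude_drop:
  assumes \<delta>: "0 < \<delta>" "\<delta> < pi / 2" and tb: "0 \<le> tb" "tb \<le> T"
    and e: "\<And>t. t \<in> {tb..T} \<Longrightarrow> energy t \<le> 1 - cos (pi - \<delta>)" and t: "t \<in> {tb..T}"
  shows "swing_integral (max (amplitude t) \<delta>) - swing_integral \<delta>
    \<le> (real (card (Z \<inter> {t<..<T})) + 1) * (\<epsilon> * (1 + pi / (\<delta> * sin \<delta>) * \<epsilon>))"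
proof -
  define q where "q = \<epsilon> * (1 + pi / (\<delta> * sin \<delta>) * \<epsilon>)"
  have c\<delta>: "cos \<delta> < 1" using cos_monotone_0_pi[of 0 \<delta>] \<delta> by simp
  have e2: "energy t < 2" if "t \<in> {tb..T}" for t using e[OF that] c\<delta> by simp
  have amp: "0 \<le> amplitude t" "amplitude t \<le> pi - \<delta>" "cos (amplitude t) = 1 - energy t" if t: "t \<in> {tb..T}" for t
  proof -
    have b: "- 1 \<le> 1 - energy t" "1 - energy t \<le> 1" using e2[OF t] energy_nonneg[of t] by auto
    show "0 \<le> amplitude t" unfolding amplitude_def by (rule arccos_lbound[OF b])
    show "cos (amplitude t) = 1 - energy t" unfolding amplitude_def by (rule cos_arccos[OF b])
    have "amplitude t \<le> arccos (cos (pi - \<delta>))" unfolding amplitude_def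
      using e[OF t] b by (intro arccos_le_arccos) auto
    then show "amplitude t \<le> pi - \<delta>" using arccos_cos[of "pi - \<delta>"] \<delta> by simp
  qed
  have step: "swing_integral (max (amplitude a) \<delta>) - swing_integral (max (amplitude b) \<delta>) \<le> q"
    if ab: "tb \<le> a" "a \<le> b" "b \<le> T" and no: "Z \<inter> {a<..<b} = {}" for a b
  proof -
    have ab': "a \<in> {tb..T}" "b \<in> {tb..T}" "0 \<le> a" using ab tb by auto
    have "\<bar>energy b - energy a\<bar> \<le> \<epsilon> * \<bar>x b - x a\<bar>" by (rule energy_increment[OF ab'(3) ab(2,3) no])
    also have "\<dots> \<le> \<epsilon> * (amplitude a + amplitude b)"
      using angle_le_amplitude[OF tb e2 ab'(1)] angle_le_amplitude[OF tb e2 ab'(2)] eps by (intro mult_left_mono) auto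
    finally have "\<bar>cos (amplitude a) - cos (amplitude b)\<bar> \<le> \<epsilon> * (amplitude a + amplitude b)"
      unfolding amp(3)[OF ab'(1)] amp(3)[OF ab'(2)] by simp
    then show ?thesis unfolding q_def by (intro swing_step[OF \<delta> eps] amp ab')
  qed
  have ampT: "max (amplitude T) \<delta> = \<delta>" using \<delta> by (simp add: amplitude_def energy_end)
  have "\<forall>t. t \<in> {tb..T} \<longrightarrow> card (Z \<inter> {t<..<T}) = n \<longrightarrow>
      swing_integral (max (amplitude t) \<delta>) - swing_integral \<delta> \<le> (real n + 1) * q" for n
  proof (induction n)
    case 0
    show ?case
    proof (intro allI impI)
      fix t assume t: "t \<in> {tb..T}" "card (Z \<inter> {t<..<T}) = 0"
      then have "Z \<inter> {t<..<T} = {}" using Z_finite by simp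
      from step[OF _ _ _ this] t(1) show "swing_integral (max (amplitude t) \<delta>) - swing_integral \<delta> \<le> (real 0 + 1) * q"
        unfolding ampT by auto
    qed
  next
    case (Suc n)
    show ?case
    proof (intro allI impI)
      fix t assume t: "t \<in> {tb..T}" and cd: "card (Z \<inter> {t<..<T}) = Suc n"
      let ?A = "Z \<inter> {t<..<T}"
      have fin: "finite ?A" using Z_finite by simp
      have ne: "?A \<noteq> {}" using cd by auto
      define r where "r = Min ?A"
      have r: "r \<in> ?A" "\<And>s. s \<in> ?A \<Longrightarrow> r \<le> s"
        unfolding r_def by (rule Min_in[OF fin ne], rule Min_le[OF fin])
      have rt: "t < r" "r < T" using r(1) by auto
      have "Z \<inter> {t<..<r} = {}"
      proof (rule ccontr)
        assume "Z \<inter> {t<..<r} \<noteq> {}"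
        then obtain s where "s \<in> Z" "t < s" "s < r" by auto
        then show False using r(2)[of s] rt by auto
      qed
      then have 1: "swing_integral (max (amplitude t) \<delta>) - swing_integral (max (amplitude r) \<delta>) \<le> q"
        using t rt by (intro step) auto
      have "Z \<inter> {r<..<T} = ?A - {r}"
      proof (intro set_eqI iffI)
        fix s assume "s \<in> ?A - {r}"
        then show "s \<in> Z \<inter> {r<..<T}" using r(2)[of s] by auto
      qed (use rt in auto)
      then have "card (Z \<inter> {r<..<T}) = n" using cd r(1) fin by (simp add: card_Diff_singleton)
      then have "swing_integral (max (amplitude r) \<delta>) - swing_integral \<delta> \<le> (real n + 1) * q"
        using Suc.IH t rt by auto
      then show "swing_integral (max (amplitude t) \<delta>) - swing_integral \<delta> \<le> (real (Suc n) + 1) * q"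
        using 1 by (simp add: algebra_simps)
    qed
  qed
  then show ?thesis using t unfolding q_def by blast
qed

text \<open>The count starts at the last time with energy 1 - cos (\<pi> - \<delta>), found by
  running time backwards; there the amplitude is exactly \<pi> - \<delta>, and afterwards the energy
  stays below this level.\<close>

lemma zeros_ge:
  assumes \<delta>: "0 < \<delta>" "\<delta> < pi / 2" and e0: "1 - cos (pi - \<delta>) \<le> energy 0"
  shows "swing_integral (pi - \<delta>) - swing_integral \<delta> \<le> (real (card Z) + 1) * (\<epsilon> * (1 + pi / (\<delta> * sin \<delta>) * \<epsilon>))"
proof -
  define c where "c = 1 - cos (pi - \<delta>)"
  have c0: "0 \<le> c" using cos_le_one[of "pi - \<delta>"] by (simp only: c_def)
  have "continuous_on {- T..- 0} (\<lambda>t. - energy (- t))"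
    by (intro continuous_intros continuous_on_compose2[OF continuous_energy]) auto
  then obtain t where t: "t \<in> {- T..- 0}" "- energy (- t) = - c" "\<And>q. q \<in> {- T..<t} \<Longrightarrow> - c < - energy (- q)"
    using continuous_hitting_time[of "- T" "- 0" "\<lambda>t. - energy (- t)" "- c"] T_nonneg energy_end c0 e0 by (auto simp: c_def)
  define tb where "tb = - t"
  have tb: "0 \<le> tb" "tb \<le> T" "tb \<in> {tb..T}" using t(1) by (auto simp: tb_def)
  have e: "energy q \<le> 1 - cos (pi - \<delta>)" if "q \<in> {tb..T}" for q
    using t(2) t(3)[of "- q"] that by (cases "q = tb") (auto simp: tb_def c_def)
  have "1 - energy tb = cos (pi - \<delta>)" using t(2) unfolding tb_def c_def by linarith
  then have "amplitude tb = pi - \<delta>" unfolding amplitude_def using \<delta> arccos_cos[of "pi - \<delta>"] by (simp only:)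
  then have m: "max (amplitude tb) \<delta> = pi - \<delta>" using \<delta> by simp
  have s\<delta>: "0 < sin \<delta>" using \<delta> by (intro sin_gt_zero) auto
  have pos: "0 \<le> \<epsilon> * (1 + pi / (\<delta> * sin \<delta>) * \<epsilon>)" using eps \<delta> s\<delta> by (intro mult_nonneg_nonneg add_nonneg_nonneg) auto
  have "swing_integral (pi - \<delta>) - swing_integral \<delta>
      \<le> (real (card (Z \<inter> {tb<..<T})) + 1) * (\<epsilon> * (1 + pi / (\<delta> * sin \<delta>) * \<epsilon>))"
    using amplitude_drop[OF \<delta> tb(1,2) e tb(3)] unfolding m .
  also have "\<dots> \<le> (real (card Z) + 1) * (\<epsilon> * (1 + pi / (\<delta> * sin \<delta>) * \<epsilon>))"
    using card_mono[OF Z_finite, of "Z \<inter> {tb<..<T}"] pos by (intro mult_right_mono) auto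
  finally show ?thesis .
qed

end

lemma num_zeros_le_max_switchings:
  assumes "time_optimal \<epsilon> p T u x y" "adjoint_variables \<epsilon> T u x y \<phi> \<psi>"
  shows "num_zeros T \<psi> \<le> max_switchings \<epsilon>"
proof -
  have "num_zeros T \<psi> \<le> switchings_from \<epsilon> p"
    unfolding switchings_from_def by (rule Sup_upper) (use assms in blast)
  also have "\<dots> \<le> max_switchings \<epsilon>" unfolding max_switchings_def by (rule SUP_upper) simp
  finally show ?thesis .
qed

lemma max_switchings_le:
  assumes "\<And>p T u x y \<phi> \<psi>. time_optimal \<epsilon> p T u x y \<Longrightarrow> adjoint_variables \<epsilon> T u x y \<phi> \<psi> \<Longrightarrow> num_zeros T \<psi> \<le> N"
  shows "max_switchings \<epsilon> \<le> N"
  unfolding max_switchings_def switchings_from_def by (intro SUP_least Sup_least) (use assms in blast)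

lemma switchings_upper:
  assumes r: "swing_integral pi < r"
  shows "\<forall>\<^sub>F \<epsilon> in at_right 0. ereal \<epsilon> * ereal_of_enat (max_switchings \<epsilon>) \<le> ereal r"
proof -
  \<comment> \<open>Half of the slack for the \<delta>-terms and half for the term with sqrt
    \<epsilon>; the factor \<pi> is there because the estimate is for \<pi> times the number of
    zeros.\<close>
  define e where "e = pi * (r - swing_integral pi) / 2"
  have e: "0 < e" using r by (simp add: e_def)
  have "((\<lambda>\<delta>. 8 * sqrt (2 * \<delta>) + 40 * \<delta>) \<longlongrightarrow> 8 * sqrt (2 * 0) + 40 * 0) (at_right 0)" by (intro tendsto_intros)
  then have "\<forall>\<^sub>F \<delta> in at_right 0. 8 * sqrt (2 * \<delta>) + 40 * \<delta> < e" using e by (intro order_tendstoD(2)) auto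
  moreover have "\<forall>\<^sub>F \<delta> in at_right 0. \<delta> \<in> {0<..<1 / 2::real}" by (rule eventually_at_right_real) simp
  ultimately have "\<forall>\<^sub>F \<delta> in at_right 0. 8 * sqrt (2 * \<delta>) + 40 * \<delta> < e \<and> \<delta> \<in> {0<..<1 / 2::real}"
    by (rule eventually_conj)
  then obtain \<delta> where \<delta>: "8 * sqrt (2 * \<delta>) + 40 * \<delta> < e" "0 < \<delta>" "\<delta> < 1 / 2"
    using eventually_happens'[OF trivial_limit_at_right_real] by auto
  obtain K \<epsilon>1 where K: "0 < \<epsilon>1"
    "\<And>\<epsilon> p T u x y \<phi> \<psi>. \<lbrakk>0 < \<epsilon>; \<epsilon> < \<epsilon>1; time_optimal \<epsilon> p T u x y; adjoint_variables \<epsilon> T u x y \<phi> \<psi>\<rbrakk> \<Longrightarrow>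
      finite {t \<in> {0..T}. \<psi> t = 0} \<and>
      \<epsilon> * pi * real (card {t \<in> {0..T}. \<psi> t = 0}) \<le> pi * swing_integral pi + 8 * sqrt (2 * \<delta>) + 40 * \<delta> + K * sqrt \<epsilon>"
    by (rule switchings_le[OF \<delta>(2,3)]) (rule that)
  have "((\<lambda>\<epsilon>. K * sqrt \<epsilon>) \<longlongrightarrow> K * sqrt 0) (at_right 0)" by (intro tendsto_intros)
  then have "\<forall>\<^sub>F \<epsilon> in at_right 0. K * sqrt \<epsilon> < e" using e by (intro order_tendstoD(2)) auto
  moreover have "\<forall>\<^sub>F \<epsilon> in at_right 0. \<epsilon> \<in> {0<..<\<epsilon>1}" by (rule eventually_at_right_real[OF K(1)])
  ultimately show ?thesis
  proof eventually_elim
    case (elim \<epsilon>)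
    then have \<epsilon>: "0 < \<epsilon>" "\<epsilon> < \<epsilon>1" by auto
    define n where "n = nat \<lfloor>r / \<epsilon>\<rfloor>"
    have r0: "0 \<le> r" using r swing_integral_diff(1)[of 0 pi] by (simp add: swing_integral_0)
    have "max_switchings \<epsilon> \<le> enat n"
    proof (rule max_switchings_le)
      fix p T u x y \<phi> \<psi>
      assume o: "time_optimal \<epsilon> p T u x y" "adjoint_variables \<epsilon> T u x y \<phi> \<psi>"
      define c where "c = card {t \<in> {0..T}. \<psi> t = 0}"
      have fin: "finite {t \<in> {0..T}. \<psi> t = 0}" and le: "\<epsilon> * pi * real c \<le> pi * swing_integral pi + 8 * sqrt (2 * \<delta>) + 40 * \<delta> + K * sqrt \<epsilon>"
        using K(2)[OF \<epsilon> o] unfolding c_def by blast+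
      have "\<epsilon> * pi * real c \<le> pi * swing_integral pi + 2 * e" using le \<delta>(1) elim(1) by linarith
      moreover have "2 * e = pi * r - pi * swing_integral pi" by (simp add: e_def right_diff_distrib)
      moreover have "\<epsilon> * pi * real c = pi * (\<epsilon> * real c)" by simp
      ultimately have "pi * (\<epsilon> * real c) \<le> pi * r" by linarith
      then have "\<epsilon> * real c \<le> r" by simp
      then have "real c \<le> r / \<epsilon>" using \<epsilon> by (simp add: pos_le_divide_eq mult.commute)
      then have "c \<le> n" unfolding n_def by (simp add: le_nat_floor)
      then show "num_zeros T \<psi> \<le> enat n" using fin unfolding c_def by (simp add: num_zeros_def)
    qed
    then have "ereal_of_enat (max_switchings \<epsilon>) \<le> ereal_of_enat (enat n)" by (simp only: ereal_of_enat_le_iff)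
    then have "ereal \<epsilon> * ereal_of_enat (max_switchings \<epsilon>) \<le> ereal \<epsilon> * ereal_of_enat (enat n)"
      using \<epsilon> by (intro ereal_mult_left_mono) auto
    also have "\<dots> = ereal (\<epsilon> * real n)" by simp
    also have "\<epsilon> * real n \<le> r"
    proof -
      have "real n \<le> r / \<epsilon>" unfolding n_def using r0 \<epsilon> by (simp add: of_nat_floor)
      then show ?thesis using \<epsilon> by (simp add: pos_le_divide_eq mult.commute)
    qed
    finally show ?case by simp
  qed
qed

text \<open>Steering from the upper equilibrium itself is the competitor that
  \<open>optimal_trajectory_near\<close> needs. A penalty of at most 2 - 2 cos \<delta> around
  (\<pi>, 0) means an initial energy of at least 1 - cos (\<pi> - \<delta>).\<close>

lemma many_switchings:
  assumes \<delta>: "0 < \<delta>" "\<delta> < 1 / 2"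
  obtains \<epsilon>1 where "0 < \<epsilon>1"
    "\<And>\<epsilon>. \<lbrakk>0 < \<epsilon>; \<epsilon> < \<epsilon>1\<rbrakk> \<Longrightarrow> \<exists>n. enat n \<le> max_switchings \<epsilon> \<and>
      swing_integral (pi - \<delta>) - swing_integral \<delta> \<le> (real n + 1) * (\<epsilon> * (1 + pi / (\<delta> * sin \<delta>) * \<epsilon>))"
proof -
  obtain K \<epsilon>1 where K: "0 \<le> K" "0 < \<epsilon>1" "\<And>\<epsilon> x1. \<lbrakk>0 < \<epsilon>; \<epsilon> < \<epsilon>1\<rbrakk> \<Longrightarrow>
      \<exists>T u x y. pw_trajectory \<epsilon> T u x y \<and> x 0 = x1 \<and> y 0 = 0 \<and> [x T = 0] (rmod 2 * pi) \<and> y T = 0 \<and>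
        \<epsilon> * T \<le> energy_potential 1 0 \<delta> (clamp_modulus \<delta> \<bar>sin (x1 / 2)\<bar>)
          - energy_potential 1 0 \<delta> \<delta> + 8 * sqrt (2 * \<delta>) + 40 * \<delta> + K * sqrt \<epsilon>"
    by (rule steering_from_turning_point[OF \<delta>]) (rule that)
  have \<delta>': "\<delta> < pi / 2" using \<delta> pi_gt3 by linarith
  have c\<delta>: "cos \<delta> < 1" using cos_monotone_0_pi[of 0 \<delta>] \<delta> \<delta>' by simp
  show thesis
  proof (rule that[OF K(2)])
    fix \<epsilon> :: real assume \<epsilon>: "0 < \<epsilon>" "\<epsilon> < \<epsilon>1"
    obtain T1 u1 x1 y1 where st: "pw_trajectory \<epsilon> T1 u1 x1 y1" "x1 0 = pi" "y1 0 = 0" "[x1 T1 = 0] (rmod 2 * pi)" "y1 T1 = 0"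
      using K(3)[OF \<epsilon>, of pi] by blast
    have st': "steers_to_origin \<epsilon> (pi, 0) T1 u1 x1 y1"
      using pw_trajectory_controlled_pendulum[OF st(1)] st by (simp add: steers_to_origin_def)
    have \<eta>: "0 < 2 - 2 * cos \<delta>" "2 - 2 * cos \<delta> < 2 - 2 * cos pi" using c\<delta> cos_gt_zero[of \<delta>] \<delta> \<delta>' by auto
    obtain p T u x y \<phi> \<psi> where o: "time_optimal \<epsilon> p T u x y" "adjoint_variables \<epsilon> T u x y \<phi> \<psi>"
      "2 - 2 * cos (x 0 - pi) + (y 0)\<^sup>2 \<le> 2 - 2 * cos \<delta>"
      by (rule optimal_trajectory_near[OF \<epsilon>(1) st' \<eta>]) (rule that)
    interpret extremal \<epsilon> T p u x y \<phi> \<psi> by (rule extremal.intro[OF \<epsilon>(1) o(1,2)])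
    have c: "cos (x 0 - pi) = - cos (x 0)" by (simp add: cos_diff)
    have "0 \<le> (y 0)\<^sup>2" by simp
    then have "1 - cos (pi - \<delta>) \<le> energy 0" using o(3) unfolding energy_def c cos_pi_minus by linarith
    then have "swing_integral (pi - \<delta>) - swing_integral \<delta> \<le> (real (card Z) + 1) * (\<epsilon> * (1 + pi / (\<delta> * sin \<delta>) * \<epsilon>))"
      by (rule zeros_ge[OF \<delta>(1) \<delta>'])
    moreover have "num_zeros T \<psi> = enat (card Z)" using Z_finite by (simp add: num_zeros_def Z_def)
    ultimately show "\<exists>n. enat n \<le> max_switchings \<epsilon> \<and>
      swing_integral (pi - \<delta>) - swing_integral \<delta> \<le> (real n + 1) * (\<epsilon> * (1 + pi / (\<delta> * sin \<delta>) * \<epsilon>))"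
      using num_zeros_le_max_switchings[OF o(1,2)] by auto
  qed
qed

lemma switchings_lower:
  assumes r: "r < swing_integral pi"
  shows "\<forall>\<^sub>F \<epsilon> in at_right 0. ereal r \<le> ereal \<epsilon> * ereal_of_enat (max_switchings \<epsilon>)"
proof -
  \<comment> \<open>The integrand is at most 1 / 2, so cutting \<delta> off at both ends loses at
    most \<delta>, which is half of the slack or less.\<close>
  define \<delta> where "\<delta> = Orderings.min (1 / 4) ((swing_integral pi - r) / 2)"
  have \<delta>: "0 < \<delta>" "\<delta> < 1 / 2" "r + \<delta> < swing_integral pi" using r by (auto simp: \<delta>_def min_def field_simps)
  define C where "C = pi / (\<delta> * sin \<delta>)"
  have C: "0 \<le> C" using \<delta> pi_gt3 sin_gt_zero[of \<delta>] by (auto simp: C_def)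
  have F: "swing_integral pi - \<delta> \<le> swing_integral (pi - \<delta>) - swing_integral \<delta>"
    using swing_integral_diff(2)[of "pi - \<delta>" pi] swing_integral_diff(2)[of 0 \<delta>] \<delta> pi_gt3 by (simp add: swing_integral_0)
  obtain \<epsilon>1 where K: "0 < \<epsilon>1"
    "\<And>\<epsilon>. \<lbrakk>0 < \<epsilon>; \<epsilon> < \<epsilon>1\<rbrakk> \<Longrightarrow> \<exists>n. enat n \<le> max_switchings \<epsilon> \<and>
      swing_integral (pi - \<delta>) - swing_integral \<delta> \<le> (real n + 1) * (\<epsilon> * (1 + pi / (\<delta> * sin \<delta>) * \<epsilon>))"
    by (rule many_switchings[OF \<delta>(1,2)]) (rule that)
  have "((\<lambda>\<epsilon>. (r + \<epsilon>) * (1 + C * \<epsilon>)) \<longlongrightarrow> (r + 0) * (1 + C * 0)) (at_right 0)" by (intro tendsto_intros)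
  then have "\<forall>\<^sub>F \<epsilon> in at_right 0. (r + \<epsilon>) * (1 + C * \<epsilon>) < swing_integral pi - \<delta>"
    using \<delta>(3) by (intro order_tendstoD(2)) auto
  moreover have "\<forall>\<^sub>F \<epsilon> in at_right 0. \<epsilon> \<in> {0<..<\<epsilon>1}" by (rule eventually_at_right_real[OF K(1)])
  ultimately show ?thesis
  proof eventually_elim
    case (elim \<epsilon>)
    then have \<epsilon>: "0 < \<epsilon>" "\<epsilon> < \<epsilon>1" by auto
    obtain n where n: "enat n \<le> max_switchings \<epsilon>"
      "swing_integral (pi - \<delta>) - swing_integral \<delta> \<le> (real n + 1) * (\<epsilon> * (1 + C * \<epsilon>))"
      using K(2)[OF \<epsilon>] unfolding C_def by blast
    have "r \<le> \<epsilon> * real n"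
    proof (rule ccontr)
      assume "\<not> r \<le> \<epsilon> * real n"
      then have "(\<epsilon> * real n + \<epsilon>) * (1 + C * \<epsilon>) \<le> (r + \<epsilon>) * (1 + C * \<epsilon>)"
        using C \<epsilon> by (intro mult_right_mono) auto
      moreover have "(\<epsilon> * real n + \<epsilon>) * (1 + C * \<epsilon>) = (real n + 1) * (\<epsilon> * (1 + C * \<epsilon>))" by (simp add: algebra_simps)
      ultimately show False using n(2) F elim(1) by linarith
    qed
    then have "ereal r \<le> ereal \<epsilon> * ereal_of_enat (enat n)" by simp
    also have "\<dots> \<le> ereal \<epsilon> * ereal_of_enat (max_switchings \<epsilon>)"
    proof (rule ereal_mult_left_mono)
      show "ereal_of_enat (enat n) \<le> ereal_of_enat (max_switchings \<epsilon>)" using n(1) by (simp only: ereal_of_enat_le_iff)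
    qed (use \<epsilon> in simp)
    finally show ?case .
  qed
qed

theorem theorem1p3:
  shows "((\<lambda>\<epsilon>. ereal \<epsilon> * ereal_of_enat (max_switchings \<epsilon>))
           \<longlongrightarrow> ereal (integral {0..pi} (\<lambda>x. sin x / (2 * x)))) (at_right 0)"
  unfolding swing_integral_def[symmetric]
\<comment> \<open>The product is an extended real, as \<open>max_switchings\<close> takes values in
  \<open>enat\<close>; each order estimate needs only a real number strictly between the bound and
  the limit.\<close>
proof (rule order_tendstoI)
  fix a :: ereal
  assume "a < ereal (swing_integral pi)"
  then obtain r where r: "a < ereal r" "r < swing_integral pi" using ereal_dense2 by force
  show "\<forall>\<^sub>F \<epsilon> in at_right 0. a < ereal \<epsilon> * ereal_of_enat (max_switchings \<epsilon>)"
    using switchings_lower[OF r(2)] by eventually_elim (rule less_le_trans[OF r(1)])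
next
  fix a :: ereal
  assume "ereal (swing_integral pi) < a"
  then obtain r where r: "ereal r < a" "swing_integral pi < r" using ereal_dense2 by force
  show "\<forall>\<^sub>F \<epsilon> in at_right 0. ereal \<epsilon> * ereal_of_enat (max_switchings \<epsilon>) < a"
    using switchings_upper[OF r(2)] by eventually_elim (rule le_less_trans[OF _ r(1)])
qed

end
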